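(* Let $k_0\ge 0$, $\nu>0$, and let $(\sigma,n)$ satisfy one of: $\sigma\in(0,\tfrac12)$ and $n\ge 2$; $\sigma=\tfrac12$ and $n\ge 1$; $\sigma\in(\tfrac12,1]$ and $n\ge 3$. Suppose $(u_0,u_1)\in (H^{k_0+1}\cap L^1)\times(H^{k_0}\cap L^1)$, and let $u\in C([0,\infty);H^{k_0+1})\cap C^1([0,\infty);H^{k_0})$ be the unique solution of $$\partial_t^2u-\Delta u+\nu(-\Delta)^\sigma\partial_tu=0\ \ (t>0,\ x\in\mathbb{R}^n),\qquad u(0,x)=u_0(x),\quad \partial_tu(0,x)=u_1(x).$$ Put $m_1:=\int_{\mathbb{R}^n}u_1(y)\,dy$. Then, as $t\to\infty$, $$\|\nabla_x^k(u(t)-m_1\mathcal{F}^{-1}[\mathcal{G}_{\sigma,\nu}(t)])\|_2=o(t^{-\gamma_{\sigma,k}})\quad\text{for }\sigma\in(0,1],$$ $$\|\partial_t\nabla_x^k(u(t)-m_1\mathcal{F}^{-1}[\mathcal{G}_{\sigma,\nu}(t)])\|_2=o(t^{-\gamma_{\sigma,k}-1})\quad\text{for }\sigma\in(0,\tfrac12],$$ $$\big\|\partial_t\nabla_x^ku(t)-\nabla_x^k m_1\mathcal{F}^{-1}\big[e^{-\frac{\nu t|\xi|^{2\sigma}}{2}}\cos(t|\xi|)\big]\big\|_2=o(t^{-\gamma_{\sigma,k}-\frac1{2\sigma}})\quad\text{for }\sigma\in(\tfrac12,1].$$ Moreover, there exists $C>0$ such that for large $t$ $$C^{-1}t^{-\gamma_{\sigma,k}-\ell}\le\|\partial_t^\ell\nabla_x^ku(t)\|_2\le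 Ct^{-\gamma_{\sigma,k}-\ell}\quad\text{for }\sigma\in(0,\tfrac12],$$ $$C^{-1}t^{-\gamma_{\sigma,k}-\frac{\ell}{2\sigma}}\le\|\partial_t^\ell\nabla_x^ku(t)\|_2\le Ct^{-\gamma_{\sigma,k}-\frac{\ell}{2\sigma}}\quad\text{for }\sigma\in(\tfrac12,1].$$ Here $\ell=0,1$, $k\in[0,k_0+1]$ and $k+\ell\le k_0+1$ (in the first three estimates $\ell$ is the number of time derivatives appearing).
   Context: Fourier transform: $\hat f(\xi)=c_n\int_{\mathbb{R}^n}e^{-ix\cdot\xi}f(x)\,dx$ with $c_n=(2\pi)^{-n/2}$, and $\mathcal{F}^{-1}$ is its inverse (taken in the variable $\xi$). $L^p=L^p(\mathbb{R}^n)$ with norm $\|\cdot\|_p$. For real $k\ge0$, $\nabla_x^k$ corresponds in $L^2$ norm to the Fourier multiplier $|\xi|^k$, and $H^k=H^k(\mathbb{R}^n)$ is the Sobolev space of real-valued $f$ with $\|f\|_{H^k}=(\|f\|_2^2+\|\nabla_x^kf\|_2^2)^{1/2}<\infty$. $(-\Delta)^\sigma$ is the Fourier multiplier $|\xi|^{2\sigma}$. The exponents are $$\gamma_{\sigma,k}=\begin{cases}\frac{n}{4(1-\sigma)}-\frac{\sigma}{1-\sigma}+\frac{k}{2(1-\sigma)},&0\le\sigma<\frac12,\\ \frac n2-1+k,&\sigma=\frac12,\\ \frac{n}{4\sigma}-\frac{1}{2\sigma}+\frac{k}{2\sigma},&\frac12<\sigma\le1,\end{cases}$$ and $$\mathcal{G}_{\sigma,\nu}(t,\xi)=\begin{cases}\dfrac{e^{-\frac1\nu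 t|\xi|^{2(1-\sigma)}}}{\nu|\xi|^{2\sigma}},&0<\sigma<\frac12,\ \nu>0,\\[2mm] \dfrac{2e^{-\frac\nu2t|\xi|}\sin\left(\frac{t|\xi|\sqrt{4-\nu^2}}{2}\right)}{|\xi|\sqrt{4-\nu^2}},&\sigma=\frac12,\ 0<\nu<2,\\[2mm] te^{-t|\xi|},&\sigma=\frac12,\ \nu=2,\\[1mm] \dfrac{2e^{-\frac\nu2t|\xi|}\sinh\left(\frac{t|\xi|\sqrt{\nu^2-4}}{2}\right)}{|\xi|\sqrt{\nu^2-4}},&\sigma=\frac12,\ \nu>2,\\[2mm] \dfrac{e^{-\frac\nu2t|\xi|^{2\sigma}}\sin(t|\xi|)}{|\xi|},&\frac12<\sigma\le1,\ \nu>0.\end{cases}$$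
   Formalization: The profiles carry the factor c_n m_1 instead of m_1, since û_1(0)=c_n m_1 in the stated normalization and the o-estimates otherwise fail when m_1≠0; the lower bounds are claimed only for m_1≠0, as they fail for m_1=0 (e.g. u=0); C may depend on k and ℓ. *)

theory Defs
  imports "HOL-Analysis.Analysis" "HOL-Library.Landau_Symbols"
begin

(* Elements of L^p(R^n) are represented by Borel functions on real^'n; every Lebesgue
   class has such a representative, and equality in L^p is equality AE. *)

definition L2 :: "(real^'n \<Rightarrow> 'b::{banach,second_countable_topology}) \<Rightarrow> bool" where
  "L2 f \<longleftrightarrow> f \<in> borel_measurable lborel \<and> integrable lborel (\<lambda>x. (norm (f x))\<^sup>2)"

(* Pitfall: the value is 0 when the square is not integrable, so l2norm is only meaningful
   together with L2. *)
definition l2norm :: "(real^'n \<Rightarrow> 'b::{banach,second_countable_topology}) \<Rightarrow> real" where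
  "l2norm f = sqrt (LINT x|lborel. (norm (f x))\<^sup>2)"

definition L2_tendsto ::
  "('i \<Rightarrow> real^'n \<Rightarrow> 'b::{banach,second_countable_topology}) \<Rightarrow> (real^'n \<Rightarrow> 'b) \<Rightarrow> 'i filter \<Rightarrow> bool"
where
  "L2_tendsto F g net \<longleftrightarrow>
     L2 g \<and> (\<forall>\<^sub>F i in net. L2 (F i)) \<and> ((\<lambda>i. l2norm (\<lambda>x. F i x - g x)) \<longlongrightarrow> 0) net"

definition fourier_const :: "nat \<Rightarrow> real" where
  "fourier_const n = (2 * pi) powr (- real n / 2)"

definition fourier_integral :: "(real^'n \<Rightarrow> complex) \<Rightarrow> real^'n \<Rightarrow> complex" where
  "fourier_integral f \<xi> =
     of_real (fourier_const CARD('n)) * (LINT x|lborel. exp (- \<i> * of_real (x \<bullet> \<xi>)) * f x)"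

(* The Fourier-Plancherel transform of f in L^2: the L^2 limit, as R tends to infinity, of the
   Fourier integrals over the balls of radius R (a representative of it).  For f in L^1 and L^2
   it agrees AE with fourier_integral f. *)
definition fourier :: "(real^'n \<Rightarrow> complex) \<Rightarrow> real^'n \<Rightarrow> complex" where
  "fourier f = (SOME g. L2_tendsto
     (\<lambda>R::real. fourier_integral (\<lambda>x. if norm x \<le> R then f x else 0)) g at_top)"

definition inv_fourier :: "(real^'n \<Rightarrow> complex) \<Rightarrow> real^'n \<Rightarrow> complex" where
  "inv_fourier g = (SOME f. L2 f \<and> (AE \<xi> in lborel. fourier f \<xi> = g \<xi>))"

(* nabla^k, for real k >= 0, enters only through its L^2 norm, i.e. through the Fourier
   multiplier |xi|^k. *)
definition nabla_symbol :: "real \<Rightarrow> (real^'n \<Rightarrow> complex) \<Rightarrow> real^'n \<Rightarrow> complex" where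
  "nabla_symbol k f \<xi> = of_real (norm \<xi> powr k) * fourier f \<xi>"

definition nabla_L2 :: "real \<Rightarrow> (real^'n \<Rightarrow> complex) \<Rightarrow> bool" where
  "nabla_L2 k f \<longleftrightarrow> L2 f \<and> L2 (nabla_symbol k f)"

definition nabla_norm :: "real \<Rightarrow> (real^'n \<Rightarrow> complex) \<Rightarrow> real" where
  "nabla_norm k f = l2norm (nabla_symbol k f)"

abbreviation cplx :: "(real^'n \<Rightarrow> real) \<Rightarrow> real^'n \<Rightarrow> complex" where
  "cplx f \<equiv> (\<lambda>x. complex_of_real (f x))"

definition sobolev :: "real \<Rightarrow> (real^'n \<Rightarrow> real) \<Rightarrow> bool" where
  "sobolev k f \<longleftrightarrow> nabla_L2 k (cplx f)"

definition sobolev_norm :: "real \<Rightarrow> (real^'n \<Rightarrow> real) \<Rightarrow> real" where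
  "sobolev_norm k f = sqrt ((l2norm f)\<^sup>2 + (nabla_norm k (cplx f))\<^sup>2)"

(* Derivative in time of an L^2-valued function on [0,\<infinity>), one-sided at 0. *)
definition has_L2_deriv ::
  "(real \<Rightarrow> real^'n \<Rightarrow> 'b::{banach,second_countable_topology}) \<Rightarrow> (real^'n \<Rightarrow> 'b) \<Rightarrow> real \<Rightarrow> bool"
where
  "has_L2_deriv v w t \<longleftrightarrow>
     L2_tendsto (\<lambda>s x. (v s x - v t x) /\<^sub>R (s - t)) w (at t within {0..})"

definition time_deriv ::
  "(real \<Rightarrow> real^'n \<Rightarrow> 'b::{banach,second_countable_topology}) \<Rightarrow> real \<Rightarrow> real^'n \<Rightarrow> 'b"
where
  "time_deriv v t = (SOME w. has_L2_deriv v w t)"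

definition C0_sobolev :: "real \<Rightarrow> (real \<Rightarrow> real^'n \<Rightarrow> real) \<Rightarrow> bool" where
  "C0_sobolev k v \<longleftrightarrow> (\<forall>t\<ge>0. sobolev k (v t) \<and>
     ((\<lambda>s. sobolev_norm k (\<lambda>x. v s x - v t x)) \<longlongrightarrow> 0) (at t within {0..}))"

(* A derivative in H^k is in particular one in L^2, hence is represented by time_deriv. *)
definition C1_sobolev :: "real \<Rightarrow> (real \<Rightarrow> real^'n \<Rightarrow> real) \<Rightarrow> bool" where
  "C1_sobolev k v \<longleftrightarrow> C0_sobolev k v \<and> C0_sobolev k (time_deriv v) \<and>
     (\<forall>t\<ge>0. ((\<lambda>s. sobolev_norm k (\<lambda>x. (v s x - v t x) / (s - t) - time_deriv v t x)) \<longlongrightarrow> 0)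
       (at t within {0..}))"

(* In the class C([0,\<infinity>);H^(k0+1)) and C^1([0,\<infinity>);H^k0), 0 <= sigma <= 1, both Laplace u and
   (-Laplace)^sigma u_t lie in H^(-2).  The second time derivative is that of u_t as an
   H^(-2)-valued function, with H^(-2) norm || (1+|xi|^2)^(-1) f^(xi) ||_2; below, w is its
   Fourier transform, and the equation is read in H^(-2), that is, AE in xi. *)
definition solves_damped_wave ::
  "real \<Rightarrow> real \<Rightarrow> (real \<Rightarrow> real^'n \<Rightarrow> real) \<Rightarrow> bool"
where
  "solves_damped_wave \<sigma> \<nu> u \<longleftrightarrow> (\<forall>t>0. \<exists>w.
     has_L2_deriv (\<lambda>s \<xi>. fourier (cplx (time_deriv u s)) \<xi> / of_real (1 + (norm \<xi>)\<^sup>2))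
       (\<lambda>\<xi>. w \<xi> / of_real (1 + (norm \<xi>)\<^sup>2)) t \<and>
     (AE \<xi> in lborel.
        w \<xi> + of_real ((norm \<xi>)\<^sup>2) * fourier (cplx (u t)) \<xi>
          + of_real (\<nu> * norm \<xi> powr (2 * \<sigma>)) * fourier (cplx (time_deriv u t)) \<xi> = 0))"

definition decay_exponent :: "nat \<Rightarrow> real \<Rightarrow> real \<Rightarrow> real" where
  "decay_exponent n \<sigma> k =
     (if \<sigma> < 1/2 then n / (4 * (1 - \<sigma>)) - \<sigma> / (1 - \<sigma>) + k / (2 * (1 - \<sigma>))
      else if \<sigma> = 1/2 then n / 2 - 1 + k
      else n / (4 * \<sigma>) - 1 / (2 * \<sigma>) + k / (2 * \<sigma>))"

definition profile :: "real \<Rightarrow> real \<Rightarrow> real \<Rightarrow> real^'n \<Rightarrow> real" where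
  "profile \<sigma> \<nu> t \<xi> =
     (if \<sigma> < 1/2 then exp (- (1 / \<nu>) * t * norm \<xi> powr (2 * (1 - \<sigma>))) / (\<nu> * norm \<xi> powr (2 * \<sigma>))
      else if \<sigma> = 1/2 then
        (if \<nu> < 2 then
           2 * exp (- (\<nu> / 2) * t * norm \<xi>) * sin (t * norm \<xi> * sqrt (4 - \<nu>\<^sup>2) / 2)
             / (norm \<xi> * sqrt (4 - \<nu>\<^sup>2))
         else if \<nu> = 2 then t * exp (- t * norm \<xi>)
         else
           2 * exp (- (\<nu> / 2) * t * norm \<xi>) * sinh (t * norm \<xi> * sqrt (\<nu>\<^sup>2 - 4) / 2)
             / (norm \<xi> * sqrt (\<nu>\<^sup>2 - 4)))
      else exp (- (\<nu> / 2) * t * norm \<xi> powr (2 * \<sigma>)) * sin (t * norm \<xi>) / norm \<xi>)"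

definition profile_cos :: "real \<Rightarrow> real \<Rightarrow> real \<Rightarrow> real^'n \<Rightarrow> real" where
  "profile_cos \<sigma> \<nu> t \<xi> = exp (- (\<nu> * t * norm \<xi> powr (2 * \<sigma>) / 2)) * cos (t * norm \<xi>)"

(* For the unitary transform fourier, F[u1](0) = fourier_const n * (integral of u1).  The leading
   part of the solution is therefore obtained with amplitude m = fourier_const n * m1, and not
   with m = m1, which would require the normalisation (2 pi)^(-n) in the inverse transform. *)
definition remainder ::
  "(real^'n \<Rightarrow> real) \<Rightarrow> real \<Rightarrow> (real^'n \<Rightarrow> real) \<Rightarrow> real^'n \<Rightarrow> complex"
where
  "remainder v m G x = of_real (v x) - of_real m * inv_fourier (cplx G) x"

end

(* On the Fourier side the equation is, for every frequency r = |xi|, the damped oscillator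
   y'' + nu r^(2 sigma) y' + r^2 y = 0.  Testing a solution against a backward solution of the
   adjoint system, multiplied by a compactly supported function of xi, gives a quantity that is
   constant in time; this identifies u^ with K0 u0^ + K u1^, where K0 and K are the fundamental
   solutions.

   For r bounded away from 0 an energy with a cross term shows that K0 and K decay exponentially,
   uniformly in r.  For small r put r = t^(-1/p) x with p = 2(1 - sigma) for sigma <= 1/2 and
   p = 2 sigma for sigma >= 1/2.  After multiplication with the right power of t the kernels are
   dominated by a fixed function (x^e + x^2) exp(-c x^p), square integrable by the condition on
   the dimension; K0 tends to 0, K becomes asymptotic to the profile, and u1^(t^(-1/p) eta) tends
   to u1^(0).  Dominated convergence in the scaled variable gives the o-estimates.

   The two-sided bounds then follow from those for the profile.  For sigma <= 1/2 the profile is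
   exactly self-similar.  For sigma > 1/2 it still oscillates in the scaled variable with
   frequency tau = t^(1 - 1/p); a dilation by 1 + 1/tau shifts the phase by |eta|, and
   sin^2 (a - b) <= 2 (sin^2 a + sin^2 b) prevents both phases from being small. *)

theory Submission
  imports Defs "HOL-Probability.Probability"
begin

section \<open>Square integrable functions\<close>

text \<open>The solution is only an L2-valued function of time: at a fixed frequency \<xi> its
  transform need not be differentiable in t, and the second derivative exists only after division by
  \<open>1 + (norm \<xi>)\<^sup>2\<close>. Hence the oscillator cannot be solved frequency by
  frequency. Compact support of the test function keeps this weight, and the multipliers growing in
  \<xi>, bounded. Two kinds of transforms are kept apart: \<open>fourier\<close> is a choice,
  determined AE only, whereas the Fourier integral of L1 data is a continuous function, and only for
  it does a value at 0 make sense. The dimension enters through the singularity of the profile at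
  \<xi> = 0, of order 2\<sigma>, 0 or 1 in the three ranges; |\<xi>|^e is square integrable near 0
  exactly for e > -n/2. High frequencies cost regularity: r K obeys the bounds of K0 and K', so u1
  may have one derivative less than u0, and a time derivative costs one more. For \<sigma> > 1/2 the
  cosine replaces the time derivative of the sine profile, since differentiating the damping factor
  gives only a term of lower order.\<close>

lemma L2_measurable: "L2 f \<Longrightarrow> f \<in> borel_measurable lborel"
  by (simp add: L2_def)

lemma L2_integrable: "L2 f \<Longrightarrow> integrable lborel (\<lambda>x. (norm (f x))\<^sup>2)"
  by (simp add: L2_def)

lemma l2norm_nonneg [simp]: "0 \<le> l2norm f"
  by (simp add: l2norm_def)

lemma l2norm_squared: "(l2norm f)\<^sup>2 = (LINT x|lborel. (norm (f x))\<^sup>2)"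
  by (simp add: l2norm_def)

lemma L2_dominated:
  fixes f :: "real^'n \<Rightarrow> 'b::{banach,second_countable_topology}"
    and g :: "real^'n \<Rightarrow> 'c::{banach,second_countable_topology}"
  assumes "L2 f" "g \<in> borel_measurable lborel" "AE x in lborel. norm (g x) \<le> norm (f x)"
  shows "L2 g"
  unfolding L2_def
proof
  show "integrable lborel (\<lambda>x. (norm (g x))\<^sup>2)"
  proof (rule Bochner_Integration.integrable_bound[OF L2_integrable[OF assms(1)]])
    show "(\<lambda>x. (norm (g x))\<^sup>2) \<in> borel_measurable lborel"
      using assms(2) by measurable
    show "AE x in lborel. norm ((norm (g x))\<^sup>2) \<le> norm ((norm (f x))\<^sup>2)"
      using assms(3) by eventually_elim (auto intro!: power_mono)
  qed
qed (fact assms(2))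

lemma l2norm_mono:
  fixes f :: "real^'n \<Rightarrow> 'b::{banach,second_countable_topology}"
    and g :: "real^'n \<Rightarrow> 'c::{banach,second_countable_topology}"
  assumes "L2 f" "AE x in lborel. norm (g x) \<le> norm (f x)"
  shows "l2norm g \<le> l2norm f"
  unfolding l2norm_def
proof (rule real_sqrt_le_mono, cases "integrable lborel (\<lambda>x. (norm (g x))\<^sup>2)")
  case True
  show "(LINT x|lborel. (norm (g x))\<^sup>2) \<le> (LINT x|lborel. (norm (f x))\<^sup>2)"
    using assms(2) by (intro integral_mono_AE[OF True L2_integrable[OF assms(1)]])
      (auto elim!: eventually_mono intro!: power_mono)
qed (simp add: not_integrable_integral_eq)

lemma l2norm_cong_AE:
  assumes "f \<in> borel_measurable lborel" "g \<in> borel_measurable lborel"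
    "AE x in lborel. norm (f x) = norm (g x)"
  shows "l2norm f = l2norm g"
  unfolding l2norm_def using assms
  by (intro arg_cong[where f=sqrt] integral_cong_AE) auto

lemma L2_cong_AE:
  assumes "L2 f" "g \<in> borel_measurable lborel" "AE x in lborel. norm (f x) = norm (g x)"
  shows "L2 g"
  using assms(3) by (intro L2_dominated[OF assms(1,2)]) (auto elim!: eventually_mono)

lemma L2_zero [simp]: "L2 (\<lambda>x. 0)" and l2norm_zero [simp]: "l2norm (\<lambda>x. 0) = 0"
  by (auto simp: L2_def l2norm_def)

lemma L2_scaled:
  fixes f :: "real^'n \<Rightarrow> 'b::{banach,second_countable_topology}"
    and g :: "real^'n \<Rightarrow> 'c::{banach,second_countable_topology}"
  assumes "L2 f" "g \<in> borel_measurable lborel" "AE x in lborel. norm (g x) \<le> C * norm (f x)"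
  shows "L2 g" "C \<ge> 0 \<Longrightarrow> l2norm g \<le> C * l2norm f"
proof -
  have L: "L2 (\<lambda>x. C *\<^sub>R f x)"
    using L2_integrable[OF assms(1)] L2_measurable[OF assms(1)]
    by (auto simp: L2_def power_mult_distrib)
  have n: "l2norm (\<lambda>x. C *\<^sub>R f x) = \<bar>C\<bar> * l2norm f"
    by (simp add: l2norm_def power_mult_distrib real_sqrt_mult)
  have ae: "AE x in lborel. norm (g x) \<le> norm (C *\<^sub>R f x)"
    using assms(3) by eventually_elim (smt (verit) norm_scaleR mult_right_mono norm_ge_zero)
  show "L2 g" by (rule L2_dominated[OF L assms(2) ae])
  assume "C \<ge> 0" then show "l2norm g \<le> C * l2norm f"
    using l2norm_mono[OF L ae] n by simp
qed

lemma L2_scaleR: "L2 f \<Longrightarrow> L2 (\<lambda>x. c *\<^sub>R f x)"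
  by (auto simp: L2_def power_mult_distrib)

lemma l2norm_scaleR: "l2norm (\<lambda>x. c *\<^sub>R f x) = \<bar>c\<bar> * l2norm f"
  by (simp add: l2norm_def power_mult_distrib real_sqrt_mult)

lemma L2_cmult:
  fixes f :: "real^'n \<Rightarrow> complex"
  assumes "L2 f" shows "L2 (\<lambda>x. c * f x)"
  by (rule L2_scaled(1)[OF assms, of _ "cmod c"])
    (use L2_measurable[OF assms] in \<open>auto simp: norm_mult\<close>)

lemma l2norm_cmult: "l2norm (\<lambda>x. (c::complex) * f x) = cmod c * l2norm f"
  by (simp add: l2norm_def power_mult_distrib norm_mult real_sqrt_mult)

lemma L2_minus: "L2 f \<Longrightarrow> L2 (\<lambda>x. - f x)"
  by (auto simp: L2_def)

lemma L2_cplx: "L2 (cplx f) \<longleftrightarrow> L2 f" and l2norm_cplx: "l2norm (cplx f) = l2norm f"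
proof -
  have "f \<in> borel_measurable lborel" if "cplx f \<in> borel_measurable lborel"
  proof -
    have "(\<lambda>x. Re (cplx f x)) \<in> borel_measurable lborel" using that by measurable
    then show ?thesis by simp
  qed
  moreover have "cplx f \<in> borel_measurable lborel" if "f \<in> borel_measurable lborel"
    using that by measurable
  ultimately show "L2 (cplx f) \<longleftrightarrow> L2 f" unfolding L2_def norm_of_real real_norm_def by blast
  show "l2norm (cplx f) = l2norm f" by (simp add: l2norm_def)
qed

lemma L2_add:
  assumes "L2 f" "L2 g" shows "L2 (\<lambda>x. f x + g x)"
  unfolding L2_def
proof
  note [measurable] = L2_measurable[OF assms(1)] L2_measurable[OF assms(2)]
  show "(\<lambda>x. f x + g x) \<in> borel_measurable lborel" by measurable
  have "integrable lborel (\<lambda>x. 2 * (norm (f x))\<^sup>2 + 2 * (norm (g x))\<^sup>2)"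
    using assms by (auto simp: L2_def)
  then show "integrable lborel (\<lambda>x. (norm (f x + g x))\<^sup>2)"
  proof (rule Bochner_Integration.integrable_bound)
    show "AE x in lborel. norm ((norm (f x + g x))\<^sup>2) \<le> norm (2 * (norm (f x))\<^sup>2 + 2 * (norm (g x))\<^sup>2)"
    proof (intro AE_I2)
      fix x
      have "(norm (f x + g x))\<^sup>2 \<le> (norm (f x) + norm (g x))\<^sup>2"
        by (intro power_mono norm_triangle_ineq) auto
      also have "\<dots> \<le> 2 * (norm (f x))\<^sup>2 + 2 * (norm (g x))\<^sup>2"
        using sum_squares_bound[of "norm (f x)" "norm (g x)"] by (simp add: power2_sum)
      finally show "norm ((norm (f x + g x))\<^sup>2) \<le> norm (2 * (norm (f x))\<^sup>2 + 2 * (norm (g x))\<^sup>2)"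
        by simp
    qed
  qed measurable
qed

lemma L2_diff: "L2 f \<Longrightarrow> L2 g \<Longrightarrow> L2 (\<lambda>x. f x - g x)"
  using L2_add[OF _ L2_minus, of f g] by simp

lemma L2_mult_integrable:
  fixes f g :: "real^'n \<Rightarrow> complex"
  assumes "L2 f" "L2 g" shows "integrable lborel (\<lambda>x. f x * g x)"
proof (rule Bochner_Integration.integrable_bound)
  show "integrable lborel (\<lambda>x. (norm (f x))\<^sup>2 + (norm (g x))\<^sup>2)"
    using assms by (auto simp: L2_def)
  show "(\<lambda>x. f x * g x) \<in> borel_measurable lborel"
    using assms by (auto simp: L2_def)
  show "AE x in lborel. norm (f x * g x) \<le> norm ((norm (f x))\<^sup>2 + (norm (g x))\<^sup>2)"
  proof (intro AE_I2)
    fix x show "norm (f x * g x) \<le> norm ((norm (f x))\<^sup>2 + (norm (g x))\<^sup>2)"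
      using sum_squares_bound[of "norm (f x)" "norm (g x)"]
        mult_nonneg_nonneg[OF norm_ge_zero[of "f x"] norm_ge_zero[of "g x"]]
      by (simp only: norm_mult real_norm_def)
  qed
qed

lemma L2_norm: "L2 f \<Longrightarrow> L2 (\<lambda>x. complex_of_real (norm (f x)))"
  by (auto simp: L2_def)

lemma L2_norm_mult_integrable:
  assumes "L2 f" "L2 g" shows "integrable lborel (\<lambda>x. norm (f x) * norm (g x))"
proof -
  have "integrable lborel (\<lambda>x. Re (complex_of_real (norm (f x)) * complex_of_real (norm (g x))))"
    by (intro integrable_Re L2_mult_integrable L2_norm assms)
  then show ?thesis by simp
qed

lemma L2_Cauchy_Schwarz:
  assumes "L2 f" "L2 g"
  shows "(LINT x|lborel. norm (f x) * norm (g x)) \<le> l2norm f * l2norm g"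
proof -
  define I where "I = (LINT x|lborel. norm (f x) * norm (g x))"
  define a b where "a = l2norm f" and "b = l2norm g"
  have a: "a \<ge> 0" and b: "b \<ge> 0" and I: "I \<ge> 0" by (auto simp: a_def b_def I_def)
  \<comment> \<open>Expanding the integral of \<open>(e * norm (f x) - norm (g x))\<^sup>2\<close>
    gives a nonnegative quadratic polynomial in \<open>e\<close>; the sign of its discriminant is
    the claim.\<close>
  have q: "0 \<le> e\<^sup>2 * a\<^sup>2 - 2 * e * I + b\<^sup>2" for e
  proof -
    have "0 \<le> (LINT x|lborel. (e * norm (f x) - norm (g x))\<^sup>2)" by simp
    also have "\<dots> = (LINT x|lborel. e\<^sup>2 * (norm (f x))\<^sup>2 - (2 * e) * (norm (f x) * norm (g x)) + (norm (g x))\<^sup>2)"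
      by (intro Bochner_Integration.integral_cong) (auto simp: power2_diff power_mult_distrib)
    also have "\<dots> = e\<^sup>2 * a\<^sup>2 - 2 * e * I + b\<^sup>2"
      unfolding a_def b_def I_def l2norm_squared
      using L2_integrable[OF assms(1)] L2_integrable[OF assms(2)] L2_norm_mult_integrable[OF assms]
      by simp
    finally show ?thesis .
  qed
  show ?thesis
  proof (cases "a = 0")
    case True
    have "I = 0"
    proof (rule ccontr)
      assume "I \<noteq> 0" then have "I > 0" using I by simp
      \<comment> \<open>For \<open>a = 0\<close> the polynomial is linear in \<open>e\<close>, and
        this choice gives it the value -1.\<close>
      then show False using q[of "(b\<^sup>2 + 1) / (2 * I)"] True by simp
    qed
    then show ?thesis using True a_def I_def by simp
  next
    case False
    then have "a > 0" using a by simp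
    have "I\<^sup>2 \<le> (a * b)\<^sup>2"
      \<comment> \<open>The minimiser of the quadratic is \<open>e = I / a\<^sup>2\<close>.\<close>
      using q[of "I / a\<^sup>2"] \<open>a > 0\<close> by (simp add: field_simps power2_eq_square)
    then have "I \<le> a * b" using power2_le_imp_le a b by fastforce
    then show ?thesis by (simp add: I_def a_def b_def)
  qed
qed

lemma L2_integral_mult_le:
  fixes f g :: "real^'n \<Rightarrow> complex"
  assumes "L2 f" "L2 g"
  shows "cmod (LINT x|lborel. f x * g x) \<le> l2norm f * l2norm g"
proof -
  have "cmod (LINT x|lborel. f x * g x) \<le> (LINT x|lborel. cmod (f x * g x))"
    by (rule integral_norm_bound)
  also have "\<dots> \<le> l2norm f * l2norm g"
    using L2_Cauchy_Schwarz[OF assms] by (simp add: norm_mult)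
  finally show ?thesis .
qed

lemma l2norm_triangle:
  assumes "L2 f" "L2 g" shows "l2norm (\<lambda>x. f x + g x) \<le> l2norm f + l2norm g"
proof (rule power2_le_imp_le)
  have "(l2norm (\<lambda>x. f x + g x))\<^sup>2 = (LINT x|lborel. (norm (f x + g x))\<^sup>2)"
    by (rule l2norm_squared)
  also have "\<dots> \<le> (LINT x|lborel. (norm (f x))\<^sup>2 + 2 * (norm (f x) * norm (g x)) + (norm (g x))\<^sup>2)"
  proof (rule integral_mono)
    show "integrable lborel (\<lambda>x. (norm (f x + g x))\<^sup>2)" by (rule L2_integrable[OF L2_add[OF assms]])
    show "integrable lborel (\<lambda>x. (norm (f x))\<^sup>2 + 2 * (norm (f x) * norm (g x)) + (norm (g x))\<^sup>2)"
      using L2_integrable[OF assms(1)] L2_integrable[OF assms(2)] L2_norm_mult_integrable[OF assms] by auto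
    fix x
    have "(norm (f x + g x))\<^sup>2 \<le> (norm (f x) + norm (g x))\<^sup>2"
      by (intro power_mono norm_triangle_ineq) auto
    then show "(norm (f x + g x))\<^sup>2 \<le> (norm (f x))\<^sup>2 + 2 * (norm (f x) * norm (g x)) + (norm (g x))\<^sup>2"
      by (simp add: power2_sum)
  qed
  also have "\<dots> = (l2norm f)\<^sup>2 + 2 * (LINT x|lborel. norm (f x) * norm (g x)) + (l2norm g)\<^sup>2"
    using L2_integrable[OF assms(1)] L2_integrable[OF assms(2)] L2_norm_mult_integrable[OF assms]
    by (simp add: l2norm_squared)
  also have "\<dots> \<le> (l2norm f + l2norm g)\<^sup>2"
    using L2_Cauchy_Schwarz[OF assms] by (simp add: power2_sum)
  finally show "(l2norm (\<lambda>x. f x + g x))\<^sup>2 \<le> (l2norm f + l2norm g)\<^sup>2" .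
qed simp

lemma l2norm_uminus: "l2norm (\<lambda>x. - f x) = l2norm f"
  by (simp add: l2norm_def)

lemma l2norm_minus_commute: "l2norm (\<lambda>x. f x - g x) = l2norm (\<lambda>x. g x - f x)"
  by (simp add: l2norm_def norm_minus_commute)

lemma l2norm_triangle_diff:
  assumes "L2 f" "L2 g" shows "l2norm (\<lambda>x. f x - g x) \<le> l2norm f + l2norm g"
  using l2norm_triangle[OF assms(1) L2_minus[OF assms(2)]] by (simp add: l2norm_uminus)

lemma l2norm_triangle3:
  assumes "L2 f" "L2 g" "L2 h"
  shows "l2norm (\<lambda>x. f x - h x) \<le> l2norm (\<lambda>x. f x - g x) + l2norm (\<lambda>x. g x - h x)"
  using l2norm_triangle[OF L2_diff[OF assms(1,2)] L2_diff[OF assms(2,3)]] by simp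

lemma l2norm_diff_abs:
  assumes "L2 f" "L2 g" shows "\<bar>l2norm f - l2norm g\<bar> \<le> l2norm (\<lambda>x. f x - g x)"
  using l2norm_triangle[OF L2_diff[OF assms] assms(2)]
    l2norm_triangle[OF L2_diff[OF assms(2,1)] assms(1)] l2norm_minus_commute[of f g]
  by simp

lemma l2norm_eq_0_AE:
  assumes "L2 f" "l2norm f = 0" shows "AE x in lborel. f x = 0"
proof -
  have "(LINT x|lborel. (norm (f x))\<^sup>2) = 0" using assms(2) l2norm_squared[of f] by simp
  then have "AE x in lborel. (norm (f x))\<^sup>2 = 0"
    by (subst (asm) integral_nonneg_eq_0_iff_AE[OF L2_integrable[OF assms(1)]]) auto
  then show ?thesis by simp
qed

section \<open>Convergence in L2\<close>

lemma L2_tendstoD: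
  assumes "L2_tendsto F g net"
  shows "L2 g" "\<forall>\<^sub>F i in net. L2 (F i)" "((\<lambda>i. l2norm (\<lambda>x. F i x - g x)) \<longlongrightarrow> 0) net"
  using assms by (auto simp: L2_tendsto_def)

lemma L2_tendsto_unique:
  assumes "L2_tendsto F g net" "L2_tendsto F h net" "net \<noteq> bot"
  shows "AE x in lborel. g x = h x"
proof -
  note g = L2_tendstoD[OF assms(1)] and h = L2_tendstoD[OF assms(2)]
  have "l2norm (\<lambda>x. g x - h x) \<le> 0 + 0"
  proof (rule tendsto_lowerbound[OF tendsto_add[OF g(3) h(3)] _ assms(3)])
    show "\<forall>\<^sub>F i in net. l2norm (\<lambda>x. g x - h x) \<le> l2norm (\<lambda>x. F i x - g x) + l2norm (\<lambda>x. F i x - h x)"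
      using g(2) by eventually_elim
        (metis (mono_tags) l2norm_triangle3[OF g(1) _ h(1)] l2norm_minus_commute)
  qed
  then have "l2norm (\<lambda>x. g x - h x) = 0" by (simp add: order_antisym)
  from l2norm_eq_0_AE[OF L2_diff[OF g(1) h(1)] this] show ?thesis by simp
qed

lemma L2_tendsto_l2norm:
  assumes "L2_tendsto F g net"
  shows "((\<lambda>i. l2norm (F i)) \<longlongrightarrow> l2norm g) net"
proof -
  note g = L2_tendstoD[OF assms]
  have "((\<lambda>i. l2norm (F i) - l2norm g) \<longlongrightarrow> 0) net"
    by (rule Lim_null_comparison[OF _ g(3)])
      (use g(2) in \<open>eventually_elim, auto intro: l2norm_diff_abs g(1)\<close>)
  then show ?thesis by (simp add: LIM_zero_iff)
qed

text \<open>F G - g h = (F - g) G + g (G - h), and the norms of \<open>G i\<close> converge. The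
  pairing is bilinear, without conjugation, as the duality argument and the multiplication formula
  require.\<close>

lemma L2_tendsto_integral_mult:
  fixes g :: "real^'n \<Rightarrow> complex"
  assumes F: "L2_tendsto F g net" and G: "L2_tendsto G h net"
  shows "((\<lambda>i. LINT x|lborel. F i x * G i x) \<longlongrightarrow> (LINT x|lborel. g x * h x)) net"
proof -
  note g = L2_tendstoD[OF F] and h = L2_tendstoD[OF G]
  have "((\<lambda>i. (LINT x|lborel. F i x * G i x) - (LINT x|lborel. g x * h x)) \<longlongrightarrow> 0) net"
  proof (rule Lim_null_comparison)
    show "\<forall>\<^sub>F i in net. norm ((LINT x|lborel. F i x * G i x) - (LINT x|lborel. g x * h x))
        \<le> l2norm (\<lambda>x. F i x - g x) * l2norm (G i) + l2norm g * l2norm (\<lambda>x. G i x - h x)"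
      using g(2) h(2)
    proof eventually_elim
      case (elim i)
      have "(LINT x|lborel. F i x * G i x) - (LINT x|lborel. g x * h x)
          = (LINT x|lborel. (F i x - g x) * G i x) + (LINT x|lborel. g x * (G i x - h x))"
        using L2_mult_integrable[OF elim] L2_mult_integrable[OF g(1) elim(2)]
          L2_mult_integrable[OF g(1) h(1)]
        by (simp add: algebra_simps)
      also have "norm \<dots> \<le> norm (LINT x|lborel. (F i x - g x) * G i x)
          + norm (LINT x|lborel. g x * (G i x - h x))" by (rule norm_triangle_ineq)
      also have "\<dots> \<le> l2norm (\<lambda>x. F i x - g x) * l2norm (G i) + l2norm g * l2norm (\<lambda>x. G i x - h x)"
        by (intro add_mono L2_integral_mult_le L2_diff elim g h)
      finally show ?case .
    qed
    have "((\<lambda>i. l2norm (\<lambda>x. F i x - g x) * l2norm (G i) + l2norm g * l2norm (\<lambda>x. G i x - h x))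
       \<longlongrightarrow> 0 * l2norm h + l2norm g * 0) net"
      by (intro tendsto_intros g h L2_tendsto_l2norm[OF G])
    then show "((\<lambda>i. l2norm (\<lambda>x. F i x - g x) * l2norm (G i) + l2norm g * l2norm (\<lambda>x. G i x - h x))
       \<longlongrightarrow> 0) net" by simp
  qed
  then show ?thesis by (simp add: LIM_zero_iff)
qed

text \<open>Dominated convergence for the squared difference, with majorant
  \<open>4 * (norm (h x))\<^sup>2\<close>. The bound is assumed only from some index
  \<open>N\<close> on, whence the shift \<open>i + N\<close>.\<close>

lemma L2_dominated_convergence_seq:
  fixes F :: "nat \<Rightarrow> real^'n \<Rightarrow> 'b::{banach,second_countable_topology}"
  assumes "L2 h" "g \<in> borel_measurable lborel"
    and "\<forall>\<^sub>F i in sequentially. F i \<in> borel_measurable lborel \<and> (AE x in lborel. norm (F i x) \<le> norm (h x))"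
    and "AE x in lborel. (\<lambda>i. F i x) \<longlonglongrightarrow> g x"
  shows "L2_tendsto F g sequentially"
proof -
  obtain N where N: "\<And>i. i \<ge> N \<Longrightarrow> F i \<in> borel_measurable lborel \<and> (AE x in lborel. norm (F i x) \<le> norm (h x))"
    using assms(3) by (auto simp: eventually_sequentially)
  have LF: "L2 (F i)" if "i \<ge> N" for i using L2_dominated[OF assms(1)] N[OF that] by auto
  have le: "AE x in lborel. \<forall>i. norm (F (i + N) x) \<le> norm (h x)"
    unfolding AE_all_countable using N by auto
  have gh: "AE x in lborel. norm (g x) \<le> norm (h x)"
    using le assms(4)
  proof eventually_elim
    case (elim x)
    from elim(2) have "(\<lambda>i. norm (F (i + N) x)) \<longlonglongrightarrow> norm (g x)"
      by (intro tendsto_norm) (rule LIMSEQ_ignore_initial_segment)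
    then show ?case by (rule LIMSEQ_le_const2) (use elim(1) in auto)
  qed
  have Lg: "L2 g" by (rule L2_dominated[OF assms(1,2) gh])
  have "(\<lambda>i. LINT x|lborel. (norm (F (i + N) x - g x))\<^sup>2) \<longlonglongrightarrow> (LINT x|(lborel :: (real^'n) measure). 0)"
  proof (rule integral_dominated_convergence[where w="\<lambda>x. 4 * (norm (h x))\<^sup>2"])
    show "integrable lborel (\<lambda>x. 4 * (norm (h x))\<^sup>2)" using assms(1) by (simp add: L2_def)
    show "(\<lambda>x. (norm (F (i + N) x - g x))\<^sup>2) \<in> borel_measurable lborel" for i
      using assms(2) N[of "i + N"] by auto
    show "AE x in lborel. (\<lambda>i. (norm (F (i + N) x - g x))\<^sup>2) \<longlonglongrightarrow> 0"
      using assms(4)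
    proof eventually_elim
      case (elim x)
      then have "(\<lambda>i. F (i + N) x) \<longlonglongrightarrow> g x" by (rule LIMSEQ_ignore_initial_segment)
      then have "(\<lambda>i. (norm (F (i + N) x - g x))\<^sup>2) \<longlonglongrightarrow> (norm (g x - g x))\<^sup>2"
        by (intro tendsto_intros)
      then show ?case by simp
    qed
    show "AE x in lborel. norm ((norm (F (i + N) x - g x))\<^sup>2) \<le> 4 * (norm (h x))\<^sup>2" for i
      using le gh
    proof eventually_elim
      case (elim x)
      have "norm (F (i + N) x - g x) \<le> 2 * norm (h x)"
        using norm_triangle_ineq4[of "F (i + N) x" "g x"] elim(1)[rule_format, of i] elim(2) by linarith
      then have "(norm (F (i + N) x - g x))\<^sup>2 \<le> (2 * norm (h x))\<^sup>2" by (intro power_mono) auto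
      then show ?case by (simp add: power_mult_distrib)
    qed
  qed simp
  then have "(\<lambda>i. sqrt (LINT x|lborel. (norm (F (i + N) x - g x))\<^sup>2)) \<longlonglongrightarrow> sqrt 0"
    by (intro tendsto_real_sqrt) simp
  then have "(\<lambda>i. l2norm (\<lambda>x. F (i + N) x - g x)) \<longlonglongrightarrow> 0" by (simp add: l2norm_def)
  then have "(\<lambda>i. l2norm (\<lambda>x. F i x - g x)) \<longlonglongrightarrow> 0" by (rule LIMSEQ_offset)
  then show ?thesis using Lg LF by (auto simp: L2_tendsto_def eventually_sequentially)
qed

lemma L2_tendsto_at_topI:
  fixes F :: "real \<Rightarrow> real^'n \<Rightarrow> 'b::{banach,second_countable_topology}"
  assumes "L2 g" "\<forall>\<^sub>F t in at_top. L2 (F t)"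
    and "\<And>X. filterlim X at_top sequentially \<Longrightarrow> L2_tendsto (\<lambda>i. F (X i)) g sequentially"
  shows "L2_tendsto F g at_top"
  unfolding L2_tendsto_def using assms
  by (auto intro!: tendsto_at_topI_sequentially simp: L2_tendsto_def)

text \<open>The null set where the bound fails may depend on the index, and only countably many null
  sets can be collected into one; the limit is therefore tested along sequences.\<close>

lemma L2_dominated_convergence_at_top:
  fixes F :: "real \<Rightarrow> real^'n \<Rightarrow> 'b::{banach,second_countable_topology}"
  assumes h: "L2 h" and g: "g \<in> borel_measurable lborel"
    and F: "\<forall>\<^sub>F i in at_top. F i \<in> borel_measurable lborel \<and> (AE x in lborel. norm (F i x) \<le> norm (h x))"
    and lim: "AE x in lborel. ((\<lambda>i. F i x) \<longlongrightarrow> g x) at_top"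
  shows "L2_tendsto F g at_top"
proof (rule L2_tendsto_at_topI)
  show seq: "L2_tendsto (\<lambda>i. F (X i)) g sequentially" if "filterlim X at_top sequentially" for X
  proof (rule L2_dominated_convergence_seq[OF h g])
    show "\<forall>\<^sub>F i in sequentially. F (X i) \<in> borel_measurable lborel \<and> (AE x in lborel. norm (F (X i) x) \<le> norm (h x))"
      by (rule eventually_compose_filterlim[OF F that])
    show "AE x in lborel. (\<lambda>i. F (X i) x) \<longlonglongrightarrow> g x"
      using lim by eventually_elim (rule filterlim_compose[OF _ that])
  qed
  show "L2 g" using L2_tendstoD(1)[OF seq[OF filterlim_real_sequentially]] .
  show "\<forall>\<^sub>F t in at_top. L2 (F t)" using F by eventually_elim (auto intro: L2_dominated[OF h])
qed

lemma L2_dominated_convergence_at: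
  fixes F :: "real \<Rightarrow> real^'n \<Rightarrow> 'b::{banach,second_countable_topology}"
  assumes h: "L2 h" and g: "g \<in> borel_measurable lborel"
    and F: "\<forall>\<^sub>F i in at t within S. F i \<in> borel_measurable lborel \<and> (AE x in lborel. norm (F i x) \<le> norm (h x))"
    and lim: "AE x in lborel. ((\<lambda>i. F i x) \<longlongrightarrow> g x) (at t within S)"
    and ne: "at t within S \<noteq> bot"
  shows "L2_tendsto F g (at t within S)"
proof -
  have seq: "L2_tendsto (\<lambda>i. F (X i)) g sequentially" if X: "filterlim X (at t within S) sequentially" for X
  proof (rule L2_dominated_convergence_seq[OF h g])
    show "\<forall>\<^sub>F i in sequentially. F (X i) \<in> borel_measurable lborel \<and> (AE x in lborel. norm (F (X i) x) \<le> norm (h x))"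
      by (rule eventually_compose_filterlim[OF F X])
    show "AE x in lborel. (\<lambda>i. F (X i) x) \<longlonglongrightarrow> g x"
      using lim by eventually_elim (rule filterlim_compose[OF _ X])
  qed
  \<comment> \<open>At least one sequence has to approach \<open>t\<close>: square integrability of
    the limit is read off along it.\<close>
  obtain X0 where "\<forall>i. X0 i \<in> S - {t}" "X0 \<longlonglongrightarrow> t"
    using ne by (auto simp: trivial_limit_within islimpt_sequential)
  then have "filterlim X0 (at t within S) sequentially"
    by (auto simp: filterlim_at)
  then have "L2 g" using L2_tendstoD(1)[OF seq] by blast
  moreover have "\<forall>\<^sub>F i in at t within S. L2 (F i)"
    using F by eventually_elim (auto intro: L2_dominated[OF h])
  moreover have "((\<lambda>i. l2norm (\<lambda>x. F i x - g x)) \<longlongrightarrow> 0) (at t within S)"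
    unfolding tendsto_at_iff_sequentially o_def
    using L2_tendstoD(3)[OF seq] by (auto simp: filterlim_at)
  ultimately show ?thesis by (simp add: L2_tendsto_def)
qed

section \<open>Completeness and density of continuous functions\<close>

lemma L2_complete:
  fixes F :: "nat \<Rightarrow> real^'n \<Rightarrow> 'b::{banach,second_countable_topology}"
  assumes F: "\<And>j. L2 (F j)"
    and cauchy: "\<And>j. (l2norm (\<lambda>x. F (Suc j) x - F j x))\<^sup>2 \<le> 1 / 8 ^ j"
  shows "\<exists>g. L2_tendsto F g sequentially"
proof -
  define d where "d j x = F (Suc j) x - F j x" for j x
  have Ld: "L2 (d j)" for j unfolding d_def by (intro L2_diff F)
  note [measurable] = L2_measurable[OF F] L2_measurable[OF Ld]
  have dd: "(LINT x|lborel. (norm (d j x))\<^sup>2) \<le> 1 / 8 ^ j" for j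
    using cauchy[of j] unfolding l2norm_squared d_def .
  \<comment> \<open>The rate 1/8^j leaves room for the weight 4^j: the weighted squares still have
    summable integrals, so at almost every point they are bounded by some \<open>B\<close>, and the
    increments there are at most sqrt B / 2^j. A bound on norms thus becomes pointwise
    convergence.\<close>
  have nn: "(\<integral>\<^sup>+x. ennreal (4 ^ j * (norm (d j x))\<^sup>2) \<partial>lborel) \<le> ennreal ((1/2) ^ j)" for j
  proof -
    have "(\<integral>\<^sup>+x. ennreal (4 ^ j * (norm (d j x))\<^sup>2) \<partial>lborel) = ennreal (LINT x|lborel. 4 ^ j * (norm (d j x))\<^sup>2)"
      using L2_integrable[OF Ld] by (intro nn_integral_eq_integral) auto
    also have "(LINT x|lborel. 4 ^ j * (norm (d j x))\<^sup>2) \<le> 4 ^ j * (1 / 8 ^ j)"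
      by (subst integral_mult_right_zero) (intro mult_left_mono dd, simp)
    also have "4 ^ j * (1 / 8 ^ j) = ((1/2) ^ j :: real)"
      by (simp add: power_divide[symmetric] divide_simps power_mult_distrib[symmetric])
    finally show ?thesis by (simp add: ennreal_leI)
  qed
  have "(\<integral>\<^sup>+x. (\<Sum>j. ennreal (4 ^ j * (norm (d j x))\<^sup>2)) \<partial>lborel)
      = (\<Sum>j. \<integral>\<^sup>+x. ennreal (4 ^ j * (norm (d j x))\<^sup>2) \<partial>lborel)"
    by (rule nn_integral_suminf) measurable
  also have "\<dots> \<le> (\<Sum>j. ennreal ((1/2) ^ j))"
    by (intro suminf_le nn) auto
  also have "\<dots> < \<infinity>"
    by (subst suminf_ennreal2) (auto intro: summable_geometric)
  finally have "AE x in lborel. (\<Sum>j. ennreal (4 ^ j * (norm (d j x))\<^sup>2)) \<noteq> \<infinity>"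
    by (intro nn_integral_noteq_infinite) auto
  then have conv: "AE x in lborel. convergent (\<lambda>j. F j x)"
  proof eventually_elim
    case (elim x)
    define B where "B = enn2real (\<Sum>j. ennreal (4 ^ j * (norm (d j x))\<^sup>2))"
    have B: "4 ^ j * (norm (d j x))\<^sup>2 \<le> B" for j
    proof -
      have "ennreal (4 ^ j * (norm (d j x))\<^sup>2) \<le> (\<Sum>j. ennreal (4 ^ j * (norm (d j x))\<^sup>2))"
        using sum_le_suminf[of "\<lambda>j. ennreal (4 ^ j * (norm (d j x))\<^sup>2)" "{j}"]
        by (simp only: summableI finite.intros sum.insert sum.empty empty_iff add_0_right zero_le not_False_eq_True)
      also have "\<dots> = ennreal B" unfolding B_def using elim
        by (intro ennreal_enn2real[symmetric]) (simp only: less_top infinity_ennreal_def)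
      finally show ?thesis
        by (subst (asm) ennreal_le_iff) (auto simp only: B_def enn2real_nonneg)
    qed
    have nd: "norm (d j x) \<le> sqrt B * (1/2) ^ j" for j
    proof -
      have "2 ^ j * norm (d j x) = sqrt (4 ^ j * (norm (d j x))\<^sup>2)"
        by (simp add: real_sqrt_mult real_sqrt_power)
      also have "\<dots> \<le> sqrt B" using B by simp
      finally show ?thesis by (simp add: field_simps power_divide)
    qed
    have "summable (\<lambda>j. sqrt B * (1/2) ^ j)"
      by (intro summable_mult summable_geometric) simp
    then have "summable (\<lambda>j. d j x)"
      by (rule summable_comparison_test'[where N=0]) (rule nd)
    then have "convergent (\<lambda>n. \<Sum>j<n. d j x)" by (simp add: summable_iff_convergent)
    moreover have "(\<Sum>j<n. d j x) = F n x - F 0 x" for n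
      unfolding d_def by (rule sum_lessThan_telescope)
    ultimately have "convergent (\<lambda>n. F n x - F 0 x + F 0 x)"
      by (intro convergent_add convergent_const) simp
    then show ?case by simp
  qed
  define g where "g x = lim (\<lambda>j. F j x)" for x
  have [measurable]: "g \<in> borel_measurable lborel" unfolding g_def by measurable
  have lim: "AE x in lborel. (\<lambda>j. F j x) \<longlonglongrightarrow> g x"
    using conv by eventually_elim (simp add: g_def convergent_LIMSEQ_iff)
  define \<epsilon> where "\<epsilon> j = 4 * (1 / sqrt 8) ^ j" for j :: nat
  have step: "l2norm (d j) \<le> (1 / sqrt 8) ^ j" for j
  proof (rule power2_le_imp_le)
    show "(l2norm (d j))\<^sup>2 \<le> ((1 / sqrt 8) ^ j)\<^sup>2"
      using cauchy[of j] unfolding d_def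
      by (simp add: power_divide power2_eq_square[of "_ ^ _"] flip: power_mult_distrib)
  qed simp
  have s8: "1 / sqrt 8 \<le> 1 / (2::real)" by (simp add: real_le_rsqrt)
  have tail: "l2norm (\<lambda>x. F (j + m) x - F j x) \<le> \<epsilon> j" for j m
  proof -
    have "l2norm (\<lambda>x. F (j + m) x - F j x) \<le> (\<Sum>i<m. (1 / sqrt 8) ^ (j + i))"
    proof (induction m)
      case (Suc m)
      have "l2norm (\<lambda>x. F (j + Suc m) x - F j x) \<le> l2norm (\<lambda>x. F (j + Suc m) x - F (j + m) x)
          + l2norm (\<lambda>x. F (j + m) x - F j x)" by (rule l2norm_triangle3) (rule F)+
      also have "l2norm (\<lambda>x. F (j + Suc m) x - F (j + m) x) \<le> (1 / sqrt 8) ^ (j + m)"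
        using step[of "j + m"] by (simp add: d_def[abs_def])
      finally show ?case using Suc by simp
    qed simp
    also have "\<dots> = (1 / sqrt 8) ^ j * (\<Sum>i<m. (1 / sqrt 8) ^ i)"
      by (simp add: power_add sum_distrib_left)
    also have "(\<Sum>i<m. (1 / sqrt 8) ^ i) \<le> (\<Sum>i<m. (1 / 2 :: real) ^ i)"
      by (intro sum_mono power_mono s8) auto
    also have "\<dots> \<le> (\<Sum>i. (1 / 2 :: real) ^ i)"
      by (intro sum_le_suminf summable_geometric) auto
    also have "\<dots> = 2" by (subst suminf_geometric) auto
    also have "(1 / sqrt 8) ^ j * 2 \<le> \<epsilon> j" by (simp add: \<epsilon>_def)
    finally show ?thesis by (simp add: mult_left_mono)
  qed
  \<comment> \<open>Fatou's lemma carries the tail bound over to m -> \<infinity>. It is stated with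
    nonnegative integrals because square integrability of \<open>g\<close> is only a consequence of
    it.\<close>
  have bound: "(\<integral>\<^sup>+x. ennreal ((norm (g x - F j x))\<^sup>2) \<partial>lborel) \<le> ennreal ((\<epsilon> j)\<^sup>2)" for j
  proof -
    have "(\<integral>\<^sup>+x. ennreal ((norm (g x - F j x))\<^sup>2) \<partial>lborel)
        = (\<integral>\<^sup>+x. liminf (\<lambda>m. ennreal ((norm (F (j + m) x - F j x))\<^sup>2)) \<partial>lborel)"
    proof (rule nn_integral_cong_AE)
      show "AE x in lborel. ennreal ((norm (g x - F j x))\<^sup>2) = liminf (\<lambda>m. ennreal ((norm (F (j + m) x - F j x))\<^sup>2))"
        using lim
      proof eventually_elim
        case (elim x)
        have "(\<lambda>m. F (j + m) x) \<longlonglongrightarrow> g x"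
          using LIMSEQ_ignore_initial_segment[OF elim, of j] by (simp add: add.commute)
        then have "(\<lambda>m. ennreal ((norm (F (j + m) x - F j x))\<^sup>2)) \<longlonglongrightarrow> ennreal ((norm (g x - F j x))\<^sup>2)"
          by (intro tendsto_intros) auto
        then show ?case by (rule lim_imp_Liminf[OF trivial_limit_sequentially, symmetric])
      qed
    qed
    also have "\<dots> \<le> liminf (\<lambda>m. \<integral>\<^sup>+x. ennreal ((norm (F (j + m) x - F j x))\<^sup>2) \<partial>lborel)"
      by (rule nn_integral_liminf) measurable
    also have "\<dots> \<le> liminf (\<lambda>m. ennreal ((\<epsilon> j)\<^sup>2))"
    proof (intro Liminf_mono always_eventually allI)
      fix m
      have "(\<integral>\<^sup>+x. ennreal ((norm (F (j + m) x - F j x))\<^sup>2) \<partial>lborel)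
         = ennreal (LINT x|lborel. (norm (F (j + m) x - F j x))\<^sup>2)"
        by (intro nn_integral_eq_integral L2_integrable L2_diff F) auto
      also have "\<dots> \<le> ennreal ((\<epsilon> j)\<^sup>2)"
        unfolding l2norm_squared[symmetric] by (intro ennreal_leI power_mono tail) auto
      finally show "(\<integral>\<^sup>+x. ennreal ((norm (F (j + m) x - F j x))\<^sup>2) \<partial>lborel) \<le> ennreal ((\<epsilon> j)\<^sup>2)" .
    qed
    also have "\<dots> = ennreal ((\<epsilon> j)\<^sup>2)" by (simp add: Liminf_const)
    finally show ?thesis .
  qed
  have LgF: "L2 (\<lambda>x. g x - F j x)" for j
    unfolding L2_def
  proof
    show "integrable lborel (\<lambda>x. (norm (g x - F j x))\<^sup>2)"
      using bound[of j] by (intro integrableI_bounded) (auto simp: top.not_eq_extremum intro: le_less_trans)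
  qed measurable
  have Lg: "L2 g" using L2_add[OF LgF[of 0] F[of 0]] by simp
  have nb: "l2norm (\<lambda>x. F j x - g x) \<le> \<epsilon> j" for j
  proof -
    have "ennreal (LINT x|lborel. (norm (g x - F j x))\<^sup>2) \<le> ennreal ((\<epsilon> j)\<^sup>2)"
      using bound[of j] by (subst nn_integral_eq_integral[symmetric]) (auto intro: L2_integrable LgF)
    then have "(l2norm (\<lambda>x. g x - F j x))\<^sup>2 \<le> (\<epsilon> j)\<^sup>2" by (simp add: l2norm_squared)
    then show ?thesis unfolding l2norm_minus_commute[of "F j" g]
      by (rule power2_le_imp_le) (simp add: \<epsilon>_def)
  qed
  have "\<epsilon> \<longlonglongrightarrow> 4 * 0" unfolding \<epsilon>_def[abs_def]
    using s8 by (intro tendsto_mult tendsto_const LIMSEQ_power_zero) auto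
  then have e0: "\<epsilon> \<longlonglongrightarrow> 0" by simp
  have "\<forall>\<^sub>F j in sequentially. norm (l2norm (\<lambda>x. F j x - g x)) \<le> \<epsilon> j"
    unfolding real_norm_def abs_of_nonneg[OF l2norm_nonneg] by (intro always_eventually allI nb)
  then have "(\<lambda>j. l2norm (\<lambda>x. F j x - g x)) \<longlonglongrightarrow> 0"
    by (rule Lim_null_comparison) (rule e0)
  then show ?thesis using Lg F by (auto simp: L2_tendsto_def)
qed

lemma L2_bounded_support:
  fixes f :: "real^'n \<Rightarrow> 'b::{banach,second_countable_topology}"
  assumes "f \<in> borel_measurable lborel" "\<And>x. norm (f x) \<le> M" "\<And>x. norm x > R \<Longrightarrow> f x = 0"
  shows "L2 f" "integrable lborel f"
proof -
  have c: "integrable lborel (\<lambda>x::real^'n. indicator (cball 0 R) x *\<^sub>R c)" for c :: real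
    by (rule integrable_real_indicator[THEN integrable_scaleR_left]) 
      (use emeasure_bounded_finite[OF bounded_cball, of 0 R] in auto)
  have le: "norm (f x) \<le> norm (indicator (cball 0 R) x *\<^sub>R M)" for x
    using assms(2)[of x] assms(3)[of x] by (cases "norm x > R") (auto simp: indicator_def)
  show "integrable lborel f"
    by (rule Bochner_Integration.integrable_bound[OF c[of M] assms(1)]) (use le in auto)
  have "L2 (\<lambda>x::real^'n. indicator (cball 0 R) x *\<^sub>R M)"
    unfolding L2_def
  proof
    show "integrable lborel (\<lambda>x::real^'n. (norm (indicator (cball 0 R) x *\<^sub>R M))\<^sup>2)"
      by (rule Bochner_Integration.integrable_bound[OF c[of "M\<^sup>2"]]) (auto simp: indicator_def)
    show "(\<lambda>x::real^'n. indicator (cball 0 R) x *\<^sub>R M) \<in> borel_measurable lborel"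
      by (intro borel_measurable_scaleR borel_measurable_indicator borel_measurable_const) simp
  qed
  then show "L2 f" by (rule L2_dominated[OF _ assms(1)]) (use le in auto)
qed

lemma L2_truncate:
  fixes f :: "real^'n \<Rightarrow> 'b::{banach,second_countable_topology}"
  assumes "L2 f" "e > 0"
  shows "\<exists>M>0. l2norm (\<lambda>x. f x - (if norm x \<le> M \<and> norm (f x) \<le> M then f x else 0)) < e"
proof -
  note [measurable] = L2_measurable[OF assms(1)]
  have "L2_tendsto (\<lambda>M x. f x - (if norm x \<le> M \<and> norm (f x) \<le> M then f x else 0)) (\<lambda>x. 0) at_top"
  proof (rule L2_dominated_convergence_at_top[OF assms(1)])
    show "AE x in lborel. ((\<lambda>M. f x - (if norm x \<le> M \<and> norm (f x) \<le> M then f x else 0)) \<longlongrightarrow> 0) at_top"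
    proof (intro AE_I2 tendsto_eventually)
      fix x
      show "\<forall>\<^sub>F M in at_top. f x - (if norm x \<le> M \<and> norm (f x) \<le> M then f x else 0) = 0"
        using eventually_ge_at_top[of "max (norm x) (norm (f x))"] by eventually_elim auto
    qed
  qed auto
  from L2_tendstoD(3)[OF this]
  have "((\<lambda>M. l2norm (\<lambda>x. f x - (if norm x \<le> M \<and> norm (f x) \<le> M then f x else 0))) \<longlongrightarrow> 0) at_top" by simp
  then have "\<forall>\<^sub>F M in at_top. l2norm (\<lambda>x. f x - (if norm x \<le> M \<and> norm (f x) \<le> M then f x else 0)) < e"
    by (rule order_tendstoD(2)) fact
  from eventually_conj[OF this eventually_gt_at_top[of 0]]
  show ?thesis by (auto dest!: eventually_happens)
qed

text \<open>Continuous functions converging almost everywhere to a truncation of \<open>f\<close>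
  are given a common bound and a common support in a way that does not disturb their limit; then
  dominated convergence applies.\<close>

lemma L2_continuous_approx:
  fixes f :: "real^'n \<Rightarrow> complex"
  assumes "L2 f" "e > 0"
  shows "\<exists>g M R. continuous_on UNIV g \<and> (\<forall>x. cmod (g x) \<le> M) \<and> (\<forall>x. norm x > R \<longrightarrow> g x = 0)
    \<and> l2norm (\<lambda>x. f x - g x) < e"
proof -
  obtain M where M: "M > 0" "l2norm (\<lambda>x. f x - (if norm x \<le> M \<and> cmod (f x) \<le> M then f x else 0)) < e / 2"
    using L2_truncate[OF assms(1), of "e / 2"] assms(2) by auto
  note [measurable] = L2_measurable[OF assms(1)]
  define f1 where "f1 x = (if norm x \<le> M \<and> cmod (f x) \<le> M then f x else 0)" for x
  have [measurable]: "f1 \<in> borel_measurable lborel" unfolding f1_def by measurable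
  have f1M: "cmod (f1 x) \<le> M" for x using M(1) by (auto simp: f1_def)
  have f1R: "norm x > M \<Longrightarrow> f1 x = 0" for x by (auto simp: f1_def)
  \<comment> \<open>In the sense of \<open>measurable_on\<close>, measurability is the existence of
    continuous functions that converge off a negligible set.\<close>
  have "f1 measurable_on UNIV"
    by (rule lebesgue_measurable_imp_measurable_on) (auto intro: measurable_completion)
  then obtain N h where N: "negligible N" and h: "\<And>n. continuous_on UNIV (h n)"
    and lim: "\<And>x. x \<notin> N \<Longrightarrow> (\<lambda>n. h n x) \<longlonglongrightarrow> f1 x"
    unfolding measurable_on_def if_P[OF UNIV_I] by blast
  have AEN: "AE x in lborel. x \<notin> N"
    using AE_not_in[of N lebesgue] N by (simp add: negligible_iff_null_sets AE_completion_iff)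
  \<comment> \<open>\<open>\<theta>\<close> is 1 on the ball of radius \<open>M\<close> and 0
    outside the ball of radius \<open>M + 1\<close>; \<open>clip\<close> is the radial retraction
    onto the disc of radius \<open>M\<close>. Neither of them changes \<open>f1\<close>.\<close>
  define \<theta> where "\<theta> x = max 0 (min 1 (M + 1 - norm x))" for x :: "real^'n"
  define clip where "clip z = z / complex_of_real (max 1 (cmod z / M))" for z
  define G where "G n x = complex_of_real (\<theta> x) * clip (h n x)" for n x
  have mx: "max 1 (cmod z / M) > 0" for z by (simp add: less_max_iff_disj)
  have clipM: "cmod (clip z) \<le> M" for z
    using M(1) mx[of z] by (auto simp: clip_def norm_divide divide_simps max_def split: if_splits)
  have \<theta>: "0 \<le> \<theta> x" "\<theta> x \<le> 1" for x by (auto simp: \<theta>_def)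
  have contclip: "continuous_on UNIV clip"
    unfolding clip_def using mx M(1) by (intro continuous_intros) (auto simp: less_le simp del: less_max_iff_disj)
  have contG: "continuous_on UNIV (G n)" for n
    unfolding G_def \<theta>_def
    by (intro continuous_intros continuous_on_compose2[OF contclip] h) auto
  have GM: "cmod (G n x) \<le> M" for n x
    using mult_mono[OF \<theta>(2)[of x] clipM[of "h n x"]] \<theta>(1)[of x] by (simp add: G_def norm_mult)
  have GR: "norm x > M + 1 \<Longrightarrow> G n x = 0" for n x by (auto simp: G_def \<theta>_def)
  have "L2_tendsto (\<lambda>n. G n) f1 sequentially"
  proof (rule L2_dominated_convergence_seq)
    show "L2 (\<lambda>x::real^'n. if norm x \<le> M + 1 then M else 0)"
      by (rule L2_bounded_support[of _ M "M + 1"]) (use M(1) in auto)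
    show "\<forall>\<^sub>F n in sequentially. G n \<in> borel_measurable lborel \<and>
        (AE x in lborel. norm (G n x) \<le> norm (if norm x \<le> M + 1 then M else 0))"
    proof (intro always_eventually allI conjI AE_I2)
      show "G n \<in> borel_measurable lborel" for n
        using borel_measurable_continuous_onI[OF contG] by simp
      show "norm (G n x) \<le> norm (if norm x \<le> M + 1 then M else 0)" for n x
        using GM[of n x] GR[of x n] M(1) by (cases "norm x \<le> M + 1") auto
    qed
    show "AE x in lborel. (\<lambda>n. G n x) \<longlonglongrightarrow> f1 x"
      using AEN
    proof eventually_elim
      case (elim x)
      have "isCont clip (f1 x)" using contclip by (simp add: continuous_on_eq_continuous_at)
      from isCont_tendsto_compose[OF this lim[OF elim]]
      have "(\<lambda>n. G n x) \<longlonglongrightarrow> complex_of_real (\<theta> x) * clip (f1 x)"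
        unfolding G_def by (intro tendsto_intros)
      moreover have "clip (f1 x) = f1 x" using f1M[of x] M(1) by (simp add: clip_def max_def)
      moreover have "complex_of_real (\<theta> x) * f1 x = f1 x"
        using f1R[of x] by (cases "norm x > M") (auto simp: \<theta>_def)
      ultimately show ?case by simp
    qed
  qed measurable
  note GD = L2_tendstoD[OF this]
  have "\<forall>\<^sub>F n in sequentially. l2norm (\<lambda>x. G n x - f1 x) < e / 2"
    by (rule order_tendstoD(2)[OF GD(3)]) (use assms(2) in simp)
  then obtain n where n: "l2norm (\<lambda>x. G n x - f1 x) < e / 2" by (auto dest: eventually_happens)
  have LG: "L2 (G n)"
    by (rule L2_bounded_support[of _ M "M + 1"])
      (use GM GR borel_measurable_continuous_onI[OF contG] in auto)
  have "l2norm (\<lambda>x. f x - G n x) \<le> l2norm (\<lambda>x. f x - f1 x) + l2norm (\<lambda>x. f1 x - G n x)"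
    by (rule l2norm_triangle3[OF assms(1) GD(1) LG])
  also have "\<dots> < e" using M(2) n l2norm_minus_commute[of f1 "G n"] by (simp add: f1_def[abs_def])
  finally show ?thesis using contG GM GR by blast
qed

section \<open>Dilations and integrability of radial functions\<close>

lemma lborel_scale:
  fixes f :: "real^'n \<Rightarrow> 'b::{banach,second_countable_topology}"
  assumes "c > 0" "f \<in> borel_measurable lborel"
  shows "integrable lborel (\<lambda>x. f (c *\<^sub>R x)) \<longleftrightarrow> integrable lborel f"
    and "(LINT x|lborel. f x) = c ^ CARD('n) *\<^sub>R (LINT x|lborel. f (c *\<^sub>R x))"
proof -
  have eq: "(lborel :: (real^'n) measure) = density (distr lborel borel (\<lambda>x. c *\<^sub>R x)) (\<lambda>_. ennreal (c ^ CARD('n)))"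
    using lborel_affine[of c "0::real^'n"] assms(1) by simp
  have m: "f \<in> borel_measurable (distr lborel borel (\<lambda>x. c *\<^sub>R x))" using assms(2) by simp
  have "integrable lborel f \<longleftrightarrow> integrable (distr lborel borel (\<lambda>x. c *\<^sub>R x)) (\<lambda>x. c ^ CARD('n) *\<^sub>R f x)"
    by (subst eq, subst integrable_density) (use m assms(1) in auto)
  also have "\<dots> \<longleftrightarrow> integrable lborel (\<lambda>x. c ^ CARD('n) *\<^sub>R f (c *\<^sub>R x))"
    by (subst integrable_distr_eq) (use assms in auto)
  also have "\<dots> \<longleftrightarrow> integrable lborel (\<lambda>x. f (c *\<^sub>R x))"
    using assms(1) integrable_scaleR_right[of "inverse (c ^ CARD('n))" lborel "\<lambda>x. c ^ CARD('n) *\<^sub>R f (c *\<^sub>R x)"]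
    by auto
  finally show "integrable lborel (\<lambda>x. f (c *\<^sub>R x)) \<longleftrightarrow> integrable lborel f" by simp
  have "(LINT x|lborel. f x) = (LINT x|distr lborel borel (\<lambda>x. c *\<^sub>R x). c ^ CARD('n) *\<^sub>R f x)"
    by (subst eq, subst integral_density) (use m assms(1) in auto)
  also have "\<dots> = (LINT x|lborel. c ^ CARD('n) *\<^sub>R f (c *\<^sub>R x))"
    by (subst integral_distr) (use assms in auto)
  finally show "(LINT x|lborel. f x) = c ^ CARD('n) *\<^sub>R (LINT x|lborel. f (c *\<^sub>R x))" by simp
qed

text \<open>The maximum is attained at y = m/c. The inequality ln z \<le> z at
  \<open>z = c * y / m\<close> gives the slightly larger constant \<open>(m / c) powr m\<close>
  without any calculus.\<close>

lemma powr_exp_bounded: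
  fixes m c :: real
  assumes "c > 0" "m \<ge> 0"
  shows "\<exists>C>0. \<forall>y>0. y powr m * exp (- c * y) \<le> C"
proof (cases "m = 0")
  case True then show ?thesis using assms by (intro exI[of _ 1]) auto
next
  case False
  then have m: "m > 0" using assms by simp
  have "y powr m * exp (- c * y) \<le> (m / c) powr m" if "y > 0" for y
  proof -
    have "ln (c * y / m) \<le> c * y / m - 1" using that m assms by (intro ln_le_minus_one) auto
    then have "ln (c * y / m) \<le> c * y / m" by simp
    then have "m * ln (c * y / m) \<le> m * (c * y / m)" using m by (intro mult_left_mono) auto
    then have "m * ln y - c * y \<le> m * ln (m / c)"
      using m assms that by (simp add: ln_mult ln_div algebra_simps)
    then have "exp (m * ln y - c * y) \<le> exp (m * ln (m / c))" by simp
    then show ?thesis using that m assms by (simp add: powr_def exp_diff exp_minus divide_inverse)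
  qed
  then show ?thesis using m assms by (intro exI[of _ "(m / c) powr m"]) auto
qed


text \<open>A substitute for polar coordinates: the function lies below the sum of
  \<open>a j\<close> times the indicator of the ball of radius \<open>R j\<close>, so that only the
  volume of balls enters.\<close>

lemma integrable_of_shells:
  fixes f :: "real^'n \<Rightarrow> real"
  assumes [measurable]: "f \<in> borel_measurable lborel" and "\<And>x. f x \<ge> 0"
    and shell: "\<And>x. f x \<noteq> 0 \<Longrightarrow> \<exists>j. norm x \<le> R j \<and> f x \<le> a j"
    and a: "\<And>j. a j \<ge> 0" and R: "\<And>j. R j \<ge> 0"
    and sum: "summable (\<lambda>j. a j * R j ^ CARD('n))"
  shows "integrable lborel f"
proof (rule integrableI_bounded)
  have [measurable]: "cball (0::real^'n) r \<in> sets borel" for r by simp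
  have em: "emeasure lborel (cball (0::real^'n) r) = ennreal (unit_ball_vol CARD('n) * r ^ CARD('n))" if "r \<ge> 0" for r
    using emeasure_cball[OF that, of "0::real^'n"] by simp
  have "(\<integral>\<^sup>+x. ennreal (norm (f x)) \<partial>lborel) \<le> (\<integral>\<^sup>+x. (\<Sum>j. ennreal (a j) * indicator (cball (0::real^'n) (R j)) x) \<partial>lborel)"
  proof (rule nn_integral_mono)
    fix x
    show "ennreal (norm (f x)) \<le> (\<Sum>j. ennreal (a j) * indicator (cball 0 (R j)) x)"
    proof (cases "f x = 0")
      case False
      then obtain j where j: "norm x \<le> R j" "f x \<le> a j" using shell by blast
      have "ennreal (norm (f x)) \<le> ennreal (a j) * indicator (cball 0 (R j)) x"
        using j assms(2)[of x] by (auto intro: ennreal_leI)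
      also have "\<dots> \<le> (\<Sum>j. ennreal (a j) * indicator (cball 0 (R j)) x)"
        using sum_le_suminf[of "\<lambda>j. ennreal (a j) * indicator (cball 0 (R j)) x" "{j}"]
        by (simp only: summableI finite.intros sum.insert sum.empty empty_iff add_0_right zero_le not_False_eq_True)
      finally show ?thesis .
    qed simp
  qed
  also have "\<dots> = (\<Sum>j. \<integral>\<^sup>+x. ennreal (a j) * indicator (cball (0::real^'n) (R j)) x \<partial>lborel)"
    by (rule nn_integral_suminf) measurable
  also have "\<dots> = (\<Sum>j. ennreal (unit_ball_vol CARD('n) * (a j * R j ^ CARD('n))))"
    using a R by (intro arg_cong[where f=suminf] ext)
      (auto simp: nn_integral_cmult_indicator em mult_ac simp flip: ennreal_mult)
  also have "\<dots> < \<infinity>"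
    using a R by (subst suminf_ennreal2) (auto intro!: summable_mult sum)
  finally show "(\<integral>\<^sup>+x. ennreal (norm (f x)) \<partial>lborel) < \<infinity>" .
qed measurable

lemma integrable_radial:
  fixes q p c :: real
  assumes "q > - real CARD('n)" "p > 0" "c > 0"
  shows "integrable lborel (\<lambda>x::real^'n. norm x powr q * exp (- c * norm x powr p))"
proof -
  \<comment> \<open>Order of the singularity at 0, made nonnegative, so that r^q \<le> r^(-s) for 0
    < r \<le> 1; the assumption on \<open>q\<close> becomes s < n.\<close>
  define s where "s = max 0 (- q)"
  have s: "0 \<le> s" "s < real CARD('n)" "- q \<le> s" using assms by (auto simp: s_def)
  \<comment> \<open>For r > 1 the exponential absorbs this power, which leaves decay of order n +
    2.\<close>
  define m where "m = max 0 (q + CARD('n) + 2)"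
  obtain C where C: "C > 0" "\<And>y. y > 0 \<Longrightarrow> y powr (m / p) * exp (- c * y) \<le> C"
    using powr_exp_bounded[of c "m / p"] assms by (auto simp: m_def)
  \<comment> \<open>Dyadic shells: values up to 2^((j+1)s) on a ball of volume proportional to
    2^(-jn), hence a geometric series with ratio 2^(s-n).\<close>
  have i0: "integrable lborel (\<lambda>x::real^'n. if norm x \<le> 1 then norm x powr (- s) else 0)"
  proof (rule integrable_of_shells[where R="\<lambda>j. 2 powr (- real j)" and a="\<lambda>j. 2 powr (real (Suc j) * s)"])
    have eq: "2 powr (real (Suc j) * s) * (2 powr - real j) ^ CARD('n) = 2 powr s * (2 powr (s - CARD('n))) ^ j" for j
      by (simp add: powr_powr powr_add[symmetric] algebra_simps flip: powr_realpow)
    have "2 powr (s - CARD('n)) < 2 powr 0" using s by (intro powr_less_mono) auto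
    then show "summable (\<lambda>j. 2 powr (real (Suc j) * s) * (2 powr - real j) ^ CARD('n))"
      unfolding eq by (intro summable_mult summable_geometric) simp
    fix x :: "real^'n" assume ne: "(if norm x \<le> 1 then norm x powr (- s) else 0) \<noteq> 0"
    then have x: "0 < norm x" "norm x \<le> 1" by (auto split: if_splits)
    define j where "j = nat \<lfloor>log 2 (1 / norm x)\<rfloor>"
    have "0 \<le> log 2 (1 / norm x)" using x by simp
    then have j: "real j \<le> log 2 (1 / norm x)" "log 2 (1 / norm x) < real j + 1"
      unfolding j_def by linarith+
    have e: "norm x = 2 powr (- log 2 (1 / norm x))" using x by (simp add: log_divide)
    have "norm x \<le> 2 powr (- real j)" by (subst e, intro powr_mono) (use j in auto)
    moreover have "norm x powr (- s) \<le> 2 powr (real (Suc j) * s)"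
      by (subst e, subst powr_powr, intro powr_mono) (use j s mult_right_mono[of "log 2 (1 / norm x)" "real j + 1" s] in \<open>auto simp: add.commute\<close>)
    ultimately show "\<exists>j. norm x \<le> 2 powr - real j \<and>
        (if norm x \<le> 1 then norm x powr (- s) else 0) \<le> 2 powr (real (Suc j) * s)"
      using x by auto
  qed auto
  \<comment> \<open>Shells of unit width; the extra 2 in the exponent n + 2 leaves the convergent
    series of 1/j^2.\<close>
  have i1: "integrable lborel (\<lambda>x::real^'n. inverse ((1 + norm x) ^ (CARD('n) + 2)))"
  proof (rule integrable_of_shells[where R="\<lambda>j. real (Suc j)" and a="\<lambda>j. inverse (real (Suc j) ^ (CARD('n) + 2))"])
    have "summable (\<lambda>j. inverse (real (Suc j) ^ 2))"
      using inverse_power_summable[of 2, where 'a=real] by (subst summable_Suc_iff) auto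
    then show "summable (\<lambda>j. inverse (real (Suc j) ^ (CARD('n) + 2)) * real (Suc j) ^ CARD('n))"
      by (simp add: power_add power2_eq_square mult_ac del: of_nat_Suc)
    fix x :: "real^'n"
    define j where "j = nat \<lfloor>norm x\<rfloor>"
    have j: "real j \<le> norm x" "norm x \<le> real (Suc j)" unfolding j_def by auto linarith+
    show "\<exists>j. norm x \<le> real (Suc j) \<and> inverse ((1 + norm x) ^ (CARD('n) + 2)) \<le> inverse (real (Suc j) ^ (CARD('n) + 2))"
      using j by (intro exI[of _ j] conjI le_imp_inverse_le power_mono) auto
  qed auto
  show ?thesis
  proof (rule Bochner_Integration.integrable_bound)
    show "integrable lborel (\<lambda>x::real^'n. (if norm x \<le> 1 then norm x powr (- s) else 0)
        + C * 2 ^ (CARD('n) + 2) * inverse ((1 + norm x) ^ (CARD('n) + 2)))"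
      using i0 i1 by auto
    show "AE x::real^'n in lborel. norm (norm x powr q * exp (- c * norm x powr p)) \<le>
      norm ((if norm x \<le> 1 then norm x powr (- s) else 0)
        + C * 2 ^ (CARD('n) + 2) * inverse ((1 + norm x) ^ (CARD('n) + 2)))"
    proof (intro AE_I2)
      fix x :: "real^'n"
      let ?r = "norm x"
      have nn: "0 \<le> C * 2 ^ (CARD('n) + 2) * inverse ((1 + ?r) ^ (CARD('n) + 2))" using C by simp
      have "?r powr q * exp (- c * ?r powr p) \<le> (if ?r \<le> 1 then ?r powr (- s) else 0)
        + C * 2 ^ (CARD('n) + 2) * inverse ((1 + ?r) ^ (CARD('n) + 2))"
      proof (cases "?r \<le> 1")
        case True
        have "?r powr q * exp (- c * ?r powr p) \<le> ?r powr q * 1"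
          using assms by (intro mult_left_mono) auto
        also have "\<dots> \<le> ?r powr (- s)"
          using True s by (cases "?r = 0") (auto intro!: powr_mono')
        finally show ?thesis using nn unfolding if_P[OF True] by linarith
      next
        case False
        then have r: "?r > 1" by simp
        have "?r powr (q + (CARD('n) + 2)) * exp (- c * ?r powr p) \<le> ?r powr m * exp (- c * ?r powr p)"
          using r by (intro mult_right_mono powr_mono) (auto simp: m_def)
        also have "?r powr m = (?r powr p) powr (m / p)" using assms by (simp add: powr_powr)
        also have "(?r powr p) powr (m / p) * exp (- c * ?r powr p) \<le> C"
          using r by (intro C(2)) auto
        finally have 1: "?r powr (q + (CARD('n) + 2)) * exp (- c * ?r powr p) \<le> C" .
        have "?r powr (q + (CARD('n) + 2)) = ?r powr q * ?r ^ (CARD('n) + 2)"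
          using r by (subst powr_add, subst powr_realpow[symmetric]) auto
        with 1 have "(?r powr q * exp (- c * ?r powr p)) * ?r ^ (CARD('n) + 2) \<le> C" by (simp only: mult_ac)
        then have "?r powr q * exp (- c * ?r powr p) \<le> C * inverse (?r ^ (CARD('n) + 2))"
          unfolding divide_inverse[symmetric]
          by (rule pos_le_divide_eq[THEN iffD2, rotated]) (use r in \<open>intro zero_less_power; auto\<close>)
        also have "inverse (?r ^ (CARD('n) + 2)) \<le> 2 ^ (CARD('n) + 2) * inverse ((1 + ?r) ^ (CARD('n) + 2))"
        proof -
          have "(1 + ?r) ^ (CARD('n) + 2) \<le> (2 * ?r) ^ (CARD('n) + 2)" using r by (intro power_mono) auto
          moreover have "0 < ?r ^ (CARD('n) + 2)" "0 < (1 + ?r) ^ (CARD('n) + 2)"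
            using r by - (rule zero_less_power, linarith)+
          moreover have "inverse A \<le> D * inverse B" if "B \<le> D * A" "0 < A" "0 < B" for A B D :: real
            using that by (simp add: field_simps)
          ultimately show ?thesis unfolding power_mult_distrib by blast
        qed
        finally show ?thesis using C unfolding if_not_P[OF False] by (simp only: mult_left_mono mult.assoc add_0_left)
      qed
      then show "norm (?r powr q * exp (- c * ?r powr p)) \<le> norm ((if ?r \<le> 1 then ?r powr (- s) else 0)
        + C * 2 ^ (CARD('n) + 2) * inverse ((1 + ?r) ^ (CARD('n) + 2)))"
        using nn by auto
    qed
  qed measurable
qed

section \<open>The Fourier-Plancherel transform\<close>

text \<open>This is the characteristic function of the standard normal law at \<open>- t\<close>,
  with the factor sqrt(2 pi) that normalises the density.\<close>

lemma gaussian_fourier_1d: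
  "integrable lborel (\<lambda>x::real. exp (- \<i> * of_real (t * x)) * of_real (exp (- x\<^sup>2 / 2)))"
  "(LINT x|lborel. exp (- \<i> * of_real (t * x)) * of_real (exp (- x\<^sup>2 / 2)))
    = of_real (sqrt (2 * pi) * exp (- t\<^sup>2 / 2))"
proof -
  have d: "exp (- x\<^sup>2 / 2) = sqrt (2 * pi) * std_normal_density x" for x :: real
    by (simp add: std_normal_density_def)
  have "integrable lborel (\<lambda>x::real. sqrt (2 * pi) * std_normal_density x)" by simp
  then have i: "integrable lborel (\<lambda>x::real. exp (- x\<^sup>2 / 2))" unfolding d .
  show "integrable lborel (\<lambda>x::real. exp (- \<i> * of_real (t * x)) * of_real (exp (- x\<^sup>2 / 2)))"
    by (rule Bochner_Integration.integrable_bound[OF i]) (auto simp: norm_mult)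
  have "complex_of_real (exp (- t\<^sup>2 / 2)) = char std_normal_distribution (- t)"
    by (simp add: char_std_normal_distribution)
  also have "\<dots> = (LINT x|lborel. std_normal_density x *\<^sub>R iexp ((- t) * x))"
    unfolding char_def by (rule integral_density) (auto simp: normal_density_nonneg)
  finally have "complex_of_real (sqrt (2 * pi) * exp (- t\<^sup>2 / 2))
     = of_real (sqrt (2 * pi)) * (LINT x|lborel. std_normal_density x *\<^sub>R iexp ((- t) * x))" by simp
  also have "\<dots> = (LINT x|lborel. of_real (sqrt (2 * pi)) * (std_normal_density x *\<^sub>R iexp ((- t) * x)))"
    by (rule integral_mult_right_zero[symmetric])
  also have "\<dots> = (LINT x|lborel. exp (- \<i> * of_real (t * x)) * of_real (exp (- x\<^sup>2 / 2)))"
    unfolding d by (intro Bochner_Integration.integral_cong) (auto simp: scaleR_conv_of_real mult_ac)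
  finally show "(LINT x|lborel. exp (- \<i> * of_real (t * x)) * of_real (exp (- x\<^sup>2 / 2)))
    = of_real (sqrt (2 * pi) * exp (- t\<^sup>2 / 2))" by simp
qed

text \<open>Both the exponential and the Gaussian factor over an orthonormal basis, so the integral
  is a product of one-dimensional ones.\<close>

lemma gaussian_fourier:
  fixes x :: "'a::euclidean_space"
  shows "integrable lborel (\<lambda>\<xi>. exp (- \<i> * of_real (\<xi> \<bullet> x)) * of_real (exp (- (norm \<xi>)\<^sup>2 / 2)))"
    and "(LINT \<xi>|lborel. exp (- \<i> * of_real (\<xi> \<bullet> x)) * of_real (exp (- (norm \<xi>)\<^sup>2 / 2)))
      = of_real (sqrt (2 * pi) ^ DIM('a) * exp (- (norm x)\<^sup>2 / 2))"
proof -
  define f where "f b y = exp (- \<i> * of_real ((x \<bullet> b) * y)) * of_real (exp (- y\<^sup>2 / 2))" for b :: 'a and y :: real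
  interpret product_sigma_finite "\<lambda>_::'a. lborel :: real measure" ..
  have eq: "exp (- \<i> * of_real (\<xi> \<bullet> x)) * of_real (exp (- (norm \<xi>)\<^sup>2 / 2)) = (\<Prod>b\<in>Basis. f b (\<xi> \<bullet> b))" for \<xi> :: 'a
  proof -
    have "- \<i> * of_real (\<xi> \<bullet> x) = (\<Sum>b\<in>Basis. - \<i> * of_real ((x \<bullet> b) * (\<xi> \<bullet> b)))"
      by (subst euclidean_inner) (simp add: sum_distrib_left sum_negf mult_ac)
    moreover have "- (norm \<xi>)\<^sup>2 / 2 = (\<Sum>b\<in>Basis. - (\<xi> \<bullet> b)\<^sup>2 / 2)"
      unfolding power2_norm_eq_inner
      by (subst euclidean_inner) (simp add: sum_divide_distrib sum_negf power2_eq_square)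
    ultimately show ?thesis unfolding f_def
      by (simp add: exp_sum prod.distrib)
  qed
  have eqf: "(\<lambda>\<xi>. exp (- \<i> * of_real (\<xi> \<bullet> x)) * of_real (exp (- (norm \<xi>)\<^sup>2 / 2)) :: complex)
    = (\<lambda>\<xi>. \<Prod>b\<in>Basis. f b (\<xi> \<bullet> b))" using eq by blast
  have fi: "integrable lborel (f b)" for b
    unfolding f_def by (rule gaussian_fourier_1d)
  have prodi: "integrable (\<Pi>\<^sub>M b\<in>Basis. lborel) (\<lambda>y. \<Prod>b\<in>Basis. f b (y b))"
    by (rule product_integrable_prod) (auto intro: fi)
  have m: "(\<lambda>f. \<Sum>b\<in>Basis. f b *\<^sub>R b) \<in> (\<Pi>\<^sub>M b\<in>Basis. lborel) \<rightarrow>\<^sub>M (borel :: 'a measure)"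
    by measurable
  have fm: "(\<lambda>\<xi>::'a. exp (- \<i> * of_real (\<xi> \<bullet> x)) * of_real (exp (- (norm \<xi>)\<^sup>2 / 2)) :: complex) \<in> borel_measurable borel"
    by measurable
  note fm = fm[unfolded eqf]
  show "integrable lborel (\<lambda>\<xi>. exp (- \<i> * of_real (\<xi> \<bullet> x)) * of_real (exp (- (norm \<xi>)\<^sup>2 / 2)))"
    unfolding eqf by (subst lborel_eq, subst integrable_distr_eq[OF m fm]) (use prodi in \<open>simp cong: prod.cong\<close>)
  have "(LINT \<xi>|lborel. exp (- \<i> * of_real (\<xi> \<bullet> x)) * of_real (exp (- (norm \<xi>)\<^sup>2 / 2)))
     = integral\<^sup>L (\<Pi>\<^sub>M b\<in>Basis. lborel) (\<lambda>y. \<Prod>b\<in>Basis. f b (y b))"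
    unfolding eqf by (subst lborel_eq, subst integral_distr[OF m fm]) (simp cong: prod.cong)
  also have "\<dots> = (\<Prod>b\<in>Basis. LINT y|lborel. f b y)"
    by (rule product_integral_prod) (auto intro: fi)
  also have "\<dots> = (\<Prod>b\<in>Basis. of_real (sqrt (2 * pi) * exp (- (x \<bullet> b)\<^sup>2 / 2)))"
    unfolding f_def gaussian_fourier_1d ..
  also have "\<dots> = of_real (sqrt (2 * pi) ^ DIM('a) * exp (\<Sum>b\<in>Basis. - (x \<bullet> b)\<^sup>2 / 2))"
    by (simp add: prod.distrib exp_sum)
  also have "(\<Sum>b\<in>Basis. - (x \<bullet> b)\<^sup>2 / 2) = - (norm x)\<^sup>2 / 2"
    unfolding power2_norm_eq_inner
    by (subst (2) euclidean_inner) (simp add: sum_divide_distrib sum_negf power2_eq_square)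
  finally show "(LINT \<xi>|lborel. exp (- \<i> * of_real (\<xi> \<bullet> x)) * of_real (exp (- (norm \<xi>)\<^sup>2 / 2)))
      = of_real (sqrt (2 * pi) ^ DIM('a) * exp (- (norm x)\<^sup>2 / 2))" .
qed

text \<open>Density of the centred normal law with standard deviation \<open>s\<close> in each
  coordinate, that is, the heat kernel at time s^2/2. It serves as an approximate identity for s ->
  0.\<close>

definition heat :: "real \<Rightarrow> real^'n \<Rightarrow> real" where
  "heat s x = exp (- (norm x / s)\<^sup>2 / 2) / (sqrt (2 * pi) * s) ^ CARD('n)"

lemma heat_measurable [measurable]: "heat s \<in> borel_measurable borel"
  unfolding heat_def[abs_def] by measurable

lemma heat_nonneg: "s > 0 \<Longrightarrow> 0 \<le> heat s x"
  by (simp add: heat_def)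

lemma heat_fourier:
  fixes x :: "real^'n"
  assumes s: "s > 0"
  shows "integrable lborel (\<lambda>\<xi>. exp (- \<i> * of_real (\<xi> \<bullet> x)) * of_real (exp (- (s * norm \<xi>)\<^sup>2 / 2)))"
    and "(LINT \<xi>|lborel. exp (- \<i> * of_real (\<xi> \<bullet> x)) * of_real (exp (- (s * norm \<xi>)\<^sup>2 / 2)))
      = of_real ((2 * pi) ^ CARD('n) * heat s x)"
proof -
  define f where "f = (\<lambda>\<xi>. exp (- \<i> * of_real (\<xi> \<bullet> (x /\<^sub>R s))) * of_real (exp (- (norm \<xi>)\<^sup>2 / 2)) :: complex)"
  have fs: "(\<lambda>\<xi>. exp (- \<i> * of_real (\<xi> \<bullet> x)) * of_real (exp (- (s * norm \<xi>)\<^sup>2 / 2))) = (\<lambda>\<xi>. f (s *\<^sub>R \<xi>))"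
  proof
    fix \<xi> :: "real^'n"
    have "(s *\<^sub>R \<xi>) \<bullet> (x /\<^sub>R s) = \<xi> \<bullet> x" using s by simp
    then show "exp (- \<i> * of_real (\<xi> \<bullet> x)) * of_real (exp (- (s * norm \<xi>)\<^sup>2 / 2)) = f (s *\<^sub>R \<xi>)"
      using s unfolding f_def by (simp del: inner_scaleR_left inner_scaleR_right)
  qed
  have fm: "f \<in> borel_measurable lborel" unfolding f_def by measurable
  show "integrable lborel (\<lambda>\<xi>. exp (- \<i> * of_real (\<xi> \<bullet> x)) * of_real (exp (- (s * norm \<xi>)\<^sup>2 / 2)))"
    unfolding fs lborel_scale(1)[OF s fm] unfolding f_def by (rule gaussian_fourier)
  have "of_real (s ^ CARD('n)) * (LINT \<xi>|lborel. f (s *\<^sub>R \<xi>)) = (LINT \<xi>|lborel. f \<xi>)"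
    using lborel_scale(2)[OF s fm] by (simp add: scaleR_conv_of_real)
  also have "\<dots> = of_real (sqrt (2 * pi) ^ CARD('n) * exp (- (norm x / s)\<^sup>2 / 2))"
  proof -
    have n: "norm (x /\<^sub>R s) = norm x / s" using s by (simp add: divide_inverse)
    show ?thesis unfolding f_def gaussian_fourier(2) n by simp
  qed
  also have "\<dots> = of_real (s ^ CARD('n) * ((2 * pi) ^ CARD('n) * heat s x))"
  proof -
    have A: "sqrt (2 * pi) ^ CARD('n) * sqrt (2 * pi) ^ CARD('n) = (2 * pi) ^ CARD('n)"
      unfolding power_mult_distrib[symmetric] real_sqrt_mult_self by simp
    have key: "A * E = S * (P * (E / (A * S)))" if "A * A = P" "A > 0" "S > 0" for A S P E :: real
      using that(2,3) unfolding that(1)[symmetric] by simp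
    have AS: "sqrt (2 * pi) ^ CARD('n) > 0" "s ^ CARD('n) > 0" using s by simp_all
    show ?thesis unfolding heat_def power_mult_distrib[of "sqrt (2 * pi)"]
      by (rule arg_cong[where f=of_real]) (rule key[OF A AS])
  qed
  finally show "(LINT \<xi>|lborel. exp (- \<i> * of_real (\<xi> \<bullet> x)) * of_real (exp (- (s * norm \<xi>)\<^sup>2 / 2)))
      = of_real ((2 * pi) ^ CARD('n) * heat s x)"
    unfolding fs using s by simp
qed

lemma heat_integral:
  assumes s: "s > 0"
  shows "integrable lborel (heat s :: real^'n \<Rightarrow> real)" "(LINT x|lborel. heat s (x :: real^'n)) = 1"
proof -
  define f where "f = (\<lambda>\<xi>::real^'n. exp (- (norm \<xi>)\<^sup>2 / 2))"
  have fm: "f \<in> borel_measurable lborel" unfolding f_def by measurable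
  have "integrable lborel (\<lambda>\<xi>. Re (of_real (f \<xi>)))"
    using gaussian_fourier(1)[of "0::real^'n"] by (intro integrable_Re) (simp add: f_def)
  then have fi: "integrable lborel f" by simp
  have "of_real (LINT \<xi>|lborel. f \<xi>) = (LINT \<xi>|lborel. complex_of_real (f \<xi>))" by simp
  also have "\<dots> = of_real (sqrt (2 * pi) ^ CARD('n))"
    using gaussian_fourier(2)[of "0::real^'n"] by (simp add: f_def)
  finally have fI: "(LINT \<xi>|lborel. f \<xi>) = sqrt (2 * pi) ^ CARD('n)" using of_real_eq_iff by blast
  have h: "heat s x = f ((1 / s) *\<^sub>R x) / (sqrt (2 * pi) * s) ^ CARD('n)" for x :: "real^'n"
    using s by (simp add: heat_def f_def)
  have i: "integrable lborel (\<lambda>x. f ((1 / s) *\<^sub>R x))" using lborel_scale(1)[of "1 / s" f] s fm fi by simp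
  then show "integrable lborel (heat s :: real^'n \<Rightarrow> real)" unfolding h by simp
  have "(LINT x|lborel. f x) = (1 / s) ^ CARD('n) * (LINT x|lborel. f ((1 / s) *\<^sub>R x))"
    using lborel_scale(2)[of "1 / s" f] s fm by simp
  then have "(LINT x|lborel. f ((1 / s) *\<^sub>R x)) = s ^ CARD('n) * sqrt (2 * pi) ^ CARD('n)"
    using s fI by (simp add: field_simps power_divide)
  then show "(LINT x|lborel. heat s (x :: real^'n)) = 1"
    unfolding h using s by (simp add: power_mult_distrib)
qed

lemma lborel_translate:
  fixes f :: "real^'n \<Rightarrow> 'b::{banach,second_countable_topology}"
  assumes [measurable]: "f \<in> borel_measurable lborel"
  shows "integrable lborel (\<lambda>x. f (a + x)) \<longleftrightarrow> integrable lborel f"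
    and "(LINT x|lborel. f (a + x)) = (LINT x|lborel. f x)"
proof -
  have m: "(+) a \<in> lborel \<rightarrow>\<^sub>M borel" "f \<in> borel_measurable borel" using assms by auto
  show "integrable lborel (\<lambda>x. f (a + x)) \<longleftrightarrow> integrable lborel f"
    using integrable_distr_eq[OF m] by (simp add: lborel_distr_plus)
  show "(LINT x|lborel. f (a + x)) = (LINT x|lborel. f x)"
    using integral_distr[OF m] by (simp add: lborel_distr_plus)
qed

section \<open>Fourier integrals of integrable functions\<close>

lemma fourier_integrable:
  fixes f :: "real^'n \<Rightarrow> complex"
  assumes "integrable lborel f"
  shows "integrable lborel (\<lambda>x. exp (- \<i> * of_real (x \<bullet> \<xi>)) * f x)"
  using assms by (rule Bochner_Integration.integrable_bound)
    (use borel_measurable_integrable[OF assms] in \<open>auto simp: norm_mult\<close>)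

lemma fourier_const_pos: "0 < fourier_const n"
  by (simp add: fourier_const_def)

lemma fourier_const_square: "(fourier_const n)\<^sup>2 * (2 * pi) ^ n = 1"
proof -
  have "(fourier_const n)\<^sup>2 = (2 * pi) powr (- real n)"
    unfolding fourier_const_def power2_eq_square powr_add[symmetric] by simp
  moreover have "(2 * pi) ^ n = (2 * pi) powr real n" by (simp add: powr_realpow)
  ultimately show ?thesis by (simp add: powr_add[symmetric] del: powr_mult)
qed

lemma fourier_integral_bound:
  fixes f :: "real^'n \<Rightarrow> complex"
  shows "cmod (fourier_integral f \<xi>) \<le> fourier_const CARD('n) * (LINT x|lborel. cmod (f x))"
proof -
  have "cmod (LINT x|lborel. exp (- \<i> * of_real (x \<bullet> \<xi>)) * f x) \<le> (LINT x|lborel. cmod (exp (- \<i> * of_real (x \<bullet> \<xi>)) * f x))"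
    by (rule integral_norm_bound)
  then show ?thesis unfolding fourier_integral_def
    using fourier_const_pos[of "CARD('n)"] by (simp add: norm_mult)
qed

lemma fourier_integral_measurable [measurable]:
  fixes f :: "real^'n \<Rightarrow> complex"
  assumes [measurable]: "f \<in> borel_measurable lborel"
  shows "fourier_integral f \<in> borel_measurable lborel"
  unfolding fourier_integral_def[abs_def] by measurable

lemma fourier_integral_continuous:
  fixes f :: "real^'n \<Rightarrow> complex"
  assumes f: "integrable lborel f"
  shows "continuous_on UNIV (fourier_integral f)"
  unfolding fourier_integral_def[abs_def]
proof (intro continuous_on_mult continuous_on_const)
  note [measurable] = borel_measurable_integrable[OF f]
  show "continuous_on UNIV (\<lambda>\<xi>. LINT x|lborel. exp (- \<i> * of_real (x \<bullet> \<xi>)) * f x)"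
    unfolding continuous_on_sequentially
  proof safe
    fix X :: "nat \<Rightarrow> real^'n" and a assume X: "X \<longlonglongrightarrow> a"
    show "((\<lambda>\<xi>. LINT x|lborel. exp (- \<i> * of_real (x \<bullet> \<xi>)) * f x) \<circ> X)
        \<longlonglongrightarrow> (LINT x|lborel. exp (- \<i> * of_real (x \<bullet> a)) * f x)"
      unfolding o_def
    proof (rule integral_dominated_convergence[where w="\<lambda>x. cmod (f x)"])
      show "AE x in lborel. (\<lambda>i. exp (- \<i> * of_real (x \<bullet> X i)) * f x) \<longlonglongrightarrow> exp (- \<i> * of_real (x \<bullet> a)) * f x"
        by (intro AE_I2 tendsto_intros X)
    qed (use f in \<open>auto simp: norm_mult\<close>)
  qed
qed

lemma integrable_product_bounded:
  fixes f g :: "real^'n \<Rightarrow> complex"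
  assumes f: "integrable lborel f" and g: "integrable lborel g"
    and [measurable]: "case_prod h \<in> borel_measurable (lborel \<Otimes>\<^sub>M lborel)"
    and h: "\<And>x y. cmod (h x y) \<le> 1"
  shows "integrable (lborel \<Otimes>\<^sub>M lborel) (\<lambda>(x, y). h x y * f x * g y)"
proof -
  note [measurable] = borel_measurable_integrable[OF f] borel_measurable_integrable[OF g]
  have "integrable (lborel \<Otimes>\<^sub>M lborel) (\<lambda>(x, y). f x * g y)"
  proof (rule lborel_pair.Fubini_integrable)
    show "integrable lborel (\<lambda>x. LINT y|lborel. norm (case (x, y) of (x, y) \<Rightarrow> f x * g y))"
      using f by (simp add: norm_mult)
  qed (use g in auto)
  then show ?thesis
  proof (rule Bochner_Integration.integrable_bound)
    show "AE x in lborel \<Otimes>\<^sub>M lborel. norm (case x of (x, y) \<Rightarrow> h x y * f x * g y) \<le> norm (case x of (x, y) \<Rightarrow> f x * g y)"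
      by (intro AE_I2) (auto simp: norm_mult intro!: mult_right_mono mult_left_le_one_le h)
  qed measurable
qed

text \<open>By Fubini both sides equal the double integral of exp(-i x.\<xi>) f(x) g(\<xi>).\<close>

lemma fourier_integral_multiplication:
  fixes f g :: "real^'n \<Rightarrow> complex"
  assumes f: "integrable lborel f" and g: "integrable lborel g"
  shows "(LINT \<xi>|lborel. fourier_integral f \<xi> * g \<xi>) = (LINT x|lborel. f x * fourier_integral g x)"
proof -
  define c where "c = complex_of_real (fourier_const CARD('n))"
  have "integrable (lborel \<Otimes>\<^sub>M lborel) (\<lambda>(x, y). exp (- \<i> * of_real (x \<bullet> y)) * f x * g y)"
    by (rule integrable_product_bounded[OF f g]) (auto simp: norm_mult)
  from lborel_pair.Fubini_integral[OF this]
  have F: "(LINT y|lborel. LINT x|lborel. exp (- \<i> * of_real (x \<bullet> y)) * f x * g y)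
    = (LINT x|lborel. LINT y|lborel. exp (- \<i> * of_real (x \<bullet> y)) * f x * g y)" .
  have "(LINT \<xi>|lborel. fourier_integral f \<xi> * g \<xi>)
      = c * (LINT y|lborel. LINT x|lborel. exp (- \<i> * of_real (x \<bullet> y)) * f x * g y)"
    by (simp add: fourier_integral_def c_def mult.assoc flip: integral_mult_left_zero)
  also have "\<dots> = (LINT x|lborel. f x * (c * (LINT y|lborel. exp (- \<i> * of_real (x \<bullet> y)) * g y)))"
    unfolding F by (subst integral_mult_right_zero[symmetric], intro Bochner_Integration.integral_cong)
      (auto simp: mult_ac simp flip: integral_mult_right_zero)
  finally show ?thesis by (simp add: fourier_integral_def c_def inner_commute)
qed

section \<open>Plancherel's identity on the intersection of L1 and L2\<close>

lemma borel_measurable_cnj [measurable]: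
  "f \<in> borel_measurable M \<Longrightarrow> (\<lambda>x. cnj (f x)) \<in> borel_measurable M"
  by (rule borel_measurable_continuous_on) (auto intro: continuous_intros)

text \<open>A regularised Plancherel identity: the Gaussian weight makes the left side converge
  before the transform is known to be square integrable, and on the other side it becomes
  convolution of the conjugate of \<open>f\<close> with the heat kernel.\<close>

lemma fourier_integral_gaussian_weight:
  fixes f :: "real^'n \<Rightarrow> complex"
  assumes f: "integrable lborel f" and s: "s > 0"
  defines "H \<equiv> \<lambda>x. LINT y|lborel. cnj (f y) * of_real (heat s (x - y))"
  shows "integrable lborel (\<lambda>x. f x * H x)"
    and "integrable lborel (\<lambda>\<xi>. (cmod (fourier_integral f \<xi>))\<^sup>2 * exp (- (s * norm \<xi>)\<^sup>2 / 2))"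
    and "of_real (LINT \<xi>|lborel. (cmod (fourier_integral f \<xi>))\<^sup>2 * exp (- (s * norm \<xi>)\<^sup>2 / 2))
      = (LINT x|lborel. f x * H x)"
proof -
  note [measurable] = borel_measurable_integrable[OF f]
  define c where "c = fourier_const CARD('n)"
  define \<gamma> where "\<gamma> \<xi> = complex_of_real (exp (- (s * norm \<xi>)\<^sup>2 / 2))" for \<xi> :: "real^'n"
  \<comment> \<open>The multiplication formula will be applied to \<open>f\<close> and
    \<open>h\<close>: the product of \<open>h\<close> with the transform of \<open>f\<close> is the
    weighted square, and the transform of \<open>h\<close> is the convolution
    \<open>H\<close>.\<close>
  define h where "h \<xi> = cnj (fourier_integral f \<xi>) * \<gamma> \<xi>" for \<xi>
  have [measurable]: "\<gamma> \<in> borel_measurable lborel" unfolding \<gamma>_def by measurable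
  have fm [measurable]: "fourier_integral f \<in> borel_measurable lborel" by measurable
  have \<gamma>i: "integrable lborel \<gamma>"
    using heat_fourier(1)[OF s, of "0::real^'n"] by (simp add: \<gamma>_def[abs_def])
  obtain B where B: "\<And>\<xi>. cmod (fourier_integral f \<xi>) \<le> B" using fourier_integral_bound[of f] by blast
  have hi: "integrable lborel h"
  proof (rule Bochner_Integration.integrable_bound)
    show "integrable lborel (\<lambda>\<xi>. of_real B * \<gamma> \<xi>)" using \<gamma>i by simp
    show "AE \<xi> in lborel. norm (h \<xi>) \<le> norm (of_real B * \<gamma> \<xi>)"
      by (intro AE_I2) (auto simp: h_def norm_mult intro!: mult_right_mono order_trans[OF B])
    show "h \<in> borel_measurable lborel" unfolding h_def by measurable
  qed
  have fH: "fourier_integral h x = H x" for x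
  proof -
    have "integrable (lborel \<Otimes>\<^sub>M lborel) (\<lambda>(y, \<xi>). exp (- \<i> * of_real (\<xi> \<bullet> (x - y))) * cnj (f y) * \<gamma> \<xi>)"
      by (rule integrable_product_bounded) (use f \<gamma>i in \<open>auto simp: norm_mult\<close>)
    from lborel_pair.Fubini_integral[OF this]
    have F: "(LINT \<xi>|lborel. LINT y|lborel. exp (- \<i> * of_real (\<xi> \<bullet> (x - y))) * cnj (f y) * \<gamma> \<xi>)
      = (LINT y|lborel. LINT \<xi>|lborel. exp (- \<i> * of_real (\<xi> \<bullet> (x - y))) * cnj (f y) * \<gamma> \<xi>)" .
    have "h \<xi> = of_real c * (LINT y|lborel. exp (\<i> * of_real (\<xi> \<bullet> y)) * cnj (f y)) * \<gamma> \<xi>" for \<xi>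
    proof -
      have "cnj (LINT x|lborel. exp (- \<i> * of_real (x \<bullet> \<xi>)) * f x) = (LINT y|lborel. exp (\<i> * of_real (\<xi> \<bullet> y)) * cnj (f y))"
        unfolding Bochner_Integration.integral_cnj[symmetric] by (simp add: exp_cnj inner_commute)
      then show ?thesis unfolding h_def fourier_integral_def c_def by simp
    qed
    then have "fourier_integral h x = of_real c * (LINT \<xi>|lborel. exp (- \<i> * of_real (\<xi> \<bullet> x)) *
         (of_real c * (LINT y|lborel. exp (\<i> * of_real (\<xi> \<bullet> y)) * cnj (f y)) * \<gamma> \<xi>))"
      unfolding fourier_integral_def[of h] c_def by simp
    also have "\<dots> = of_real (c\<^sup>2) * (LINT \<xi>|lborel. LINT y|lborel. exp (- \<i> * of_real (\<xi> \<bullet> (x - y))) * cnj (f y) * \<gamma> \<xi>)"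
    proof -
      have "exp (- \<i> * of_real (\<xi> \<bullet> x)) * (of_real c * (LINT y|lborel. exp (\<i> * of_real (\<xi> \<bullet> y)) * cnj (f y)) * \<gamma> \<xi>)
        = of_real c * (LINT y|lborel. exp (- \<i> * of_real (\<xi> \<bullet> (x - y))) * cnj (f y) * \<gamma> \<xi>)" for \<xi>
      proof -
        have "exp (- \<i> * of_real (\<xi> \<bullet> (x - y))) * cnj (f y) * \<gamma> \<xi>
          = (exp (- \<i> * of_real (\<xi> \<bullet> x)) * \<gamma> \<xi>) * (exp (\<i> * of_real (\<xi> \<bullet> y)) * cnj (f y))" for y
          by (simp add: inner_diff_right exp_diff exp_minus algebra_simps divide_inverse)
        then show ?thesis by (simp only: integral_mult_right_zero) (simp only: mult_ac)
      qed
      then show ?thesis by (simp only: integral_mult_right_zero) (simp add: power2_eq_square mult_ac)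
    qed
    also have "\<dots> = of_real (c\<^sup>2) * (LINT y|lborel. cnj (f y) * of_real ((2 * pi) ^ CARD('n) * heat s (x - y)))"
    proof -
      have "(LINT \<xi>|lborel. exp (- \<i> * of_real (\<xi> \<bullet> (x - y))) * cnj (f y) * \<gamma> \<xi>)
        = cnj (f y) * of_real ((2 * pi) ^ CARD('n) * heat s (x - y))" for y
      proof -
        have "(LINT \<xi>|lborel. exp (- \<i> * of_real (\<xi> \<bullet> (x - y))) * cnj (f y) * \<gamma> \<xi>)
          = (LINT \<xi>|lborel. cnj (f y) * (exp (- \<i> * of_real (\<xi> \<bullet> (x - y))) * \<gamma> \<xi>))"
          by (intro Bochner_Integration.integral_cong) (simp_all only: mult_ac)
        then show ?thesis unfolding integral_mult_right_zero \<gamma>_def heat_fourier(2)[OF s] .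
      qed
      then show ?thesis unfolding F by simp
    qed
    also have "\<dots> = (LINT y|lborel. of_real (c\<^sup>2) * (cnj (f y) * of_real ((2 * pi) ^ CARD('n) * heat s (x - y))))"
      by (rule integral_mult_right_zero[symmetric])
    also have "\<dots> = H x"
    proof -
      \<comment> \<open>The unitary normalisation enters here: the square of the Fourier constant
        times (2 pi)^n is 1.\<close>
      have k: "of_real (c\<^sup>2) * (cnj (f y) * of_real ((2 * pi) ^ CARD('n) * heat s (x - y)))
        = cnj (f y) * complex_of_real (heat s (x - y))" for y
        using fourier_const_square[of "CARD('n)"] unfolding c_def
        by (metis (no_types, opaque_lifting) mult.assoc mult.left_commute mult.left_neutral of_real_mult)
      show ?thesis unfolding H_def by (intro Bochner_Integration.integral_cong refl) (rule k)
    qed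
    finally show ?thesis .
  qed
  have cm: "of_real ((cmod (fourier_integral f \<xi>))\<^sup>2 * exp (- (s * norm \<xi>)\<^sup>2 / 2)) = fourier_integral f \<xi> * h \<xi>" for \<xi>
    unfolding h_def \<gamma>_def by (simp only: of_real_mult complex_norm_square mult.assoc)
  have [measurable]: "H \<in> borel_measurable lborel"
  proof -
    have "fourier_integral h \<in> borel_measurable lborel" using hi by measurable
    then show ?thesis unfolding fH[abs_def] .
  qed
  obtain B' where B': "\<And>\<xi>. cmod (H \<xi>) \<le> B'" using fourier_integral_bound[of h] fH by metis
  show "integrable lborel (\<lambda>x. f x * H x)"
  proof (rule Bochner_Integration.integrable_bound)
    show "integrable lborel (\<lambda>x. of_real B' * f x)" using f by simp
    show "AE x in lborel. norm (f x * H x) \<le> norm (of_real B' * f x)"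
      by (intro AE_I2) (auto simp: norm_mult mult.commute intro!: mult_right_mono order_trans[OF B'])
  qed measurable
  have "integrable lborel (\<lambda>\<xi>. fourier_integral f \<xi> * h \<xi>)"
  proof (rule Bochner_Integration.integrable_bound)
    show "integrable lborel (\<lambda>\<xi>. of_real B * h \<xi>)" using hi by simp
    show "AE \<xi> in lborel. norm (fourier_integral f \<xi> * h \<xi>) \<le> norm (of_real B * h \<xi>)"
      by (intro AE_I2) (auto simp: norm_mult intro!: mult_right_mono order_trans[OF B])
    show "(\<lambda>\<xi>. fourier_integral f \<xi> * h \<xi>) \<in> borel_measurable lborel" using hi by measurable
  qed
  then have "integrable lborel (\<lambda>\<xi>. Re (of_real ((cmod (fourier_integral f \<xi>))\<^sup>2 * exp (- (s * norm \<xi>)\<^sup>2 / 2))))"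
    unfolding cm by (rule integrable_Re)
  then show "integrable lborel (\<lambda>\<xi>. (cmod (fourier_integral f \<xi>))\<^sup>2 * exp (- (s * norm \<xi>)\<^sup>2 / 2))"
    unfolding Re_complex_of_real .
  have "of_real (LINT \<xi>|lborel. (cmod (fourier_integral f \<xi>))\<^sup>2 * exp (- (s * norm \<xi>)\<^sup>2 / 2))
    = (LINT \<xi>|lborel. fourier_integral f \<xi> * h \<xi>)"
    unfolding cm[symmetric] by (rule integral_complex_of_real[symmetric])
  also have "\<dots> = (LINT x|lborel. f x * H x)"
    unfolding fourier_integral_multiplication[OF f hi] fH ..
  finally show "of_real (LINT \<xi>|lborel. (cmod (fourier_integral f \<xi>))\<^sup>2 * exp (- (s * norm \<xi>)\<^sup>2 / 2))
      = (LINT x|lborel. f x * H x)" .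
qed

lemma nn_integral_heat:
  fixes x :: "real^'n"
  assumes s: "s > 0"
  shows "(\<integral>\<^sup>+y. ennreal (heat s (x - y)) \<partial>lborel) = 1" "(\<integral>\<^sup>+y. ennreal (heat s (y - x)) \<partial>lborel) = 1"
proof -
  have e: "heat s (x - y) = heat s (- x + y)" for y by (simp add: heat_def norm_minus_commute)
  have "integrable lborel (\<lambda>y. heat s (- x + y))" "(LINT y|lborel. heat s (- x + y)) = 1"
    using lborel_translate[of "heat s" "- x"] heat_integral[OF s, where 'n='n] by simp_all
  then have *: "(\<integral>\<^sup>+y. ennreal (heat s (- x + y)) \<partial>lborel) = 1"
    by (subst nn_integral_eq_integral) (auto simp: heat_nonneg s)
  then show "(\<integral>\<^sup>+y. ennreal (heat s (x - y)) \<partial>lborel) = 1" unfolding e .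
  have e2: "heat s (y - x) = heat s (- x + y)" for y by simp
  show "(\<integral>\<^sup>+y. ennreal (heat s (y - x)) \<partial>lborel) = 1" unfolding e2 by (rule *)
qed

text \<open>Young's inequality for a symmetric probability kernel: |f(x) f(y)| is at most half the
  sum of the squares, and integrating the kernel in either variable gives 1. Nonnegative integrals
  avoid questions of integrability for the double integral.\<close>

lemma fourier_integral_gaussian_weight_le:
  fixes f :: "real^'n \<Rightarrow> complex"
  assumes f: "integrable lborel f" and f2: "L2 f" and s: "s > 0"
  shows "(LINT \<xi>|lborel. (cmod (fourier_integral f \<xi>))\<^sup>2 * exp (- (s * norm \<xi>)\<^sup>2 / 2)) \<le> (l2norm f)\<^sup>2"
proof -
  note [measurable] = borel_measurable_integrable[OF f]
  let ?H = "\<lambda>x. LINT y|lborel. cnj (f y) * of_real (heat s (x - y))"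
  define a where "a x = cmod (f x)" for x
  have [measurable]: "a \<in> borel_measurable lborel" unfolding a_def by measurable
  note w = fourier_integral_gaussian_weight[OF f s]
  have a2: "(\<integral>\<^sup>+x. ennreal ((a x)\<^sup>2) \<partial>lborel) = ennreal ((l2norm f)\<^sup>2)"
    unfolding l2norm_squared a_def by (rule nn_integral_eq_integral[OF L2_integrable[OF f2]]) auto
  have "ennreal (LINT \<xi>|lborel. (cmod (fourier_integral f \<xi>))\<^sup>2 * exp (- (s * norm \<xi>)\<^sup>2 / 2))
      = ennreal (cmod (LINT x|lborel. f x * ?H x))"
    unfolding w(3)[symmetric] norm_of_real by (subst abs_of_nonneg) auto
  also have "\<dots> \<le> (\<integral>\<^sup>+x. ennreal (cmod (f x * ?H x)) \<partial>lborel)"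
    by (rule integral_norm_bound_ennreal[OF w(1)])
  also have "\<dots> \<le> (\<integral>\<^sup>+x. \<integral>\<^sup>+y. ennreal (1/2 * ((a x)\<^sup>2 * heat s (x - y)) + 1/2 * ((a y)\<^sup>2 * heat s (x - y))) \<partial>lborel \<partial>lborel)"
  proof (rule nn_integral_mono)
    fix x :: "real^'n"
    have "ennreal (cmod (?H x)) \<le> (\<integral>\<^sup>+y. ennreal (a y * heat s (x - y)) \<partial>lborel)"
    \<comment> \<open>If the integrand is not integrable, its Bochner integral is 0 and the bound is
      trivial.\<close>
    proof (cases "integrable lborel (\<lambda>y. cnj (f y) * complex_of_real (heat s (x - y)))")
      case True
      from integral_norm_bound_ennreal[OF this] show ?thesis
        by (simp add: norm_mult a_def heat_nonneg s)
    qed (simp add: not_integrable_integral_eq)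
    then have "ennreal (a x) * ennreal (cmod (?H x)) \<le> ennreal (a x) * (\<integral>\<^sup>+y. ennreal (a y * heat s (x - y)) \<partial>lborel)"
      by (rule mult_left_mono) simp
    also have "\<dots> = (\<integral>\<^sup>+y. ennreal (a x) * ennreal (a y * heat s (x - y)) \<partial>lborel)"
      by (rule nn_integral_cmult[symmetric]) measurable
    also have "\<dots> \<le> (\<integral>\<^sup>+y. ennreal (1/2 * ((a x)\<^sup>2 * heat s (x - y)) + 1/2 * ((a y)\<^sup>2 * heat s (x - y))) \<partial>lborel)"
    proof (rule nn_integral_mono)
      fix y
      have "a x * a y \<le> 1/2 * (a x)\<^sup>2 + 1/2 * (a y)\<^sup>2" using sum_squares_bound[of "a x" "a y"] by simp
      from mult_right_mono[OF this heat_nonneg[OF s, of "x - y"]]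
      have "a x * (a y * heat s (x - y)) \<le> 1/2 * ((a x)\<^sup>2 * heat s (x - y)) + 1/2 * ((a y)\<^sup>2 * heat s (x - y))"
        by (simp add: algebra_simps)
      then show "ennreal (a x) * ennreal (a y * heat s (x - y)) \<le> ennreal (1/2 * ((a x)\<^sup>2 * heat s (x - y)) + 1/2 * ((a y)\<^sup>2 * heat s (x - y)))"
        by (subst ennreal_mult[symmetric]) (auto simp only: a_def heat_nonneg s norm_ge_zero mult_nonneg_nonneg intro!: ennreal_leI)
    qed
    finally show "ennreal (cmod (f x * ?H x)) \<le> (\<integral>\<^sup>+y. ennreal (1/2 * ((a x)\<^sup>2 * heat s (x - y)) + 1/2 * ((a y)\<^sup>2 * heat s (x - y))) \<partial>lborel)"
      by (simp add: norm_mult a_def ennreal_mult)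
  qed
  also have "\<dots> = (\<integral>\<^sup>+x. \<integral>\<^sup>+y. ennreal (1/2) * (ennreal ((a x)\<^sup>2) * ennreal (heat s (x - y))) \<partial>lborel
        + \<integral>\<^sup>+y. ennreal (1/2) * (ennreal ((a y)\<^sup>2) * ennreal (heat s (x - y))) \<partial>lborel \<partial>lborel)"
  proof (rule nn_integral_cong)
    fix x :: "real^'n"
    have "ennreal (1/2 * (A * h) + 1/2 * (B * h)) = ennreal (1/2) * (ennreal A * ennreal h) + ennreal (1/2) * (ennreal B * ennreal h)"
      if "0 \<le> A" "0 \<le> B" "0 \<le> h" for A B h :: real
    proof -
      have "0 \<le> A * h" "0 \<le> B * h" "(0::real) \<le> 1/2" using that by auto
      then show ?thesis using that by (simp only: ennreal_mult[symmetric] ennreal_plus[symmetric] mult_nonneg_nonneg)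
    qed
    then have "(\<integral>\<^sup>+y. ennreal (1/2 * ((a x)\<^sup>2 * heat s (x - y)) + 1/2 * ((a y)\<^sup>2 * heat s (x - y))) \<partial>lborel)
      = (\<integral>\<^sup>+y. ennreal (1/2) * (ennreal ((a x)\<^sup>2) * ennreal (heat s (x - y)))
          + ennreal (1/2) * (ennreal ((a y)\<^sup>2) * ennreal (heat s (x - y))) \<partial>lborel)"
      by (intro nn_integral_cong) (simp only: zero_le_power2 heat_nonneg[OF s])
    also have "\<dots> = (\<integral>\<^sup>+y. ennreal (1/2) * (ennreal ((a x)\<^sup>2) * ennreal (heat s (x - y))) \<partial>lborel)
          + (\<integral>\<^sup>+y. ennreal (1/2) * (ennreal ((a y)\<^sup>2) * ennreal (heat s (x - y))) \<partial>lborel)"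
      by (rule nn_integral_add) measurable
    finally show "(\<integral>\<^sup>+y. ennreal (1/2 * ((a x)\<^sup>2 * heat s (x - y)) + 1/2 * ((a y)\<^sup>2 * heat s (x - y))) \<partial>lborel)
      = (\<integral>\<^sup>+y. ennreal (1/2) * (ennreal ((a x)\<^sup>2) * ennreal (heat s (x - y))) \<partial>lborel)
          + (\<integral>\<^sup>+y. ennreal (1/2) * (ennreal ((a y)\<^sup>2) * ennreal (heat s (x - y))) \<partial>lborel)" .
  qed
  also have "\<dots> = (\<integral>\<^sup>+x. \<integral>\<^sup>+y. ennreal (1/2) * (ennreal ((a x)\<^sup>2) * ennreal (heat s (x - y))) \<partial>lborel \<partial>lborel)
       + (\<integral>\<^sup>+x. \<integral>\<^sup>+y. ennreal (1/2) * (ennreal ((a y)\<^sup>2) * ennreal (heat s (x - y))) \<partial>lborel \<partial>lborel)"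
    by (rule nn_integral_add) measurable
  also have "(\<integral>\<^sup>+x. \<integral>\<^sup>+y. ennreal (1/2) * (ennreal ((a y)\<^sup>2) * ennreal (heat s (x - y))) \<partial>lborel \<partial>lborel)
      = (\<integral>\<^sup>+y. \<integral>\<^sup>+x. ennreal (1/2) * (ennreal ((a y)\<^sup>2) * ennreal (heat s (x - y))) \<partial>lborel \<partial>lborel)"
    by (rule lborel_pair.Fubini') measurable
  also have "\<dots> = ennreal (1/2) * ennreal ((l2norm f)\<^sup>2)"
    by (simp add: nn_integral_cmult nn_integral_heat s a2)
  also have "(\<integral>\<^sup>+x. \<integral>\<^sup>+y. ennreal (1/2) * (ennreal ((a x)\<^sup>2) * ennreal (heat s (x - y))) \<partial>lborel \<partial>lborel) = ennreal (1/2) * ennreal ((l2norm f)\<^sup>2)"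
    by (simp add: nn_integral_cmult nn_integral_heat s a2)
  also have "ennreal (1/2) * ennreal ((l2norm f)\<^sup>2) + ennreal (1/2) * ennreal ((l2norm f)\<^sup>2) = ennreal ((l2norm f)\<^sup>2)"
    by (subst (1 2) ennreal_mult[symmetric], simp_all only: zero_le_power2 zero_le_divide_1_iff zero_le_numeral)
      (subst ennreal_plus[symmetric], auto)
  finally show ?thesis by (subst (asm) ennreal_le_iff) auto
qed

text \<open>Fatou's lemma along s = 1/(j+1) removes the Gaussian weight. This yields square
  integrability and one inequality, which already makes the transform continuous in the L2
  norm.\<close>

lemma fourier_integral_L2:
  fixes f :: "real^'n \<Rightarrow> complex"
  assumes f: "integrable lborel f" and f2: "L2 f"
  shows "L2 (fourier_integral f)" "l2norm (fourier_integral f) \<le> l2norm f"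
proof -
  note [measurable] = borel_measurable_integrable[OF f]
  define e where "e j \<xi> = exp (- (1 / real (Suc j) * norm \<xi>)\<^sup>2 / 2)" for j and \<xi> :: "real^'n"
  have [measurable]: "e j \<in> borel_measurable lborel" for j unfolding e_def by measurable
  have fm [measurable]: "fourier_integral f \<in> borel_measurable lborel" by measurable
  have lim: "(\<lambda>j. e j \<xi>) \<longlonglongrightarrow> 1" for \<xi>
  proof -
    have "(\<lambda>j. exp (- (1 / real (Suc j) * norm \<xi>)\<^sup>2 / 2)) \<longlonglongrightarrow> exp (- (0 * norm \<xi>)\<^sup>2 / 2)"
      by (intro tendsto_intros LIMSEQ_Suc lim_1_over_n) auto
    then show ?thesis by (simp add: e_def)
  qed
  have "(\<integral>\<^sup>+\<xi>. ennreal ((cmod (fourier_integral f \<xi>))\<^sup>2) \<partial>lborel)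
      = (\<integral>\<^sup>+\<xi>. liminf (\<lambda>j. ennreal ((cmod (fourier_integral f \<xi>))\<^sup>2 * e j \<xi>)) \<partial>lborel)"
  proof (rule nn_integral_cong)
    fix \<xi>
    have "(\<lambda>j. (cmod (fourier_integral f \<xi>))\<^sup>2 * e j \<xi>) \<longlonglongrightarrow> (cmod (fourier_integral f \<xi>))\<^sup>2 * 1"
      by (intro tendsto_intros lim)
    then have "(\<lambda>j. ennreal ((cmod (fourier_integral f \<xi>))\<^sup>2 * e j \<xi>)) \<longlonglongrightarrow> ennreal ((cmod (fourier_integral f \<xi>))\<^sup>2)"
      by (intro tendsto_ennrealI) simp
    then show "ennreal ((cmod (fourier_integral f \<xi>))\<^sup>2) = liminf (\<lambda>j. ennreal ((cmod (fourier_integral f \<xi>))\<^sup>2 * e j \<xi>))"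
      by (rule lim_imp_Liminf[OF trivial_limit_sequentially, symmetric])
  qed
  also have "\<dots> \<le> liminf (\<lambda>j. \<integral>\<^sup>+\<xi>. ennreal ((cmod (fourier_integral f \<xi>))\<^sup>2 * e j \<xi>) \<partial>lborel)"
    by (rule nn_integral_liminf) measurable
  also have "\<dots> \<le> liminf (\<lambda>j::nat. ennreal ((l2norm f)\<^sup>2))"
  proof (intro Liminf_mono always_eventually allI)
    fix j :: nat
    have s: "1 / real (Suc j) > 0" by simp
    have "(\<integral>\<^sup>+\<xi>. ennreal ((cmod (fourier_integral f \<xi>))\<^sup>2 * e j \<xi>) \<partial>lborel)
      = ennreal (LINT \<xi>|lborel. (cmod (fourier_integral f \<xi>))\<^sup>2 * e j \<xi>)"
      unfolding e_def
      by (rule nn_integral_eq_integral[OF fourier_integral_gaussian_weight(2)[OF f s]]) auto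
    also have "\<dots> \<le> ennreal ((l2norm f)\<^sup>2)"
      unfolding e_def by (intro ennreal_leI fourier_integral_gaussian_weight_le[OF f f2 s])
    finally show "(\<integral>\<^sup>+\<xi>. ennreal ((cmod (fourier_integral f \<xi>))\<^sup>2 * e j \<xi>) \<partial>lborel) \<le> ennreal ((l2norm f)\<^sup>2)" .
  qed
  also have "\<dots> = ennreal ((l2norm f)\<^sup>2)" by (simp add: Liminf_const)
  finally have le: "(\<integral>\<^sup>+\<xi>. ennreal ((cmod (fourier_integral f \<xi>))\<^sup>2) \<partial>lborel) \<le> ennreal ((l2norm f)\<^sup>2)" .
  have "integrable lborel (\<lambda>\<xi>. (cmod (fourier_integral f \<xi>))\<^sup>2)"
    using le by (intro integrableI_bounded) (auto simp: top.not_eq_extremum intro: le_less_trans)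
  then show L: "L2 (fourier_integral f)" by (simp add: L2_def fm)
  have "ennreal ((l2norm (fourier_integral f))\<^sup>2) \<le> ennreal ((l2norm f)\<^sup>2)"
    unfolding l2norm_squared[of "fourier_integral f"]
    using le by (subst nn_integral_eq_integral[symmetric]) (auto intro: L2_integrable L)
  then have "(l2norm (fourier_integral f))\<^sup>2 \<le> (l2norm f)\<^sup>2" by simp
  then show "l2norm (fourier_integral f) \<le> l2norm f" by (rule power2_le_imp_le) simp
qed

text \<open>For bounded continuous \<open>f\<close> the heat convolution converges at every point,
  so the limit s -> 0 can be taken on both sides of the regularised identity.\<close>

lemma plancherel_continuous:
  fixes f :: "real^'n \<Rightarrow> complex"
  assumes f: "integrable lborel f" and f2: "L2 f" and cont: "continuous_on UNIV f" and M: "\<And>x. cmod (f x) \<le> M"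
  shows "l2norm (fourier_integral f) = l2norm f"
proof -
  note [measurable] = borel_measurable_integrable[OF f]
  have fm [measurable]: "fourier_integral f \<in> borel_measurable lborel" by measurable
  define s where "s j = 1 / real (Suc j)" for j
  have s0: "s j > 0" for j by (simp add: s_def)
  have slim: "s \<longlonglongrightarrow> 0" unfolding s_def by (rule LIMSEQ_Suc[OF lim_1_over_n])
  have M0: "M \<ge> 0" using order_trans[OF norm_ge_zero M] .
  define H where "H j x = (LINT y|lborel. cnj (f y) * of_real (heat (s j) (x - y)))" for j x
  \<comment> \<open>The substitution y = x + s z moves the parameter from the kernel into the
    argument of \<open>f\<close>, where continuity can be used against a fixed density.\<close>
  have Heq: "H j x = (LINT z|lborel. cnj (f (x + s j *\<^sub>R z)) * of_real (heat 1 z))" for j x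
  proof -
    have "H j x = (LINT y|lborel. cnj (f (x + y)) * of_real (heat (s j) y))"
    proof -
      have "(\<lambda>y. cnj (f y) * complex_of_real (heat (s j) (x - y))) \<in> borel_measurable lborel" by measurable
      from lborel_translate(2)[OF this, of x, symmetric] show ?thesis unfolding H_def by (simp add: heat_def)
    qed
    also have "\<dots> = s j ^ CARD('n) *\<^sub>R (LINT z|lborel. cnj (f (x + s j *\<^sub>R z)) * of_real (heat (s j) (s j *\<^sub>R z)))"
      by (rule lborel_scale(2)[OF s0]) measurable
    also have "\<dots> = (LINT z|lborel. s j ^ CARD('n) *\<^sub>R (cnj (f (x + s j *\<^sub>R z)) * of_real (heat (s j) (s j *\<^sub>R z))))"
      by (rule integral_scaleR_right[symmetric])
    also have "\<dots> = (LINT z|lborel. cnj (f (x + s j *\<^sub>R z)) * of_real (heat 1 z))"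
    proof (intro Bochner_Integration.integral_cong refl)
      fix z :: "real^'n"
      have "s j ^ CARD('n) * heat (s j) (s j *\<^sub>R z) = heat 1 z"
        using s0[of j] by (simp add: heat_def power_mult_distrib)
      then have "s j ^ CARD('n) *\<^sub>R complex_of_real (heat (s j) (s j *\<^sub>R z)) = of_real (heat 1 z)"
        unfolding scaleR_conv_of_real[of _ "complex_of_real _"] of_real_mult[symmetric] by simp
      then show "s j ^ CARD('n) *\<^sub>R (cnj (f (x + s j *\<^sub>R z)) * of_real (heat (s j) (s j *\<^sub>R z))) = cnj (f (x + s j *\<^sub>R z)) * of_real (heat 1 z)"
        by (metis mult_scaleR_right)
    qed
    finally show ?thesis .
  qed
  have h1: "integrable lborel (\<lambda>z::real^'n. heat 1 z)" by (rule heat_integral) simp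
  have Hb: "cmod (H j x) \<le> M" for j x
  proof -
    have "cmod (H j x) \<le> (LINT z|lborel. M * heat 1 (z::real^'n))"
      unfolding Heq
    proof (rule order_trans[OF integral_norm_bound integral_mono'])
      show "integrable lborel (\<lambda>z::real^'n. M * heat 1 z)" using h1 by simp
      show "norm (cnj (f (x + s j *\<^sub>R z)) * complex_of_real (heat 1 z)) \<le> M * heat 1 z" for z
        by (auto simp: norm_mult heat_nonneg intro!: mult_right_mono M)
      show "0 \<le> M * heat 1 z" for z :: "real^'n" using M0 by (simp add: heat_nonneg)
    qed
    then show ?thesis using heat_integral(2)[of 1, where 'n='n] by simp
  qed
  have Hlim: "(\<lambda>j. H j x) \<longlonglongrightarrow> cnj (f x)" for x
  proof -
    have "(\<lambda>j. LINT z|lborel. cnj (f (x + s j *\<^sub>R z)) * complex_of_real (heat 1 z))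
      \<longlonglongrightarrow> (LINT z|lborel. cnj (f x) * complex_of_real (heat 1 (z::real^'n)))"
    proof (rule integral_dominated_convergence[where w="\<lambda>z. M * heat 1 z"])
      show "AE z in lborel. (\<lambda>j. cnj (f (x + s j *\<^sub>R z)) * complex_of_real (heat 1 z)) \<longlonglongrightarrow> cnj (f x) * complex_of_real (heat 1 z)"
      proof (intro AE_I2)
        fix z :: "real^'n"
        have "isCont f x" using cont by (simp add: continuous_on_eq_continuous_at)
        moreover have "(\<lambda>j. x + s j *\<^sub>R z) \<longlonglongrightarrow> x + 0 *\<^sub>R z" by (intro tendsto_intros slim)
        ultimately have "(\<lambda>j. f (x + s j *\<^sub>R z)) \<longlonglongrightarrow> f x"
          by (intro isCont_tendsto_compose[of x f]) auto
        then show "(\<lambda>j. cnj (f (x + s j *\<^sub>R z)) * complex_of_real (heat 1 z)) \<longlonglongrightarrow> cnj (f x) * complex_of_real (heat 1 z)"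
          by (intro tendsto_intros)
      qed
      show "AE z in lborel. norm (cnj (f (x + s j *\<^sub>R z)) * complex_of_real (heat 1 z)) \<le> M * heat 1 z" for j
        by (intro AE_I2) (auto simp: norm_mult heat_nonneg intro!: mult_right_mono M)
    qed (use h1 in auto)
    also have "(LINT z|lborel. cnj (f x) * complex_of_real (heat 1 (z::real^'n))) = cnj (f x)"
      using heat_integral(2)[of 1, where 'n='n] by (simp add: integral_mult_right_zero integral_complex_of_real)
    finally show ?thesis unfolding Heq .
  qed
  have "(\<lambda>j. LINT x|lborel. f x * H j x) \<longlonglongrightarrow> (LINT x|lborel. f x * cnj (f x))"
  proof (rule integral_dominated_convergence[where w="\<lambda>x. M * cmod (f x)"])
    show "(\<lambda>x. f x * H j x) \<in> borel_measurable lborel" for j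
      using fourier_integral_gaussian_weight(1)[OF f s0[of j]] unfolding H_def by measurable
    show "AE x in lborel. (\<lambda>j. f x * H j x) \<longlonglongrightarrow> f x * cnj (f x)"
      by (intro AE_I2 tendsto_intros Hlim)
    show "AE x in lborel. norm (f x * H j x) \<le> M * cmod (f x)" for j
      by (intro AE_I2) (auto simp: norm_mult mult.commute[of M] intro!: mult_left_mono Hb)
  qed (use f in auto)
  moreover have "(LINT x|lborel. f x * cnj (f x)) = of_real ((l2norm f)\<^sup>2)"
    unfolding l2norm_squared complex_norm_square[symmetric] by (rule integral_complex_of_real)
  ultimately have R: "(\<lambda>j. LINT x|lborel. f x * H j x) \<longlonglongrightarrow> of_real ((l2norm f)\<^sup>2)" by simp
  have L: "(\<lambda>j. LINT \<xi>|lborel. (cmod (fourier_integral f \<xi>))\<^sup>2 * exp (- (s j * norm \<xi>)\<^sup>2 / 2))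
      \<longlonglongrightarrow> (LINT \<xi>|lborel. (cmod (fourier_integral f \<xi>))\<^sup>2)"
  proof (rule integral_dominated_convergence[where w="\<lambda>\<xi>. (cmod (fourier_integral f \<xi>))\<^sup>2"])
    show "AE \<xi> in lborel. (\<lambda>j. (cmod (fourier_integral f \<xi>))\<^sup>2 * exp (- (s j * norm \<xi>)\<^sup>2 / 2)) \<longlonglongrightarrow> (cmod (fourier_integral f \<xi>))\<^sup>2"
    proof (intro AE_I2)
      fix \<xi> :: "real^'n"
      have "(\<lambda>j. (cmod (fourier_integral f \<xi>))\<^sup>2 * exp (- (s j * norm \<xi>)\<^sup>2 / 2)) \<longlonglongrightarrow> (cmod (fourier_integral f \<xi>))\<^sup>2 * exp (- (0 * norm \<xi>)\<^sup>2 / 2)"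
        by (intro tendsto_intros slim) auto
      then show "(\<lambda>j. (cmod (fourier_integral f \<xi>))\<^sup>2 * exp (- (s j * norm \<xi>)\<^sup>2 / 2)) \<longlonglongrightarrow> (cmod (fourier_integral f \<xi>))\<^sup>2" by simp
    qed
    show "AE \<xi> in lborel. norm ((cmod (fourier_integral f \<xi>))\<^sup>2 * exp (- (s j * norm \<xi>)\<^sup>2 / 2)) \<le> (cmod (fourier_integral f \<xi>))\<^sup>2" for j
      by (intro AE_I2) (auto intro!: mult_right_le_one_le)
  qed (use L2_integrable[OF fourier_integral_L2(1)[OF f f2]] in auto)
  have "(\<lambda>j. LINT x|lborel. f x * H j x) \<longlonglongrightarrow> of_real ((l2norm (fourier_integral f))\<^sup>2)"
    using tendsto_of_real[OF L, where 'a=complex]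
    unfolding H_def fourier_integral_gaussian_weight(3)[OF f s0, symmetric] l2norm_squared .
  from LIMSEQ_unique[OF this R] have "(l2norm (fourier_integral f))\<^sup>2 = (l2norm f)\<^sup>2"
    using of_real_eq_iff by blast
  then show ?thesis by simp
qed

lemma fourier_integral_diff:
  fixes f g :: "real^'n \<Rightarrow> complex"
  assumes "integrable lborel f" "integrable lborel g"
  shows "fourier_integral (\<lambda>x. f x - g x) \<xi> = fourier_integral f \<xi> - fourier_integral g \<xi>"
  using fourier_integrable[OF assms(1), of \<xi>] fourier_integrable[OF assms(2), of \<xi>]
  by (simp add: fourier_integral_def right_diff_distrib)

lemma fourier_integral_cmult:
  fixes f :: "real^'n \<Rightarrow> complex"
  shows "fourier_integral (\<lambda>x. a * f x) \<xi> = a * fourier_integral f \<xi>"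
proof -
  have "exp (- \<i> * of_real (x \<bullet> \<xi>)) * (a * f x) = a * (exp (- \<i> * of_real (x \<bullet> \<xi>)) * f x)" for x
    by (simp only: mult_ac)
  then show ?thesis unfolding fourier_integral_def by (simp only: integral_mult_right_zero mult_ac)
qed

text \<open>Both norms change by less than e when \<open>f\<close> is replaced by a continuous
  approximation: on the Fourier side this is the inequality already known, applied to the
  difference.\<close>

lemma plancherel_L1_L2:
  fixes f :: "real^'n \<Rightarrow> complex"
  assumes f: "integrable lborel f" and f2: "L2 f"
  shows "l2norm (fourier_integral f) = l2norm f"
proof -
  have "\<bar>l2norm (fourier_integral f) - l2norm f\<bar> \<le> 2 * e" if "e > 0" for e
  proof -
    obtain g M R where g: "continuous_on UNIV g" "\<And>x. cmod (g x) \<le> M" "\<And>x. norm x > R \<Longrightarrow> g x = 0"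
      "l2norm (\<lambda>x. f x - g x) < e" using L2_continuous_approx[OF f2 \<open>e > 0\<close>] by blast
    have "g \<in> borel_measurable lborel" using borel_measurable_continuous_onI[OF g(1)] by simp
    from L2_bounded_support[OF this g(2,3)] have g2: "L2 g" and gi: "integrable lborel g" by blast+
    have "\<bar>l2norm (fourier_integral f) - l2norm (fourier_integral g)\<bar>
       \<le> l2norm (\<lambda>\<xi>. fourier_integral f \<xi> - fourier_integral g \<xi>)"
      by (intro l2norm_diff_abs fourier_integral_L2 f f2 g2 gi)
    also have "\<dots> = l2norm (fourier_integral (\<lambda>x. f x - g x))"
      by (simp add: fourier_integral_diff[OF f gi, abs_def])
    also have "\<dots> \<le> l2norm (\<lambda>x. f x - g x)"
      by (intro fourier_integral_L2 L2_diff f2 g2 Bochner_Integration.integrable_diff f gi)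
    finally have "\<bar>l2norm (fourier_integral f) - l2norm (fourier_integral g)\<bar> < e" using g(4) by simp
    moreover have "l2norm (fourier_integral g) = l2norm g"
      by (rule plancherel_continuous[OF gi g2 g(1,2)])
    moreover have "\<bar>l2norm f - l2norm g\<bar> < e" using l2norm_diff_abs[OF f2 g2] g(4) by simp
    ultimately show ?thesis by linarith
  qed
  from this[of "e / 2" for e] have "\<bar>l2norm (fourier_integral f) - l2norm f\<bar> \<le> 0 + e" if "e > 0" for e
    using that by simp
  then have "\<bar>l2norm (fourier_integral f) - l2norm f\<bar> \<le> 0" by (rule field_le_epsilon)
  then show ?thesis by simp
qed

section \<open>Extension of the transform to L2\<close>

definition ball_restrict :: "real \<Rightarrow> (real^'n \<Rightarrow> complex) \<Rightarrow> real^'n \<Rightarrow> complex" where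
  "ball_restrict R f x = (if norm x \<le> R then f x else 0)"

lemma ball_restrict_measurable:
  fixes f :: "real^'n \<Rightarrow> complex"
  assumes [measurable]: "f \<in> borel_measurable lborel"
  shows "ball_restrict R f \<in> borel_measurable lborel"
  unfolding ball_restrict_def[abs_def] by measurable

lemma ball_restrict_L2:
  fixes f :: "real^'n \<Rightarrow> complex"
  shows "L2 f \<Longrightarrow> L2 (ball_restrict R f)"
  by (rule L2_dominated[OF _ ball_restrict_measurable[OF L2_measurable]]) (auto simp: ball_restrict_def)

lemma ball_restrict_integrable:
  fixes f :: "real^'n \<Rightarrow> complex"
  assumes "L2 f" shows "integrable lborel (ball_restrict R f)"
proof (rule Bochner_Integration.integrable_bound)
  have "integrable lborel (\<lambda>x::real^'n. if norm x \<le> R then 1 else (0::real))"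
    by (rule L2_bounded_support(2)[of _ 1 R]) auto
  then show "integrable lborel (\<lambda>x::real^'n. (if norm x \<le> R then 1 else (0::real)) + (cmod (f x))\<^sup>2)"
    using L2_integrable[OF assms] by simp
  show "ball_restrict R f \<in> borel_measurable lborel"
    by (rule ball_restrict_measurable[OF L2_measurable[OF assms]])
  show "AE x in lborel. norm (ball_restrict R f x) \<le> norm ((if norm x \<le> R then 1 else 0) + (cmod (f x))\<^sup>2)"
  proof (intro AE_I2)
    fix x
    have "cmod (f x) \<le> 1 + (cmod (f x))\<^sup>2"
      using sum_squares_bound[of 1 "cmod (f x)"] norm_ge_zero[of "f x"]
      unfolding one_power2 mult_1_right by linarith
    then show "norm (ball_restrict R f x) \<le> norm ((if norm x \<le> R then 1 else 0) + (cmod (f x))\<^sup>2)"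
      by (auto simp: ball_restrict_def)
  qed
qed

lemma ball_restrict_tendsto:
  fixes f :: "real^'n \<Rightarrow> complex"
  assumes "L2 f" shows "L2_tendsto (\<lambda>R. ball_restrict R f) f at_top"
proof (rule L2_dominated_convergence_at_top[OF assms L2_measurable[OF assms]])
  show "\<forall>\<^sub>F R in at_top. ball_restrict R f \<in> borel_measurable lborel \<and> (AE x in lborel. norm (ball_restrict R f x) \<le> norm (f x))"
    by (intro always_eventually allI conjI ball_restrict_measurable L2_measurable assms) (auto simp: ball_restrict_def)
  show "AE x in lborel. ((\<lambda>R. ball_restrict R f x) \<longlongrightarrow> f x) at_top"
  proof (intro AE_I2 tendsto_eventually)
    fix x show "\<forall>\<^sub>F R in at_top. ball_restrict R f x = f x"
      using eventually_ge_at_top[of "norm x"] by eventually_elim (simp add: ball_restrict_def)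
  qed
qed

lemma plancherel_diff:
  fixes f g :: "real^'n \<Rightarrow> complex"
  assumes "L2 f" "L2 g" "integrable lborel f" "integrable lborel g"
  shows "l2norm (\<lambda>x. fourier_integral f x - fourier_integral g x) = l2norm (\<lambda>x. f x - g x)"
  using plancherel_L1_L2[OF Bochner_Integration.integrable_diff[OF assms(3,4)] L2_diff[OF assms(1,2)]]
  unfolding fourier_integral_diff[OF assms(3,4), abs_def] .

text \<open>Plancherel turns differences of the transforms into differences of the truncations,
  which are small for large radii. The limit is obtained along a sequence of radii; the same Cauchy
  estimate extends it to all radii.\<close>

lemma fourier_exists:
  fixes f :: "real^'n \<Rightarrow> complex"
  assumes f: "L2 f"
  shows "\<exists>g. L2_tendsto (\<lambda>R. fourier_integral (ball_restrict R f)) g at_top"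
proof -
  let ?F = "\<lambda>R. fourier_integral (ball_restrict R f)"
  \<comment> \<open>Chosen so that \<open>(2 * \<epsilon> j)\<^sup>2 = 1 / 9 ^ j\<close>, which is
    below the rate 1/8^j demanded for completeness.\<close>
  define \<epsilon> where "\<epsilon> j = (1/3) ^ j / (2::real)" for j :: nat
  note L = ball_restrict_L2[OF f] and I = ball_restrict_integrable[OF f]
  have LF: "L2 (?F R)" for R by (rule fourier_integral_L2(1)[OF I L])
  note T = L2_tendstoD(3)[OF ball_restrict_tendsto[OF f]]
  have "\<exists>R. \<forall>S\<ge>R. l2norm (\<lambda>x. ball_restrict S f x - f x) < \<epsilon> j" for j
    using order_tendstoD(2)[OF T, of "\<epsilon> j"] by (auto simp: \<epsilon>_def eventually_at_top_linorder)
  then obtain R where R: "\<And>j S. S \<ge> R j \<Longrightarrow> l2norm (\<lambda>x. ball_restrict S f x - f x) < \<epsilon> j" by metis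
  \<comment> \<open>Taking the maximum over the earlier thresholds puts \<open>r k\<close> beyond
    \<open>R j\<close> for every j \<le> k, in particular both \<open>r j\<close> and
    \<open>r (Suc j)\<close>.\<close>
  define r where "r j = Max (R ` {..j})" for j
  have rR: "r k \<ge> R j" if "j \<le> k" for j k using that by (auto simp: r_def)
  have D: "l2norm (\<lambda>x. ?F S x - ?F S' x) \<le> 2 * \<epsilon> j" if "S \<ge> R j" "S' \<ge> R j" for S S' j
  proof -
    have "l2norm (\<lambda>x. ?F S x - ?F S' x) = l2norm (\<lambda>x. ball_restrict S f x - ball_restrict S' f x)"
      by (rule plancherel_diff[OF L L I I])
    also have "\<dots> \<le> l2norm (\<lambda>x. ball_restrict S f x - f x) + l2norm (\<lambda>x. f x - ball_restrict S' f x)"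
      by (rule l2norm_triangle3[OF L f L])
    finally show ?thesis
      using R[OF that(1)] R[OF that(2)] l2norm_minus_commute[of "ball_restrict S' f" f] by simp
  qed
  have "\<exists>g. L2_tendsto (\<lambda>j. ?F (r j)) g sequentially"
  proof (rule L2_complete)
    fix j
    have "l2norm (\<lambda>x. ?F (r (Suc j)) x - ?F (r j) x) \<le> 2 * \<epsilon> j" by (rule D) (auto intro!: rR)
    then have "(l2norm (\<lambda>x. ?F (r (Suc j)) x - ?F (r j) x))\<^sup>2 \<le> (2 * \<epsilon> j)\<^sup>2" by (intro power_mono) auto
    also have "(2 * \<epsilon> j)\<^sup>2 = (1/9) ^ j"
      by (simp add: \<epsilon>_def power2_eq_square flip: power_mult_distrib)
    also have "\<dots> \<le> (1/8) ^ j" by (intro power_mono) auto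
    finally show "(l2norm (\<lambda>x. ?F (r (Suc j)) x - ?F (r j) x))\<^sup>2 \<le> 1 / 8 ^ j" by (simp add: power_divide)
  qed (rule LF)
  then obtain g where g: "L2_tendsto (\<lambda>j. ?F (r j)) g sequentially" by blast
  note gD = L2_tendstoD[OF g]
  have "((\<lambda>S. l2norm (\<lambda>x. ?F S x - g x)) \<longlongrightarrow> 0) at_top"
  proof (rule tendstoI)
    fix e :: real assume "e > 0"
    have "\<epsilon> \<longlonglongrightarrow> 0 / 2" unfolding \<epsilon>_def by (intro tendsto_divide LIMSEQ_power_zero tendsto_const) auto
    then have "\<forall>\<^sub>F j in sequentially. \<epsilon> j < e / 4"
      by (intro order_tendstoD(2)) (use \<open>e > 0\<close> in auto)
    moreover have "\<forall>\<^sub>F j in sequentially. l2norm (\<lambda>x. ?F (r j) x - g x) < e / 2"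
      by (rule order_tendstoD(2)[OF gD(3)]) (use \<open>e > 0\<close> in auto)
    ultimately have "\<exists>j. \<epsilon> j < e / 4 \<and> l2norm (\<lambda>x. ?F (r j) x - g x) < e / 2"
      by (intro eventually_happens'[OF trivial_limit_sequentially] eventually_conj)
    then obtain j where j: "\<epsilon> j < e / 4" "l2norm (\<lambda>x. ?F (r j) x - g x) < e / 2" by blast
    show "\<forall>\<^sub>F S in at_top. dist (l2norm (\<lambda>x. ?F S x - g x)) 0 < e"
      using eventually_ge_at_top[of "R j"]
    proof eventually_elim
      case (elim S)
      have "l2norm (\<lambda>x. ?F S x - g x) \<le> l2norm (\<lambda>x. ?F S x - ?F (r j) x) + l2norm (\<lambda>x. ?F (r j) x - g x)"
        by (rule l2norm_triangle3[OF LF LF gD(1)])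
      also have "\<dots> < e" using D[OF elim rR[OF order_refl]] j by simp
      finally show ?case by simp
    qed
  qed
  then show ?thesis using gD(1) LF by (intro exI[of _ g]) (simp add: L2_tendsto_def)
qed

lemma fourier_tendsto:
  fixes f :: "real^'n \<Rightarrow> complex"
  assumes "L2 f"
  shows "L2_tendsto (\<lambda>R. fourier_integral (ball_restrict R f)) (fourier f) at_top"
  unfolding fourier_def ball_restrict_def[abs_def]
  using someI_ex[OF fourier_exists[OF assms]] unfolding ball_restrict_def[abs_def] .

lemma fourier_L2:
  fixes f :: "real^'n \<Rightarrow> complex"
  shows "L2 f \<Longrightarrow> L2 (fourier f)"
  by (rule L2_tendstoD(1)[OF fourier_tendsto])

lemma fourier_measurable:
  fixes f :: "real^'n \<Rightarrow> complex"
  shows "L2 f \<Longrightarrow> fourier f \<in> borel_measurable lborel"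
  by (rule L2_measurable[OF fourier_L2])

lemma fourier_eqI:
  fixes f :: "real^'n \<Rightarrow> complex"
  assumes "L2 f" "L2_tendsto (\<lambda>R. fourier_integral (ball_restrict R f)) g at_top"
  shows "AE \<xi> in lborel. fourier f \<xi> = g \<xi>"
  by (rule L2_tendsto_unique[OF fourier_tendsto[OF assms(1)] assms(2)]) simp

lemma plancherel:
  fixes f :: "real^'n \<Rightarrow> complex"
  assumes f: "L2 f"
  shows "l2norm (fourier f) = l2norm f"
proof -
  have "((\<lambda>R. l2norm (ball_restrict R f)) \<longlongrightarrow> l2norm (fourier f)) at_top"
    using L2_tendsto_l2norm[OF fourier_tendsto[OF f]]
    unfolding plancherel_L1_L2[OF ball_restrict_integrable[OF f] ball_restrict_L2[OF f]] .
  from tendsto_unique[OF _ this L2_tendsto_l2norm[OF ball_restrict_tendsto[OF f]]]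
  show ?thesis by simp
qed

text \<open>An equality of functions, not merely AE: the integrals do not see null sets, so the two
  choices are made from the same predicate.\<close>

lemma fourier_cong_AE:
  fixes f g :: "real^'n \<Rightarrow> complex"
  assumes "f \<in> borel_measurable lborel" "g \<in> borel_measurable lborel" "AE x in lborel. f x = g x"
  shows "fourier f = fourier g"
proof -
  have "fourier_integral (ball_restrict R f) = fourier_integral (ball_restrict R g)" for R
  proof
    fix \<xi>
    note [measurable] = ball_restrict_measurable[OF assms(1)] ball_restrict_measurable[OF assms(2)]
    have "(LINT x|lborel. exp (- \<i> * of_real (x \<bullet> \<xi>)) * ball_restrict R f x)
      = (LINT x|lborel. exp (- \<i> * of_real (x \<bullet> \<xi>)) * ball_restrict R g x)"
      by (rule integral_cong_AE, measurable)
        (use assms(3) in \<open>eventually_elim, auto simp: ball_restrict_def\<close>)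
    then show "fourier_integral (ball_restrict R f) \<xi> = fourier_integral (ball_restrict R g) \<xi>"
      by (simp add: fourier_integral_def)
  qed
  then show ?thesis unfolding fourier_def ball_restrict_def[abs_def] by simp
qed

lemma L2_tendsto_diff:
  assumes "L2_tendsto F g net" "L2_tendsto F' g' net"
  shows "L2_tendsto (\<lambda>i x. F i x - F' i x) (\<lambda>x. g x - g' x) net"
proof -
  note g = L2_tendstoD[OF assms(1)] and g' = L2_tendstoD[OF assms(2)]
  have "((\<lambda>i. l2norm (\<lambda>x. F i x - F' i x - (g x - g' x))) \<longlongrightarrow> 0) net"
  proof (rule Lim_null_comparison)
    show "\<forall>\<^sub>F i in net. norm (l2norm (\<lambda>x. F i x - F' i x - (g x - g' x)))
      \<le> l2norm (\<lambda>x. F i x - g x) + l2norm (\<lambda>x. F' i x - g' x)"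
      using g(2) g'(2)
    proof eventually_elim
      case (elim i)
      have "(\<lambda>x. F i x - F' i x - (g x - g' x)) = (\<lambda>x. (F i x - g x) - (F' i x - g' x))" by auto
      then show ?case using l2norm_triangle_diff[OF L2_diff[OF elim(1) g(1)] L2_diff[OF elim(2) g'(1)]] by simp
    qed
    show "((\<lambda>i. l2norm (\<lambda>x. F i x - g x) + l2norm (\<lambda>x. F' i x - g' x)) \<longlongrightarrow> 0) net"
      using tendsto_add[OF g(3) g'(3)] by simp
  qed
  moreover have "\<forall>\<^sub>F i in net. L2 (\<lambda>x. F i x - F' i x)"
    using g(2) g'(2) by eventually_elim (rule L2_diff)
  ultimately show ?thesis using L2_diff[OF g(1) g'(1)] by (simp add: L2_tendsto_def)
qed

lemma L2_tendsto_cmult: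
  fixes g :: "real^'n \<Rightarrow> complex"
  assumes "L2_tendsto F g net"
  shows "L2_tendsto (\<lambda>i x. a * F i x) (\<lambda>x. a * g x) net"
proof -
  note g = L2_tendstoD[OF assms]
  have "((\<lambda>i. cmod a * l2norm (\<lambda>x. F i x - g x)) \<longlongrightarrow> cmod a * 0) net" by (intro tendsto_intros g)
  then have "((\<lambda>i. l2norm (\<lambda>x. a * F i x - a * g x)) \<longlongrightarrow> 0) net"
    unfolding right_diff_distrib[symmetric] l2norm_cmult by simp
  moreover have "\<forall>\<^sub>F i in net. L2 (\<lambda>x. a * F i x)" using g(2) by eventually_elim (rule L2_cmult)
  ultimately show ?thesis using L2_cmult[OF g(1)] by (simp add: L2_tendsto_def)
qed

lemma fourier_diff:
  fixes f g :: "real^'n \<Rightarrow> complex"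
  assumes "L2 f" "L2 g"
  shows "AE \<xi> in lborel. fourier (\<lambda>x. f x - g x) \<xi> = fourier f \<xi> - fourier g \<xi>"
proof (rule fourier_eqI[OF L2_diff[OF assms]])
  have "fourier_integral (ball_restrict R (\<lambda>x. f x - g x)) = (\<lambda>\<xi>. fourier_integral (ball_restrict R f) \<xi> - fourier_integral (ball_restrict R g) \<xi>)" for R
  proof -
    have "ball_restrict R (\<lambda>x. f x - g x) = (\<lambda>x. ball_restrict R f x - ball_restrict R g x)"
      by (auto simp: ball_restrict_def)
    then show ?thesis using fourier_integral_diff[OF ball_restrict_integrable[OF assms(1)] ball_restrict_integrable[OF assms(2)]] by auto
  qed
  then show "L2_tendsto (\<lambda>R. fourier_integral (ball_restrict R (\<lambda>x. f x - g x))) (\<lambda>\<xi>. fourier f \<xi> - fourier g \<xi>) at_top"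
    using L2_tendsto_diff[OF fourier_tendsto[OF assms(1)] fourier_tendsto[OF assms(2)]] by simp
qed

lemma fourier_cmult:
  fixes f :: "real^'n \<Rightarrow> complex"
  assumes "L2 f"
  shows "AE \<xi> in lborel. fourier (\<lambda>x. a * f x) \<xi> = a * fourier f \<xi>"
proof (rule fourier_eqI[OF L2_cmult[OF assms]])
  have "fourier_integral (ball_restrict R (\<lambda>x. a * f x)) = (\<lambda>\<xi>. a * fourier_integral (ball_restrict R f) \<xi>)" for R
  proof -
    have "ball_restrict R (\<lambda>x. a * f x) = (\<lambda>x. a * ball_restrict R f x)"
      by (auto simp: ball_restrict_def)
    then show ?thesis using fourier_integral_cmult by auto
  qed
  then show "L2_tendsto (\<lambda>R. fourier_integral (ball_restrict R (\<lambda>x. a * f x))) (\<lambda>\<xi>. a * fourier f \<xi>) at_top"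
    using L2_tendsto_cmult[OF fourier_tendsto[OF assms]] by simp
qed

lemma fourier_eq_integral:
  fixes f :: "real^'n \<Rightarrow> complex"
  assumes f: "L2 f" and i: "integrable lborel f"
  shows "AE \<xi> in lborel. fourier f \<xi> = fourier_integral f \<xi>"
proof (rule fourier_eqI[OF f])
  note L = ball_restrict_L2[OF f] and I = ball_restrict_integrable[OF f]
  have "L2 (fourier_integral (ball_restrict R f))" for R by (rule fourier_integral_L2(1)[OF I L])
  then show "L2_tendsto (\<lambda>R. fourier_integral (ball_restrict R f)) (fourier_integral f) at_top"
    unfolding L2_tendsto_def plancherel_diff[OF L f I i]
    using fourier_integral_L2(1)[OF i f] L2_tendstoD(3)[OF ball_restrict_tendsto[OF f]] by simp
qed

lemma fourier_multiplication:
  fixes f g :: "real^'n \<Rightarrow> complex"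
  assumes f: "L2 f" and g: "L2 g"
  shows "(LINT \<xi>|lborel. fourier f \<xi> * g \<xi>) = (LINT x|lborel. f x * fourier g x)"
proof -
  have "((\<lambda>R. LINT \<xi>|lborel. fourier_integral (ball_restrict R f) \<xi> * ball_restrict R g \<xi>)
      \<longlongrightarrow> (LINT \<xi>|lborel. fourier f \<xi> * g \<xi>)) at_top"
    by (rule L2_tendsto_integral_mult[OF fourier_tendsto[OF f] ball_restrict_tendsto[OF g]])
  moreover have "((\<lambda>R. LINT x|lborel. ball_restrict R f x * fourier_integral (ball_restrict R g) x)
      \<longlongrightarrow> (LINT x|lborel. f x * fourier g x)) at_top"
    by (rule L2_tendsto_integral_mult[OF ball_restrict_tendsto[OF f] fourier_tendsto[OF g]])
  ultimately show ?thesis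
    unfolding fourier_integral_multiplication[OF ball_restrict_integrable[OF f] ball_restrict_integrable[OF g]]
    using tendsto_unique trivial_limit_at_top_linorder by blast
qed

section \<open>Reflection, conjugation and inversion\<close>

lemma lborel_reflect:
  fixes f :: "real^'n \<Rightarrow> 'b::{banach,second_countable_topology}"
  assumes [measurable]: "f \<in> borel_measurable lborel"
  shows "integrable lborel (\<lambda>x. f (- x)) \<longleftrightarrow> integrable lborel f"
    and "(LINT x|lborel. f (- x)) = (LINT x|lborel. f x)"
proof -
  have eq: "distr lborel borel uminus = (lborel :: (real^'n) measure)"
    using lborel_affine[of "-1" "0::real^'n"] by (simp add: density_1 scaleR_minus1_left[abs_def])
  have m: "uminus \<in> lborel \<rightarrow>\<^sub>M (borel :: (real^'n) measure)" "f \<in> borel_measurable borel" using assms by auto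
  show "integrable lborel (\<lambda>x. f (- x)) \<longleftrightarrow> integrable lborel f"
    using integrable_distr_eq[OF m] by (simp add: eq)
  show "(LINT x|lborel. f (- x)) = (LINT x|lborel. f x)"
    using integral_distr[OF m] by (simp add: eq)
qed

lemma L2_reflect:
  fixes f :: "real^'n \<Rightarrow> complex"
  assumes "L2 f" shows "L2 (\<lambda>x. f (- x))" "l2norm (\<lambda>x. f (- x)) = l2norm f"
proof -
  note [measurable] = L2_measurable[OF assms]
  have m: "(\<lambda>x. (cmod (f x))\<^sup>2) \<in> borel_measurable lborel" by measurable
  show "L2 (\<lambda>x. f (- x))" using lborel_reflect(1)[OF m] assms by (auto simp: L2_def)
  show "l2norm (\<lambda>x. f (- x)) = l2norm f" using lborel_reflect(2)[OF m] by (simp add: l2norm_def)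
qed

lemma L2_cnj:
  fixes f :: "real^'n \<Rightarrow> complex"
  shows "L2 f \<Longrightarrow> L2 (\<lambda>x. cnj (f x))"
  by (rule L2_dominated[OF _ borel_measurable_cnj[OF L2_measurable]]) auto

lemma fourier_cnj:
  fixes g :: "real^'n \<Rightarrow> complex"
  assumes g: "L2 g"
  shows "AE \<xi> in lborel. fourier (\<lambda>x. cnj (g x)) \<xi> = cnj (fourier g (- \<xi>))"
proof (rule fourier_eqI[OF L2_cnj[OF g]])
  note T = L2_tendstoD[OF fourier_tendsto[OF g]]
  have eq: "fourier_integral (ball_restrict R (\<lambda>x. cnj (g x))) \<xi> = cnj (fourier_integral (ball_restrict R g) (- \<xi>))" for R \<xi>
  proof -
    have "exp (- \<i> * of_real (x \<bullet> \<xi>)) * ball_restrict R (\<lambda>x. cnj (g x)) x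
      = cnj (exp (- \<i> * of_real (x \<bullet> - \<xi>)) * ball_restrict R g x)" for x
      by (simp add: ball_restrict_def exp_cnj)
    then show ?thesis unfolding fourier_integral_def by (simp only: Bochner_Integration.integral_cnj) simp
  qed
  have LF: "L2 (fourier_integral (ball_restrict R g))" for R
    by (rule fourier_integral_L2(1)[OF ball_restrict_integrable[OF g] ball_restrict_L2[OF g]])
  have "l2norm (\<lambda>\<xi>. cnj (fourier_integral (ball_restrict R g) (- \<xi>)) - cnj (fourier g (- \<xi>)))
    = l2norm (\<lambda>\<xi>. fourier_integral (ball_restrict R g) \<xi> - fourier g \<xi>)" for R
  proof -
    have "l2norm (\<lambda>\<xi>. cnj (fourier_integral (ball_restrict R g) (- \<xi>)) - cnj (fourier g (- \<xi>)))
     = l2norm (\<lambda>\<xi>. fourier_integral (ball_restrict R g) (- \<xi>) - fourier g (- \<xi>))"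
      unfolding l2norm_def complex_cnj_diff[symmetric] complex_mod_cnj ..
    then show ?thesis using L2_reflect(2)[OF L2_diff[OF LF fourier_L2[OF g]]] by simp
  qed
  then show "L2_tendsto (\<lambda>R. fourier_integral (ball_restrict R (\<lambda>x. cnj (g x)))) (\<lambda>\<xi>. cnj (fourier g (- \<xi>))) at_top"
    unfolding L2_tendsto_def eq[abs_def]
    using T(3) by (auto intro!: always_eventually L2_cnj L2_reflect LF fourier_L2 g)
qed

text \<open>With \<open>a\<close> the reflected transform of \<open>g\<close>, the squared distance
  of the transform of \<open>a\<close> from \<open>g\<close> is expanded. All terms are known: the
  two norms by Plancherel, and the cross term by the multiplication formula together with the rule
  for conjugates; they cancel.\<close>

lemma fourier_inversion:
  fixes g :: "real^'n \<Rightarrow> complex"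
  assumes g: "L2 g"
  shows "AE \<xi> in lborel. fourier (\<lambda>x. fourier g (- x)) \<xi> = g \<xi>"
proof -
  define a where "a x = fourier g (- x)" for x
  have a: "L2 a" unfolding a_def by (intro L2_reflect fourier_L2 g)
  have an: "l2norm a = l2norm g" unfolding a_def L2_reflect(2)[OF fourier_L2[OF g]] by (rule plancherel[OF g])
  note Fa = fourier_L2[OF a]
  note [measurable] = L2_measurable[OF Fa] L2_measurable[OF g] L2_measurable[OF a] fourier_measurable[OF L2_cnj[OF g]]
  have "(LINT \<xi>|lborel. fourier a \<xi> * cnj (g \<xi>)) = (LINT x|lborel. a x * fourier (\<lambda>x. cnj (g x)) x)"
    by (rule fourier_multiplication[OF a L2_cnj[OF g]])
  also have "\<dots> = (LINT x|lborel. a x * cnj (a x))"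
    by (rule integral_cong_AE) (use fourier_cnj[OF g] in \<open>auto simp: a_def[symmetric]\<close>)
  also have "\<dots> = of_real ((l2norm g)\<^sup>2)"
    unfolding complex_norm_square[symmetric] an[symmetric] l2norm_squared by (rule integral_complex_of_real)
  finally have cross: "(LINT \<xi>|lborel. fourier a \<xi> * cnj (g \<xi>)) = of_real ((l2norm g)\<^sup>2)" .
  have i: "integrable lborel (\<lambda>\<xi>. fourier a \<xi> * cnj (g \<xi>))" by (rule L2_mult_integrable[OF Fa L2_cnj[OF g]])
  have "(l2norm (\<lambda>\<xi>. fourier a \<xi> - g \<xi>))\<^sup>2
      = (LINT \<xi>|lborel. (cmod (fourier a \<xi>))\<^sup>2 + (cmod (g \<xi>))\<^sup>2 - 2 * Re (fourier a \<xi> * cnj (g \<xi>)))"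
    unfolding l2norm_squared
    by (intro Bochner_Integration.integral_cong refl)
      (simp add: cmod_power2 power2_diff algebra_simps)
  also have "\<dots> = (l2norm (fourier a))\<^sup>2 + (l2norm g)\<^sup>2 - 2 * Re (LINT \<xi>|lborel. fourier a \<xi> * cnj (g \<xi>))"
  proof -
    have C: "integrable lborel (\<lambda>\<xi>. 2 * Re (fourier a \<xi> * cnj (g \<xi>)))"
      by (rule integrable_mult_right[OF integrable_Re[OF i]])
    note A = L2_integrable[OF Fa] and B = L2_integrable[OF g]
    show ?thesis
      by (simp only: Bochner_Integration.integral_diff[OF Bochner_Integration.integrable_add[OF A B] C]
        Bochner_Integration.integral_add[OF A B] integral_mult_right_zero integral_Re[OF i] l2norm_squared)
  qed
  also have "\<dots> = 0" unfolding cross plancherel[OF a] an by simp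
  finally have "l2norm (\<lambda>\<xi>. fourier a \<xi> - g \<xi>) = 0" by simp
  from l2norm_eq_0_AE[OF L2_diff[OF Fa g] this] show ?thesis by (simp add: a_def[abs_def])
qed

lemma inv_fourier_props:
  fixes g :: "real^'n \<Rightarrow> complex"
  assumes g: "L2 g"
  shows "L2 (inv_fourier g)" "AE \<xi> in lborel. fourier (inv_fourier g) \<xi> = g \<xi>"
proof -
  have "\<exists>f. L2 f \<and> (AE \<xi> in lborel. fourier f \<xi> = g \<xi>)"
    using fourier_inversion[OF g] L2_reflect(1)[OF fourier_L2[OF g]] by blast
  from someI_ex[OF this] show "L2 (inv_fourier g)" "AE \<xi> in lborel. fourier (inv_fourier g) \<xi> = g \<xi>"
    unfolding inv_fourier_def by blast+
qed

section \<open>Time derivatives and the Fourier transform\<close>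

lemma l2norm_diff_quotient_fourier:
  fixes f g w f' g' w' :: "real^'n \<Rightarrow> complex"
  assumes L: "L2 f" "L2 g" "L2 w"
    and m: "f' \<in> borel_measurable lborel" "g' \<in> borel_measurable lborel" "w' \<in> borel_measurable lborel"
    and ae: "AE \<xi> in lborel. fourier f \<xi> = f' \<xi>" "AE \<xi> in lborel. fourier g \<xi> = g' \<xi>" "AE \<xi> in lborel. fourier w \<xi> = w' \<xi>"
  shows "l2norm (\<lambda>\<xi>. (f' \<xi> - g' \<xi>) /\<^sub>R c - w' \<xi>) = l2norm (\<lambda>x. (f x - g x) /\<^sub>R c - w x)"
proof -
  have e: "(z :: complex) /\<^sub>R c = of_real (inverse c) * z" for z by (simp add: scaleR_conv_of_real)
  have Lq: "L2 (\<lambda>x. of_real (inverse c) * (f x - g x))" by (intro L2_cmult L2_diff L)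
  have "l2norm (\<lambda>x. (f x - g x) /\<^sub>R c - w x) = l2norm (fourier (\<lambda>x. of_real (inverse c) * (f x - g x) - w x))"
    unfolding e by (rule plancherel[symmetric, OF L2_diff[OF Lq L(3)]])
  also have "\<dots> = l2norm (\<lambda>\<xi>. (f' \<xi> - g' \<xi>) /\<^sub>R c - w' \<xi>)"
    unfolding e
  proof (rule l2norm_cong_AE)
    show "AE \<xi> in lborel. norm (fourier (\<lambda>x. of_real (inverse c) * (f x - g x) - w x) \<xi>)
        = norm (of_real (inverse c) * (f' \<xi> - g' \<xi>) - w' \<xi>)"
      using fourier_diff[OF Lq L(3)] fourier_cmult[OF L2_diff[OF L(1,2)], of "of_real (inverse c)"]
        fourier_diff[OF L(1,2)] ae
      by eventually_elim simp
  qed (use m fourier_measurable[OF L2_diff[OF Lq L(3)]] in auto)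
  finally show ?thesis ..
qed

text \<open>An isometry respects limits of difference quotients. The lemma speaks of arbitrary
  representatives \<open>V\<close> and \<open>w'\<close> of the transforms, since these are
  determined only AE, and it asks for the relation only near \<open>t\<close>.\<close>

lemma has_L2_deriv_fourier_iff:
  fixes U V :: "real \<Rightarrow> real^'n \<Rightarrow> complex"
  assumes ev: "\<forall>\<^sub>F s in at t within {0..}. L2 (U s) \<and> L2 (V s) \<and> (AE \<xi> in lborel. fourier (U s) \<xi> = V s \<xi>)"
    and t: "L2 (U t)" "L2 (V t)" "AE \<xi> in lborel. fourier (U t) \<xi> = V t \<xi>"
    and w: "L2 w" "L2 w'" "AE \<xi> in lborel. fourier w \<xi> = w' \<xi>"
  shows "has_L2_deriv U w t \<longleftrightarrow> has_L2_deriv V w' t"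
proof -
  have "\<forall>\<^sub>F s in at t within {0..}. L2 (\<lambda>x. (U s x - U t x) /\<^sub>R (s - t)) \<and> L2 (\<lambda>x. (V s x - V t x) /\<^sub>R (s - t))
      \<and> l2norm (\<lambda>x. (V s x - V t x) /\<^sub>R (s - t) - w' x) = l2norm (\<lambda>x. (U s x - U t x) /\<^sub>R (s - t) - w x)"
    using ev
  proof eventually_elim
    case (elim s)
    then show ?case using t w
      by (auto intro!: L2_scaleR L2_diff l2norm_diff_quotient_fourier L2_measurable)
  qed
  note ev' = this
  have "((\<lambda>s. l2norm (\<lambda>x. (V s x - V t x) /\<^sub>R (s - t) - w' x)) \<longlongrightarrow> 0) (at t within {0..})
    \<longleftrightarrow> ((\<lambda>s. l2norm (\<lambda>x. (U s x - U t x) /\<^sub>R (s - t) - w x)) \<longlongrightarrow> 0) (at t within {0..})"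
    by (rule filterlim_cong[OF refl refl]) (use ev' in \<open>eventually_elim, auto\<close>)
  moreover have "\<forall>\<^sub>F s in at t within {0..}. L2 (\<lambda>x. (U s x - U t x) /\<^sub>R (s - t))"
    "\<forall>\<^sub>F s in at t within {0..}. L2 (\<lambda>x. (V s x - V t x) /\<^sub>R (s - t))"
    using ev' by (eventually_elim, auto)+
  ultimately show ?thesis using w by (simp add: has_L2_deriv_def L2_tendsto_def)
qed

lemma at_within_Ici_nontrivial: "t \<ge> (0::real) \<Longrightarrow> at t within {0..} \<noteq> bot"
proof
  assume "t \<ge> 0" "at t within {0..} = bot"
  moreover from \<open>t \<ge> 0\<close> have "{t<..} \<subseteq> {0..}" by auto
  ultimately have "at_right t \<le> bot" using at_le[of "{t<..}" "{0..}" t] by simp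
  then show False using trivial_limit_at_right_real[of t] by (simp add: bot_unique)
qed

lemma has_L2_deriv_unique:
  fixes v :: "real \<Rightarrow> real^'n \<Rightarrow> 'b::{banach,second_countable_topology}"
  assumes "has_L2_deriv v w t" "has_L2_deriv v w' t" "t \<ge> 0"
  shows "AE x in lborel. w x = w' x"
proof -
  from at_within_Ici_nontrivial[OF assms(3)] show ?thesis using L2_tendsto_unique assms unfolding has_L2_deriv_def by blast
qed

lemma has_L2_deriv_time_deriv:
  assumes "has_L2_deriv v w t" shows "has_L2_deriv v (time_deriv v t) t"
  unfolding time_deriv_def by (rule someI[of _ w]) fact

section \<open>Duality for the damped oscillator\<close>

lemma real_mvt_bound:
  fixes f f' :: "real \<Rightarrow> real"
  assumes "\<And>x. x \<in> {a..b} \<Longrightarrow> (f has_real_derivative f' x) (at x)" "\<And>x. x \<in> {a..b} \<Longrightarrow> \<bar>f' x\<bar> \<le> M"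
    and "x \<in> {a..b}" "y \<in> {a..b}"
  shows "\<bar>f y - f x\<bar> \<le> M * \<bar>y - x\<bar>"
proof -
  have "norm (f y - f x) \<le> M * norm (y - x)"
    by (rule field_differentiable_bound[of "{a..b}" f f' M])
      (use assms in \<open>auto intro: has_field_derivative_at_within\<close>)
  then show ?thesis by simp
qed

lemma real_mvt_quotient_bound:
  fixes f f' :: "real \<Rightarrow> real"
  assumes "\<And>x. x \<in> {a..b} \<Longrightarrow> (f has_real_derivative f' x) (at x)" "\<And>x. x \<in> {a..b} \<Longrightarrow> \<bar>f' x\<bar> \<le> M"
    and "x \<in> {a..b}" "y \<in> {a..b}" "M \<ge> 0"
  shows "\<bar>(f y - f x) / (y - x)\<bar> \<le> M"
  using real_mvt_bound[OF assms(1-4)] assms(5) by (cases "y = x") (auto simp: abs_divide divide_simps)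

text \<open>Both components of the backward adjoint solution are multipliers of this kind.
  Boundedness is assumed on a ball of frequencies and a time interval only; the test functions
  \<open>\<phi>\<close> below vanish outside the ball.\<close>

locale time_multiplier =
  fixes N N' :: "real \<Rightarrow> real^'n \<Rightarrow> real" and R T M :: real
  assumes N_meas [measurable]: "\<And>s. N s \<in> borel_measurable lborel" "\<And>s. N' s \<in> borel_measurable lborel"
    and deriv: "\<And>\<xi> s. ((\<lambda>s. N s \<xi>) has_real_derivative N' s \<xi>) (at s)"
    and bounds: "\<And>s \<xi>. s \<in> {0..T} \<Longrightarrow> norm \<xi> \<le> R \<Longrightarrow> \<bar>N s \<xi>\<bar> \<le> M \<and> \<bar>N' s \<xi>\<bar> \<le> M"
begin

text \<open>The weight \<open>\<omega>\<close> is carried along because a function may be controlled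
  only after division by it; on the support of \<open>\<phi>\<close> it is bounded, so the test
  function can take it over.\<close>

lemma multiplied_tendsto:
  fixes \<phi> :: "real^'n \<Rightarrow> complex" and \<omega> :: "real^'n \<Rightarrow> real"
  assumes \<phi>: "L2 \<phi>" "\<And>\<xi>. norm \<xi> > R \<Longrightarrow> \<phi> \<xi> = 0"
    and [measurable]: "\<omega> \<in> borel_measurable lborel" and \<omega>: "\<And>\<xi>. norm \<xi> \<le> R \<Longrightarrow> \<bar>\<omega> \<xi>\<bar> \<le> W"
    and s: "s \<in> {0..T}" "at s within {0..T} \<noteq> bot"
  shows "L2_tendsto (\<lambda>r \<xi>. \<phi> \<xi> * of_real (\<omega> \<xi> * N r \<xi>)) (\<lambda>\<xi>. \<phi> \<xi> * of_real (\<omega> \<xi> * N s \<xi>)) (at s within {0..T})"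
proof (rule L2_dominated_convergence_at[OF L2_cmult[OF \<phi>(1), of "of_real (W * M)"]])
  note [measurable] = L2_measurable[OF \<phi>(1)]
  show "(\<lambda>\<xi>. \<phi> \<xi> * of_real (\<omega> \<xi> * N s \<xi>)) \<in> borel_measurable lborel" by measurable
  show "\<forall>\<^sub>F r in at s within {0..T}. (\<lambda>\<xi>. \<phi> \<xi> * of_real (\<omega> \<xi> * N r \<xi>)) \<in> borel_measurable lborel \<and>
    (AE \<xi> in lborel. norm (\<phi> \<xi> * of_real (\<omega> \<xi> * N r \<xi>)) \<le> norm (of_real (W * M) * \<phi> \<xi>))"
    unfolding eventually_at_filter
  proof (intro always_eventually allI impI conjI AE_I2)
    show "(\<lambda>\<xi>. \<phi> \<xi> * of_real (\<omega> \<xi> * N r \<xi>)) \<in> borel_measurable lborel" for r by measurable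
    fix r \<xi> assume r: "r \<in> {0..T}"
    show "norm (\<phi> \<xi> * of_real (\<omega> \<xi> * N r \<xi>)) \<le> norm (of_real (W * M) * \<phi> \<xi>)"
    proof (cases "norm \<xi> \<le> R")
      case True
      have "\<bar>\<omega> \<xi> * N r \<xi>\<bar> \<le> W * M"
        unfolding abs_mult using bounds[OF r True] \<omega>[OF True] by (intro mult_mono) auto
      also have "\<dots> \<le> \<bar>W * M\<bar>" by simp
      finally show ?thesis
        unfolding norm_mult norm_of_real mult.commute[of "cmod (\<phi> \<xi>)"] by (rule mult_right_mono) simp
    qed (use \<phi>(2) in auto)
  qed
  have "((\<lambda>r. N r \<xi>) \<longlongrightarrow> N s \<xi>) (at s within {0..T})" for \<xi>
    using DERIV_isCont[OF deriv[of \<xi> s]] by (auto simp: isCont_def intro: tendsto_within_subset)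
  then show "AE \<xi> in lborel. ((\<lambda>r. \<phi> \<xi> * of_real (\<omega> \<xi> * N r \<xi>)) \<longlongrightarrow> \<phi> \<xi> * of_real (\<omega> \<xi> * N s \<xi>)) (at s within {0..T})"
    by (intro AE_I2 tendsto_intros)
qed (rule s)

lemma multiplied_continuous:
  fixes \<phi> :: "real^'n \<Rightarrow> complex"
  assumes \<phi>: "L2 \<phi>" "\<And>\<xi>. norm \<xi> > R \<Longrightarrow> \<phi> \<xi> = 0"
    and v: "L2_tendsto v (v s) (at s within {0..T})"
    and s: "s \<in> {0..T}" "at s within {0..T} \<noteq> bot"
  shows "((\<lambda>r. LINT \<xi>|lborel. \<phi> \<xi> * of_real (N r \<xi>) * v r \<xi>) \<longlongrightarrow> (LINT \<xi>|lborel. \<phi> \<xi> * of_real (N s \<xi>) * v s \<xi>))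
    (at s within {0..T})"
  using L2_tendsto_integral_mult[OF multiplied_tendsto[where \<omega>="\<lambda>_. 1" and W=1 and s=s, OF \<phi>] v] s by simp

text \<open>The product rule for the pairing when \<open>v\<close> is differentiable only in the
  weighted norm. The derivative \<open>w\<close> itself need not be square integrable, but its
  product with \<open>\<phi>\<close> is integrable, since the weight is cancelled on the
  support.\<close>

lemma multiplied_quotient_tendsto:
  fixes \<phi> :: "real^'n \<Rightarrow> complex" and \<omega> :: "real^'n \<Rightarrow> real" and v :: "real \<Rightarrow> real^'n \<Rightarrow> complex"
  assumes \<phi>: "L2 \<phi>" "\<And>\<xi>. norm \<xi> > R \<Longrightarrow> \<phi> \<xi> = 0"
    and [measurable]: "\<omega> \<in> borel_measurable lborel" and \<omega>: "\<And>\<xi>. norm \<xi> \<le> R \<Longrightarrow> \<bar>\<omega> \<xi>\<bar> \<le> W" "\<And>\<xi>. \<omega> \<xi> > 0"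
    and s: "s \<in> {0..T}" "at s within {0..T} \<noteq> bot"
    and v: "\<And>r. r \<in> {0..T} \<Longrightarrow> L2 (v r)"
    and dv: "has_L2_deriv (\<lambda>r \<xi>. v r \<xi> / of_real (\<omega> \<xi>)) (\<lambda>\<xi>. w \<xi> / of_real (\<omega> \<xi>)) s"
  shows "((\<lambda>r. ((LINT \<xi>|lborel. \<phi> \<xi> * of_real (N r \<xi>) * v r \<xi>) - (LINT \<xi>|lborel. \<phi> \<xi> * of_real (N s \<xi>) * v s \<xi>)) / of_real (r - s))
      \<longlongrightarrow> (LINT \<xi>|lborel. \<phi> \<xi> * of_real (N' s \<xi>) * v s \<xi>) + (LINT \<xi>|lborel. \<phi> \<xi> * of_real (N s \<xi>) * w \<xi>)) (at s within {0..T})"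
    and "integrable lborel (\<lambda>\<xi>. \<phi> \<xi> * of_real (N' s \<xi>) * v s \<xi>)"
    and "integrable lborel (\<lambda>\<xi>. \<phi> \<xi> * of_real (N s \<xi>) * w \<xi>)"
proof -
  note [measurable] = L2_measurable[OF \<phi>(1)]
  define Q where "Q r \<xi> = (N r \<xi> - N s \<xi>) / (r - s)" for r \<xi>
  have [measurable]: "Q r \<in> borel_measurable lborel" for r unfolding Q_def by measurable
  have \<omega>0: "\<omega> \<xi> \<noteq> 0" for \<xi> using \<omega>(2)[of \<xi>] by simp
  have dom: "L2 (\<lambda>\<xi>. \<phi> \<xi> * of_real (n \<xi>))" if "n \<in> borel_measurable lborel" "\<And>\<xi>. norm \<xi> \<le> R \<Longrightarrow> \<bar>n \<xi>\<bar> \<le> K" for n :: "real^'n \<Rightarrow> real" and K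
  proof (rule L2_scaled(1)[OF \<phi>(1), of _ "\<bar>K\<bar>"])
    show "(\<lambda>\<xi>. \<phi> \<xi> * of_real (n \<xi>)) \<in> borel_measurable lborel" using that(1) by measurable
    show "AE \<xi> in lborel. norm (\<phi> \<xi> * complex_of_real (n \<xi>)) \<le> \<bar>K\<bar> * norm (\<phi> \<xi>)"
    proof (intro AE_I2)
      fix \<xi> show "norm (\<phi> \<xi> * complex_of_real (n \<xi>)) \<le> \<bar>K\<bar> * norm (\<phi> \<xi>)"
        using that(2)[of \<xi>] \<phi>(2)[of \<xi>] by (cases "norm \<xi> \<le> R") (auto simp: norm_mult mult.commute intro!: mult_right_mono)
    qed
  qed
  have LN: "L2 (\<lambda>\<xi>. \<phi> \<xi> * of_real (N r \<xi>))" "L2 (\<lambda>\<xi>. \<phi> \<xi> * of_real (N' r \<xi>))" if "r \<in> {0..T}" for r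
    using bounds[OF that] by (auto intro!: dom[of _ M])
  have within: "at s within {0..T} \<le> at s within {0..}" by (rule at_le) auto
  have dvT: "L2_tendsto (\<lambda>r \<xi>. (v r \<xi> / of_real (\<omega> \<xi>) - v s \<xi> / of_real (\<omega> \<xi>)) /\<^sub>R (r - s)) (\<lambda>\<xi>. w \<xi> / of_real (\<omega> \<xi>)) (at s within {0..T})"
    using dv within unfolding has_L2_deriv_def L2_tendsto_def
    by (auto intro: tendsto_mono filter_leD)
  have M0: "M \<ge> 0" if "norm \<xi> \<le> R" for \<xi> :: "real^'n" using bounds[OF s(1) that] by linarith
  have QT: "L2_tendsto (\<lambda>r \<xi>. \<phi> \<xi> * of_real (Q r \<xi>)) (\<lambda>\<xi>. \<phi> \<xi> * of_real (N' s \<xi>)) (at s within {0..T})"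
  proof (rule L2_dominated_convergence_at[OF L2_cmult[OF \<phi>(1), of "of_real M"]])
    show "\<forall>\<^sub>F r in at s within {0..T}. (\<lambda>\<xi>. \<phi> \<xi> * of_real (Q r \<xi>)) \<in> borel_measurable lborel \<and>
      (AE \<xi> in lborel. norm (\<phi> \<xi> * of_real (Q r \<xi>)) \<le> norm (of_real M * \<phi> \<xi>))"
      unfolding eventually_at_filter
    proof (intro always_eventually allI impI conjI AE_I2)
      show "(\<lambda>\<xi>. \<phi> \<xi> * of_real (Q r \<xi>)) \<in> borel_measurable lborel" for r by measurable
      fix r \<xi> assume r: "r \<in> {0..T}"
      show "norm (\<phi> \<xi> * of_real (Q r \<xi>)) \<le> norm (of_real M * \<phi> \<xi>)"
      proof (cases "norm \<xi> \<le> R")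
        case True
        have "\<bar>Q r \<xi>\<bar> \<le> M" unfolding Q_def
          by (rule real_mvt_quotient_bound[where f'="\<lambda>s. N' s \<xi>" and a=0 and b=T])
            (use deriv bounds True s r M0 in auto)
        also have "M \<le> \<bar>M\<bar>" by simp
        finally show ?thesis
          unfolding norm_mult norm_of_real mult.commute[of "cmod (\<phi> \<xi>)"] by (rule mult_right_mono) simp
      qed (use \<phi>(2) in auto)
    qed
    have "((\<lambda>r. Q r \<xi>) \<longlongrightarrow> N' s \<xi>) (at s within {0..T})" for \<xi>
      using deriv[of \<xi> s] unfolding has_field_derivative_iff Q_def by (auto intro: tendsto_within_subset)
    then show "AE \<xi> in lborel. ((\<lambda>r. \<phi> \<xi> * of_real (Q r \<xi>)) \<longlongrightarrow> \<phi> \<xi> * of_real (N' s \<xi>)) (at s within {0..T})"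
      by (intro AE_I2 tendsto_intros)
  qed (use s in auto)
  have cv: "L2_tendsto (\<lambda>r. v s) (v s) (at s within {0..T})"
    using v[OF s(1)] by (simp add: L2_tendsto_def)
  have eqw: "\<phi> \<xi> * of_real (\<omega> \<xi> * N r \<xi>) * (w' \<xi> / of_real (\<omega> \<xi>)) = \<phi> \<xi> * of_real (N r \<xi>) * w' \<xi>" for r \<xi> and w' :: "_ \<Rightarrow> complex"
    using \<omega>0[of \<xi>] by simp
  note MT = multiplied_tendsto[where \<omega>=\<omega> and W=W, OF \<phi> assms(3) \<omega>(1) s]
  have lim1: "((\<lambda>r. LINT \<xi>|lborel. \<phi> \<xi> * of_real (\<omega> \<xi> * N r \<xi>) * ((v r \<xi> / of_real (\<omega> \<xi>) - v s \<xi> / of_real (\<omega> \<xi>)) /\<^sub>R (r - s)))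
    \<longlongrightarrow> (LINT \<xi>|lborel. \<phi> \<xi> * of_real (N s \<xi>) * w \<xi>)) (at s within {0..T})"
    using L2_tendsto_integral_mult[OF MT dvT] unfolding eqw .
  have lim2: "((\<lambda>r. LINT \<xi>|lborel. \<phi> \<xi> * of_real (Q r \<xi>) * v s \<xi>) \<longlongrightarrow> (LINT \<xi>|lborel. \<phi> \<xi> * of_real (N' s \<xi>) * v s \<xi>)) (at s within {0..T})"
    by (rule L2_tendsto_integral_mult[OF QT cv])
  show "integrable lborel (\<lambda>\<xi>. \<phi> \<xi> * of_real (N' s \<xi>) * v s \<xi>)"
    by (rule L2_mult_integrable[OF LN(2)[OF s(1)] v[OF s(1)]])
  show "integrable lborel (\<lambda>\<xi>. \<phi> \<xi> * of_real (N s \<xi>) * w \<xi>)"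
    using L2_mult_integrable[OF L2_tendstoD(1)[OF MT] L2_tendstoD(1)[OF dvT]] unfolding eqw .
  \<comment> \<open>N(r) v(r) - N(s) v(s) = (N(r) - N(s)) v(s) + N(r) (v(r) - v(s)): in the first
    term the quotient of the multiplier is bounded by the mean value theorem, in the second the
    weight is inserted and removed.\<close>
  have key: "((LINT \<xi>|lborel. \<phi> \<xi> * of_real (N r \<xi>) * v r \<xi>) - (LINT \<xi>|lborel. \<phi> \<xi> * of_real (N s \<xi>) * v s \<xi>)) / of_real (r - s)
    = (LINT \<xi>|lborel. \<phi> \<xi> * of_real (Q r \<xi>) * v s \<xi>)
     + (LINT \<xi>|lborel. \<phi> \<xi> * of_real (\<omega> \<xi> * N r \<xi>) * ((v r \<xi> / of_real (\<omega> \<xi>) - v s \<xi> / of_real (\<omega> \<xi>)) /\<^sub>R (r - s)))"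
    if r: "r \<in> {0..T}" "r \<noteq> s" for r
  proof -
    define c where "c = complex_of_real (inverse (r - s))"
    have i1: "integrable lborel (\<lambda>\<xi>. \<phi> \<xi> * of_real (N r \<xi>) * v r \<xi>)" by (rule L2_mult_integrable[OF LN(1)[OF r(1)] v[OF r(1)]])
    have i2: "integrable lborel (\<lambda>\<xi>. \<phi> \<xi> * of_real (N s \<xi>) * v s \<xi>)" by (rule L2_mult_integrable[OF LN(1)[OF s(1)] v[OF s(1)]])
    have i3: "integrable lborel (\<lambda>\<xi>. \<phi> \<xi> * of_real (N r \<xi>) * v s \<xi>)" by (rule L2_mult_integrable[OF LN(1)[OF r(1)] v[OF s(1)]])
    have e1: "\<phi> \<xi> * of_real (Q r \<xi>) * v s \<xi> = c * (\<phi> \<xi> * of_real (N r \<xi>) * v s \<xi> - \<phi> \<xi> * of_real (N s \<xi>) * v s \<xi>)" for \<xi>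
      by (simp add: Q_def c_def divide_inverse algebra_simps)
    have e2: "\<phi> \<xi> * of_real (\<omega> \<xi> * N r \<xi>) * ((v r \<xi> / of_real (\<omega> \<xi>) - v s \<xi> / of_real (\<omega> \<xi>)) /\<^sub>R (r - s))
      = c * (\<phi> \<xi> * of_real (N r \<xi>) * v r \<xi> - \<phi> \<xi> * of_real (N r \<xi>) * v s \<xi>)" for \<xi>
    proof -
      have "\<phi> \<xi> * of_real (\<omega> \<xi> * N r \<xi>) * ((v r \<xi> / of_real (\<omega> \<xi>) - v s \<xi> / of_real (\<omega> \<xi>)) /\<^sub>R (r - s))
        = c * (\<phi> \<xi> * of_real (\<omega> \<xi> * N r \<xi>) * ((v r \<xi> - v s \<xi>) / of_real (\<omega> \<xi>)))"
        by (simp add: c_def scaleR_conv_of_real diff_divide_distrib)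
      also have "\<dots> = c * (\<phi> \<xi> * of_real (N r \<xi>) * (v r \<xi> - v s \<xi>))"
        using \<omega>0[of \<xi>] by simp
      finally show ?thesis by (simp add: algebra_simps)
    qed
    show ?thesis unfolding e1 e2 integral_mult_right_zero
        Bochner_Integration.integral_diff[OF i3 i2] Bochner_Integration.integral_diff[OF i1 i3]
      by (simp add: c_def divide_inverse algebra_simps)
  qed
  have "((\<lambda>r. (LINT \<xi>|lborel. \<phi> \<xi> * of_real (Q r \<xi>) * v s \<xi>)
     + (LINT \<xi>|lborel. \<phi> \<xi> * of_real (\<omega> \<xi> * N r \<xi>) * ((v r \<xi> / of_real (\<omega> \<xi>) - v s \<xi> / of_real (\<omega> \<xi>)) /\<^sub>R (r - s))))
     \<longlongrightarrow> (LINT \<xi>|lborel. \<phi> \<xi> * of_real (N' s \<xi>) * v s \<xi>) + (LINT \<xi>|lborel. \<phi> \<xi> * of_real (N s \<xi>) * w \<xi>)) (at s within {0..T})"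
    by (rule tendsto_add[OF lim2 lim1])
  then show "((\<lambda>r. ((LINT \<xi>|lborel. \<phi> \<xi> * of_real (N r \<xi>) * v r \<xi>) - (LINT \<xi>|lborel. \<phi> \<xi> * of_real (N s \<xi>) * v s \<xi>)) / of_real (r - s))
      \<longlongrightarrow> (LINT \<xi>|lborel. \<phi> \<xi> * of_real (N' s \<xi>) * v s \<xi>) + (LINT \<xi>|lborel. \<phi> \<xi> * of_real (N s \<xi>) * w \<xi>)) (at s within {0..T})"
    by (rule Lim_transform_eventually)
      (unfold eventually_at_filter, intro always_eventually allI impI key[symmetric])
qed

end

text \<open>The equation is posed for t > 0 only, so nothing is known about the derivative at 0;
  continuity there allows 0 to be an exceptional point.\<close>

lemma constant_of_quotient_tendsto_zero:
  fixes a :: "real \<Rightarrow> complex"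
  assumes T: "T > 0" and cont: "\<And>s. s \<in> {0..T} \<Longrightarrow> (a \<longlongrightarrow> a s) (at s within {0..T})"
    and der: "\<And>s. 0 < s \<Longrightarrow> s \<le> T \<Longrightarrow> ((\<lambda>r. (a r - a s) / of_real (r - s)) \<longlongrightarrow> 0) (at s within {0..T})"
  shows "a T = a 0"
proof (rule has_derivative_zero_unique_strong_interval[where k="{0}" and a=0 and b=T])
  show "continuous_on {0..T} a" using cont by (simp add: continuous_on_def)
  fix s assume s: "s \<in> {0..T} - {0}"
  have "((\<lambda>r. norm ((a r - a s) / of_real (r - s))) \<longlongrightarrow> 0) (at s within {0..T})"
    using der[of s] s by (intro tendsto_norm_zero) auto
  then show "(a has_derivative (\<lambda>h. 0)) (at s within {0..T})"
    unfolding has_derivative_iff_norm by (simp add: norm_divide flip: of_real_diff)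
qed (use T in auto)

text \<open>Pairing the solution with a backward solution of the adjoint system makes the pairing
  constant in time; the test function is then the conjugate of the defect itself.\<close>

lemma second_order_duality:
  fixes V0 V1 :: "real \<Rightarrow> real^'n \<Rightarrow> complex" and A B :: "real \<Rightarrow> real^'n \<Rightarrow> real" and b :: "real^'n \<Rightarrow> real"
  assumes T: "T > 0"
    and L0: "\<And>t. t \<ge> 0 \<Longrightarrow> L2 (V0 t)" and L1: "\<And>t. t \<ge> 0 \<Longrightarrow> L2 (V1 t)"
    and c0: "\<And>t. t \<ge> 0 \<Longrightarrow> L2_tendsto V0 (V0 t) (at t within {0..})"
    and c1: "\<And>t. t \<ge> 0 \<Longrightarrow> L2_tendsto V1 (V1 t) (at t within {0..})"
    and d0: "\<And>t. t > 0 \<Longrightarrow> has_L2_deriv V0 (V1 t) t"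
    and d1: "\<And>t. t > 0 \<Longrightarrow> \<exists>w. has_L2_deriv (\<lambda>s \<xi>. V1 s \<xi> / of_real (1 + (norm \<xi>)\<^sup>2)) (\<lambda>\<xi>. w \<xi> / of_real (1 + (norm \<xi>)\<^sup>2)) t
       \<and> (AE \<xi> in lborel. w \<xi> + of_real ((norm \<xi>)\<^sup>2) * V0 t \<xi> + of_real (b \<xi>) * V1 t \<xi> = 0)"
    and mb [measurable]: "b \<in> borel_measurable lborel"
    and mA [measurable]: "\<And>s. A s \<in> borel_measurable lborel"
    and mB [measurable]: "\<And>s. B s \<in> borel_measurable lborel"
    and dA: "\<And>\<xi> s. ((\<lambda>s. A s \<xi>) has_real_derivative - (norm \<xi>)\<^sup>2 * B s \<xi>) (at s)"
    and dB: "\<And>\<xi> s. ((\<lambda>s. B s \<xi>) has_real_derivative A s \<xi> - b \<xi> * B s \<xi>) (at s)"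
    and bd: "\<And>R. \<exists>M. \<forall>s\<in>{0..T}. \<forall>\<xi>. norm \<xi> \<le> R \<longrightarrow> \<bar>A s \<xi>\<bar> \<le> M \<and> \<bar>B s \<xi>\<bar> \<le> M \<and> \<bar>b \<xi>\<bar> \<le> M"
  shows "AE \<xi> in lborel. of_real (A T \<xi>) * V0 0 \<xi> + of_real (B T \<xi>) * V1 0 \<xi>
    = of_real (A 0 \<xi>) * V0 T \<xi> + of_real (B 0 \<xi>) * V1 T \<xi>"
proof -
  define D where "D \<xi> = of_real (A T \<xi>) * V0 0 \<xi> + of_real (B T \<xi>) * V1 0 \<xi>
    - (of_real (A 0 \<xi>) * V0 T \<xi> + of_real (B 0 \<xi>) * V1 T \<xi>)" for \<xi>
  \<comment> \<open>\<open>A\<close>, \<open>B\<close> and \<open>b\<close> are bounded on balls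
    only, so the defect \<open>D\<close> is annihilated on each ball of integer radius.\<close>
  have "AE \<xi> in lborel. norm \<xi> \<le> real k \<longrightarrow> D \<xi> = 0" for k
  proof -
    define R where "R = real k"
    obtain M where M: "\<And>s \<xi>. s \<in> {0..T} \<Longrightarrow> norm \<xi> \<le> R \<Longrightarrow> \<bar>A s \<xi>\<bar> \<le> M \<and> \<bar>B s \<xi>\<bar> \<le> M \<and> \<bar>b \<xi>\<bar> \<le> M"
      using bd[of R] by blast
    note [measurable] = L2_measurable[OF L0[OF order_refl]] L2_measurable[OF L1[OF order_refl]]
      L2_measurable[OF L0[OF less_imp_le[OF T]]] L2_measurable[OF L1[OF less_imp_le[OF T]]]
    define \<phi> where "\<phi> \<xi> = (if norm \<xi> \<le> R then cnj (D \<xi>) else 0)" for \<xi>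
    have \<phi>2: "L2 \<phi>"
    proof -
      have 1: "L2 (\<lambda>\<xi>. if norm \<xi> \<le> R then of_real (g \<xi>) * f \<xi> else 0)" if "g \<in> borel_measurable lborel" "L2 f"
        "\<And>\<xi>. norm \<xi> \<le> R \<Longrightarrow> \<bar>g \<xi>\<bar> \<le> M" for g :: "real^'n \<Rightarrow> real" and f :: "real^'n \<Rightarrow> complex"
      proof (rule L2_scaled(1)[OF that(2), of _ "\<bar>M\<bar>"])
        note [measurable] = that(1) L2_measurable[OF that(2)]
        show "(\<lambda>\<xi>. if norm \<xi> \<le> R then of_real (g \<xi>) * f \<xi> else 0) \<in> borel_measurable lborel" by measurable
        show "AE \<xi> in lborel. norm (if norm \<xi> \<le> R then of_real (g \<xi>) * f \<xi> else 0) \<le> \<bar>M\<bar> * norm (f \<xi>)"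
          by (intro AE_I2) (auto simp: norm_mult intro!: mult_right_mono order_trans[OF that(3)])
      qed
      have "L2 (\<lambda>\<xi>. cnj (((if norm \<xi> \<le> R then of_real (A T \<xi>) * V0 0 \<xi> else 0) + (if norm \<xi> \<le> R then of_real (B T \<xi>) * V1 0 \<xi> else 0))
        - ((if norm \<xi> \<le> R then of_real (A 0 \<xi>) * V0 T \<xi> else 0) + (if norm \<xi> \<le> R then of_real (B 0 \<xi>) * V1 T \<xi> else 0))))"
        using M[of T] M[of 0] T
        by (intro L2_cnj L2_diff L2_add 1 L0 L1 mA mB) auto
      moreover have "(\<lambda>\<xi>. cnj (((if norm \<xi> \<le> R then of_real (A T \<xi>) * V0 0 \<xi> else 0) + (if norm \<xi> \<le> R then of_real (B T \<xi>) * V1 0 \<xi> else 0))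
        - ((if norm \<xi> \<le> R then of_real (A 0 \<xi>) * V0 T \<xi> else 0) + (if norm \<xi> \<le> R then of_real (B 0 \<xi>) * V1 T \<xi> else 0)))) = \<phi>"
        by (auto simp: \<phi>_def D_def)
      ultimately show ?thesis by simp
    qed
    have \<phi>0: "norm \<xi> > R \<Longrightarrow> \<phi> \<xi> = 0" for \<xi> by (auto simp: \<phi>_def)
    \<comment> \<open>Bounds the multipliers and also their time derivatives, which carry the
      factors \<open>(norm \<xi>)\<^sup>2\<close> and \<open>b \<xi>\<close>.\<close>
    define M' where "M' = max M (max (R\<^sup>2 * M) (M + M * M))"
    have rev: "((\<lambda>s. T - s) has_real_derivative -1) (at s)" for s
      by (auto intro!: derivative_eq_intros)
    interpret MA: time_multiplier "\<lambda>s. A (T - s)" "\<lambda>s \<xi>. (norm \<xi>)\<^sup>2 * B (T - s) \<xi>" R T M'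
    proof
      show "((\<lambda>s. A (T - s) \<xi>) has_real_derivative (norm \<xi>)\<^sup>2 * B (T - s) \<xi>) (at s)" for \<xi> s
        using DERIV_chain2[where f="\<lambda>s. A s \<xi>" and g="\<lambda>s. T - s", OF dA rev, of s] by simp
      fix s \<xi> assume s: "s \<in> {0..T}" and \<xi>: "norm (\<xi>::real^'n) \<le> R"
      have m: "\<bar>A (T - s) \<xi>\<bar> \<le> M \<and> \<bar>B (T - s) \<xi>\<bar> \<le> M \<and> \<bar>b \<xi>\<bar> \<le> M" using s by (intro M \<xi>) auto
      have "\<bar>(norm \<xi>)\<^sup>2 * B (T - s) \<xi>\<bar> \<le> R\<^sup>2 * M"
        unfolding abs_mult using m \<xi> by (intro mult_mono) (auto intro!: power_mono)
      then show "\<bar>A (T - s) \<xi>\<bar> \<le> M' \<and> \<bar>(norm \<xi>)\<^sup>2 * B (T - s) \<xi>\<bar> \<le> M'" using m by (auto simp: M'_def)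
    qed measurable
    interpret MB: time_multiplier "\<lambda>s. B (T - s)" "\<lambda>s \<xi>. - (A (T - s) \<xi> - b \<xi> * B (T - s) \<xi>)" R T M'
    proof
      show "((\<lambda>s. B (T - s) \<xi>) has_real_derivative - (A (T - s) \<xi> - b \<xi> * B (T - s) \<xi>)) (at s)" for \<xi> s
        using DERIV_chain2[where f="\<lambda>s. B s \<xi>" and g="\<lambda>s. T - s", OF dB rev, of s] by simp
      fix s \<xi> assume s: "s \<in> {0..T}" and \<xi>: "norm (\<xi>::real^'n) \<le> R"
      have m: "\<bar>A (T - s) \<xi>\<bar> \<le> M \<and> \<bar>B (T - s) \<xi>\<bar> \<le> M \<and> \<bar>b \<xi>\<bar> \<le> M" using s by (intro M \<xi>) auto
      have "\<bar>b \<xi> * B (T - s) \<xi>\<bar> \<le> M * M" unfolding abs_mult using m by (intro mult_mono) auto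
      then have "\<bar>- (A (T - s) \<xi> - b \<xi> * B (T - s) \<xi>)\<bar> \<le> M + M * M" using m by linarith
      then show "\<bar>B (T - s) \<xi>\<bar> \<le> M' \<and> \<bar>- (A (T - s) \<xi> - b \<xi> * B (T - s) \<xi>)\<bar> \<le> M'" using m by (auto simp: M'_def)
    qed measurable
    \<comment> \<open>At s = 0 the multipliers are \<open>A T\<close>, \<open>B T\<close>, at s = T
      they are \<open>A 0\<close>, \<open>B 0\<close>; the two values of \<open>a\<close> are the
      two sides of the claim tested with \<open>\<phi>\<close>.\<close>
    define a where "a s = (LINT \<xi>|lborel. \<phi> \<xi> * of_real (A (T - s) \<xi>) * V0 s \<xi>) + (LINT \<xi>|lborel. \<phi> \<xi> * of_real (B (T - s) \<xi>) * V1 s \<xi>)" for s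
    have nb: "at s within {0..T} \<noteq> bot" if "s \<in> {0..T}" for s
      using that T by (simp add: trivial_limit_within islimpt_Icc)
    have within: "at s within {0..T} \<le> at s within {0..}" for s by (rule at_le) auto
    have mono: "L2_tendsto F g (at s within {0..T})" if "L2_tendsto F g (at s within {0..})" for F and g :: "real^'n \<Rightarrow> complex" and s
      using that within[of s] unfolding L2_tendsto_def by (auto intro: tendsto_mono filter_leD)
    have "a T = a 0"
    proof (rule constant_of_quotient_tendsto_zero[OF T])
      fix s assume s: "s \<in> {0..T}"
      then show "(a \<longlongrightarrow> a s) (at s within {0..T})"
        unfolding a_def
        by (intro tendsto_add MA.multiplied_continuous MB.multiplied_continuous \<phi>2 \<phi>0 mono c0 c1 nb) auto
    next
      fix s assume s: "0 < s" "s \<le> T"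
      then have sT: "s \<in> {0..T}" by auto
      obtain w where w: "has_L2_deriv (\<lambda>s \<xi>. V1 s \<xi> / of_real (1 + (norm \<xi>)\<^sup>2)) (\<lambda>\<xi>. w \<xi> / of_real (1 + (norm \<xi>)\<^sup>2)) s"
        and eq: "AE \<xi> in lborel. w \<xi> + of_real ((norm \<xi>)\<^sup>2) * V0 s \<xi> + of_real (b \<xi>) * V1 s \<xi> = 0"
        using d1[OF s(1)] by blast
      \<comment> \<open>\<open>V0\<close> is differentiable in L2, so its weight is 1;
        \<open>V1\<close> is differentiable only after division by
        \<open>1 + (norm \<xi>)\<^sup>2\<close>.\<close>
      have d0': "has_L2_deriv (\<lambda>r \<xi>. V0 r \<xi> / of_real 1) (\<lambda>\<xi>. V1 s \<xi> / of_real 1) s"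
        using d0[OF s(1)] by simp
      have one: "(\<lambda>_::real^'n. 1::real) \<in> borel_measurable lborel"
        "\<And>\<xi>::real^'n. norm \<xi> \<le> R \<Longrightarrow> \<bar>1::real\<bar> \<le> 1" "\<And>\<xi>::real^'n. (1::real) > 0" by auto
      have wt: "(\<lambda>\<xi>::real^'n. 1 + (norm \<xi>)\<^sup>2) \<in> borel_measurable lborel"
        "\<And>\<xi>::real^'n. norm \<xi> \<le> R \<Longrightarrow> \<bar>1 + (norm \<xi>)\<^sup>2\<bar> \<le> 1 + R\<^sup>2" "\<And>\<xi>::real^'n. 1 + (norm \<xi>)\<^sup>2 > 0"
        by (auto simp: add_pos_nonneg intro!: power_mono)
      have L0': "\<And>r. r \<in> {0..T} \<Longrightarrow> L2 (V0 r)" and L1': "\<And>r. r \<in> {0..T} \<Longrightarrow> L2 (V1 r)"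
        using L0 L1 by auto
      note QA = MA.multiplied_quotient_tendsto[OF \<phi>2 \<phi>0 one sT nb[OF sT] L0' d0']
      note QB = MB.multiplied_quotient_tendsto[OF \<phi>2 \<phi>0 wt sT nb[OF sT] L1' w]
      let ?I1 = "LINT \<xi>|lborel. \<phi> \<xi> * of_real ((norm \<xi>)\<^sup>2 * B (T - s) \<xi>) * V0 s \<xi>"
      let ?I2 = "LINT \<xi>|lborel. \<phi> \<xi> * of_real (A (T - s) \<xi>) * V1 s \<xi>"
      let ?I3 = "LINT \<xi>|lborel. \<phi> \<xi> * of_real (- (A (T - s) \<xi> - b \<xi> * B (T - s) \<xi>)) * V1 s \<xi>"
      let ?I4 = "LINT \<xi>|lborel. \<phi> \<xi> * of_real (B (T - s) \<xi>) * w \<xi>"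
      have i: "integrable lborel (\<lambda>\<xi>. \<phi> \<xi> * of_real ((norm \<xi>)\<^sup>2 * B (T - s) \<xi>) * V0 s \<xi>)"
        "integrable lborel (\<lambda>\<xi>. \<phi> \<xi> * of_real (A (T - s) \<xi>) * V1 s \<xi>)"
        "integrable lborel (\<lambda>\<xi>. \<phi> \<xi> * of_real (- (A (T - s) \<xi> - b \<xi> * B (T - s) \<xi>)) * V1 s \<xi>)"
        "integrable lborel (\<lambda>\<xi>. \<phi> \<xi> * of_real (B (T - s) \<xi>) * w \<xi>)"
        using QA(2,3) QB(2,3) by - assumption+
      have "?I1 + ?I2 + (?I3 + ?I4) = (LINT \<xi>|lborel. (\<phi> \<xi> * of_real ((norm \<xi>)\<^sup>2 * B (T - s) \<xi>) * V0 s \<xi> + \<phi> \<xi> * of_real (A (T - s) \<xi>) * V1 s \<xi>)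
         + (\<phi> \<xi> * of_real (- (A (T - s) \<xi> - b \<xi> * B (T - s) \<xi>)) * V1 s \<xi> + \<phi> \<xi> * of_real (B (T - s) \<xi>) * w \<xi>))"
        by (simp only: Bochner_Integration.integral_add i Bochner_Integration.integrable_add)
      also have "\<dots> = (LINT \<xi>|(lborel :: (real^'n) measure). 0)"
      proof (rule integral_cong_AE)
        show "AE \<xi> in lborel. (\<phi> \<xi> * of_real ((norm \<xi>)\<^sup>2 * B (T - s) \<xi>) * V0 s \<xi> + \<phi> \<xi> * of_real (A (T - s) \<xi>) * V1 s \<xi>)
         + (\<phi> \<xi> * of_real (- (A (T - s) \<xi> - b \<xi> * B (T - s) \<xi>)) * V1 s \<xi> + \<phi> \<xi> * of_real (B (T - s) \<xi>) * w \<xi>) = 0"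
          using eq
        proof eventually_elim
          case (elim \<xi>)
          \<comment> \<open>The terms with \<open>A\<close> and \<open>V1\<close> cancel; what is
            left is the equation multiplied by \<open>\<phi>\<close> and \<open>B\<close>.\<close>
          have "(\<phi> \<xi> * of_real ((norm \<xi>)\<^sup>2 * B (T - s) \<xi>) * V0 s \<xi> + \<phi> \<xi> * of_real (A (T - s) \<xi>) * V1 s \<xi>)
           + (\<phi> \<xi> * of_real (- (A (T - s) \<xi> - b \<xi> * B (T - s) \<xi>)) * V1 s \<xi> + \<phi> \<xi> * of_real (B (T - s) \<xi>) * w \<xi>)
           = \<phi> \<xi> * of_real (B (T - s) \<xi>) * (w \<xi> + of_real ((norm \<xi>)\<^sup>2) * V0 s \<xi> + of_real (b \<xi>) * V1 s \<xi>)"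
            by (simp add: algebra_simps)
          then show ?case using elim by simp
        qed
      qed (use i in \<open>auto intro!: borel_measurable_add borel_measurable_integrable\<close>)
      finally have "?I1 + ?I2 + (?I3 + ?I4) = 0" by simp
      moreover have "((\<lambda>r. (a r - a s) / of_real (r - s)) \<longlongrightarrow> (?I1 + ?I2) + (?I3 + ?I4)) (at s within {0..T})"
      proof (rule Lim_transform_eventually[OF tendsto_add[OF QA(1) QB(1)]])
        show "\<forall>\<^sub>F r in at s within {0..T}.
         ((LINT \<xi>|lborel. \<phi> \<xi> * of_real (A (T - r) \<xi>) * V0 r \<xi>) - (LINT \<xi>|lborel. \<phi> \<xi> * of_real (A (T - s) \<xi>) * V0 s \<xi>)) / of_real (r - s)
         + ((LINT \<xi>|lborel. \<phi> \<xi> * of_real (B (T - r) \<xi>) * V1 r \<xi>) - (LINT \<xi>|lborel. \<phi> \<xi> * of_real (B (T - s) \<xi>) * V1 s \<xi>)) / of_real (r - s)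
         = (a r - a s) / of_real (r - s)"
          by (intro always_eventually allI) (simp add: a_def add_divide_distrib diff_divide_distrib)
      qed
      ultimately show "((\<lambda>r. (a r - a s) / of_real (r - s)) \<longlongrightarrow> 0) (at s within {0..T})" by simp
    qed
    have LA: "L2 (\<lambda>\<xi>. \<phi> \<xi> * of_real (A r \<xi>))" "L2 (\<lambda>\<xi>. \<phi> \<xi> * of_real (B r \<xi>))" if "r \<in> {0..T}" for r
      using L2_tendstoD(1)[OF MA.multiplied_tendsto[where \<omega>="\<lambda>_. 1" and W=1 and s="T - r", OF \<phi>2 \<phi>0]]
        L2_tendstoD(1)[OF MB.multiplied_tendsto[where \<omega>="\<lambda>_. 1" and W=1 and s="T - r", OF \<phi>2 \<phi>0]] nb[of "T - r"] that by auto
    \<comment> \<open>With \<open>\<phi>\<close> the truncated conjugate of \<open>D\<close>, the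
      difference of the two pairings is the squared norm of \<open>\<phi>\<close>.\<close>
    have "0 = a 0 - a T" using \<open>a T = a 0\<close> by simp
    also have "\<dots> = (LINT \<xi>|lborel. (\<phi> \<xi> * of_real (A T \<xi>) * V0 0 \<xi> + \<phi> \<xi> * of_real (B T \<xi>) * V1 0 \<xi>)
       - (\<phi> \<xi> * of_real (A 0 \<xi>) * V0 T \<xi> + \<phi> \<xi> * of_real (B 0 \<xi>) * V1 T \<xi>))"
    proof -
      have j: "integrable lborel (\<lambda>\<xi>. \<phi> \<xi> * of_real (A T \<xi>) * V0 0 \<xi>)" "integrable lborel (\<lambda>\<xi>. \<phi> \<xi> * of_real (B T \<xi>) * V1 0 \<xi>)"
        "integrable lborel (\<lambda>\<xi>. \<phi> \<xi> * of_real (A 0 \<xi>) * V0 T \<xi>)" "integrable lborel (\<lambda>\<xi>. \<phi> \<xi> * of_real (B 0 \<xi>) * V1 T \<xi>)"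
        using T by (auto intro!: L2_mult_integrable LA L0 L1)
      show ?thesis unfolding a_def
        by (simp only: Bochner_Integration.integral_add Bochner_Integration.integral_diff j Bochner_Integration.integrable_add diff_zero diff_self)
    qed
    also have "\<dots> = (LINT \<xi>|lborel. complex_of_real ((cmod (\<phi> \<xi>))\<^sup>2))"
      by (intro Bochner_Integration.integral_cong refl, unfold complex_norm_square) (auto simp: \<phi>_def D_def algebra_simps)
    also have "\<dots> = of_real ((l2norm \<phi>)\<^sup>2)" unfolding l2norm_squared by (rule integral_complex_of_real)
    finally have "l2norm \<phi> = 0" by simp
    from l2norm_eq_0_AE[OF \<phi>2 this] show ?thesis
      by (rule eventually_mono) (auto simp: \<phi>_def R_def split: if_splits)
  qed
  then have "AE \<xi> in lborel. \<forall>k::nat. norm \<xi> \<le> real k \<longrightarrow> D \<xi> = 0" unfolding AE_all_countable by blast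
  then show ?thesis
  proof eventually_elim
    case (elim \<xi>)
    obtain k :: nat where "norm \<xi> \<le> real k" using real_arch_simple by blast
    with elim have "D \<xi> = 0" by blast
    then show ?case by (simp add: D_def)
  qed
qed

section \<open>Fundamental solutions of the damped oscillator\<close>

text \<open>\<open>y'' = d y\<close> with data \<open>(0, 1)\<close> and \<open>(1, 0)\<close>, for either sign of \<open>d\<close>.\<close>

definition gsin :: "real \<Rightarrow> real \<Rightarrow> real" where
  "gsin d t = (if d = 0 then t else if d > 0 then sinh (sqrt d * t) / sqrt d else sin (sqrt (- d) * t) / sqrt (- d))"

definition gcos :: "real \<Rightarrow> real \<Rightarrow> real" where
  "gcos d t = (if d = 0 then 1 else if d > 0 then cosh (sqrt d * t) else cos (sqrt (- d) * t))"

lemma gsin_gcos_pos: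
  assumes "q > 0"
  shows "gsin (q\<^sup>2) = (\<lambda>t. sinh (q * t) / q)" "gcos (q\<^sup>2) = (\<lambda>t. cosh (q * t))"
    "gsin (- q\<^sup>2) = (\<lambda>t. sin (q * t) / q)" "gcos (- q\<^sup>2) = (\<lambda>t. cos (q * t))"
  using assms by (auto simp: gsin_def gcos_def fun_eq_iff)

lemma gsin_gcos_deriv:
  "(gsin d has_real_derivative gcos d t) (at t)" "(gcos d has_real_derivative d * gsin d t) (at t)"
proof -
  consider "d = 0" | q where "q > 0" "d = q\<^sup>2" | q where "q > 0" "d = - q\<^sup>2"
    by (metis add.inverse_inverse linorder_neqE_linordered_idom neg_0_less_iff_less real_sqrt_gt_0_iff real_sqrt_pow2 less_imp_le)
  then have "(gsin d has_real_derivative gcos d t) (at t) \<and> (gcos d has_real_derivative d * gsin d t) (at t)"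
  proof cases
    case 1 then show ?thesis by (simp add: gsin_def[abs_def] gcos_def[abs_def])
  next
    case 2 then show ?thesis unfolding 2(2) gsin_gcos_pos[OF 2(1)]
      by (auto intro!: derivative_eq_intros simp: power2_eq_square)
  next
    case 3 then show ?thesis unfolding 3(2) gsin_gcos_pos[OF 3(1)]
      by (auto intro!: derivative_eq_intros simp: power2_eq_square)
  qed
  then show "(gsin d has_real_derivative gcos d t) (at t)" "(gcos d has_real_derivative d * gsin d t) (at t)" by auto
qed

lemma gsin_0 [simp]: "gsin d 0 = 0" and gcos_0 [simp]: "gcos d 0 = 1"
  by (auto simp: gsin_def gcos_def)

lemma gsin_scale:
  assumes "r > 0" shows "gsin (r\<^sup>2 * d) t = gsin d (r * t) / r" "gcos (r\<^sup>2 * d) t = gcos d (r * t)"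
proof -
  have "sqrt (r\<^sup>2 * d) = r * sqrt d" "sqrt (- (r\<^sup>2 * d)) = r * sqrt (- d)"
    using assms real_sqrt_mult[of "r\<^sup>2" d] real_sqrt_mult[of "r\<^sup>2" "- d"] by auto
  moreover have "r\<^sup>2 * d > 0 \<longleftrightarrow> d > 0" using assms by (simp add: zero_less_mult_iff)
  ultimately show "gsin (r\<^sup>2 * d) t = gsin d (r * t) / r" "gcos (r\<^sup>2 * d) t = gcos d (r * t)"
    using assms by (auto simp: gsin_def gcos_def mult_ac)
qed

text \<open>Fundamental solutions of \<open>y'' + b y' + r\<^sup>2 y = 0\<close>: data \<open>(0, 1)\<close> for \<open>kern\<close>, data \<open>(1, 0)\<close> for \<open>kern0\<close>.\<close>

definition kern :: "real \<Rightarrow> real \<Rightarrow> real \<Rightarrow> real" where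
  "kern b r t = exp (- (b / 2) * t) * gsin (b\<^sup>2 / 4 - r\<^sup>2) t"

definition dkern :: "real \<Rightarrow> real \<Rightarrow> real \<Rightarrow> real" where
  "dkern b r t = exp (- (b / 2) * t) * (gcos (b\<^sup>2 / 4 - r\<^sup>2) t - b / 2 * gsin (b\<^sup>2 / 4 - r\<^sup>2) t)"

text \<open>If y solves the equation, so does y' + b y. For y = \<open>kern\<close> its value at 0
  is 1, and its derivative \<open>- (r\<^sup>2 * kern b r t)\<close> vanishes at 0.\<close>

definition kern0 :: "real \<Rightarrow> real \<Rightarrow> real \<Rightarrow> real" where
  "kern0 b r t = dkern b r t + b * kern b r t"

lemma kern_deriv: "(kern b r has_real_derivative dkern b r t) (at t)"
  unfolding kern_def[abs_def] dkern_def
  by (auto intro!: derivative_eq_intros gsin_gcos_deriv simp: algebra_simps)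

lemma dkern_deriv: "(dkern b r has_real_derivative - (r\<^sup>2 * kern b r t) - b * dkern b r t) (at t)"
  unfolding kern_def dkern_def[abs_def]
  by (auto intro!: derivative_eq_intros gsin_gcos_deriv simp: field_simps power2_eq_square)

lemma kern0_deriv: "(kern0 b r has_real_derivative - (r\<^sup>2 * kern b r t)) (at t)"
  unfolding kern0_def[abs_def]
  by (auto intro!: derivative_eq_intros kern_deriv dkern_deriv)

lemma kern_initial [simp]: "kern b r 0 = 0" "dkern b r 0 = 1" "kern0 b r 0 = 1"
  by (auto simp: kern_def dkern_def kern0_def)

lemma kern_measurable [measurable (raw)]:
  assumes [measurable]: "b \<in> borel_measurable M" "r \<in> borel_measurable M"
  shows "(\<lambda>x. kern (b x) (r x) t) \<in> borel_measurable M"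
    "(\<lambda>x. dkern (b x) (r x) t) \<in> borel_measurable M"
    "(\<lambda>x. kern0 (b x) (r x) t) \<in> borel_measurable M"
proof -
  have [measurable]: "(\<lambda>x. sinh (f x)) \<in> borel_measurable M" "(\<lambda>x. cosh (f x)) \<in> borel_measurable M"
    if "f \<in> borel_measurable M" for f :: "_ \<Rightarrow> real"
    by (rule borel_measurable_continuous_on[OF _ that], intro continuous_intros)+
  show "(\<lambda>x. kern (b x) (r x) t) \<in> borel_measurable M"
    "(\<lambda>x. dkern (b x) (r x) t) \<in> borel_measurable M"
    "(\<lambda>x. kern0 (b x) (r x) t) \<in> borel_measurable M"
    unfolding kern_def dkern_def kern0_def gsin_def gcos_def by measurable
qed

section \<open>Energy estimates for the oscillator\<close>

lemma energy_nonincreasing: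
  fixes y y' :: "real \<Rightarrow> real"
  assumes y: "\<And>t. (y has_real_derivative y' t) (at t)"
    and y': "\<And>t. (y' has_real_derivative - (r\<^sup>2 * y t) - b * y' t) (at t)"
    and b: "b \<ge> 0" and t: "t \<ge> 0"
  shows "(y' t)\<^sup>2 + r\<^sup>2 * (y t)\<^sup>2 \<le> (y' 0)\<^sup>2 + r\<^sup>2 * (y 0)\<^sup>2"
proof -
  have "((\<lambda>t. (y' t)\<^sup>2 + r\<^sup>2 * (y t)\<^sup>2) has_real_derivative - 2 * b * (y' t)\<^sup>2) (at t)" for t
    by (auto intro!: derivative_eq_intros y y' simp: power2_eq_square algebra_simps)
  then show ?thesis
    using DERIV_nonpos_imp_nonincreasing[OF t, of "\<lambda>t. (y' t)\<^sup>2 + r\<^sup>2 * (y t)\<^sup>2"] b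
    by (metis (no_types, lifting) mult_minus_left neg_le_0_iff_le mult_nonneg_nonneg zero_le_numeral zero_le_power2)
qed

text \<open>The cross term \<open>\<alpha> y y'\<close> turns the partial dissipation \<open>- b y'\<^sup>2\<close> of the energy into full dissipation.\<close>

lemma energy_decay:
  fixes y y' :: "real \<Rightarrow> real"
  assumes y: "\<And>t. (y has_real_derivative y' t) (at t)"
    and y': "\<And>t. (y' has_real_derivative - (r\<^sup>2 * y t) - b * y' t) (at t)"
    and \<alpha>: "\<alpha> > 0" "2 * \<alpha> \<le> b" "2 * \<alpha> \<le> r" and \<beta>: "b \<le> \<beta> * r\<^sup>2" and t: "t \<ge> 0"
  defines "m \<equiv> 3 / 4 + \<alpha> * \<beta> / 2"
  shows "(y' t)\<^sup>2 + r\<^sup>2 * (y t)\<^sup>2 \<le> 4 * m * exp (- (\<alpha> / m) * t) * ((y' 0)\<^sup>2 + r\<^sup>2 * (y 0)\<^sup>2)"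
proof -
  define X where "X t = (y' t)\<^sup>2 + r\<^sup>2 * (y t)\<^sup>2" for t
  \<comment> \<open>Differentiating y y' produces - b y y'; the added term b y^2 / 2 cancels
    it.\<close>
  define E where "E t = X t / 2 + \<alpha> * (y t * y' t + b / 2 * (y t)\<^sup>2)" for t
  have b0: "b > 0" and r0: "r > 0" using \<alpha> by linarith+
  have "0 < \<beta> * r\<^sup>2" using b0 \<beta> by linarith
  then have "\<beta> > 0" using r0 by (simp add: zero_less_mult_iff)
  then have m: "m > 0" using \<alpha> by (simp add: m_def add_pos_pos)
  \<comment> \<open>From 2 \<alpha> \<le> r the cross term is at most a quarter of \<open>X\<close>,
    so E lies between X/4 and (3/4) X plus the contribution of y^2; the constant \<open>m\<close>
    collects the upper bound.\<close>
  have cross: "\<bar>\<alpha> * (y t * y' t)\<bar> \<le> X t / 4" for t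
  proof -
    have "2 * (\<bar>y' t\<bar> * (2 * \<alpha> * \<bar>y t\<bar>)) \<le> \<bar>y' t\<bar>\<^sup>2 + (2 * \<alpha> * \<bar>y t\<bar>)\<^sup>2"
      using sum_squares_bound[of "\<bar>y' t\<bar>" "2 * \<alpha> * \<bar>y t\<bar>"] by simp
    also have "(2 * \<alpha> * \<bar>y t\<bar>)\<^sup>2 \<le> (r * \<bar>y t\<bar>)\<^sup>2"
      using \<alpha> by (intro power_mono mult_right_mono) auto
    finally have "4 * (\<alpha> * (\<bar>y t\<bar> * \<bar>y' t\<bar>)) \<le> X t" by (simp add: X_def power_mult_distrib mult_ac)
    then show ?thesis using \<alpha> by (simp add: abs_mult)
  qed
  have low: "X t / 4 \<le> E t" for t
  proof -
    have "0 \<le> \<alpha> * (b / 2 * (y t)\<^sup>2)" using \<alpha> b0 by simp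
    then show ?thesis using cross[of t] unfolding E_def distrib_left by linarith
  qed
  have up: "E t \<le> m * X t" for t
  proof -
    have "\<alpha> * (b / 2 * (y t)\<^sup>2) \<le> \<alpha> * (\<beta> * r\<^sup>2 / 2 * (y t)\<^sup>2)"
      using \<alpha> \<beta> by (intro mult_left_mono mult_right_mono divide_right_mono) auto
    also have "\<dots> = \<alpha> * \<beta> / 2 * (r\<^sup>2 * (y t)\<^sup>2)" by simp
    also have "\<dots> \<le> \<alpha> * \<beta> / 2 * X t"
      using \<alpha> \<open>\<beta> > 0\<close> unfolding X_def by (intro mult_left_mono) auto
    finally show ?thesis using cross[of t] unfolding E_def m_def distrib_left distrib_right by linarith
  qed
  have dE: "(E has_real_derivative - (b - \<alpha>) * (y' t)\<^sup>2 - \<alpha> * r\<^sup>2 * (y t)\<^sup>2) (at t)" for t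
    unfolding E_def[abs_def] X_def[abs_def]
    by (auto intro!: derivative_eq_intros y y' simp: power2_eq_square algebra_simps)
  \<comment> \<open>From 2 \<alpha> \<le> b one has b - \<alpha> \<ge> \<alpha>, so the dissipation
    is at least \<alpha> X, hence at least (\<alpha> / m) E.\<close>
  have diss: "- (b - \<alpha>) * (y' t)\<^sup>2 - \<alpha> * r\<^sup>2 * (y t)\<^sup>2 + \<alpha> / m * E t \<le> 0" for t
  proof -
    have "\<alpha> / m * E t \<le> \<alpha> / m * (m * X t)" using \<alpha> m up by (intro mult_left_mono) auto
    also have "\<dots> = \<alpha> * (y' t)\<^sup>2 + \<alpha> * (r\<^sup>2 * (y t)\<^sup>2)" using m by (simp add: X_def distrib_left)
    also have "\<alpha> * (y' t)\<^sup>2 \<le> (b - \<alpha>) * (y' t)\<^sup>2" using \<alpha> by (intro mult_right_mono) auto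
    finally show ?thesis by (simp add: algebra_simps)
  qed
  have "((\<lambda>t. exp (\<alpha> / m * t) * E t) has_real_derivative
      exp (\<alpha> / m * t) * (- (b - \<alpha>) * (y' t)\<^sup>2 - \<alpha> * r\<^sup>2 * (y t)\<^sup>2 + \<alpha> / m * E t)) (at t)" for t
    using m by (auto intro!: derivative_eq_intros dE simp: algebra_simps)
  then have "exp (\<alpha> / m * t) * E t \<le> exp (\<alpha> / m * 0) * E 0"
    using DERIV_nonpos_imp_nonincreasing[OF t, of "\<lambda>t. exp (\<alpha> / m * t) * E t"] diss
    by (meson exp_ge_zero mult_nonneg_nonpos)
  then have "exp (\<alpha> / m * t) * E t \<le> m * X 0" using up[of 0] by simp
  moreover have "exp (\<alpha> / m * t) * (X t / 4) \<le> exp (\<alpha> / m * t) * E t" using low[of t] by simp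
  ultimately have "exp (\<alpha> / m * t) * (X t / 4) \<le> m * X 0" by linarith
  then have "X t \<le> 4 * m * exp (- (\<alpha> / m) * t) * X 0" using m by (simp add: exp_minus field_simps)
  then show ?thesis by (simp add: X_def)
qed

text \<open>The energy starts at 1 and damping only lowers it. Unlike exponential decay, these
  bounds hold uniformly down to r = 0.\<close>

lemma dkern_le_1:
  assumes "b \<ge> 0" "t \<ge> 0" shows "\<bar>dkern b r t\<bar> \<le> 1" "\<bar>kern b r t\<bar> \<le> t"
proof -
  have *: "\<bar>dkern b r t\<bar> \<le> 1" if "t \<ge> 0" for t
  proof -
    have "(dkern b r t)\<^sup>2 + r\<^sup>2 * (kern b r t)\<^sup>2 \<le> 1"
      using energy_nonincreasing[OF kern_deriv dkern_deriv assms(1) that] by simp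
    moreover have "0 \<le> r\<^sup>2 * (kern b r t)\<^sup>2" by simp
    ultimately have "(dkern b r t)\<^sup>2 \<le> 1" by linarith
    then show ?thesis by (simp add: abs_square_le_1)
  qed
  then show "\<bar>dkern b r t\<bar> \<le> 1" using assms by blast
  have "\<bar>kern b r t - kern b r 0\<bar> \<le> 1 * \<bar>t - 0\<bar>"
    by (rule real_mvt_bound[of 0 t "kern b r" "dkern b r"]) (use * kern_deriv assms in auto)
  then show "\<bar>kern b r t\<bar> \<le> t" using assms by simp
qed

text \<open>Uniformity in r \<ge> \<rho> is monotonicity: the damping coefficient and r increase,
  while their quotient \<nu> r^(2\<sigma>-2) of damping by r^2 does not increase because \<sigma>
  \<le> 1. The admissible \<alpha> and \<beta> are thus those at r = \<rho>.\<close>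

lemma kern_decay:
  assumes \<nu>: "\<nu> > 0" and \<sigma>: "0 < \<sigma>" "\<sigma> \<le> 1" and \<rho>: "\<rho> > 0"
  shows "\<exists>C c. C > 0 \<and> c > 0 \<and> (\<forall>r\<ge>\<rho>. \<forall>t\<ge>0.
     \<bar>kern0 (\<nu> * r powr (2 * \<sigma>)) r t\<bar> \<le> C * exp (- c * t)
   \<and> \<bar>dkern (\<nu> * r powr (2 * \<sigma>)) r t\<bar> \<le> C * exp (- c * t)
   \<and> r * \<bar>kern (\<nu> * r powr (2 * \<sigma>)) r t\<bar> \<le> C * exp (- c * t))"
proof -
  define \<alpha> where "\<alpha> = min (\<nu> * \<rho> powr (2 * \<sigma>)) \<rho> / 2"
  define \<beta> where "\<beta> = \<nu> * \<rho> powr (2 * \<sigma> - 2)"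
  define m where "m = 3 / 4 + \<alpha> * \<beta> / 2"
  have \<alpha>: "\<alpha> > 0" using \<nu> \<rho> by (simp add: \<alpha>_def)
  have m: "m > 0" using \<alpha> \<nu> \<rho> by (simp add: m_def \<beta>_def add_pos_nonneg)
  define C where "C = sqrt (4 * m)"
  define c where "c = \<alpha> / m / 2"
  show ?thesis
  proof (rule exI[of _ C], rule exI[of _ c], intro conjI allI impI)
    show "C > 0" "c > 0" using m \<alpha> by (auto simp: C_def c_def)
    fix r t :: real assume r: "r \<ge> \<rho>" and t: "t \<ge> 0"
    let ?b = "\<nu> * r powr (2 * \<sigma>)"
    have r0: "r > 0" using r \<rho> by linarith
    have "\<nu> * \<rho> powr (2 * \<sigma>) \<le> ?b" using r \<rho> \<nu> \<sigma> by (intro mult_left_mono powr_mono2) auto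
    then have b1: "2 * \<alpha> \<le> ?b" by (simp add: \<alpha>_def)
    have r1: "2 * \<alpha> \<le> r" using r by (simp add: \<alpha>_def)
    have "r powr (2 * \<sigma>) = r powr (2 * \<sigma> - 2) * r\<^sup>2"
      using r0 powr_add[of r "2 * \<sigma> - 2" 2] by simp
    also have "r powr (2 * \<sigma> - 2) \<le> \<rho> powr (2 * \<sigma> - 2)"
      using r \<rho> \<sigma> by (intro powr_mono2') auto
    finally have b2: "?b \<le> \<beta> * r\<^sup>2" using \<nu> r0 by (simp add: \<beta>_def mult_left_mono mult_right_mono)
    have ex: "exp (- (\<alpha> / m) * t) = (exp (- c * t))\<^sup>2"
      by (simp add: c_def power2_eq_square flip: exp_add)
    have sq: "\<bar>x\<bar> \<le> C * exp (- c * t)" if "x\<^sup>2 \<le> 4 * m * exp (- (\<alpha> / m) * t)" for x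
    proof (rule power2_le_imp_le)
      show "\<bar>x\<bar>\<^sup>2 \<le> (C * exp (- c * t))\<^sup>2" using that m unfolding ex by (simp add: C_def power_mult_distrib)
      show "0 \<le> C * exp (- c * t)" using m by (simp add: C_def)
    qed
    have 1: "(dkern ?b r t)\<^sup>2 + r\<^sup>2 * (kern ?b r t)\<^sup>2 \<le> 4 * m * exp (- (\<alpha> / m) * t)"
      using energy_decay[OF kern_deriv dkern_deriv \<alpha> b1 r1 b2 t] by (simp add: m_def)
    have nn: "0 \<le> r\<^sup>2 * (kern ?b r t)\<^sup>2" "0 \<le> (dkern ?b r t)\<^sup>2" by auto
    show "\<bar>dkern ?b r t\<bar> \<le> C * exp (- c * t)" by (rule sq) (use 1 nn in linarith)
    have "\<bar>r * kern ?b r t\<bar> \<le> C * exp (- c * t)"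
      by (rule sq, unfold power_mult_distrib) (use 1 nn in linarith)
    then show "r * \<bar>kern ?b r t\<bar> \<le> C * exp (- c * t)" using r0 by (simp add: abs_mult)
    \<comment> \<open>\<open>kern0\<close> and its derivative \<open>- (r\<^sup>2 * kern)\<close>
      form another solution, of initial energy \<open>r\<^sup>2\<close>; dividing by that leaves a
      bound free of r.\<close>
    have d0: "((\<lambda>t. - (r\<^sup>2 * kern ?b r t)) has_real_derivative - (r\<^sup>2 * kern0 ?b r t) - ?b * - (r\<^sup>2 * kern ?b r t)) (at t)" for t
      by (auto intro!: derivative_eq_intros kern_deriv simp: kern0_def algebra_simps)
    have "(- (r\<^sup>2 * kern ?b r t))\<^sup>2 + r\<^sup>2 * (kern0 ?b r t)\<^sup>2 \<le> 4 * m * exp (- (\<alpha> / m) * t) * r\<^sup>2"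
      using energy_decay[OF kern0_deriv d0 \<alpha> b1 r1 b2 t] by (simp add: m_def)
    then have "r\<^sup>2 * (kern0 ?b r t)\<^sup>2 \<le> 4 * m * exp (- (\<alpha> / m) * t) * r\<^sup>2"
      using zero_le_power2[of "- (r\<^sup>2 * kern ?b r t)"] by linarith
    then have "(kern0 ?b r t)\<^sup>2 \<le> 4 * m * exp (- (\<alpha> / m) * t)"
      using r0 by (simp add: mult.commute[of "r\<^sup>2"])
    then show "\<bar>kern0 ?b r t\<bar> \<le> C * exp (- c * t)" by (rule sq)
  qed
qed

text \<open>For \<sigma> = 1/2 damping and frequency have the same homogeneity, so the kernels
  depend on r and t through r t alone, up to the factor 1/r in \<open>kern\<close>.\<close>

lemma kern_scale:
  assumes "r > 0"
  shows "kern (\<nu> * r) r t = kern \<nu> 1 (r * t) / r"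
    "dkern (\<nu> * r) r t = dkern \<nu> 1 (r * t)"
    "kern0 (\<nu> * r) r t = kern0 \<nu> 1 (r * t)"
proof -
  have d: "(\<nu> * r)\<^sup>2 / 4 - r\<^sup>2 = r\<^sup>2 * (\<nu>\<^sup>2 / 4 - 1\<^sup>2)" by (simp add: power_mult_distrib algebra_simps)
  show *: "kern (\<nu> * r) r t = kern \<nu> 1 (r * t) / r" "dkern (\<nu> * r) r t = dkern \<nu> 1 (r * t)"
    unfolding kern_def dkern_def d gsin_scale[OF assms] using assms by (auto simp: field_simps)
  show "kern0 (\<nu> * r) r t = kern0 \<nu> 1 (r * t)" unfolding kern0_def * using assms by simp
qed

lemma kern_unit_bounds:
  assumes "\<nu> > 0"
  shows "\<exists>C c. C > 0 \<and> c > 0 \<and> (\<forall>s>0. \<bar>kern \<nu> 1 s\<bar> \<le> C * (s * exp (- c * s)) \<and> \<bar>kern \<nu> 1 s\<bar> \<le> C * exp (- c * s)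
    \<and> \<bar>dkern \<nu> 1 s\<bar> \<le> C * exp (- c * s) \<and> \<bar>kern0 \<nu> 1 s\<bar> \<le> C * exp (- c * s))"
proof -
  obtain C c where C: "C > 0" "c > 0" and d: "\<And>s. s \<ge> 0 \<Longrightarrow> \<bar>kern0 \<nu> 1 s\<bar> \<le> C * exp (- c * s)
     \<and> \<bar>dkern \<nu> 1 s\<bar> \<le> C * exp (- c * s) \<and> \<bar>kern \<nu> 1 s\<bar> \<le> C * exp (- c * s)"
    using kern_decay[OF assms, of "1/2" 1] by force
  \<comment> \<open>For s \<le> 1 the bound |kern| \<le> s is used, and exp c makes up for the
    factor exp(- c s); for s > 1 the factor s may be inserted freely.\<close>
  define C' where "C' = max C (exp c)"
  have le: "C * exp (- c * s) \<le> C' * exp (- c * s)" for s by (intro mult_right_mono) (auto simp: C'_def)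
  have "\<bar>kern \<nu> 1 s\<bar> \<le> C' * (s * exp (- c * s))" if s: "s > 0" for s
  proof (cases "s \<le> 1")
    case True
    have "\<bar>kern \<nu> 1 s\<bar> \<le> s" using dkern_le_1(2)[of \<nu> s 1] assms s by simp
    also have "\<dots> \<le> s * exp (c - c * s)" using C True s by (auto simp: mult_left_le)
    also have "\<dots> = exp c * (s * exp (- c * s))" by (simp add: exp_diff exp_minus divide_inverse)
    also have "\<dots> \<le> C' * (s * exp (- c * s))" using s by (intro mult_right_mono) (auto simp: C'_def)
    finally show ?thesis .
  next
    case False
    have "\<bar>kern \<nu> 1 s\<bar> \<le> C' * exp (- c * s)" using d[of s] le[of s] s by linarith
    also have "\<dots> \<le> C' * exp (- c * s) * s"
      using False C mult_left_mono[of 1 s "C' * exp (- c * s)"] by (simp add: C'_def)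
    finally show ?thesis by (simp add: mult_ac)
  qed
  moreover have "\<bar>kern \<nu> 1 s\<bar> \<le> C' * exp (- c * s) \<and> \<bar>dkern \<nu> 1 s\<bar> \<le> C' * exp (- c * s)
      \<and> \<bar>kern0 \<nu> 1 s\<bar> \<le> C' * exp (- c * s)" if "s > 0" for s
    using d[of s] le[of s] that by (meson less_imp_le order_trans)
  moreover have "C' > 0" using C by (simp add: C'_def less_max_iff_disj)
  ultimately show ?thesis using C(2) 
    by - (rule exI[of _ C'], rule exI[of _ c], intro conjI allI impI, simp_all)
qed

section \<open>Dominated convergence in the scaled variable\<close>

lemma L2_radial:
  fixes e c p :: real
  assumes "e > - real CARD('n) / 2" "p > 0" "c > 0"
  shows "L2 (\<lambda>\<eta>::real^'n. norm \<eta> powr e * exp (- c * norm \<eta> powr p))"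
  unfolding L2_def
proof
  have "(norm (norm \<eta> powr e * exp (- c * norm \<eta> powr p)))\<^sup>2 = norm \<eta> powr (2 * e) * exp (- (2 * c) * norm \<eta> powr p)" for \<eta> :: "real^'n"
  proof -
    have "(norm \<eta> powr e)\<^sup>2 = norm \<eta> powr (2 * e)" by (simp add: power2_eq_square flip: powr_add)
    moreover have "(exp (- c * norm \<eta> powr p))\<^sup>2 = exp (- (2 * c) * norm \<eta> powr p)"
      by (simp add: power2_eq_square flip: exp_add)
    ultimately show ?thesis by (simp only: real_norm_def power2_abs power_mult_distrib)
  qed
  then show "integrable lborel (\<lambda>\<eta>::real^'n. (norm (norm \<eta> powr e * exp (- c * norm \<eta> powr p)))\<^sup>2)"
    using integrable_radial[of "2 * e" p "2 * c", where 'n='n] assms by simp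
qed measurable

lemma AE_nonzero: "AE \<eta>::real^'n in lborel. \<eta> \<noteq> 0"
  by (rule AE_lborel_singleton)

text \<open>The source of the decay exponent: with s = t^(-1/p) the Jacobian contributes s^(n/2) to
  the norm and the multiplier contributes s^k.\<close>

lemma l2norm_scale:
  fixes g :: "real^'n \<Rightarrow> complex"
  assumes [measurable]: "g \<in> borel_measurable lborel" and t: "t > 0" and p: "p \<noteq> 0"
  shows "L2 (\<lambda>\<eta>. of_real (norm \<eta> powr k) * g ((t powr (-1/p)) *\<^sub>R \<eta>)) \<longleftrightarrow> L2 (\<lambda>\<xi>. of_real (norm \<xi> powr k) * g \<xi>)"
    and "l2norm (\<lambda>\<xi>. of_real (norm \<xi> powr k) * g \<xi>)
      = t powr (- ((real CARD('n) / 2 + k) / p)) * l2norm (\<lambda>\<eta>. of_real (norm \<eta> powr k) * g ((t powr (-1/p)) *\<^sub>R \<eta>))"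
proof -
  define s where "s = t powr (-1/p)"
  have s: "s > 0" using t by (simp add: s_def)
  define f where "f \<xi> = (cmod (of_real (norm \<xi> powr k) * g \<xi>))\<^sup>2" for \<xi>
  define F where "F \<eta> = (cmod (of_real (norm \<eta> powr k) * g (s *\<^sub>R \<eta>)))\<^sup>2" for \<eta>
  have [measurable]: "f \<in> borel_measurable lborel" unfolding f_def by measurable
  have fs: "f (s *\<^sub>R \<eta>) = (s powr k)\<^sup>2 * F \<eta>" for \<eta>
    using s by (simp add: f_def F_def norm_mult power_mult_distrib powr_mult)
  have sk: "(s powr k)\<^sup>2 \<noteq> 0" using s by simp
  have I: "integrable lborel F \<longleftrightarrow> integrable lborel f"
    using lborel_scale(1)[OF s, of f] sk unfolding fs by simp
  have gm: "(\<lambda>\<eta>. g (s *\<^sub>R \<eta>)) \<in> borel_measurable lborel" by measurable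
  show "L2 (\<lambda>\<eta>. of_real (norm \<eta> powr k) * g ((t powr (-1/p)) *\<^sub>R \<eta>)) \<longleftrightarrow> L2 (\<lambda>\<xi>. of_real (norm \<xi> powr k) * g \<xi>)"
    unfolding s_def[symmetric] L2_def F_def[symmetric] f_def[symmetric] I using gm by simp
  have "(LINT \<xi>|lborel. f \<xi>) = s ^ CARD('n) * ((s powr k)\<^sup>2 * (LINT \<eta>|lborel. F \<eta>))"
    using lborel_scale(2)[OF s, of f] unfolding fs by simp
  also have "s ^ CARD('n) * ((s powr k)\<^sup>2 * X) = (s powr (CARD('n) / 2 + k))\<^sup>2 * X" for X
    using s by (simp add: power2_eq_square powr_add[symmetric] flip: powr_realpow)
  finally have "sqrt (LINT \<xi>|lborel. f \<xi>) = s powr (CARD('n) / 2 + k) * sqrt (LINT \<eta>|lborel. F \<eta>)"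
    by (simp add: real_sqrt_mult)
  then show "l2norm (\<lambda>\<xi>. of_real (norm \<xi> powr k) * g \<xi>)
      = t powr (- ((real CARD('n) / 2 + k) / p)) * l2norm (\<lambda>\<eta>. of_real (norm \<eta> powr k) * g ((t powr (-1/p)) *\<^sub>R \<eta>))"
    unfolding l2norm_def f_def F_def s_def powr_powr by (simp add: field_simps)
qed

text \<open>A single majorant for all powers x^d with e \<le> d \<le> 2 times the exponential: x^e
  serves for x \<le> 1 and x^2 for x > 1, so kernels of different homogeneity share it.\<close>

definition envelope :: "real \<Rightarrow> real \<Rightarrow> real \<Rightarrow> real \<Rightarrow> real" where
  "envelope e c p x = (x powr e + x powr 2) * exp (- c * x powr p)"

lemma envelope_nonneg: "0 \<le> envelope e c p x"
  by (simp add: envelope_def)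

lemma powr_le_envelope:
  assumes "x > 0" "e \<le> d" "d \<le> 2"
  shows "x powr d * exp (- c * x powr p) \<le> envelope e c p x"
proof -
  have "x powr d \<le> x powr e + x powr 2"
  proof (cases "x \<le> 1")
    case True then have "x powr d \<le> x powr e" using assms by (intro powr_mono') auto
    then show ?thesis by (simp add: add_increasing2)
  next
    case False then have "x powr d \<le> x powr 2" using assms by (intro powr_mono) auto
    then show ?thesis by (simp add: add_increasing)
  qed
  then show ?thesis unfolding envelope_def by (rule mult_right_mono) simp
qed

lemma L2_envelope:
  fixes k :: real
  assumes "e > - real CARD('n) / 2" "e \<le> 2" "p > 0" "c > 0" "k \<ge> 0"
  shows "L2 (\<lambda>\<eta>::real^'n. norm \<eta> powr k * (A * envelope e c p (norm \<eta>)))"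
proof -
  have "L2 (\<lambda>\<eta>::real^'n. norm \<eta> powr (k + e) * exp (- c * norm \<eta> powr p) + norm \<eta> powr (k + 2) * exp (- c * norm \<eta> powr p))"
    using assms by (intro L2_add L2_radial) auto
  from L2_scaleR[OF this, of A] show ?thesis
    by (simp add: envelope_def powr_add algebra_simps)
qed

lemma exp_decay_smallo:
  assumes "c > 0" shows "(\<lambda>t::real. exp (- c * t)) \<in> o(\<lambda>t. t powr b)"
proof -
  obtain C where C: "\<And>y. y > 0 \<Longrightarrow> y powr (max 0 (1 - b)) * exp (- c * y) \<le> C"
    using powr_exp_bounded[OF assms, of "max 0 (1 - b)"] by auto
  have "(\<lambda>t::real. exp (- c * t)) \<in> O(\<lambda>t. t powr (b - 1))"
  proof (rule bigoI)
    show "\<forall>\<^sub>F t in at_top. norm (exp (- c * t)) \<le> C * norm (t powr (b - 1))"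
      using eventually_ge_at_top[of 1]
    proof eventually_elim
      case (elim t)
      have "t powr (1 - b) * exp (- c * t) \<le> t powr (max 0 (1 - b)) * exp (- c * t)"
        using elim by (intro mult_right_mono powr_mono) auto
      also have "\<dots> \<le> C" using elim by (intro C) auto
      finally have "t powr (b - 1) * (t powr (1 - b) * exp (- c * t)) \<le> t powr (b - 1) * C"
        by (rule mult_left_mono) simp
      moreover have "t powr (b - 1) * t powr (1 - b) = 1" using elim by (simp flip: powr_add)
      ultimately show ?case by (simp add: mult.commute[of C] flip: mult.assoc)
    qed
  qed
  also have "(\<lambda>t::real. t powr (b - 1)) \<in> o(\<lambda>t. t powr b)"
  proof (rule smalloI_tendsto)
    have "((\<lambda>t::real. t powr (-1)) \<longlongrightarrow> 0) at_top" by (intro tendsto_neg_powr filterlim_ident) auto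
    moreover have "t powr (b - 1) / t powr b = t powr (-1)" for t :: real
      unfolding powr_diff[symmetric] by simp
    ultimately show "((\<lambda>t::real. t powr (b - 1) / t powr b) \<longlongrightarrow> 0) at_top" by simp
    show "\<forall>\<^sub>F t in at_top. (t::real) powr b \<noteq> 0" using eventually_gt_at_top[of 0] by eventually_elim auto
  qed
  finally show ?thesis .
qed

text \<open>\<open>X0\<close> and \<open>X1\<close> are the kernels acting on the two data and
  \<open>P\<close> the profile replacing \<open>X1\<close>; t^\<alpha> is the normalisation that
  makes the scaled kernels bounded by the envelope. The statement is kept abstract so that it covers
  the solution and its time derivative for every \<sigma>. The second datum enters through its value
  at 0, the first only through its bound and Sobolev norm.\<close>

lemma asymptotic_profile:
  fixes W0 W1 :: "real^'n \<Rightarrow> complex" and X0 X1 P :: "real \<Rightarrow> real \<Rightarrow> real"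
  assumes p: "p > 0" and c: "c > 0" and \<rho>: "\<rho> > 0" and k: "k \<ge> 0" and e: "e > - real CARD('n) / 2" "e \<le> 2" and A: "A \<ge> 0"
    and W: "W0 \<in> borel_measurable lborel" "W1 \<in> borel_measurable lborel"
    and M: "\<And>\<xi>. cmod (W0 \<xi>) \<le> M" "\<And>\<xi>. cmod (W1 \<xi>) \<le> M"
    and m: "isCont W1 0" "W1 0 = of_real m"
    and X: "\<And>t. (\<lambda>\<xi>::real^'n. X0 t (norm \<xi>)) \<in> borel_measurable lborel"
      "\<And>t. (\<lambda>\<xi>::real^'n. X1 t (norm \<xi>)) \<in> borel_measurable lborel"
      "\<And>t. (\<lambda>\<xi>::real^'n. P t (norm \<xi>)) \<in> borel_measurable lborel"
    and dom: "\<And>t x. t \<ge> 1 \<Longrightarrow> x > 0 \<Longrightarrow> t powr (-1/p) * x \<le> \<rho> \<Longrightarrow>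
      t powr \<alpha> * \<bar>X0 t (t powr (-1/p) * x)\<bar> \<le> A * envelope e c p x \<and>
      t powr \<alpha> * \<bar>X1 t (t powr (-1/p) * x)\<bar> \<le> A * envelope e c p x"
    and domP: "\<And>t x. t \<ge> 1 \<Longrightarrow> x > 0 \<Longrightarrow> t powr \<alpha> * \<bar>P t (t powr (-1/p) * x)\<bar> \<le> A * envelope e c p x"
    and lim0: "\<And>x. x > 0 \<Longrightarrow> ((\<lambda>t. t powr \<alpha> * X0 t (t powr (-1/p) * x)) \<longlongrightarrow> 0) at_top"
    and limP: "\<And>x. x > 0 \<Longrightarrow> ((\<lambda>t. t powr \<alpha> * (X1 t (t powr (-1/p) * x) - P t (t powr (-1/p) * x))) \<longlongrightarrow> 0) at_top"
    and high: "\<And>t r. t \<ge> 1 \<Longrightarrow> r > \<rho> \<Longrightarrow> r powr k * \<bar>X0 t r\<bar> \<le> B * exp (- d * t) * r powr k1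
      \<and> r powr k * \<bar>X1 t r\<bar> \<le> B * exp (- d * t) * r powr k2" and d: "d > 0" and B: "B \<ge> 0"
    and Q: "L2 (\<lambda>\<xi>. of_real (norm \<xi> powr k1) * W0 \<xi>)" "L2 (\<lambda>\<xi>. of_real (norm \<xi> powr k2) * W1 \<xi>)"
  defines "D \<equiv> \<lambda>t \<xi>. of_real (X0 t (norm \<xi>)) * W0 \<xi> + of_real (X1 t (norm \<xi>)) * W1 \<xi> - of_real (m * P t (norm \<xi>))"
  shows "\<And>t. t \<ge> 1 \<Longrightarrow> L2 (\<lambda>\<xi>. of_real (norm \<xi> powr k) * D t \<xi>)"
    and "(\<lambda>t. l2norm (\<lambda>\<xi>. of_real (norm \<xi> powr k) * D t \<xi>)) \<in> o(\<lambda>t. t powr (- ((real CARD('n) / 2 + k) / p + \<alpha>)))"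
proof -
  note [measurable] = W X
  \<comment> \<open>Each of the two data contributes \<open>M\<close>, the profile contributes
    \<bar>m\<bar>.\<close>
  define H where "H \<eta> = norm \<eta> powr k * ((2 * M + \<bar>m\<bar>) * A * envelope e c p (norm \<eta>))" for \<eta> :: "real^'n"
  have LH: "L2 H" unfolding H_def by (rule L2_envelope[OF e p c k])
  have M0: "M \<ge> 0" using order_trans[OF norm_ge_zero M(1)] .
  \<comment> \<open>Only the kernels are cut at \<open>\<rho>\<close>. The profile stays on all
    frequencies, because its bound \<open>domP\<close> is global; thus \<open>h\<close> contains
    kernels alone.\<close>
  define f where "f t \<xi> = (if norm \<xi> \<le> \<rho> then of_real (X0 t (norm \<xi>)) * W0 \<xi> + of_real (X1 t (norm \<xi>)) * W1 \<xi> else 0) - of_real (m * P t (norm \<xi>))" for t \<xi>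
  define h where "h t \<xi> = (if norm \<xi> \<le> \<rho> then 0 else of_real (X0 t (norm \<xi>)) * W0 \<xi> + of_real (X1 t (norm \<xi>)) * W1 \<xi>)" for t \<xi>
  have [measurable]: "f t \<in> borel_measurable lborel" "h t \<in> borel_measurable lborel" for t
    unfolding f_def h_def by measurable
  have D: "D t = (\<lambda>\<xi>. f t \<xi> + h t \<xi>)" for t by (auto simp: D_def f_def h_def)
  define s where "s t = t powr (-1/p)" for t
  have s0: "s t > 0" if "t \<ge> 1" for t using that by (simp add: s_def)
  define F where "F t \<eta> = of_real (t powr \<alpha>) * (of_real (norm \<eta> powr k) * f t (s t *\<^sub>R \<eta>))" for t \<eta>
  have Fm [measurable]: "F t \<in> borel_measurable lborel" for t unfolding F_def by measurable
  have FH: "cmod (F t \<eta>) \<le> norm (H \<eta>)" if t: "t \<ge> 1" and \<eta>: "\<eta> \<noteq> 0" for t and \<eta> :: "real^'n"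
  proof -
    let ?x = "norm \<eta>" and ?E = "A * envelope e c p (norm \<eta>)" and ?\<xi> = "s t *\<^sub>R \<eta>"
    have x: "?x > 0" using \<eta> by simp
    have n: "norm ?\<xi> = t powr (-1/p) * ?x" using s0[OF t] by (simp add: s_def)
    have E0: "0 \<le> ?E" using A by (simp add: envelope_nonneg)
    have 1: "t powr \<alpha> * cmod (if norm ?\<xi> \<le> \<rho> then of_real (X0 t (norm ?\<xi>)) * W0 ?\<xi> + of_real (X1 t (norm ?\<xi>)) * W1 ?\<xi> else 0) \<le> ?E * M + ?E * M"
    proof (cases "norm ?\<xi> \<le> \<rho>")
      case True
      have "t powr \<alpha> * cmod (of_real (X0 t (norm ?\<xi>)) * W0 ?\<xi> + of_real (X1 t (norm ?\<xi>)) * W1 ?\<xi>)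
        \<le> t powr \<alpha> * (cmod (of_real (X0 t (norm ?\<xi>)) * W0 ?\<xi>) + cmod (of_real (X1 t (norm ?\<xi>)) * W1 ?\<xi>))"
        by (intro mult_left_mono norm_triangle_ineq) auto
      also have "\<dots> = (t powr \<alpha> * \<bar>X0 t (norm ?\<xi>)\<bar>) * cmod (W0 ?\<xi>) + (t powr \<alpha> * \<bar>X1 t (norm ?\<xi>)\<bar>) * cmod (W1 ?\<xi>)"
        by (simp only: norm_mult norm_of_real distrib_left mult.assoc)
      also have "\<dots> \<le> ?E * M + ?E * M"
      proof -
        have "t powr \<alpha> * \<bar>X0 t (norm ?\<xi>)\<bar> \<le> ?E" "t powr \<alpha> * \<bar>X1 t (norm ?\<xi>)\<bar> \<le> ?E"
          using dom[OF t x] True unfolding n by auto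
        then show ?thesis by (intro add_mono mult_mono[OF _ M(1)] mult_mono[OF _ M(2)] E0 norm_ge_zero)
      qed
      finally show ?thesis unfolding if_P[OF True] .
    next
      case False
      then show ?thesis using mult_nonneg_nonneg[OF E0 M0] by (simp only: if_False norm_zero mult_zero_right)
    qed
    have 2: "t powr \<alpha> * cmod (of_real (m * P t (norm ?\<xi>))) \<le> \<bar>m\<bar> * ?E"
      using mult_left_mono[OF domP[OF t x], of "\<bar>m\<bar>"] unfolding n by (simp add: norm_mult abs_mult mult_ac)
    have "t powr \<alpha> * cmod (f t ?\<xi>) \<le> t powr \<alpha> * (cmod (if norm ?\<xi> \<le> \<rho> then of_real (X0 t (norm ?\<xi>)) * W0 ?\<xi> + of_real (X1 t (norm ?\<xi>)) * W1 ?\<xi> else 0)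
       + cmod (of_real (m * P t (norm ?\<xi>))))"
      unfolding f_def by (intro mult_left_mono norm_triangle_ineq4) auto
    also have "\<dots> \<le> (2 * M + \<bar>m\<bar>) * A * envelope e c p ?x" using 1 2 by (simp add: algebra_simps)
    finally have "?x powr k * (t powr \<alpha> * cmod (f t ?\<xi>)) \<le> H \<eta>"
      unfolding H_def by (rule mult_left_mono) simp
    moreover have "cmod (F t \<eta>) = ?x powr k * (t powr \<alpha> * cmod (f t ?\<xi>))"
      by (simp add: F_def norm_mult mult_ac)
    ultimately show ?thesis by simp
  qed
  have slim: "(s \<longlongrightarrow> 0) at_top"
    unfolding s_def using p by (intro tendsto_neg_powr filterlim_ident) auto
  have Flim: "((\<lambda>t. F t \<eta>) \<longlongrightarrow> 0) at_top" if \<eta>: "\<eta> \<noteq> 0" for \<eta>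
  proof -
    let ?x = "norm \<eta>"
    have x: "?x > 0" using \<eta> by simp
    have sx: "((\<lambda>t. s t * ?x) \<longlongrightarrow> 0 * ?x) at_top" by (intro tendsto_intros slim)
    \<comment> \<open>For fixed \<open>\<eta>\<close> the actual frequency tends to 0, so the
      cut-off eventually disappears.\<close>
    have ev: "\<forall>\<^sub>F t in at_top. s t * ?x < \<rho>" by (rule order_tendstoD(2)[OF sx]) (use \<rho> in simp)
    have "((\<lambda>t. s t *\<^sub>R \<eta>) \<longlongrightarrow> 0 *\<^sub>R \<eta>) at_top" by (intro tendsto_intros slim)
    then have W1lim: "((\<lambda>t. W1 (s t *\<^sub>R \<eta>)) \<longlongrightarrow> of_real m) at_top"
      using isCont_tendsto_compose[OF m(1), of "\<lambda>t. s t *\<^sub>R \<eta>"] m(2) by simp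
    \<comment> \<open>The scaled integrand splits into X0 W0, for which boundedness of W0 is enough,
      X1 (W1 - m), which vanishes by continuity of W1 at 0, and m (X1 - P), which vanishes by
      assumption.\<close>
    have T0: "((\<lambda>t. of_real (t powr \<alpha> * X0 t (s t * ?x)) * W0 (s t *\<^sub>R \<eta>)) \<longlongrightarrow> 0) at_top"
    proof (rule Lim_null_comparison)
      show "\<forall>\<^sub>F t in at_top. norm (of_real (t powr \<alpha> * X0 t (s t * ?x)) * W0 (s t *\<^sub>R \<eta>)) \<le> \<bar>t powr \<alpha> * X0 t (s t * ?x)\<bar> * M"
        by (intro always_eventually allI) (simp only: norm_mult norm_of_real mult_left_mono[OF M(1)] abs_ge_zero)
      show "((\<lambda>t. \<bar>t powr \<alpha> * X0 t (s t * ?x)\<bar> * M) \<longlongrightarrow> 0) at_top"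
        using tendsto_mult_left_zero[OF tendsto_rabs_zero[OF lim0[OF x]], of M] by (simp add: s_def)
    qed
    have T1: "((\<lambda>t. of_real (t powr \<alpha> * X1 t (s t * ?x)) * (W1 (s t *\<^sub>R \<eta>) - of_real m)) \<longlongrightarrow> 0) at_top"
    proof (rule Lim_null_comparison)
      show "\<forall>\<^sub>F t in at_top. norm (of_real (t powr \<alpha> * X1 t (s t * ?x)) * (W1 (s t *\<^sub>R \<eta>) - of_real m))
         \<le> (A * envelope e c p ?x) * cmod (W1 (s t *\<^sub>R \<eta>) - of_real m)"
        using ev eventually_ge_at_top[of 1]
      proof eventually_elim
        case (elim t)
        then have "\<bar>t powr \<alpha> * X1 t (s t * ?x)\<bar> \<le> A * envelope e c p ?x"
          using dom[OF elim(2) x] by (auto simp: abs_mult s_def)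
        then show ?case unfolding norm_mult norm_of_real by (rule mult_right_mono) simp
      qed
      have "((\<lambda>t. (A * envelope e c p ?x) * cmod (W1 (s t *\<^sub>R \<eta>) - of_real m)) \<longlongrightarrow> (A * envelope e c p ?x) * cmod (of_real m - of_real m)) at_top"
        by (intro tendsto_intros W1lim)
      then show "((\<lambda>t. (A * envelope e c p ?x) * cmod (W1 (s t *\<^sub>R \<eta>) - of_real m)) \<longlongrightarrow> 0) at_top" by simp
    qed
    have T2: "((\<lambda>t. of_real (m * (t powr \<alpha> * (X1 t (s t * ?x) - P t (s t * ?x))))) \<longlongrightarrow> (0::complex)) at_top"
      using tendsto_of_real[OF tendsto_mult_right_zero[OF limP[OF x], of m], where 'a=complex] by (simp add: s_def)
    have "((\<lambda>t. of_real (?x powr k) * (of_real (t powr \<alpha> * X0 t (s t * ?x)) * W0 (s t *\<^sub>R \<eta>)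
        + of_real (t powr \<alpha> * X1 t (s t * ?x)) * (W1 (s t *\<^sub>R \<eta>) - of_real m)
        + of_real (m * (t powr \<alpha> * (X1 t (s t * ?x) - P t (s t * ?x)))))) \<longlongrightarrow> of_real (?x powr k) * (0 + 0 + 0)) at_top"
      by (intro tendsto_mult tendsto_const tendsto_add T0 T1 T2)
    then have *: "((\<lambda>t. of_real (?x powr k) * (of_real (t powr \<alpha> * X0 t (s t * ?x)) * W0 (s t *\<^sub>R \<eta>)
        + of_real (t powr \<alpha> * X1 t (s t * ?x)) * (W1 (s t *\<^sub>R \<eta>) - of_real m)
        + of_real (m * (t powr \<alpha> * (X1 t (s t * ?x) - P t (s t * ?x)))))) \<longlongrightarrow> 0) at_top" by simp
    show ?thesis
    proof (rule Lim_transform_eventually[OF *])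
      show "\<forall>\<^sub>F t in at_top. of_real (?x powr k) * (of_real (t powr \<alpha> * X0 t (s t * ?x)) * W0 (s t *\<^sub>R \<eta>)
        + of_real (t powr \<alpha> * X1 t (s t * ?x)) * (W1 (s t *\<^sub>R \<eta>) - of_real m)
        + of_real (m * (t powr \<alpha> * (X1 t (s t * ?x) - P t (s t * ?x))))) = F t \<eta>"
        using ev eventually_ge_at_top[of 1]
      proof eventually_elim
        case (elim t)
        have n: "norm (s t *\<^sub>R \<eta>) = s t * ?x" using s0[OF elim(2)] by simp
        show ?case unfolding F_def f_def n if_P[OF less_imp_le[OF elim(1)]]
          by (simp add: algebra_simps)
      qed
    qed
  qed
  have FT: "L2_tendsto F (\<lambda>_. 0) at_top"
  proof (rule L2_dominated_convergence_at_top[OF LH])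
    show "\<forall>\<^sub>F t in at_top. F t \<in> borel_measurable lborel \<and> (AE \<eta> in lborel. norm (F t \<eta>) \<le> norm (H \<eta>))"
      using eventually_ge_at_top[of 1]
      by eventually_elim (use AE_nonzero FH in \<open>auto elim!: eventually_mono\<close>)
    show "AE \<eta> in lborel. ((\<lambda>t. F t \<eta>) \<longlongrightarrow> 0) at_top"
      using AE_nonzero by (rule eventually_mono) (rule Flim)
  qed auto
  have LF: "L2 (F t)" if "t \<ge> 1" for t
    by (rule L2_dominated[OF LH Fm]) (use AE_nonzero FH[OF that] in \<open>auto elim!: eventually_mono\<close>)
  have scal: "L2 (\<lambda>\<xi>. of_real (norm \<xi> powr k) * f t \<xi>) \<and>
      l2norm (\<lambda>\<xi>. of_real (norm \<xi> powr k) * f t \<xi>) = t powr (- ((real CARD('n) / 2 + k) / p + \<alpha>)) * l2norm (F t)" if t: "t \<ge> 1" for t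
  proof -
    have t0: "t > 0" using t by simp
    let ?g = "\<lambda>\<eta>. of_real (norm \<eta> powr k) * f t (s t *\<^sub>R \<eta>)"
    have one: "complex_of_real (t powr (- \<alpha>)) * of_real (t powr \<alpha>) = 1" using t0 by (simp add: powr_minus)
    have g: "?g = (\<lambda>\<eta>. of_real (t powr (- \<alpha>)) * F t \<eta>)"
      by (simp only: F_def mult.assoc[symmetric] one mult_1_left)
    have "L2 ?g" unfolding g by (rule L2_cmult[OF LF[OF t]])
    moreover have "l2norm ?g = t powr (- \<alpha>) * l2norm (F t)" unfolding g l2norm_cmult by simp
    ultimately show ?thesis
      using l2norm_scale[of "f t" t p k] t0 p unfolding s_def
      by (simp add: powr_add[symmetric] mult.assoc[symmetric] algebra_simps)
  qed
  define Q where "Q \<xi> = of_real (norm \<xi> powr k1) * W0 \<xi>" for \<xi>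
  define Q' where "Q' \<xi> = of_real (norm \<xi> powr k2) * W1 \<xi>" for \<xi>
  have LQ: "L2 (\<lambda>\<xi>. cmod (Q \<xi>) + cmod (Q' \<xi>))"
    using Q by (intro L2_add) (auto simp: L2_def Q_def Q'_def)
  \<comment> \<open>Beyond \<open>\<rho>\<close> the kernels turn the weight k into the Sobolev
    weights k1 and k2 of the data and supply an exponential in t, which beats every power.\<close>
  have hQ: "norm (of_real (norm \<xi> powr k) * h t \<xi>) \<le> (B * exp (- d * t)) * norm (cmod (Q \<xi>) + cmod (Q' \<xi>))" if t: "t \<ge> 1" for t \<xi>
  proof (cases "norm \<xi> \<le> \<rho>")
    case True then show ?thesis using B by (simp add: h_def)
  next
    case False
    let ?r = "norm \<xi>"
    have hi: "?r powr k * \<bar>X0 t ?r\<bar> \<le> B * exp (- d * t) * ?r powr k1" "?r powr k * \<bar>X1 t ?r\<bar> \<le> B * exp (- d * t) * ?r powr k2"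
      using high[OF t, of ?r] False by auto
    have "norm (of_real (?r powr k) * h t \<xi>) \<le> ?r powr k * (cmod (of_real (X0 t ?r) * W0 \<xi>) + cmod (of_real (X1 t ?r) * W1 \<xi>))"
      unfolding h_def if_not_P[OF False] norm_mult[of "of_real (?r powr k)"] norm_of_real
      by (simp add: mult_left_mono norm_triangle_ineq)
    also have "\<dots> = (?r powr k * \<bar>X0 t ?r\<bar>) * cmod (W0 \<xi>) + (?r powr k * \<bar>X1 t ?r\<bar>) * cmod (W1 \<xi>)"
      by (simp only: norm_mult norm_of_real distrib_left mult.assoc)
    also have "\<dots> \<le> (B * exp (- d * t) * ?r powr k1) * cmod (W0 \<xi>) + (B * exp (- d * t) * ?r powr k2) * cmod (W1 \<xi>)"
      by (intro add_mono mult_right_mono hi norm_ge_zero)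
    also have "\<dots> = (B * exp (- d * t)) * norm (cmod (Q \<xi>) + cmod (Q' \<xi>))"
      by (simp add: Q_def Q'_def norm_mult algebra_simps)
    finally show ?thesis .
  qed
  have Lh: "L2 (\<lambda>\<xi>. of_real (norm \<xi> powr k) * h t \<xi>) \<and>
     l2norm (\<lambda>\<xi>. of_real (norm \<xi> powr k) * h t \<xi>) \<le> B * exp (- d * t) * l2norm (\<lambda>\<xi>. cmod (Q \<xi>) + cmod (Q' \<xi>))" if t: "t \<ge> 1" for t
    using L2_scaled[OF LQ, of "\<lambda>\<xi>. of_real (norm \<xi> powr k) * h t \<xi>" "B * exp (- d * t)"] hQ[OF t] B by auto
  show LD: "L2 (\<lambda>\<xi>. of_real (norm \<xi> powr k) * D t \<xi>)" if "t \<ge> 1" for t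
    unfolding D distrib_left using scal[OF that] Lh[OF that] by (intro L2_add) auto
  let ?g = "\<lambda>t. t powr (- ((real CARD('n) / 2 + k) / p + \<alpha>))"
  have o1: "(\<lambda>t. ?g t * l2norm (F t)) \<in> o(?g)"
  proof -
    have "((\<lambda>t. l2norm (F t)) \<longlongrightarrow> 0) at_top" using L2_tendsto_l2norm[OF FT] by simp
    then have "(\<lambda>t. l2norm (F t)) \<in> o(\<lambda>_. 1)" by (intro smalloI_tendsto) auto
    from landau_o.small.mult_left[OF this, of ?g] show ?thesis by simp
  qed
  have o2: "(\<lambda>t. B * exp (- d * t) * l2norm (\<lambda>\<xi>. cmod (Q \<xi>) + cmod (Q' \<xi>))) \<in> o(?g)"
  proof -
    define Z where "Z = B * l2norm (\<lambda>\<xi>. cmod (Q \<xi>) + cmod (Q' \<xi>))"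
    have "(\<lambda>t. Z * exp (- d * t)) \<in> o(?g)"
      using exp_decay_smallo[OF d] by (cases "Z = 0") simp_all
    then show ?thesis by (simp add: Z_def mult_ac)
  qed
  have "(\<lambda>t. ?g t * l2norm (F t) + B * exp (- d * t) * l2norm (\<lambda>\<xi>. cmod (Q \<xi>) + cmod (Q' \<xi>))) \<in> o(?g)"
    by (rule sum_in_smallo(1)[OF o1 o2])
  moreover have "\<forall>\<^sub>F t in at_top. norm (l2norm (\<lambda>\<xi>. of_real (norm \<xi> powr k) * D t \<xi>))
      \<le> 1 * norm (?g t * l2norm (F t) + B * exp (- d * t) * l2norm (\<lambda>\<xi>. cmod (Q \<xi>) + cmod (Q' \<xi>)))"
    using eventually_ge_at_top[of 1]
  proof eventually_elim
    case (elim t)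
    have "l2norm (\<lambda>\<xi>. of_real (norm \<xi> powr k) * D t \<xi>)
      \<le> l2norm (\<lambda>\<xi>. of_real (norm \<xi> powr k) * f t \<xi>) + l2norm (\<lambda>\<xi>. of_real (norm \<xi> powr k) * h t \<xi>)"
      unfolding D distrib_left using scal[OF elim] Lh[OF elim] by (intro l2norm_triangle) auto
    also have "\<dots> \<le> ?g t * l2norm (F t) + B * exp (- d * t) * l2norm (\<lambda>\<xi>. cmod (Q \<xi>) + cmod (Q' \<xi>))"
      using scal[OF elim] Lh[OF elim] by simp
    finally show ?case by simp
  qed
  ultimately show "(\<lambda>t. l2norm (\<lambda>\<xi>. of_real (norm \<xi> powr k) * D t \<xi>)) \<in> o(?g)"
    by (rule landau_o.big_small_trans[OF bigoI, rotated])
qed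

section \<open>The Fourier transform of the solution\<close>

lemma sobolev_L2:
  assumes "sobolev k f" shows "L2 f" "L2 (nabla_symbol k (cplx f))"
  using assms unfolding sobolev_def nabla_L2_def by (auto simp: L2_cplx)

lemma l2norm_le_sobolev_norm: "l2norm f \<le> sobolev_norm k f"
  unfolding sobolev_norm_def by (rule real_le_rsqrt) simp

lemma eventually_within_Ici: "(\<And>s. s \<ge> (0::real) \<Longrightarrow> P s) \<Longrightarrow> \<forall>\<^sub>F s in at t within {0..}. P s"
  by (auto simp: eventually_at_filter intro!: always_eventually)

lemma C0_sobolev_L2_tendsto:
  fixes v :: "real \<Rightarrow> real^'n \<Rightarrow> real"
  assumes "C0_sobolev k v" "t \<ge> 0"
  shows "L2_tendsto v (v t) (at t within {0..})"
proof -
  have L: "L2 (v s)" if "s \<ge> 0" for s using assms(1) that sobolev_L2(1) unfolding C0_sobolev_def by blast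
  have lim: "((\<lambda>s. sobolev_norm k (\<lambda>x. v s x - v t x)) \<longlongrightarrow> 0) (at t within {0..})"
    using assms unfolding C0_sobolev_def by blast
  have "\<forall>\<^sub>F s in at t within {0..}. norm (l2norm (\<lambda>x. v s x - v t x)) \<le> sobolev_norm k (\<lambda>x. v s x - v t x)"
    using l2norm_le_sobolev_norm by (intro always_eventually allI) simp
  from Lim_null_comparison[OF this lim] show ?thesis
    unfolding L2_tendsto_def using L assms(2) eventually_within_Ici[of "\<lambda>s. L2 (v s)"] by blast
qed

lemma l2norm_fourier_diff:
  fixes f g :: "real^'n \<Rightarrow> complex"
  assumes "L2 f" "L2 g"
  shows "l2norm (\<lambda>\<xi>. fourier f \<xi> - fourier g \<xi>) = l2norm (\<lambda>x. f x - g x)"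
proof -
  have "l2norm (\<lambda>x. f x - g x) = l2norm (fourier (\<lambda>x. f x - g x))"
    by (rule plancherel[symmetric, OF L2_diff[OF assms]])
  also have "\<dots> = l2norm (\<lambda>\<xi>. fourier f \<xi> - fourier g \<xi>)"
    by (rule l2norm_cong_AE[OF fourier_measurable[OF L2_diff[OF assms]]
        borel_measurable_diff[OF fourier_measurable[OF assms(1)] fourier_measurable[OF assms(2)]]])
      (use fourier_diff[OF assms] in \<open>auto elim!: eventually_mono\<close>)
  finally show ?thesis ..
qed

lemma L2_tendsto_fourier_cplx:
  fixes g :: "real^'n \<Rightarrow> real"
  assumes "L2_tendsto F g net"
  shows "L2_tendsto (\<lambda>i. fourier (cplx (F i))) (fourier (cplx g)) net"
proof -
  note g = L2_tendstoD[OF assms]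
  have gc: "L2 (cplx g)" using g(1) by (simp add: L2_cplx)
  have "\<forall>\<^sub>F i in net. l2norm (\<lambda>x. F i x - g x) = l2norm (\<lambda>\<xi>. fourier (cplx (F i)) \<xi> - fourier (cplx g) \<xi>)"
    using g(2)
  proof eventually_elim
    case (elim i)
    then have "L2 (cplx (F i))" by (simp add: L2_cplx)
    from l2norm_fourier_diff[OF this gc] show ?case
      using l2norm_cplx[of "\<lambda>x. F i x - g x"] by simp
  qed
  from Lim_transform_eventually[OF g(3) this] show ?thesis
    unfolding L2_tendsto_def using g(2) gc
    by (auto intro!: fourier_L2 elim!: eventually_mono simp: L2_cplx)
qed

section \<open>The solution and its data on the Fourier side\<close>

locale damped_wave =
  fixes k0 \<nu> \<sigma> m1 :: real and u0 u1 :: "real^'n \<Rightarrow> real" and u :: "real \<Rightarrow> real^'n \<Rightarrow> real"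
  assumes k0: "k0 \<ge> 0" and \<nu>: "\<nu> > 0" and \<sigma>: "0 < \<sigma>" "\<sigma> \<le> 1"
    and u0: "sobolev (k0 + 1) u0" "integrable lborel u0"
    and u1: "sobolev k0 u1" "integrable lborel u1"
    and u_C0: "C0_sobolev (k0 + 1) u" and u_C1: "C1_sobolev k0 u"
    and solves: "solves_damped_wave \<sigma> \<nu> u"
    and init0: "AE x in lborel. u 0 x = u0 x"
    and init1: "AE x in lborel. time_deriv u 0 x = u1 x"
    and m1: "m1 = (LINT y|lborel. u1 y)"
begin

text \<open>Fourier integrals of the data rather than their Plancherel transforms: these functions
  are defined everywhere, bounded and continuous, so a value at 0 makes sense. \<open>U 0\<close>
  and \<open>V 0\<close> agree with them only AE.\<close>

definition "W0 = fourier_integral (cplx u0)"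
definition "W1 = fourier_integral (cplx u1)"
definition "U t = fourier (cplx (u t))"
definition "V t = fourier (cplx (time_deriv u t))"
definition "m = fourier_const CARD('n) * m1"
definition "damp r = \<nu> * r powr (2 * \<sigma>)"

lemma ut_C0: "C0_sobolev k0 (time_deriv u)"
  using u_C1 by (simp add: C1_sobolev_def)

lemma u_L2: "t \<ge> 0 \<Longrightarrow> L2 (u t)" "t \<ge> 0 \<Longrightarrow> L2 (time_deriv u t)"
  using u_C0 ut_C0 sobolev_L2(1) unfolding C0_sobolev_def by blast+

lemma u_cL2: "t \<ge> 0 \<Longrightarrow> L2 (cplx (u t))" "t \<ge> 0 \<Longrightarrow> L2 (cplx (time_deriv u t))"
  using u_L2 by (simp_all add: L2_cplx)

lemma UV_L2: "t \<ge> 0 \<Longrightarrow> L2 (U t)" "t \<ge> 0 \<Longrightarrow> L2 (V t)"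
  unfolding U_def V_def by (intro fourier_L2 u_cL2; simp)+

lemma u_has_L2_deriv:
  assumes t: "t \<ge> 0"
  shows "has_L2_deriv u (time_deriv u t) t" "has_L2_deriv (\<lambda>s. cplx (u s)) (cplx (time_deriv u t)) t"
proof -
  have "((\<lambda>s. sobolev_norm k0 (\<lambda>x. (u s x - u t x) / (s - t) - time_deriv u t x)) \<longlongrightarrow> 0) (at t within {0..})"
    using u_C1 t by (simp add: C1_sobolev_def)
  moreover have "\<forall>\<^sub>F s in at t within {0..}. norm (l2norm (\<lambda>x. (u s x - u t x) / (s - t) - time_deriv u t x))
     \<le> sobolev_norm k0 (\<lambda>x. (u s x - u t x) / (s - t) - time_deriv u t x)"
    using l2norm_le_sobolev_norm by (intro always_eventually allI) simp
  ultimately have lim: "((\<lambda>s. l2norm (\<lambda>x. (u s x - u t x) / (s - t) - time_deriv u t x)) \<longlongrightarrow> 0) (at t within {0..})"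
    by (rule Lim_null_comparison[rotated])
  have d: "a /\<^sub>R c = a / c" for a c :: real by (simp add: divide_inverse)
  have L: "\<forall>\<^sub>F s in at t within {0..}. L2 (\<lambda>x. (u s x - u t x) /\<^sub>R (s - t))"
    by (rule eventually_within_Ici) (intro L2_scaleR L2_diff u_L2 t; simp)
  show "has_L2_deriv u (time_deriv u t) t"
    unfolding has_L2_deriv_def L2_tendsto_def using lim L u_L2(2)[OF t] unfolding d by blast
  have c: "(complex_of_real a - of_real b) /\<^sub>R c = of_real ((a - b) / c)" for a b c
    by (simp add: scaleR_conv_of_real divide_inverse)
  have c': "(complex_of_real a - of_real b) /\<^sub>R c - of_real w = of_real ((a - b) / c - w)" for a b c w
    unfolding c by simp
  show "has_L2_deriv (\<lambda>s. cplx (u s)) (cplx (time_deriv u t)) t"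
    unfolding has_L2_deriv_def L2_tendsto_def c' l2norm_cplx unfolding c L2_cplx
    using lim L u_L2(2)[OF t] unfolding d by blast
qed

lemma U_has_L2_deriv: "t \<ge> 0 \<Longrightarrow> has_L2_deriv U (V t) t"
  unfolding U_def V_def
  by (subst has_L2_deriv_fourier_iff[symmetric, where U="\<lambda>s. cplx (u s)"])
    (auto intro!: eventually_within_Ici fourier_L2 u_cL2 u_has_L2_deriv)

lemma W_measurable [measurable]: "W0 \<in> borel_measurable lborel" "W1 \<in> borel_measurable lborel"
  unfolding W0_def W1_def using u0(2) u1(2) by measurable

lemma W_integrable: "integrable lborel (cplx u0)" "integrable lborel (cplx u1)"
  using u0(2) u1(2) by auto

lemma UV_initial: "AE \<xi> in lborel. U 0 \<xi> = W0 \<xi>" "AE \<xi> in lborel. V 0 \<xi> = W1 \<xi>"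
proof -
  have L: "L2 (cplx u0)" "L2 (cplx u1)" using sobolev_L2(1)[OF u0(1)] sobolev_L2(1)[OF u1(1)] by (simp_all add: L2_cplx)
  have "U 0 = fourier (cplx u0)" unfolding U_def
    by (rule fourier_cong_AE) (use init0 L2_measurable[OF L(1)] L2_measurable[OF u_cL2(1)[OF order_refl]] in \<open>auto elim!: eventually_mono\<close>)
  then show "AE \<xi> in lborel. U 0 \<xi> = W0 \<xi>"
    using fourier_eq_integral[OF L(1) W_integrable(1)] by (simp add: W0_def)
  have "V 0 = fourier (cplx u1)" unfolding V_def
    by (rule fourier_cong_AE) (use init1 L2_measurable[OF L(2)] L2_measurable[OF u_cL2(2)[OF order_refl]] in \<open>auto elim!: eventually_mono\<close>)
  then show "AE \<xi> in lborel. V 0 \<xi> = W1 \<xi>"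
    using fourier_eq_integral[OF L(2) W_integrable(2)] by (simp add: W1_def)
qed

lemma W_L2: "L2 (\<lambda>\<xi>. of_real (norm \<xi> powr (k0 + 1)) * W0 \<xi>)" "L2 (\<lambda>\<xi>. of_real (norm \<xi> powr k0) * W1 \<xi>)"
proof -
  have L: "L2 (cplx u0)" "L2 (cplx u1)" using sobolev_L2(1)[OF u0(1)] sobolev_L2(1)[OF u1(1)] by (simp_all add: L2_cplx)
  show "L2 (\<lambda>\<xi>. of_real (norm \<xi> powr (k0 + 1)) * W0 \<xi>)"
    by (rule L2_cong_AE[OF sobolev_L2(2)[OF u0(1)]], measurable)
      (use fourier_eq_integral[OF L(1) W_integrable(1)] in \<open>auto simp: nabla_symbol_def W0_def elim!: eventually_mono\<close>)
  show "L2 (\<lambda>\<xi>. of_real (norm \<xi> powr k0) * W1 \<xi>)"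
    by (rule L2_cong_AE[OF sobolev_L2(2)[OF u1(1)]], measurable)
      (use fourier_eq_integral[OF L(2) W_integrable(2)] in \<open>auto simp: nabla_symbol_def W1_def elim!: eventually_mono\<close>)
qed

lemma W_bounded: "\<exists>M. \<forall>\<xi>. cmod (W0 \<xi>) \<le> M \<and> cmod (W1 \<xi>) \<le> M"
proof -
  let ?A = "fourier_const CARD('n) * (LINT x|lborel. cmod (cplx u0 x))"
  let ?B = "fourier_const CARD('n) * (LINT x|lborel. cmod (cplx u1 x))"
  have "cmod (W0 \<xi>) \<le> max ?A ?B \<and> cmod (W1 \<xi>) \<le> max ?A ?B" for \<xi>
    unfolding W0_def W1_def using fourier_integral_bound[of "cplx u0" \<xi>] fourier_integral_bound[of "cplx u1" \<xi>]
    by (meson max.cobounded1 max.cobounded2 order_trans)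
  then show ?thesis by blast
qed

lemma W1_at_0: "isCont W1 0" "W1 0 = of_real m"
proof -
  show "isCont W1 0"
    using fourier_integral_continuous[OF W_integrable(2)] by (simp add: W1_def continuous_on_eq_continuous_at)
  show "W1 0 = of_real m"
    unfolding W1_def fourier_integral_def m_def by (simp add: m1)
qed

lemma damp_nonneg: "0 \<le> damp r"
  using \<nu> by (simp add: damp_def)

lemma damp_measurable [measurable]: "damp \<in> borel_measurable borel"
  unfolding damp_def[abs_def] by measurable

lemma kern_family_measurable [measurable]:
  "(\<lambda>\<xi>::real^'n. kern (damp (norm \<xi>)) (norm \<xi>) t) \<in> borel_measurable borel"
  "(\<lambda>\<xi>::real^'n. dkern (damp (norm \<xi>)) (norm \<xi>) t) \<in> borel_measurable borel"
  "(\<lambda>\<xi>::real^'n. kern0 (damp (norm \<xi>)) (norm \<xi>) t) \<in> borel_measurable borel"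
  by measurable

text \<open>Duality is applied to two solutions of the adjoint system: (kern0, kern), which starts
  at (1, 0) and isolates \<open>U t\<close>, and its time derivative
  \<open>(- r\<^sup>2 * kern, dkern)\<close>, which starts at (0, 1) and isolates
  \<open>V t\<close>. The local bounds on the multipliers come from the energy.\<close>

lemma solution_formula:
  assumes t: "t > 0"
  shows "AE \<xi> in lborel. U t \<xi> = of_real (kern0 (damp (norm \<xi>)) (norm \<xi>) t) * W0 \<xi> + of_real (kern (damp (norm \<xi>)) (norm \<xi>) t) * W1 \<xi>"
    and "AE \<xi> in lborel. V t \<xi> = of_real (- ((norm \<xi>)\<^sup>2 * kern (damp (norm \<xi>)) (norm \<xi>) t)) * W0 \<xi> + of_real (dkern (damp (norm \<xi>)) (norm \<xi>) t) * W1 \<xi>"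
proof -
  let ?K = "\<lambda>s \<xi>::real^'n. kern (damp (norm \<xi>)) (norm \<xi>) s" and ?K' = "\<lambda>s \<xi>::real^'n. dkern (damp (norm \<xi>)) (norm \<xi>) s"
    and ?Z = "\<lambda>s \<xi>::real^'n. kern0 (damp (norm \<xi>)) (norm \<xi>) s"
  have cU: "L2_tendsto U (U s) (at s within {0..})" "L2_tendsto V (V s) (at s within {0..})" if "s \<ge> 0" for s
    unfolding U_def[abs_def] V_def[abs_def]
    by (rule L2_tendsto_fourier_cplx[OF C0_sobolev_L2_tendsto[OF u_C0 that]] L2_tendsto_fourier_cplx[OF C0_sobolev_L2_tendsto[OF ut_C0 that]])+
  have eq: "\<exists>w. has_L2_deriv (\<lambda>s \<xi>. V s \<xi> / of_real (1 + (norm \<xi>)\<^sup>2)) (\<lambda>\<xi>. w \<xi> / of_real (1 + (norm \<xi>)\<^sup>2)) s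
      \<and> (AE \<xi> in lborel. w \<xi> + of_real ((norm \<xi>)\<^sup>2) * U s \<xi> + of_real (damp (norm \<xi>)) * V s \<xi> = 0)" if "s > 0" for s
    using solves that unfolding solves_damped_wave_def U_def V_def damp_def by blast
  have kb: "\<bar>?K s \<xi>\<bar> \<le> t" "\<bar>?K' s \<xi>\<bar> \<le> 1" "\<bar>?Z s \<xi>\<bar> \<le> 1 + damp (norm \<xi>) * t" if "s \<in> {0..t}" for s and \<xi> :: "real^'n"
  proof -
    have s: "0 \<le> s" "s \<le> t" using that by auto
    show 1: "\<bar>?K s \<xi>\<bar> \<le> t" and 2: "\<bar>?K' s \<xi>\<bar> \<le> 1"
      using dkern_le_1[OF damp_nonneg s(1), of "norm \<xi>" "norm \<xi>"] s by auto
    have "\<bar>?Z s \<xi>\<bar> \<le> \<bar>?K' s \<xi>\<bar> + damp (norm \<xi>) * \<bar>?K s \<xi>\<bar>"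
      unfolding kern0_def using damp_nonneg[of "norm \<xi>"] by (metis abs_triangle_ineq abs_mult abs_of_nonneg)
    then show "\<bar>?Z s \<xi>\<bar> \<le> 1 + damp (norm \<xi>) * t"
      using 2 mult_left_mono[OF 1 damp_nonneg[of "norm \<xi>"]] by linarith
  qed
  have db: "damp (norm \<xi>) \<le> damp R" if "norm \<xi> \<le> R" for \<xi> :: "real^'n" and R
    unfolding damp_def using \<nu> \<sigma> that by (intro mult_left_mono powr_mono2) auto
  have t1: "t \<ge> 0" using t by simp
  note duality = second_order_duality[OF t UV_L2 cU U_has_L2_deriv[OF less_imp_le] eq]
  have "AE \<xi> in lborel. of_real (?Z t \<xi>) * U 0 \<xi> + of_real (?K t \<xi>) * V 0 \<xi> = of_real (?Z 0 \<xi>) * U t \<xi> + of_real (?K 0 \<xi>) * V t \<xi>"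
  proof (rule duality)
    show "((\<lambda>s. ?Z s \<xi>) has_real_derivative - (norm \<xi>)\<^sup>2 * ?K s \<xi>) (at s)" for s and \<xi> :: "real^'n"
      using kern0_deriv by simp
    show "((\<lambda>s. ?K s \<xi>) has_real_derivative ?Z s \<xi> - damp (norm \<xi>) * ?K s \<xi>) (at s)" for s and \<xi> :: "real^'n"
      using kern_deriv by (simp add: kern0_def)
    show "\<exists>M. \<forall>s\<in>{0..t}. \<forall>\<xi>::real^'n. norm \<xi> \<le> R \<longrightarrow> \<bar>?Z s \<xi>\<bar> \<le> M \<and> \<bar>?K s \<xi>\<bar> \<le> M \<and> \<bar>damp (norm \<xi>)\<bar> \<le> M" for R
    proof (intro exI[of _ "1 + damp R * t + t + damp R"] ballI allI impI)
      fix s and \<xi> :: "real^'n" assume s: "s \<in> {0..t}" and \<xi>: "norm \<xi> \<le> R"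
      have "0 \<le> damp R * t" using damp_nonneg t1 by simp
      then show "\<bar>?Z s \<xi>\<bar> \<le> 1 + damp R * t + t + damp R \<and> \<bar>?K s \<xi>\<bar> \<le> 1 + damp R * t + t + damp R \<and> \<bar>damp (norm \<xi>)\<bar> \<le> 1 + damp R * t + t + damp R"
        using kb[OF s, of \<xi>] mult_right_mono[OF db[OF \<xi>] t1] db[OF \<xi>] damp_nonneg[of "norm \<xi>"] damp_nonneg[of R] t1 by auto
    qed
  qed measurable
  then show "AE \<xi> in lborel. U t \<xi> = of_real (?Z t \<xi>) * W0 \<xi> + of_real (?K t \<xi>) * W1 \<xi>"
    using UV_initial by eventually_elim simp
  have "AE \<xi> in lborel. of_real (- ((norm \<xi>)\<^sup>2 * ?K t \<xi>)) * U 0 \<xi> + of_real (?K' t \<xi>) * V 0 \<xi> = of_real (- ((norm \<xi>)\<^sup>2 * ?K 0 \<xi>)) * U t \<xi> + of_real (?K' 0 \<xi>) * V t \<xi>"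
  proof (rule duality)
    show "((\<lambda>s. - ((norm \<xi>)\<^sup>2 * ?K s \<xi>)) has_real_derivative - (norm \<xi>)\<^sup>2 * ?K' s \<xi>) (at s)" for s and \<xi> :: "real^'n"
      by (auto intro!: derivative_eq_intros kern_deriv)
    show "((\<lambda>s. ?K' s \<xi>) has_real_derivative - ((norm \<xi>)\<^sup>2 * ?K s \<xi>) - damp (norm \<xi>) * ?K' s \<xi>) (at s)" for s and \<xi> :: "real^'n"
      using dkern_deriv by simp
    show "\<exists>M. \<forall>s\<in>{0..t}. \<forall>\<xi>::real^'n. norm \<xi> \<le> R \<longrightarrow> \<bar>- ((norm \<xi>)\<^sup>2 * ?K s \<xi>)\<bar> \<le> M \<and> \<bar>?K' s \<xi>\<bar> \<le> M \<and> \<bar>damp (norm \<xi>)\<bar> \<le> M" for R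
    proof (intro exI[of _ "R\<^sup>2 * t + 1 + damp R"] ballI allI impI)
      fix s and \<xi> :: "real^'n" assume s: "s \<in> {0..t}" and \<xi>: "norm \<xi> \<le> R"
      have "\<bar>- ((norm \<xi>)\<^sup>2 * ?K s \<xi>)\<bar> \<le> R\<^sup>2 * t"
        unfolding abs_minus_cancel abs_mult using \<xi> kb(1)[OF s, of \<xi>] by (intro mult_mono) (auto intro!: power_mono)
      moreover have "0 \<le> R\<^sup>2 * t" using t1 by simp
      ultimately show "\<bar>- ((norm \<xi>)\<^sup>2 * ?K s \<xi>)\<bar> \<le> R\<^sup>2 * t + 1 + damp R \<and> \<bar>?K' s \<xi>\<bar> \<le> R\<^sup>2 * t + 1 + damp R \<and> \<bar>damp (norm \<xi>)\<bar> \<le> R\<^sup>2 * t + 1 + damp R"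
        using kb(2)[OF s, of \<xi>] db[OF \<xi>] damp_nonneg[of "norm \<xi>"] damp_nonneg[of R] by auto
    qed
  qed measurable
  then show "AE \<xi> in lborel. V t \<xi> = of_real (- ((norm \<xi>)\<^sup>2 * ?K t \<xi>)) * W0 \<xi> + of_real (?K' t \<xi>) * W1 \<xi>"
    using UV_initial by eventually_elim simp
qed

end

section \<open>Low frequencies\<close>

text \<open>The part of the assumptions on kernels and profile that has to be proved separately for
  each range of \<sigma>. The kernels are dominated only where the actual frequency is at most
  \<open>\<rho>\<close>, the profile everywhere. Here \<open>p\<close> is the scaling exponent,
  \<alpha> the power of t that normalises, and \<open>e\<close> the order at the origin.\<close>

definition low_freq :: "real \<Rightarrow> real \<Rightarrow> real \<Rightarrow> (real \<Rightarrow> real \<Rightarrow> real) \<Rightarrow> (real \<Rightarrow> real \<Rightarrow> real) \<Rightarrow> (real \<Rightarrow> real \<Rightarrow> real) \<Rightarrow> bool" where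
  "low_freq p \<alpha> e X0 X1 P \<longleftrightarrow> (\<exists>A c \<rho>. A \<ge> 0 \<and> c > 0 \<and> \<rho> > 0 \<and>
    (\<forall>t\<ge>1. \<forall>x>0. t powr (-1/p) * x \<le> \<rho> \<longrightarrow>
      t powr \<alpha> * \<bar>X0 t (t powr (-1/p) * x)\<bar> \<le> A * envelope e c p x \<and>
      t powr \<alpha> * \<bar>X1 t (t powr (-1/p) * x)\<bar> \<le> A * envelope e c p x) \<and>
    (\<forall>t\<ge>1. \<forall>x>0. t powr \<alpha> * \<bar>P t (t powr (-1/p) * x)\<bar> \<le> A * envelope e c p x) \<and>
    (\<forall>x>0. ((\<lambda>t. t powr \<alpha> * X0 t (t powr (-1/p) * x)) \<longlongrightarrow> 0) at_top) \<and>
    (\<forall>x>0. ((\<lambda>t. t powr \<alpha> * (X1 t (t powr (-1/p) * x) - P t (t powr (-1/p) * x))) \<longlongrightarrow> 0) at_top))"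

lemma scaled_powr: "(t powr (-1/p) * x) powr a = t powr (-a/p) * x powr a" for t x p a :: real
  by (simp add: powr_mult powr_powr)

lemma scaled_powr_tendsto_0:
  assumes "p > 0" "a > 0" "x > 0"
  shows "((\<lambda>t::real. (t powr (-1/p) * x) powr a) \<longlongrightarrow> 0) at_top"
proof -
  have "((\<lambda>t::real. t powr (-a/p)) \<longlongrightarrow> 0) at_top"
    using assms by (intro tendsto_neg_powr filterlim_ident) auto
  then have "((\<lambda>t::real. t powr (-a/p) * x powr a) \<longlongrightarrow> 0) at_top" by (rule tendsto_mult_left_zero)
  then show ?thesis unfolding scaled_powr .
qed

text \<open>By homogeneity the kernel is its own profile and the difference vanishes identically.
  Only the contribution of the first datum has to tend to 0; in both statements a factor 1/t is left
  over.\<close>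

lemma low_freq_half:
  assumes \<nu>: "\<nu> > 0"
  shows "low_freq 1 (-1) 0 (\<lambda>t r. kern0 (\<nu> * r) r t) (\<lambda>t r. kern (\<nu> * r) r t) (\<lambda>t r. kern (\<nu> * r) r t)"
    and "low_freq 1 0 0 (\<lambda>t r. - (r\<^sup>2 * kern (\<nu> * r) r t)) (\<lambda>t r. dkern (\<nu> * r) r t) (\<lambda>t r. dkern (\<nu> * r) r t)"
proof -
  obtain C c where C: "C > 0" "c > 0" and
    b: "\<And>s. s > 0 \<Longrightarrow> \<bar>kern \<nu> 1 s\<bar> \<le> C * (s * exp (- c * s)) \<and> \<bar>kern \<nu> 1 s\<bar> \<le> C * exp (- c * s)
    \<and> \<bar>dkern \<nu> 1 s\<bar> \<le> C * exp (- c * s) \<and> \<bar>kern0 \<nu> 1 s\<bar> \<le> C * exp (- c * s)"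
    using kern_unit_bounds[OF \<nu>] by blast
  have env: "exp (- c * x) \<le> envelope 0 c 1 x" "x * exp (- c * x) \<le> envelope 0 c 1 x" if "x > 0" for x
    using powr_le_envelope[OF that, of 0 0 c 1] powr_le_envelope[OF that, of 0 1 c 1] that by auto
  have CE: "C * exp (- c * x) \<le> C * envelope 0 c 1 x" "C * (x * exp (- c * x)) \<le> C * envelope 0 c 1 x" if "x > 0" for x
    using env[OF that] C by auto
  have r: "t powr (-1/1) * x = x / t" if "t \<ge> 1" for t x :: real using that by (simp add: powr_minus divide_inverse)
  have eqs: "kern (\<nu> * (x / t)) (x / t) t = kern \<nu> 1 x * t / x" "dkern (\<nu> * (x / t)) (x / t) t = dkern \<nu> 1 x"
    "kern0 (\<nu> * (x / t)) (x / t) t = kern0 \<nu> 1 x" if "t \<ge> 1" "x > 0" for t x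
    using kern_scale[of "x / t" \<nu> t] that by auto
  have inv0: "((\<lambda>t::real. t powr -1 * z) \<longlongrightarrow> 0) at_top" for z
    by (intro tendsto_mult_left_zero tendsto_neg_powr filterlim_ident) auto
  have K: "t powr -1 * \<bar>kern (\<nu> * (x / t)) (x / t) t\<bar> \<le> C * envelope 0 c 1 x" if "t \<ge> 1" "x > 0" for t x
  proof -
    have "t powr -1 * \<bar>kern (\<nu> * (x / t)) (x / t) t\<bar> = \<bar>kern \<nu> 1 x\<bar> / x"
      unfolding eqs[OF that] using that by (simp add: abs_mult abs_divide powr_minus)
    also have "\<dots> \<le> C * exp (- c * x)" using b[OF that(2)] that by (simp add: divide_le_eq mult_ac)
    finally show ?thesis using CE(1)[OF that(2)] by linarith
  qed
  show "low_freq 1 (-1) 0 (\<lambda>t r. kern0 (\<nu> * r) r t) (\<lambda>t r. kern (\<nu> * r) r t) (\<lambda>t r. kern (\<nu> * r) r t)"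
    unfolding low_freq_def
  proof (rule exI[of _ C], rule exI[of _ c], rule exI[of _ 1], intro conjI allI impI)
    fix t x :: real assume t: "t \<ge> 1" and x: "x > 0"
    show "t powr - 1 * \<bar>kern (\<nu> * (t powr (- 1 / 1) * x)) (t powr (- 1 / 1) * x) t\<bar> \<le> C * envelope 0 c 1 x"
      unfolding r[OF t] by (rule K[OF t x])
    then show "t powr - 1 * \<bar>kern (\<nu> * (t powr (- 1 / 1) * x)) (t powr (- 1 / 1) * x) t\<bar> \<le> C * envelope 0 c 1 x" .
    have "t powr -1 * \<bar>kern0 \<nu> 1 x\<bar> \<le> 1 * (C * exp (- c * x))"
      using b[OF x] t by (intro mult_mono) (auto simp: powr_minus inverse_le_1_iff)
    then show "t powr - 1 * \<bar>kern0 (\<nu> * (t powr (- 1 / 1) * x)) (t powr (- 1 / 1) * x) t\<bar> \<le> C * envelope 0 c 1 x"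
      unfolding r[OF t] eqs[OF t x] using CE(1)[OF x] by linarith
  next
    fix x :: real assume x: "x > 0"
    show "((\<lambda>t. t powr - 1 * kern0 (\<nu> * (t powr (- 1 / 1) * x)) (t powr (- 1 / 1) * x) t) \<longlongrightarrow> 0) at_top"
      by (rule Lim_transform_eventually[OF inv0[of "kern0 \<nu> 1 x"]])
        (use eventually_ge_at_top[of 1] in \<open>eventually_elim, simp only: r eqs x\<close>)
  qed (use C in auto)
  show "low_freq 1 0 0 (\<lambda>t r. - (r\<^sup>2 * kern (\<nu> * r) r t)) (\<lambda>t r. dkern (\<nu> * r) r t) (\<lambda>t r. dkern (\<nu> * r) r t)"
    unfolding low_freq_def
  proof (rule exI[of _ C], rule exI[of _ c], rule exI[of _ 1], intro conjI allI impI)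
    fix t x :: real assume t: "t \<ge> 1" and x: "x > 0"
    have D: "t powr 0 * \<bar>dkern (\<nu> * (t powr (- 1 / 1) * x)) (t powr (- 1 / 1) * x) t\<bar> \<le> C * envelope 0 c 1 x"
      unfolding r[OF t] eqs[OF t x] using b[OF x] CE(1)[OF x] t by simp
    then show "t powr 0 * \<bar>dkern (\<nu> * (t powr (- 1 / 1) * x)) (t powr (- 1 / 1) * x) t\<bar> \<le> C * envelope 0 c 1 x" .
    show "t powr 0 * \<bar>dkern (\<nu> * (t powr (- 1 / 1) * x)) (t powr (- 1 / 1) * x) t\<bar> \<le> C * envelope 0 c 1 x" by (rule D)
    have "\<bar>(x / t)\<^sup>2 * (kern \<nu> 1 x * t / x)\<bar> = x / t * \<bar>kern \<nu> 1 x\<bar>"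
      using t x by (simp add: abs_mult power2_eq_square)
    also have "\<dots> \<le> x * (C * exp (- c * x))" using b[OF x] t x by (intro mult_mono) (auto simp: divide_le_eq)
    finally show "t powr 0 * \<bar>- ((t powr (- 1 / 1) * x)\<^sup>2 * kern (\<nu> * (t powr (- 1 / 1) * x)) (t powr (- 1 / 1) * x) t)\<bar> \<le> C * envelope 0 c 1 x"
      unfolding r[OF t] eqs[OF t x] using CE(2)[OF x] t by (simp add: mult_ac)
  next
    fix x :: real assume x: "x > 0"
    show "((\<lambda>t. t powr 0 * - ((t powr (- 1 / 1) * x)\<^sup>2 * kern (\<nu> * (t powr (- 1 / 1) * x)) (t powr (- 1 / 1) * x) t)) \<longlongrightarrow> 0) at_top"
    proof (rule Lim_transform_eventually[OF inv0[of "- (x * kern \<nu> 1 x)"]])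
      show "\<forall>\<^sub>F t in at_top. t powr -1 * - (x * kern \<nu> 1 x) = t powr 0 * - ((t powr (- 1 / 1) * x)\<^sup>2 * kern (\<nu> * (t powr (- 1 / 1) * x)) (t powr (- 1 / 1) * x) t)"
        using eventually_ge_at_top[of 1]
        by eventually_elim (simp only: r eqs x, use x in \<open>simp add: power2_eq_square powr_minus field_simps\<close>)
    qed
  qed (use C in auto)
qed

section \<open>Kernels by the sign of the discriminant\<close>

lemma kern_overdamped:
  assumes r: "r > 0" and \<nu>: "\<nu> > 0" and q: "4 * r powr (2 - 4 * \<sigma>) < \<nu>\<^sup>2"
  defines "s \<equiv> sqrt (\<nu>\<^sup>2 - 4 * r powr (2 - 4 * \<sigma>))" and "a \<equiv> r powr (2 * \<sigma>)"
  defines "Ep \<equiv> \<lambda>t. exp (- ((\<nu> - s) / 2 * (a * t)))" and "Em \<equiv> \<lambda>t. exp (- ((\<nu> + s) / 2 * (a * t)))"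
  shows "kern (\<nu> * r powr (2 * \<sigma>)) r t = (Ep t - Em t) / (a * s)"
    and "dkern (\<nu> * r powr (2 * \<sigma>)) r t = ((s - \<nu>) * Ep t + (s + \<nu>) * Em t) / (2 * s)"
    and "kern0 (\<nu> * r powr (2 * \<sigma>)) r t = ((s + \<nu>) * Ep t + (s - \<nu>) * Em t) / (2 * s)"
proof -
  have s: "s > 0" "s\<^sup>2 = \<nu>\<^sup>2 - 4 * r powr (2 - 4 * \<sigma>)" using q by (auto simp: s_def)
  have a: "a > 0" using r by (simp add: a_def)
  have r2: "r\<^sup>2 = r powr 2" using r by simp
  have "r\<^sup>2 = a\<^sup>2 * r powr (2 - 4 * \<sigma>)"
    unfolding a_def r2 power2_eq_square[of "_ powr _"] powr_add[symmetric] by simp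
  \<comment> \<open>The dominant damping \<open>a\<close> is factored out of the discriminant; the
    two decay rates are then a (\<nu> - s) / 2 and a (\<nu> + s) / 2.\<close>
  then have d: "(\<nu> * a)\<^sup>2 / 4 - r\<^sup>2 = (a * s / 2)\<^sup>2" by (simp add: power_mult_distrib s(2) power_divide algebra_simps)
  have pos: "a * s / 2 > 0" using a s by simp
  have e: "exp (- (\<nu> * a / 2) * t) * exp (a * s / 2 * t) = Ep t" "exp (- (\<nu> * a / 2) * t) * exp (- (a * s / 2 * t)) = Em t"
    unfolding Ep_def Em_def exp_add[symmetric] by (simp_all add: field_simps)
  have sh: "exp (- (\<nu> * a / 2) * t) * sinh (a * s / 2 * t) = (Ep t - Em t) / 2"
    "exp (- (\<nu> * a / 2) * t) * cosh (a * s / 2 * t) = (Ep t + Em t) / 2"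
    unfolding sinh_field_def cosh_field_def e[symmetric] by (simp_all add: algebra_simps)
  show K: "kern (\<nu> * r powr (2 * \<sigma>)) r t = (Ep t - Em t) / (a * s)"
    unfolding a_def[symmetric] kern_def d gsin_gcos_pos[OF pos] times_divide_eq_right sh using a s by (simp add: field_simps)
  show D: "dkern (\<nu> * r powr (2 * \<sigma>)) r t = ((s - \<nu>) * Ep t + (s + \<nu>) * Em t) / (2 * s)"
    unfolding a_def[symmetric] dkern_def d gsin_gcos_pos[OF pos] right_diff_distrib sh
  proof -
    have "exp (- (\<nu> * a / 2) * t) * (\<nu> * a / 2 * (sinh (a * s / 2 * t) / (a * s / 2)))
      = \<nu> * a / 2 * (exp (- (\<nu> * a / 2) * t) * sinh (a * s / 2 * t)) / (a * s / 2)" by simp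
    also have "\<dots> = \<nu> / s * ((Ep t - Em t) / 2)" unfolding sh using a s by simp
    finally show "(Ep t + Em t) / 2 - exp (- (\<nu> * a / 2) * t) * (\<nu> * a / 2 * (sinh (a * s / 2 * t) / (a * s / 2)))
      = ((s - \<nu>) * Ep t + (s + \<nu>) * Em t) / (2 * s)" using s by (simp add: field_simps)
  qed
  show "kern0 (\<nu> * r powr (2 * \<sigma>)) r t = ((s + \<nu>) * Ep t + (s - \<nu>) * Em t) / (2 * s)"
    unfolding kern0_def K D unfolding a_def[symmetric] using a s by (simp add: field_simps)
qed

lemma kern_underdamped:
  assumes r: "r > 0" and \<nu>: "\<nu> > 0" and q: "\<nu>\<^sup>2 * r powr (4 * \<sigma> - 2) / 4 < 1"
  defines "s \<equiv> sqrt (1 - \<nu>\<^sup>2 * r powr (4 * \<sigma> - 2) / 4)"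
  defines "E \<equiv> \<lambda>t. exp (- (\<nu> / 2 * (r powr (2 * \<sigma>) * t)))"
  shows "kern (\<nu> * r powr (2 * \<sigma>)) r t = E t * sin (r * t * s) / (r * s)"
    and "dkern (\<nu> * r powr (2 * \<sigma>)) r t = E t * (cos (r * t * s) - \<nu> / 2 * r powr (2 * \<sigma> - 1) * sin (r * t * s) / s)"
    and "kern0 (\<nu> * r powr (2 * \<sigma>)) r t = E t * (cos (r * t * s) + \<nu> / 2 * r powr (2 * \<sigma> - 1) * sin (r * t * s) / s)"
proof -
  define a where "a = r powr (2 * \<sigma>)"
  have s: "s > 0" "s\<^sup>2 = 1 - \<nu>\<^sup>2 * r powr (4 * \<sigma> - 2) / 4" using q by (auto simp: s_def)
  have r2: "r\<^sup>2 = r powr 2" using r by simp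
  have "a\<^sup>2 = r\<^sup>2 * r powr (4 * \<sigma> - 2)"
    unfolding a_def r2 power2_eq_square[of "_ powr _"] powr_add[symmetric] by simp
  \<comment> \<open>Here the frequency \<open>r\<close> is factored out, since damping is the
    perturbation: \<open>r * s\<close> is the damped frequency.\<close>
  then have d: "(\<nu> * a)\<^sup>2 / 4 - r\<^sup>2 = - (r * s)\<^sup>2" by (simp add: power_mult_distrib s(2) algebra_simps)
  have pos: "r * s > 0" using r s by simp
  have ar: "a / r = r powr (2 * \<sigma> - 1)" using r by (simp add: a_def powr_diff)
  have E: "exp (- (\<nu> * a / 2) * t) = E t" by (simp add: E_def a_def)
  show K: "kern (\<nu> * r powr (2 * \<sigma>)) r t = E t * sin (r * t * s) / (r * s)"
    unfolding a_def[symmetric] kern_def d gsin_gcos_pos[OF pos] E by (simp add: mult_ac)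
  show D: "dkern (\<nu> * r powr (2 * \<sigma>)) r t = E t * (cos (r * t * s) - \<nu> / 2 * r powr (2 * \<sigma> - 1) * sin (r * t * s) / s)"
    unfolding a_def[symmetric] dkern_def d gsin_gcos_pos[OF pos] E ar[symmetric] by (simp add: mult_ac)
  show "kern0 (\<nu> * r powr (2 * \<sigma>)) r t = E t * (cos (r * t * s) + \<nu> / 2 * r powr (2 * \<sigma> - 1) * sin (r * t * s) / s)"
    unfolding kern0_def K D unfolding a_def[symmetric] ar[symmetric] using r s by (simp add: field_simps)
qed

lemma sin_cos_lipschitz: "\<bar>sin a - sin b\<bar> \<le> \<bar>a - b\<bar>" "\<bar>cos a - cos b\<bar> \<le> \<bar>a - b\<bar>" for a b :: real
proof -
  have "\<bar>sin a - sin b\<bar> \<le> 1 * \<bar>a - b\<bar>"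
    by (rule real_mvt_bound[of "min a b" "max a b" sin cos]) (auto intro!: derivative_eq_intros)
  then show "\<bar>sin a - sin b\<bar> \<le> \<bar>a - b\<bar>" by simp
  have "\<bar>cos a - cos b\<bar> \<le> 1 * \<bar>a - b\<bar>"
    by (rule real_mvt_bound[of "min a b" "max a b" cos "\<lambda>x. - sin x"]) (auto intro!: derivative_eq_intros)
  then show "\<bar>cos a - cos b\<bar> \<le> \<bar>a - b\<bar>" by simp
qed

lemma small_powr_radius:
  assumes "a > 0" "q0 > (0::real)"
  shows "q0 powr (1/a) > 0" "\<And>r. r > 0 \<Longrightarrow> r \<le> q0 powr (1/a) \<Longrightarrow> r powr a \<le> q0"
proof -
  fix r :: real assume "r > 0" "r \<le> q0 powr (1/a)"
  then have "r powr a \<le> (q0 powr (1/a)) powr a" using assms by (intro powr_mono2) auto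
  then show "r powr a \<le> q0" using assms by (simp add: powr_powr)
qed (use assms in simp)

text \<open>In the scaled variable the damping factor is exactly exp(- \<nu> x^p / 2). The phase r t
  tends to infinity, so closeness of the frequencies is not enough; what matters is that the phase
  error r t (1 - s) still tends to 0. The singularity 1/r of the profile gives the order -1.\<close>

lemma low_freq_large:
  assumes \<nu>: "\<nu> > 0" and \<sigma>: "1/2 < \<sigma>" "\<sigma> \<le> 1"
  defines "p \<equiv> 2 * \<sigma>"
  shows "low_freq p (-1/p) (-1) (\<lambda>t r. kern0 (\<nu> * r powr (2 * \<sigma>)) r t) (\<lambda>t r. kern (\<nu> * r powr (2 * \<sigma>)) r t)
       (\<lambda>t r. exp (- (\<nu> / 2) * t * r powr (2 * \<sigma>)) * sin (t * r) / r)"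
    and "low_freq p 0 (-1) (\<lambda>t r. - (r\<^sup>2 * kern (\<nu> * r powr (2 * \<sigma>)) r t)) (\<lambda>t r. dkern (\<nu> * r powr (2 * \<sigma>)) r t)
       (\<lambda>t r. exp (- (\<nu> * t * r powr (2 * \<sigma>) / 2)) * cos (t * r))"
proof -
  have p: "p > 1" "p \<le> 2" using \<sigma> by (auto simp: p_def)
  \<comment> \<open>With q \<le> q0 the term \<nu>^2 q / 4 is at most 3/4, so the square root
    \<open>s\<close> stays above 1/2.\<close>
  define q0 where "q0 = 3 / \<nu>\<^sup>2"
  have q0: "q0 > 0" using \<nu> by (simp add: q0_def)
  define \<rho> where "\<rho> = q0 powr (1 / (4 * \<sigma> - 2))"
  have \<rho>: "\<rho> > 0" "\<And>r. r > 0 \<Longrightarrow> r \<le> \<rho> \<Longrightarrow> r powr (4 * \<sigma> - 2) \<le> q0"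
    using small_powr_radius[of "4 * \<sigma> - 2" q0] \<sigma> q0 by (auto simp: \<rho>_def)
  define r where "r t x = t powr (-1/p) * x" for t x :: real
  define \<alpha> where "\<alpha> = -1/p"
  define q where "q t x = r t x powr (4 * \<sigma> - 2)" for t x
  define s where "s t x = sqrt (1 - \<nu>\<^sup>2 * q t x / 4)" for t x
  define E where "E x = exp (- (\<nu> / 2) * x powr p)" for x
  have E0: "E x > 0" for x by (simp add: E_def)
  have r0: "r t x > 0" if "t \<ge> 1" "x > 0" for t x using that by (simp add: r_def)
  have rp: "r t x powr (2 * \<sigma>) * t = x powr p" if "t \<ge> 1" "x > 0" for t x
    using scaled_powr[of t p x p] that p by (simp add: r_def p_def powr_minus)
  have sq: "r t x powr (2 * \<sigma> - 1) = sqrt (q t x)" if "t \<ge> 1" "x > 0" for t x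
  proof -
    have "(4 * \<sigma> - 2) * (1/2) = 2 * \<sigma> - 1" by simp
    moreover have "sqrt (q t x) = q t x powr (1/2)" by (simp add: powr_half_sqrt q_def)
    ultimately show ?thesis unfolding q_def powr_powr by metis
  qed
  have ta: "t powr \<alpha> = r t x / x" if "x > 0" for t x using that by (simp add: r_def \<alpha>_def)
  have t1: "t powr \<alpha> \<le> 1" if "t \<ge> 1" for t using that p powr_mono[of \<alpha> 0 t] by (simp add: \<alpha>_def)
  have rx: "r t x \<le> x" if "t \<ge> 1" "x > 0" for t x
    unfolding r_def \<alpha>_def[symmetric] using t1[OF that(1)] that by (intro mult_left_le_one_le) auto
  have sb: "\<nu>\<^sup>2 * q t x / 4 \<le> 3/4" "1/2 \<le> s t x" "s t x \<le> 1" "1 - s t x \<le> \<nu>\<^sup>2 * q t x / 4" "sqrt (q t x) \<le> sqrt q0"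
    if "t \<ge> 1" "x > 0" "r t x \<le> \<rho>" for t x
  proof -
    have q: "0 \<le> q t x" "q t x \<le> q0" using \<rho>(2)[OF r0[OF that(1,2)] that(3)] by (auto simp: q_def)
    then show "sqrt (q t x) \<le> sqrt q0" by simp
    show *: "\<nu>\<^sup>2 * q t x / 4 \<le> 3/4" using q \<nu> by (simp add: q0_def field_simps)
    have "sqrt (1/4) \<le> s t x" unfolding s_def using * by (intro real_sqrt_le_mono) simp
    then show h: "1/2 \<le> s t x" by (simp add: real_sqrt_divide)
    have "s t x \<le> sqrt 1" unfolding s_def using q by (intro real_sqrt_le_mono) simp
    then show le: "s t x \<le> 1" by simp
    have "s t x * s t x = 1 - \<nu>\<^sup>2 * q t x / 4" unfolding s_def using * by simp
    moreover have "s t x * s t x \<le> s t x" using h le by (intro mult_left_le) auto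
    ultimately show "1 - s t x \<le> \<nu>\<^sup>2 * q t x / 4" by linarith
  qed
  have eqs: "kern (\<nu> * r t x powr (2 * \<sigma>)) (r t x) t = E x * sin (r t x * t * s t x) / (r t x * s t x)"
    "dkern (\<nu> * r t x powr (2 * \<sigma>)) (r t x) t = E x * (cos (r t x * t * s t x) - \<nu> / 2 * sqrt (q t x) * sin (r t x * t * s t x) / s t x)"
    "kern0 (\<nu> * r t x powr (2 * \<sigma>)) (r t x) t = E x * (cos (r t x * t * s t x) + \<nu> / 2 * sqrt (q t x) * sin (r t x * t * s t x) / s t x)"
    if tx: "t \<ge> 1" "x > 0" "r t x \<le> \<rho>" for t x
    using kern_underdamped[OF r0[OF tx(1,2)] \<nu>, of \<sigma> t] sb(1)[OF tx]
    unfolding q_def[symmetric] s_def[symmetric] rp[OF tx(1,2)] sq[OF tx(1,2)] by (simp_all add: E_def)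
  have EP: "exp (- (\<nu> / 2) * t * r t x powr (2 * \<sigma>)) = E x" "exp (- (\<nu> * t * r t x powr (2 * \<sigma>) / 2)) = E x" if "t \<ge> 1" "x > 0" for t x
    using rp[OF that] by (auto simp: E_def mult_ac)
  have sn: "\<bar>sin y / s t x\<bar> \<le> 2" if "t \<ge> 1" "x > 0" "r t x \<le> \<rho>" for t x y
  proof -
    have "\<bar>sin y\<bar> * 1 \<le> 1 * (2 * s t x)" using sb(2)[OF that] by (intro mult_mono) auto
    then show ?thesis using sb(2)[OF that] by (simp add: abs_divide divide_le_eq)
  qed
  have qlim: "((\<lambda>t. q t x) \<longlongrightarrow> 0) at_top" if "x > 0" for x
    unfolding q_def r_def using p \<sigma> that by (intro scaled_powr_tendsto_0) auto
  have rlim: "((\<lambda>t. r t x) \<longlongrightarrow> 0) at_top" if "x > 0" for x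
    using scaled_powr_tendsto_0[of p 1 x] p that unfolding r_def by (simp add: powr_one' abs_mult)
  have evr: "\<forall>\<^sub>F t in at_top. t \<ge> 1 \<and> r t x \<le> \<rho>" if "x > 0" for x
    using eventually_ge_at_top[of 1] order_tendstoD(2)[OF rlim[OF that] \<rho>(1)] by eventually_elim auto
  \<comment> \<open>Bound for the phase error: 1 - s is at most \<nu>^2 q / 4, and r t sqrt q = x^p,
    so one factor sqrt q survives and forces the error to 0.\<close>
  define \<delta> where "\<delta> t x = x powr p * (\<nu>\<^sup>2 / 4) * sqrt (q t x)" for t x
  have phase: "\<bar>r t x * t * s t x - t * r t x\<bar> \<le> \<delta> t x" if tx: "t \<ge> 1" "x > 0" "r t x \<le> \<rho>" for t x
  proof -
    have q: "q t x > 0" using r0[OF tx(1,2)] by (simp add: q_def)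
    have "r t x powr (2 * \<sigma>) = r t x * sqrt (q t x)"
      unfolding sq[OF tx(1,2), symmetric] using r0[OF tx(1,2)] by (simp add: powr_mult_base)
    then have rt: "r t x * t * sqrt (q t x) = x powr p" using rp[OF tx(1,2)] by (simp add: mult_ac)
    have "\<bar>r t x * t * s t x - t * r t x\<bar> = r t x * t * (1 - s t x)"
    proof -
      have "r t x * t * s t x - t * r t x = - (r t x * t * (1 - s t x))" by (simp add: algebra_simps)
      moreover have "0 \<le> r t x * t * (1 - s t x)" using r0[OF tx(1,2)] sb(3)[OF tx] tx by simp
      ultimately show ?thesis by simp
    qed
    also have "\<dots> \<le> r t x * t * (\<nu>\<^sup>2 * q t x / 4)" using r0[OF tx(1,2)] sb(4)[OF tx] tx by (intro mult_left_mono) auto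
    also have "\<dots> = (r t x * t * sqrt (q t x)) * (\<nu>\<^sup>2 / 4) * sqrt (q t x)" using q by simp
    also have "\<dots> = \<delta> t x" unfolding rt \<delta>_def ..
    finally show ?thesis .
  qed
  have \<delta>lim: "((\<lambda>t. \<delta> t x) \<longlongrightarrow> 0) at_top" if "x > 0" for x
    using tendsto_mult_right_zero[OF tendsto_real_sqrt[OF qlim[OF that], unfolded real_sqrt_zero], of "x powr p * (\<nu>\<^sup>2 / 4)"]
    by (simp add: \<delta>_def)
  have env: "x powr d * E x \<le> envelope (-1) (\<nu> / 2) p x" if "x > 0" "-1 \<le> d" "d \<le> 2" for x d
    using powr_le_envelope[OF that, of "\<nu> / 2" p] by (simp add: E_def)
  have envm: "E x / x \<le> envelope (-1) (\<nu> / 2) p x" "E x \<le> envelope (-1) (\<nu> / 2) p x" "x * E x \<le> envelope (-1) (\<nu> / 2) p x" if "x > 0" for x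
  proof -
    have "x powr (-1) * E x = E x / x" "x powr 0 * E x = E x" "x powr 1 * E x = x * E x"
      using that by (simp_all add: powr_minus divide_inverse)
    then show "E x / x \<le> envelope (-1) (\<nu> / 2) p x" "E x \<le> envelope (-1) (\<nu> / 2) p x" "x * E x \<le> envelope (-1) (\<nu> / 2) p x"
      using env[OF that, of "-1"] env[OF that, of 0] env[OF that, of 1] by linarith+
  qed
  \<comment> \<open>The summand 2 bounds 1/s; \<nu> sqrt q0 bounds the sine term that accompanies
    the cosine.\<close>
  define A where "A = 2 + \<nu> * sqrt q0"
  have A: "2 \<le> A" using \<nu> q0 by (simp add: A_def)
  have envA: "B * envelope (-1) (\<nu> / 2) p x \<le> A * envelope (-1) (\<nu> / 2) p x" if "B \<le> A" for B x
    using that by (intro mult_right_mono envelope_nonneg)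
  have osc: "\<bar>y + \<nu> / 2 * sqrt (q t x) * sin z / s t x\<bar> \<le> A" "\<bar>y - \<nu> / 2 * sqrt (q t x) * sin z / s t x\<bar> \<le> A"
    if tx: "t \<ge> 1" "x > 0" "r t x \<le> \<rho>" and y: "\<bar>y\<bar> \<le> 1" for t x y z
  proof -
    have "\<bar>\<nu> / 2 * sqrt (q t x) * (sin z / s t x)\<bar> \<le> \<nu> / 2 * sqrt q0 * 2"
      unfolding abs_mult[of "\<nu> / 2 * _"] using sn[OF tx, of z] sb(5)[OF tx] \<nu> q0 by (intro mult_mono) (auto simp: q_def)
    then have "\<bar>\<nu> / 2 * sqrt (q t x) * sin z / s t x\<bar> \<le> \<nu> * sqrt q0" by simp
    then show "\<bar>y + \<nu> / 2 * sqrt (q t x) * sin z / s t x\<bar> \<le> A" "\<bar>y - \<nu> / 2 * sqrt (q t x) * sin z / s t x\<bar> \<le> A"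
      using y unfolding A_def by linarith+
  qed
  have bK0: "\<bar>kern0 (\<nu> * r t x powr (2 * \<sigma>)) (r t x) t\<bar> \<le> A * E x" and bD: "\<bar>dkern (\<nu> * r t x powr (2 * \<sigma>)) (r t x) t\<bar> \<le> A * E x"
    if tx: "t \<ge> 1" "x > 0" "r t x \<le> \<rho>" for t x
  proof -
    have c: "\<bar>cos (r t x * t * s t x)\<bar> \<le> 1" by simp
    have e: "\<bar>E x * z\<bar> \<le> A * E x" if "\<bar>z\<bar> \<le> A" for z
      using mult_left_mono[OF that less_imp_le[OF E0[of x]]] E0[of x] by (simp add: abs_mult mult.commute)
    show "\<bar>kern0 (\<nu> * r t x powr (2 * \<sigma>)) (r t x) t\<bar> \<le> A * E x"
      unfolding eqs[OF tx] by (rule e[OF osc(1)[OF tx c]])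
    show "\<bar>dkern (\<nu> * r t x powr (2 * \<sigma>)) (r t x) t\<bar> \<le> A * E x"
      unfolding eqs[OF tx] by (rule e[OF osc(2)[OF tx c]])
  qed
  have bK: "r t x * \<bar>kern (\<nu> * r t x powr (2 * \<sigma>)) (r t x) t\<bar> \<le> 2 * E x" if tx: "t \<ge> 1" "x > 0" "r t x \<le> \<rho>" for t x
  proof -
    have "r t x * \<bar>kern (\<nu> * r t x powr (2 * \<sigma>)) (r t x) t\<bar> = E x * \<bar>sin (r t x * t * s t x) / s t x\<bar>"
      unfolding eqs[OF tx] using E0[of x] r0[OF tx(1,2)] by (simp add: abs_mult abs_divide)
    also have "\<dots> \<le> E x * 2" using sn[OF tx] E0[of x] by (intro mult_left_mono) auto
    finally show ?thesis by simp
  qed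
  have AE: "A * E x \<le> A * envelope (-1) (\<nu> / 2) p x" if "x > 0" for x
    using envm(2)[OF that] A by (intro mult_left_mono) auto
  show "low_freq p (-1/p) (-1) (\<lambda>t r. kern0 (\<nu> * r powr (2 * \<sigma>)) r t) (\<lambda>t r. kern (\<nu> * r powr (2 * \<sigma>)) r t)
       (\<lambda>t r. exp (- (\<nu> / 2) * t * r powr (2 * \<sigma>)) * sin (t * r) / r)"
    unfolding \<alpha>_def[symmetric] unfolding low_freq_def unfolding r_def[symmetric]
  proof (rule exI[of _ A], rule exI[of _ "\<nu> / 2"], rule exI[of _ \<rho>], intro conjI allI impI)
    fix t x :: real assume t: "t \<ge> 1" and x: "x > 0"
    {
      assume "r t x \<le> \<rho>"
      note tx = t x this
      have "t powr \<alpha> * \<bar>kern0 (\<nu> * r t x powr (2 * \<sigma>)) (r t x) t\<bar> \<le> 1 * (A * E x)"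
        using t1[OF t] bK0[OF tx] by (intro mult_mono) auto
      then show "t powr \<alpha> * \<bar>kern0 (\<nu> * r t x powr (2 * \<sigma>)) (r t x) t\<bar> \<le> A * envelope (-1) (\<nu> / 2) p x"
        using AE[OF x] by linarith
      have "t powr \<alpha> * \<bar>kern (\<nu> * r t x powr (2 * \<sigma>)) (r t x) t\<bar> = r t x * \<bar>kern (\<nu> * r t x powr (2 * \<sigma>)) (r t x) t\<bar> / x"
        unfolding ta[OF x] by simp
      also have "\<dots> \<le> 2 * E x / x" using bK[OF tx] x by (intro divide_right_mono) auto
      also have "\<dots> \<le> 2 * envelope (-1) (\<nu> / 2) p x" using envm(1)[OF x] by simp
      finally show "t powr \<alpha> * \<bar>kern (\<nu> * r t x powr (2 * \<sigma>)) (r t x) t\<bar> \<le> A * envelope (-1) (\<nu> / 2) p x"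
        using envA[OF A, of x] by linarith
    }
    have "t powr \<alpha> * \<bar>exp (- (\<nu> / 2) * t * r t x powr (2 * \<sigma>)) * sin (t * r t x) / r t x\<bar> = E x * \<bar>sin (t * r t x)\<bar> / x"
      unfolding EP[OF t x] ta[OF x] using r0[OF t x] E0[of x] by (simp add: abs_mult abs_divide)
    also have "\<dots> \<le> E x * 1 / x" using E0[of x] x by (intro divide_right_mono mult_left_mono) auto
    finally show "t powr \<alpha> * \<bar>exp (- (\<nu> / 2) * t * r t x powr (2 * \<sigma>)) * sin (t * r t x) / r t x\<bar> \<le> A * envelope (-1) (\<nu> / 2) p x"
      using envm(1)[OF x] envA[of 1 x] A by simp
  next
    fix x :: real assume x: "x > 0"
    have tl: "((\<lambda>t::real. t powr \<alpha>) \<longlongrightarrow> 0) at_top"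
      using p by (intro tendsto_neg_powr filterlim_ident) (auto simp: \<alpha>_def)
    show "((\<lambda>t. t powr \<alpha> * kern0 (\<nu> * r t x powr (2 * \<sigma>)) (r t x) t) \<longlongrightarrow> 0) at_top"
    proof (rule Lim_null_comparison[OF _ tendsto_mult_left_zero[OF tl, of "A * E x"]])
      show "\<forall>\<^sub>F t in at_top. norm (t powr \<alpha> * kern0 (\<nu> * r t x powr (2 * \<sigma>)) (r t x) t) \<le> t powr \<alpha> * (A * E x)"
        using evr[OF x] by eventually_elim (use bK0[OF _ x] in \<open>auto simp: abs_mult intro!: mult_left_mono\<close>)
    qed
    show "((\<lambda>t. t powr \<alpha> * (kern (\<nu> * r t x powr (2 * \<sigma>)) (r t x) t - exp (- (\<nu> / 2) * t * r t x powr (2 * \<sigma>)) * sin (t * r t x) / r t x)) \<longlongrightarrow> 0) at_top"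
    proof (rule Lim_null_comparison)
      show "((\<lambda>t. E x / x * (2 * (\<nu>\<^sup>2 * q t x / 4) + \<delta> t x)) \<longlongrightarrow> 0) at_top"
        using tendsto_mult_right_zero[OF tendsto_add_zero[OF tendsto_mult_right_zero[OF qlim[OF x], of "2 * \<nu>\<^sup>2 / 4"] \<delta>lim[OF x]], of "E x / x"]
        by (simp add: algebra_simps)
      show "\<forall>\<^sub>F t in at_top. norm (t powr \<alpha> * (kern (\<nu> * r t x powr (2 * \<sigma>)) (r t x) t - exp (- (\<nu> / 2) * t * r t x powr (2 * \<sigma>)) * sin (t * r t x) / r t x))
        \<le> E x / x * (2 * (\<nu>\<^sup>2 * q t x / 4) + \<delta> t x)"
        using evr[OF x]
      proof eventually_elim
        case (elim t)
        then have t: "t \<ge> 1" "r t x \<le> \<rho>" by auto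
        note tx = t(1) x t(2)
        let ?s = "s t x" and ?y = "r t x * t * s t x"
        have "t powr \<alpha> * (kern (\<nu> * r t x powr (2 * \<sigma>)) (r t x) t - exp (- (\<nu> / 2) * t * r t x powr (2 * \<sigma>)) * sin (t * r t x) / r t x)
          = E x / x * (sin ?y / ?s - sin (t * r t x))"
          unfolding eqs[OF tx] EP[OF t(1) x] ta[OF x] using r0[OF t(1) x] sb(2)[OF tx] x by (simp add: field_simps)
        moreover have "\<bar>sin ?y / ?s - sin (t * r t x)\<bar> \<le> 2 * (\<nu>\<^sup>2 * q t x / 4) + \<delta> t x"
        proof -
          \<comment> \<open>The amplitude error 1 - s and the phase error are separated.\<close>
          have "sin ?y / ?s - sin (t * r t x) = (sin ?y / ?s) * (1 - ?s) + (sin ?y - sin (t * r t x))"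
            using sb(2)[OF tx] by (simp add: field_simps)
          moreover have "\<bar>(sin ?y / ?s) * (1 - ?s)\<bar> \<le> 2 * (\<nu>\<^sup>2 * q t x / 4)"
            unfolding abs_mult using sn[OF tx, of ?y] sb(3,4)[OF tx] by (intro mult_mono) auto
          moreover have "\<bar>sin ?y - sin (t * r t x)\<bar> \<le> \<delta> t x"
            using sin_cos_lipschitz(1)[of ?y "t * r t x"] phase[OF tx] by linarith
          ultimately show ?thesis by linarith
        qed
        ultimately show ?case using E0[of x] x by (simp add: abs_mult abs_divide mult_left_mono divide_right_mono)
      qed
    qed
  qed (use A \<nu> \<rho> in auto)
  show "low_freq p 0 (-1) (\<lambda>t r. - (r\<^sup>2 * kern (\<nu> * r powr (2 * \<sigma>)) r t)) (\<lambda>t r. dkern (\<nu> * r powr (2 * \<sigma>)) r t)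
       (\<lambda>t r. exp (- (\<nu> * t * r powr (2 * \<sigma>) / 2)) * cos (t * r))"
    unfolding low_freq_def r_def[symmetric]
  proof (rule exI[of _ A], rule exI[of _ "\<nu> / 2"], rule exI[of _ \<rho>], intro conjI allI impI)
    have X0: "\<bar>- ((r t x)\<^sup>2 * kern (\<nu> * r t x powr (2 * \<sigma>)) (r t x) t)\<bar> \<le> r t x * (2 * E x)" if tx: "t \<ge> 1" "x > 0" "r t x \<le> \<rho>" for t x
      using mult_left_mono[OF bK[OF tx], of "r t x"] r0[OF tx(1,2)] by (simp add: abs_mult power2_eq_square mult.assoc)
    fix t x :: real assume t: "t \<ge> 1" and x: "x > 0"
    {
      assume "r t x \<le> \<rho>"
      note tx = t x this
      have "r t x * (2 * E x) \<le> x * (2 * E x)" using rx[OF t x] E0[of x] by (intro mult_right_mono) auto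
      also have "\<dots> \<le> 2 * envelope (-1) (\<nu> / 2) p x" using envm(3)[OF x] by simp
      finally show "t powr 0 * \<bar>- ((r t x)\<^sup>2 * kern (\<nu> * r t x powr (2 * \<sigma>)) (r t x) t)\<bar> \<le> A * envelope (-1) (\<nu> / 2) p x"
        using X0[OF tx] envA[OF A, of x] t by simp
      show "t powr 0 * \<bar>dkern (\<nu> * r t x powr (2 * \<sigma>)) (r t x) t\<bar> \<le> A * envelope (-1) (\<nu> / 2) p x"
        using bD[OF tx] AE[OF x] t by simp
    }
    have "E x * \<bar>cos (t * r t x)\<bar> \<le> E x * 1" using E0[of x] by (intro mult_left_mono) auto
    moreover have "t powr 0 * \<bar>E x * cos (t * r t x)\<bar> = E x * \<bar>cos (t * r t x)\<bar>" using t E0[of x] by (simp add: abs_mult)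
    moreover have "1 * envelope (-1) (\<nu> / 2) p x \<le> A * envelope (-1) (\<nu> / 2) p x" using A by (intro envA) simp
    ultimately show "t powr 0 * \<bar>exp (- (\<nu> * t * r t x powr (2 * \<sigma>) / 2)) * cos (t * r t x)\<bar> \<le> A * envelope (-1) (\<nu> / 2) p x"
      unfolding EP[OF t x] using envm(2)[OF x] by linarith
  next
    fix x :: real assume x: "x > 0"
    have X0: "\<bar>- ((r t x)\<^sup>2 * kern (\<nu> * r t x powr (2 * \<sigma>)) (r t x) t)\<bar> \<le> r t x * (2 * E x)" if tx: "t \<ge> 1" "x > 0" "r t x \<le> \<rho>" for t x
      using mult_left_mono[OF bK[OF tx], of "r t x"] r0[OF tx(1,2)] by (simp add: abs_mult power2_eq_square mult.assoc)
    show "((\<lambda>t. t powr 0 * - ((r t x)\<^sup>2 * kern (\<nu> * r t x powr (2 * \<sigma>)) (r t x) t)) \<longlongrightarrow> 0) at_top"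
    proof (rule Lim_null_comparison[OF _ tendsto_mult_left_zero[OF rlim[OF x], of "2 * E x"]])
      show "\<forall>\<^sub>F t in at_top. norm (t powr 0 * - ((r t x)\<^sup>2 * kern (\<nu> * r t x powr (2 * \<sigma>)) (r t x) t)) \<le> r t x * (2 * E x)"
        using evr[OF x] by eventually_elim (use X0[OF _ x] in auto)
    qed
    show "((\<lambda>t. t powr 0 * (dkern (\<nu> * r t x powr (2 * \<sigma>)) (r t x) t - exp (- (\<nu> * t * r t x powr (2 * \<sigma>) / 2)) * cos (t * r t x))) \<longlongrightarrow> 0) at_top"
    proof (rule Lim_null_comparison)
      show "((\<lambda>t. E x * (\<nu> * sqrt (q t x) + \<delta> t x)) \<longlongrightarrow> 0) at_top"
        using tendsto_mult_right_zero[OF tendsto_add_zero[OF tendsto_mult_right_zero[OF tendsto_real_sqrt[OF qlim[OF x], unfolded real_sqrt_zero], of \<nu>] \<delta>lim[OF x]], of "E x"] .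
      show "\<forall>\<^sub>F t in at_top. norm (t powr 0 * (dkern (\<nu> * r t x powr (2 * \<sigma>)) (r t x) t - exp (- (\<nu> * t * r t x powr (2 * \<sigma>) / 2)) * cos (t * r t x)))
        \<le> E x * (\<nu> * sqrt (q t x) + \<delta> t x)"
        using evr[OF x]
      proof eventually_elim
        case (elim t)
        then have t: "t \<ge> 1" "r t x \<le> \<rho>" by auto
        note tx = t(1) x t(2)
        let ?s = "s t x" and ?y = "r t x * t * s t x"
        have "t powr 0 * (dkern (\<nu> * r t x powr (2 * \<sigma>)) (r t x) t - exp (- (\<nu> * t * r t x powr (2 * \<sigma>) / 2)) * cos (t * r t x))
          = E x * ((cos ?y - cos (t * r t x)) - \<nu> / 2 * sqrt (q t x) * (sin ?y / ?s))"
          unfolding eqs[OF tx] EP[OF t(1) x] using t by (simp add: algebra_simps)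
        moreover have "\<bar>(cos ?y - cos (t * r t x)) - \<nu> / 2 * sqrt (q t x) * (sin ?y / ?s)\<bar> \<le> \<nu> * sqrt (q t x) + \<delta> t x"
        proof -
          have "\<bar>\<nu> / 2 * sqrt (q t x) * (sin ?y / ?s)\<bar> \<le> \<nu> / 2 * sqrt (q t x) * 2"
            unfolding abs_mult[of "\<nu> / 2 * _"] using sn[OF tx, of ?y] \<nu> by (intro mult_mono) (auto simp: q_def)
          moreover have "\<bar>cos ?y - cos (t * r t x)\<bar> \<le> \<delta> t x"
            using sin_cos_lipschitz(2)[of ?y "t * r t x"] phase[OF tx] by linarith
          ultimately show ?thesis by linarith
        qed
        ultimately show ?case using E0[of x] by (simp add: abs_mult mult_left_mono)
      qed
    qed
  qed (use A \<nu> \<rho> in auto)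
qed

text \<open>The slow root of the characteristic equation has a rate asymptotic to r^p / \<nu> and
  produces the diffusive profile. In the scaled variable the fast root carries the exponent x^p / q
  with q -> 0, so its mode is negligible even after division by \<open>q\<close>. The second profile
  is the exact time derivative of the first.\<close>

lemma low_freq_small:
  assumes \<nu>: "\<nu> > 0" and \<sigma>: "0 < \<sigma>" "\<sigma> < 1/2"
  defines "p \<equiv> 2 * (1 - \<sigma>)"
  shows "low_freq p (- (2 * \<sigma>) / p) (- (2 * \<sigma>)) (\<lambda>t r. kern0 (\<nu> * r powr (2 * \<sigma>)) r t) (\<lambda>t r. kern (\<nu> * r powr (2 * \<sigma>)) r t)
       (\<lambda>t r. exp (- (1 / \<nu>) * t * r powr p) / (\<nu> * r powr (2 * \<sigma>)))"
    and "low_freq p ((2 - 4 * \<sigma>) / p) (- (2 * \<sigma>)) (\<lambda>t r. - (r\<^sup>2 * kern (\<nu> * r powr (2 * \<sigma>)) r t)) (\<lambda>t r. dkern (\<nu> * r powr (2 * \<sigma>)) r t)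
       (\<lambda>t r. - (1 / \<nu>) * r powr p * (exp (- (1 / \<nu>) * t * r powr p) / (\<nu> * r powr (2 * \<sigma>))))"
proof -
  have p: "p > 1" "p \<le> 2" using \<sigma> by (auto simp: p_def)
  \<comment> \<open>With q \<le> q0 the square \<open>\<nu>\<^sup>2 - 4 * q\<close> is at least a
    quarter of \<open>\<nu>\<^sup>2\<close>, so \<open>s\<close> is at least \<nu> / 2.\<close>
  define q0 where "q0 = 3 * \<nu>\<^sup>2 / 16"
  have q0: "q0 > 0" using \<nu> by (simp add: q0_def)
  define \<rho> where "\<rho> = q0 powr (1 / (2 - 4 * \<sigma>))"
  have \<rho>: "\<rho> > 0" "\<And>r. r > 0 \<Longrightarrow> r \<le> \<rho> \<Longrightarrow> r powr (2 - 4 * \<sigma>) \<le> q0"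
    using small_powr_radius[of "2 - 4 * \<sigma>" q0] \<sigma> q0 by (auto simp: \<rho>_def)
  define r where "r t x = t powr (-1/p) * x" for t x :: real
  define \<alpha>0 where "\<alpha>0 = - (2 * \<sigma>) / p"
  define \<alpha>1 where "\<alpha>1 = (2 - 4 * \<sigma>) / p"
  define q where "q t x = r t x powr (2 - 4 * \<sigma>)" for t x
  define s where "s t x = sqrt (\<nu>\<^sup>2 - 4 * q t x)" for t x
  define E where "E x = exp (- (1 / \<nu>) * x powr p)" for x
  \<comment> \<open>The slow mode, with (\<nu> - s) / 2 replaced by 2 q / (\<nu> + s): this avoids
    the cancellation in \<nu> - s and makes the factor 1/q from \<open>rs\<close> disappear.\<close>
  define Ep where "Ep t x = exp (- (2 / (\<nu> + s t x)) * x powr p)" for t x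
  define Em where "Em t x = exp (- ((\<nu> + s t x) / 2 * (x powr p / q t x)))" for t x
  have E0: "E x > 0" for x by (simp add: E_def)
  have r0: "r t x > 0" if "t \<ge> 1" "x > 0" for t x using that by (simp add: r_def)
  have rp: "r t x powr p * t = x powr p" if "t \<ge> 1" "x > 0" for t x
    using scaled_powr[of t p x p] that p by (simp add: r_def powr_minus)
  have qpos: "q t x > 0" if "t \<ge> 1" "x > 0" for t x using r0[OF that] by (simp add: q_def)
  have rq: "r t x powr p = r t x powr (2 * \<sigma>) * q t x" for t x
    unfolding q_def powr_add[symmetric] by (simp add: p_def algebra_simps)
  have rs: "r t x powr (2 * \<sigma>) * t = x powr p / q t x" if "t \<ge> 1" "x > 0" for t x
    using rp[OF that] qpos[OF that] unfolding rq by (simp add: field_simps)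
  have ta: "t powr \<alpha>0 = r t x powr (2 * \<sigma>) * x powr (- (2 * \<sigma>))" if "x > 0" for t x
    using that scaled_powr[of t p x "2 * \<sigma>"] by (simp add: r_def \<alpha>0_def powr_minus)
  have tb: "t powr \<alpha>1 = x powr (2 - 4 * \<sigma>) / q t x" if "t \<ge> 1" "x > 0" for t x
  proof -
    have "q t x * t powr \<alpha>1 = t powr (- (2 - 4 * \<sigma>) / p) * t powr \<alpha>1 * x powr (2 - 4 * \<sigma>)"
      unfolding q_def r_def scaled_powr by simp
    also have "t powr (- (2 - 4 * \<sigma>) / p) * t powr \<alpha>1 = t powr 0"
      unfolding powr_add[symmetric] by (simp add: \<alpha>1_def add_divide_distrib[symmetric])
    finally show ?thesis using qpos[OF that] that by (simp add: field_simps)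
  qed
  have t1: "t powr \<alpha>0 \<le> 1" if "t \<ge> 1" for t
    using that p \<sigma> powr_mono[of \<alpha>0 0 t] by (simp add: \<alpha>0_def)
  \<comment> \<open>A time derivative raises the normalising power of t by exactly one.\<close>
  have t01: "t powr \<alpha>1 = t powr \<alpha>0 * t" if "t \<ge> 1" for t
  proof -
    have "\<alpha>1 = \<alpha>0 + 1" using p by (simp add: \<alpha>0_def \<alpha>1_def p_def field_simps)
    then show ?thesis using that by (simp add: powr_add)
  qed
  have sb: "4 * q t x < \<nu>\<^sup>2" "\<nu> / 2 \<le> s t x" "s t x \<le> \<nu>" "q t x \<le> q0" "(\<nu> - s t x) * (\<nu> + s t x) = 4 * q t x"
    if "t \<ge> 1" "x > 0" "r t x \<le> \<rho>" for t x
  proof -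
    show q: "q t x \<le> q0" using \<rho>(2)[OF r0[OF that(1,2)] that(3)] by (simp add: q_def)
    have n2: "\<nu>\<^sup>2 > 0" using \<nu> by simp
    then show l: "4 * q t x < \<nu>\<^sup>2" using q unfolding q0_def by linarith
    have "sqrt ((\<nu> / 2)\<^sup>2) \<le> s t x" unfolding s_def using q by (intro real_sqrt_le_mono) (simp add: q0_def power_divide)
    then show "\<nu> / 2 \<le> s t x" using \<nu> by simp
    have "s t x \<le> sqrt (\<nu>\<^sup>2)" unfolding s_def using qpos[OF that(1,2)] by (intro real_sqrt_le_mono) simp
    then show "s t x \<le> \<nu>" using \<nu> by simp
    have "s t x * s t x = \<nu>\<^sup>2 - 4 * q t x" unfolding s_def using l by simp
    then show "(\<nu> - s t x) * (\<nu> + s t x) = 4 * q t x" by (simp add: algebra_simps power2_eq_square)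
  qed
  have eqs: "kern (\<nu> * r t x powr (2 * \<sigma>)) (r t x) t = (Ep t x - Em t x) / (r t x powr (2 * \<sigma>) * s t x)"
    "dkern (\<nu> * r t x powr (2 * \<sigma>)) (r t x) t = ((s t x - \<nu>) * Ep t x + (s t x + \<nu>) * Em t x) / (2 * s t x)"
    "kern0 (\<nu> * r t x powr (2 * \<sigma>)) (r t x) t = ((s t x + \<nu>) * Ep t x + (s t x - \<nu>) * Em t x) / (2 * s t x)"
    if tx: "t \<ge> 1" "x > 0" "r t x \<le> \<rho>" for t x
  proof -
    have pos: "\<nu> + s t x > 0" using \<nu> sb(2)[OF tx] by linarith
    have "\<nu> - s t x = 4 * q t x / (\<nu> + s t x)" using sb(5)[OF tx] pos by (simp add: field_simps)
    moreover have "4 * Q / D / 2 * (X / Q) = 2 / D * X" if "Q > 0" "D > 0" for Q D X :: real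
      using that by (simp add: field_simps)
    ultimately have e: "exp (- ((\<nu> - s t x) / 2 * (x powr p / q t x))) = Ep t x"
      unfolding Ep_def using qpos[OF tx(1,2)] pos by (simp only: mult_minus_left)
    note K = kern_overdamped[OF r0[OF tx(1,2)] \<nu>, of \<sigma> t]
    show "kern (\<nu> * r t x powr (2 * \<sigma>)) (r t x) t = (Ep t x - Em t x) / (r t x powr (2 * \<sigma>) * s t x)"
      "dkern (\<nu> * r t x powr (2 * \<sigma>)) (r t x) t = ((s t x - \<nu>) * Ep t x + (s t x + \<nu>) * Em t x) / (2 * s t x)"
      "kern0 (\<nu> * r t x powr (2 * \<sigma>)) (r t x) t = ((s t x + \<nu>) * Ep t x + (s t x - \<nu>) * Em t x) / (2 * s t x)"
      using K sb(1)[OF tx] unfolding q_def[symmetric] s_def[symmetric] rs[OF tx(1,2)] e Em_def[symmetric]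
      by (simp_all add: add.commute)
  qed
  have EP: "exp (- (1 / \<nu>) * t * r t x powr p) = E x" if "t \<ge> 1" "x > 0" for t x
    using rp[OF that] by (simp add: E_def mult_ac)
  have Epb: "0 \<le> Ep t x" "Ep t x \<le> E x" if tx: "t \<ge> 1" "x > 0" "r t x \<le> \<rho>" for t x
  proof -
    have "1 / \<nu> \<le> 2 / (\<nu> + s t x)" using sb(2,3)[OF tx] \<nu> by (simp add: field_simps)
    then have "1 / \<nu> * x powr p \<le> 2 / (\<nu> + s t x) * x powr p" by (rule mult_right_mono) simp
    then show "Ep t x \<le> E x" unfolding Ep_def E_def by simp
  qed (simp add: Ep_def)
  \<comment> \<open>\<open>Em\<close> is at most exp(- 2 z) with z proportional to x^p / q. One
    factor exp(- z) pays for the division by \<open>q\<close>, through z \<le> exp z; the other one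
    remains as decay.\<close>
  have Emz: "0 \<le> Em t x" "Em t x / q t x \<le> 4 / \<nu> * x powr (- p) * exp (- (\<nu> / 4 * x powr p / q t x))"
    "exp (- (\<nu> / 4 * x powr p / q t x)) \<le> E x" "Em t x \<le> E x"
    if tx: "t \<ge> 1" "x > 0" "r t x \<le> \<rho>" for t x
  proof -
    note q = qpos[OF tx(1,2)]
    define z where "z = \<nu> / 4 * x powr p / q t x"
    have z: "z > 0" using q \<nu> tx by (simp add: z_def)
    have "\<nu> / 2 * (x powr p / q t x) \<le> (\<nu> + s t x) / 2 * (x powr p / q t x)"
      using sb(2)[OF tx] q \<nu> by (intro mult_right_mono) auto
    then have m: "Em t x \<le> exp (- (2 * z))" unfolding Em_def z_def by (simp add: field_simps)
    have "z \<le> exp z" using exp_ge_add_one_self[of z] by linarith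
    then have "exp (- (2 * z)) * z \<le> exp (- (2 * z)) * exp z" by simp
    also have "\<dots> = exp (- z)" by (simp flip: exp_add)
    finally have "exp (- (2 * z)) * z \<le> exp (- z)" .
    moreover have "1 / q t x = 4 / \<nu> * x powr (- p) * z"
      using q \<nu> tx by (simp add: z_def powr_minus field_simps)
    ultimately have "exp (- (2 * z)) * (1 / q t x) \<le> 4 / \<nu> * x powr (- p) * exp (- z)"
      using \<nu> by (simp add: mult.left_commute[of "exp _"] mult_left_mono divide_right_mono)
    moreover have "Em t x / q t x \<le> exp (- (2 * z)) * (1 / q t x)" using m q by (simp add: divide_right_mono)
    ultimately show "Em t x / q t x \<le> 4 / \<nu> * x powr (- p) * exp (- (\<nu> / 4 * x powr p / q t x))" by (simp add: z_def)
    \<comment> \<open>By the choice of \<open>q0\<close> the remaining exponent is at least 4 x^p /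
      (3 \<nu>), so the fast mode also lies below \<open>E\<close>.\<close>
    have "1 / \<nu> * x powr p \<le> 4 / (3 * \<nu>) * x powr p" using \<nu> by (intro mult_right_mono) (auto simp: field_simps)
    also have "\<dots> = \<nu> / 4 * x powr p / q0" using \<nu> by (simp add: q0_def power2_eq_square)
    also have "\<dots> \<le> z" unfolding z_def using sb(4)[OF tx] q q0 \<nu> by (intro divide_left_mono) auto
    finally show zE: "exp (- (\<nu> / 4 * x powr p / q t x)) \<le> E x" by (simp add: E_def z_def)
    have "Em t x \<le> exp (- z)" using m z by (smt (verit) exp_le_cancel_iff)
    then show "Em t x \<le> E x" using zE by (simp add: z_def)
  qed (simp add: Em_def)
  have qlim: "((\<lambda>t. q t x) \<longlongrightarrow> 0) at_top" if "x > 0" for x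
    unfolding q_def r_def using p \<sigma> that by (intro scaled_powr_tendsto_0) auto
  have rlim: "((\<lambda>t. r t x) \<longlongrightarrow> 0) at_top" if "x > 0" for x
    using scaled_powr_tendsto_0[of p 1 x] p that unfolding r_def by (simp add: powr_one' abs_mult)
  have evr: "\<forall>\<^sub>F t in at_top. t \<ge> 1 \<and> r t x \<le> \<rho>" if "x > 0" for x
    using eventually_ge_at_top[of 1] order_tendstoD(2)[OF rlim[OF that] \<rho>(1)] by eventually_elim auto
  have slim: "((\<lambda>t. s t x) \<longlongrightarrow> \<nu>) at_top" if "x > 0" for x
  proof -
    have "((\<lambda>t. s t x) \<longlongrightarrow> sqrt (\<nu>\<^sup>2 - 4 * 0)) at_top" unfolding s_def by (intro tendsto_intros qlim that)
    then show ?thesis using \<nu> by simp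
  qed
  have Eplim: "((\<lambda>t. Ep t x) \<longlongrightarrow> E x) at_top" if "x > 0" for x
  proof -
    have "((\<lambda>t. Ep t x) \<longlongrightarrow> exp (- (2 / (\<nu> + \<nu>)) * x powr p)) at_top"
      unfolding Ep_def using \<nu> by (intro tendsto_intros slim that) auto
    then show ?thesis using \<nu> by (simp add: E_def)
  qed
  have Emqlim: "((\<lambda>t. Em t x / q t x) \<longlongrightarrow> 0) at_top" if x: "x > 0" for x
  proof (rule Lim_null_comparison)
    define y where "y = \<nu> / 4 * x powr p"
    have y: "y > 0" using \<nu> x by (simp add: y_def)
    show "((\<lambda>t. 4 / \<nu> * x powr (- p) / y * q t x) \<longlongrightarrow> 0) at_top"
      by (rule tendsto_mult_right_zero[OF qlim[OF x]])
    show "\<forall>\<^sub>F t in at_top. norm (Em t x / q t x) \<le> 4 / \<nu> * x powr (- p) / y * q t x"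
      using evr[OF x]
    proof eventually_elim
      case (elim t)
      then have tx: "t \<ge> 1" "x > 0" "r t x \<le> \<rho>" using x by auto
      note q = qpos[OF tx(1,2)]
      have "y / q t x \<le> exp (y / q t x)" using exp_ge_add_one_self[of "y / q t x"] by linarith
      then have "exp (- (y / q t x)) \<le> q t x / y" using y q by (simp add: exp_minus field_simps)
      then have "4 / \<nu> * x powr (- p) * exp (- (y / q t x)) \<le> 4 / \<nu> * x powr (- p) * (q t x / y)"
        using \<nu> by (intro mult_left_mono) auto
      moreover have "Em t x / q t x \<le> 4 / \<nu> * x powr (- p) * exp (- (y / q t x))" using Emz(2)[OF tx] by (simp add: y_def)
      moreover have "0 \<le> Em t x / q t x" using Emz(1)[OF tx] q by simp
      ultimately show ?case by simp
    qed
  qed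
  have Emlim: "((\<lambda>t. Em t x) \<longlongrightarrow> 0) at_top" if x: "x > 0" for x
  proof -
    have "((\<lambda>t. q t x * (Em t x / q t x)) \<longlongrightarrow> 0 * 0) at_top" by (intro tendsto_mult qlim Emqlim x)
    then have l: "((\<lambda>t. q t x * (Em t x / q t x)) \<longlongrightarrow> 0) at_top" by simp
    show ?thesis
    proof (rule Lim_transform_eventually[OF l])
      show "\<forall>\<^sub>F t in at_top. q t x * (Em t x / q t x) = Em t x"
        using eventually_ge_at_top[of 1] by eventually_elim (use qpos[OF _ x] in \<open>simp add: less_imp_neq[symmetric]\<close>)
    qed
  qed
  let ?env = "envelope (- (2 * \<sigma>)) (1 / \<nu>) p"
  have env: "x powr d * E x \<le> ?env x" if "x > 0" "- (2 * \<sigma>) \<le> d" "d \<le> 2" for x d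
    using powr_le_envelope[OF that, of "1 / \<nu>" p] by (simp add: E_def)
  have env0: "E x \<le> ?env x" if "x > 0" for x using env[OF that, of 0] that \<sigma> by simp
  \<comment> \<open>The sum of all constants that occur below, each of which is then at most
    \<open>A\<close>.\<close>
  define A where "A = 3 + 2 / \<nu> + 4 / \<nu>\<^sup>2 + 8 / \<nu> + 1 / \<nu> + 1 / \<nu>\<^sup>2"
  have Ab: "3 \<le> A" "2 / \<nu> \<le> A" "4 / \<nu>\<^sup>2 + 8 / \<nu> \<le> A" "1 / \<nu> \<le> A" "1 / \<nu>\<^sup>2 \<le> A"
  proof -
    have "0 < 1 / \<nu>" "0 < 1 / \<nu>\<^sup>2" using \<nu> by auto
    moreover have e: "2 / \<nu> = 2 * (1 / \<nu>)" "8 / \<nu> = 8 * (1 / \<nu>)" "4 / \<nu>\<^sup>2 = 4 * (1 / \<nu>\<^sup>2)" by simp_all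
    ultimately show "3 \<le> A" "2 / \<nu> \<le> A" "4 / \<nu>\<^sup>2 + 8 / \<nu> \<le> A" "1 / \<nu> \<le> A" "1 / \<nu>\<^sup>2 \<le> A"
      unfolding A_def e by linarith+
  qed
  have AE: "b * (x powr d * E x) \<le> A * ?env x" if "x > 0" "- (2 * \<sigma>) \<le> d" "d \<le> 2" "b \<le> A" for x d b
  proof -
    have "b * (x powr d * E x) \<le> A * (x powr d * E x)" using that E0[of x] by (intro mult_right_mono) auto
    also have "\<dots> \<le> A * ?env x" using env[OF that(1-3)] Ab(1) by (intro mult_left_mono) auto
    finally show ?thesis .
  qed
  have diff: "\<bar>(Ep t x - Em t x) / s t x\<bar> \<le> 2 / \<nu> * E x" if tx: "t \<ge> 1" "x > 0" "r t x \<le> \<rho>" for t x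
  proof -
    have "\<bar>Ep t x - Em t x\<bar> \<le> E x" using Epb[OF tx] Emz(1,4)[OF tx] by linarith
    moreover have "inverse (s t x) \<le> inverse (\<nu> / 2)" using sb(2)[OF tx] \<nu> by (intro le_imp_inverse_le) auto
    ultimately have le: "\<bar>Ep t x - Em t x\<bar> * inverse (s t x) \<le> E x * inverse (\<nu> / 2)"
      by (rule mult_mono) (use E0[of x] sb(2)[OF tx] \<nu> in auto)
    have s: "s t x > 0" using sb(2)[OF tx] \<nu> by linarith
    show ?thesis
      unfolding abs_divide abs_of_pos[OF s] divide_inverse[of "\<bar>_\<bar>"]
      by (rule order_trans[OF le]) (simp add: mult.commute)
  qed
  have K1: "t powr \<alpha>0 * kern (\<nu> * r t x powr (2 * \<sigma>)) (r t x) t = x powr (- (2 * \<sigma>)) * ((Ep t x - Em t x) / s t x)"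
    if tx: "t \<ge> 1" "x > 0" "r t x \<le> \<rho>" for t x
    unfolding eqs[OF tx] ta[OF tx(2)] using r0[OF tx(1,2)] by simp
  have P1: "t powr \<alpha>0 * (exp (- (1 / \<nu>) * t * r t x powr p) / (\<nu> * r t x powr (2 * \<sigma>))) = x powr (- (2 * \<sigma>)) * (E x / \<nu>)"
    if "t \<ge> 1" "x > 0" for t x
    unfolding EP[OF that] ta[OF that(2)] using r0[OF that] by simp
  have bK0: "\<bar>kern0 (\<nu> * r t x powr (2 * \<sigma>)) (r t x) t\<bar> \<le> 3 * E x" if tx: "t \<ge> 1" "x > 0" "r t x \<le> \<rho>" for t x
  proof -
    have s: "s t x > 0" using sb(2)[OF tx] \<nu> by linarith
    have a: "0 \<le> (s t x + \<nu>) * Ep t x" "(s t x + \<nu>) * Ep t x \<le> (2 * \<nu>) * E x"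
      using Epb[OF tx] sb(3)[OF tx] s \<nu> E0[of x] by (auto intro!: mult_mono mult_nonneg_nonneg)
    have b: "0 \<le> (\<nu> - s t x) * Em t x" "(\<nu> - s t x) * Em t x \<le> \<nu> * E x"
      using Emz(1,4)[OF tx] sb(3)[OF tx] s \<nu> E0[of x] by (auto intro!: mult_mono mult_nonneg_nonneg)
    have "\<bar>(s t x + \<nu>) * Ep t x + (s t x - \<nu>) * Em t x\<bar> \<le> 3 * \<nu> * E x"
      using a b by (simp add: algebra_simps abs_le_iff) 
    also have "\<dots> \<le> 3 * (2 * s t x) * E x" using sb(2)[OF tx] E0[of x] by (intro mult_right_mono) auto
    finally show ?thesis unfolding eqs[OF tx] using s by (simp add: abs_divide divide_le_eq mult_ac)
  qed
  have tl: "((\<lambda>t::real. t powr \<alpha>0) \<longlongrightarrow> 0) at_top"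
    using p \<sigma> by (intro tendsto_neg_powr filterlim_ident) (auto simp: \<alpha>0_def)
  show "low_freq p (- (2 * \<sigma>) / p) (- (2 * \<sigma>)) (\<lambda>t r. kern0 (\<nu> * r powr (2 * \<sigma>)) r t) (\<lambda>t r. kern (\<nu> * r powr (2 * \<sigma>)) r t)
       (\<lambda>t r. exp (- (1 / \<nu>) * t * r powr p) / (\<nu> * r powr (2 * \<sigma>)))"
    unfolding \<alpha>0_def[symmetric] unfolding low_freq_def unfolding r_def[symmetric]
  proof (rule exI[of _ A], rule exI[of _ "1 / \<nu>"], rule exI[of _ \<rho>], intro conjI allI impI)
    fix t x :: real assume t: "t \<ge> 1" and x: "x > 0"
    {
      assume "r t x \<le> \<rho>"
      note tx = t x this
      have "t powr \<alpha>0 * \<bar>kern0 (\<nu> * r t x powr (2 * \<sigma>)) (r t x) t\<bar> \<le> 1 * (3 * E x)"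
        using t1[OF t] bK0[OF tx] by (intro mult_mono) auto
      then show "t powr \<alpha>0 * \<bar>kern0 (\<nu> * r t x powr (2 * \<sigma>)) (r t x) t\<bar> \<le> A * ?env x"
        using AE[OF x, of 0 3] Ab \<sigma> x by simp
      have "t powr \<alpha>0 * \<bar>kern (\<nu> * r t x powr (2 * \<sigma>)) (r t x) t\<bar> = \<bar>t powr \<alpha>0 * kern (\<nu> * r t x powr (2 * \<sigma>)) (r t x) t\<bar>"
        by (simp add: abs_mult)
      also have "\<dots> = x powr (- (2 * \<sigma>)) * \<bar>(Ep t x - Em t x) / s t x\<bar>" unfolding K1[OF tx] abs_mult by simp
      also have "\<dots> \<le> x powr (- (2 * \<sigma>)) * (2 / \<nu> * E x)" by (intro mult_left_mono diff tx) auto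
      also have "\<dots> \<le> A * ?env x" using AE[OF x, of "- (2 * \<sigma>)" "2 / \<nu>"] Ab \<sigma> by (simp only: mult.left_commute)
      finally show "t powr \<alpha>0 * \<bar>kern (\<nu> * r t x powr (2 * \<sigma>)) (r t x) t\<bar> \<le> A * ?env x" .
    }
    have "t powr \<alpha>0 * \<bar>exp (- (1 / \<nu>) * t * r t x powr p) / (\<nu> * r t x powr (2 * \<sigma>))\<bar>
      = \<bar>t powr \<alpha>0 * (exp (- (1 / \<nu>) * t * r t x powr p) / (\<nu> * r t x powr (2 * \<sigma>)))\<bar>" by (simp add: abs_mult)
    also have "\<dots> = 1 / \<nu> * (x powr (- (2 * \<sigma>)) * E x)" unfolding P1[OF t x] using \<nu> E0[of x] by (simp add: abs_mult)
    also have "\<dots> \<le> A * ?env x" using Ab \<sigma> by (intro AE x) auto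
    finally show "t powr \<alpha>0 * \<bar>exp (- (1 / \<nu>) * t * r t x powr p) / (\<nu> * r t x powr (2 * \<sigma>))\<bar> \<le> A * ?env x" .
  next
    fix x :: real assume x: "x > 0"
    show "((\<lambda>t. t powr \<alpha>0 * kern0 (\<nu> * r t x powr (2 * \<sigma>)) (r t x) t) \<longlongrightarrow> 0) at_top"
    proof (rule Lim_null_comparison[OF _ tendsto_mult_left_zero[OF tl, of "3 * E x"]])
      show "\<forall>\<^sub>F t in at_top. norm (t powr \<alpha>0 * kern0 (\<nu> * r t x powr (2 * \<sigma>)) (r t x) t) \<le> t powr \<alpha>0 * (3 * E x)"
        using evr[OF x] by eventually_elim (use bK0[OF _ x] in \<open>auto simp: abs_mult intro!: mult_left_mono\<close>)
    qed
    have "((\<lambda>t. x powr (- (2 * \<sigma>)) * ((Ep t x - Em t x) / s t x - E x / \<nu>)) \<longlongrightarrow> x powr (- (2 * \<sigma>)) * ((E x - 0) / \<nu> - E x / \<nu>)) at_top"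
      using \<nu> by (intro tendsto_intros Eplim Emlim slim x) auto
    then have l: "((\<lambda>t. x powr (- (2 * \<sigma>)) * ((Ep t x - Em t x) / s t x - E x / \<nu>)) \<longlongrightarrow> 0) at_top" by simp
    show "((\<lambda>t. t powr \<alpha>0 * (kern (\<nu> * r t x powr (2 * \<sigma>)) (r t x) t - exp (- (1 / \<nu>) * t * r t x powr p) / (\<nu> * r t x powr (2 * \<sigma>)))) \<longlongrightarrow> 0) at_top"
    proof (rule Lim_transform_eventually[OF l])
      show "\<forall>\<^sub>F t in at_top. x powr (- (2 * \<sigma>)) * ((Ep t x - Em t x) / s t x - E x / \<nu>)
        = t powr \<alpha>0 * (kern (\<nu> * r t x powr (2 * \<sigma>)) (r t x) t - exp (- (1 / \<nu>) * t * r t x powr p) / (\<nu> * r t x powr (2 * \<sigma>)))"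
        using evr[OF x] by eventually_elim (simp only: right_diff_distrib K1 P1 x)
    qed
  qed (use Ab \<nu> \<rho> in auto)
  \<comment> \<open>Writing s - \<nu> as - 4 q / (\<nu> + s) cancels the factor 1/q of t^\<alpha>1
    in the slow mode; in the fast mode the quotient Em / q remains.\<close>
  have D1: "t powr \<alpha>1 * dkern (\<nu> * r t x powr (2 * \<sigma>)) (r t x) t
      = x powr (2 - 4 * \<sigma>) * ((s t x + \<nu>) / (2 * s t x) * (Em t x / q t x) - 2 / (s t x * (\<nu> + s t x)) * Ep t x)"
    if tx: "t \<ge> 1" "x > 0" "r t x \<le> \<rho>" for t x
  proof -
    have s: "s t x > 0" "\<nu> + s t x > 0" using sb(2)[OF tx] \<nu> by linarith+
    have sn: "s t x - \<nu> = - (4 * q t x / (\<nu> + s t x))" using sb(5)[OF tx] s by (simp add: field_simps)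
    have "X / Q * ((- (4 * Q / D) * P + S * M) / (2 * Z)) = X * (S / (2 * Z) * (M / Q) - 2 / (Z * D) * P)"
      if "Q > 0" "Z > 0" "D > 0" for X Q D P S M Z :: real
      using that by (simp add: field_simps)
    then show ?thesis unfolding eqs[OF tx] tb[OF tx(1,2)] sn using s qpos[OF tx(1,2)] by blast
  qed
  have P2: "t powr \<alpha>1 * (- (1 / \<nu>) * r t x powr p * (exp (- (1 / \<nu>) * t * r t x powr p) / (\<nu> * r t x powr (2 * \<sigma>))))
      = - (1 / \<nu>\<^sup>2 * (x powr (2 - 4 * \<sigma>) * E x))"
    if "t \<ge> 1" "x > 0" for t x
    unfolding EP[OF that] tb[OF that] unfolding rq using r0[OF that] qpos[OF that] \<nu> by (simp add: power2_eq_square)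
  \<comment> \<open>Since r^2 = r^p r^(2\<sigma>), the extra factor t turns r^p into x^p; the power
    t^\<alpha>0 with \<alpha>0 < 0 is left and tends to 0.\<close>
  have X2: "t powr \<alpha>1 * (- ((r t x)\<^sup>2 * kern (\<nu> * r t x powr (2 * \<sigma>)) (r t x) t)) = - (t powr \<alpha>0 * (x powr p * ((Ep t x - Em t x) / s t x)))"
    if tx: "t \<ge> 1" "x > 0" "r t x \<le> \<rho>" for t x
  proof -
    have "(r t x)\<^sup>2 = r t x powr p * r t x powr (2 * \<sigma>)"
      unfolding powr_add[symmetric] using r0[OF tx(1,2)] by (simp add: p_def algebra_simps)
    then have "(r t x)\<^sup>2 * kern (\<nu> * r t x powr (2 * \<sigma>)) (r t x) t * t = (r t x powr p * t) * ((Ep t x - Em t x) / s t x)"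
      unfolding eqs[OF tx] using r0[OF tx(1,2)] by simp
    then have F: "(r t x)\<^sup>2 * kern (\<nu> * r t x powr (2 * \<sigma>)) (r t x) t * t = x powr p * ((Ep t x - Em t x) / s t x)"
      unfolding rp[OF tx(1,2)] .
    have "a * t * - R = - (a * (R * t))" for a R :: real by simp
    then show ?thesis unfolding t01[OF tx(1)] using F by metis
  qed
  show "low_freq p ((2 - 4 * \<sigma>) / p) (- (2 * \<sigma>)) (\<lambda>t r. - (r\<^sup>2 * kern (\<nu> * r powr (2 * \<sigma>)) r t)) (\<lambda>t r. dkern (\<nu> * r powr (2 * \<sigma>)) r t)
       (\<lambda>t r. - (1 / \<nu>) * r powr p * (exp (- (1 / \<nu>) * t * r powr p) / (\<nu> * r powr (2 * \<sigma>))))"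
    unfolding \<alpha>1_def[symmetric] unfolding low_freq_def unfolding r_def[symmetric]
  proof (rule exI[of _ A], rule exI[of _ "1 / \<nu>"], rule exI[of _ \<rho>], intro conjI allI impI)
    fix t x :: real assume t: "t \<ge> 1" and x: "x > 0"
    {
      assume "r t x \<le> \<rho>"
      note tx = t x this
      have "t powr \<alpha>1 * \<bar>- ((r t x)\<^sup>2 * kern (\<nu> * r t x powr (2 * \<sigma>)) (r t x) t)\<bar>
         = \<bar>t powr \<alpha>1 * (- ((r t x)\<^sup>2 * kern (\<nu> * r t x powr (2 * \<sigma>)) (r t x) t))\<bar>" by (simp only: abs_mult abs_of_nonneg[OF powr_ge_zero])
      also have "\<dots> = t powr \<alpha>0 * (x powr p * \<bar>(Ep t x - Em t x) / s t x\<bar>)" unfolding X2[OF tx] by (simp add: abs_mult)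
      also have "\<dots> \<le> 1 * (x powr p * (2 / \<nu> * E x))" by (intro mult_mono t1 t diff tx) auto
      also have "\<dots> = 2 / \<nu> * (x powr p * E x)" by simp
      also have "\<dots> \<le> A * ?env x" using Ab \<sigma> p by (intro AE x) auto
      finally show "t powr \<alpha>1 * \<bar>- ((r t x)\<^sup>2 * kern (\<nu> * r t x powr (2 * \<sigma>)) (r t x) t)\<bar> \<le> A * ?env x" .
      have s: "s t x > 0" "\<nu> + s t x > 0" using sb(2)[OF tx] \<nu> by linarith+
      have a: "(s t x + \<nu>) / (2 * s t x) * (Em t x / q t x) \<le> 2 * (4 / \<nu> * x powr (- p) * E x)"
      proof (intro mult_mono)
        show "(s t x + \<nu>) / (2 * s t x) \<le> 2" using sb(2)[OF tx] s by (simp add: divide_le_eq)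
        have "4 / \<nu> * x powr (- p) * exp (- (\<nu> / 4 * x powr p / q t x)) \<le> 4 / \<nu> * x powr (- p) * E x"
          using Emz(3)[OF tx] \<nu> by (intro mult_left_mono) auto
        then show "Em t x / q t x \<le> 4 / \<nu> * x powr (- p) * E x" using Emz(2)[OF tx] by linarith
      qed (use Emz(1)[OF tx] qpos[OF t x] in auto)
      have a0: "0 \<le> (s t x + \<nu>) / (2 * s t x) * (Em t x / q t x)" using s \<nu> Emz(1)[OF tx] qpos[OF t x] by simp
      have b: "2 / (s t x * (\<nu> + s t x)) * Ep t x \<le> 4 / \<nu>\<^sup>2 * E x"
      proof (intro mult_mono)
        have "\<nu> / 2 * \<nu> \<le> s t x * (\<nu> + s t x)" using sb(2)[OF tx] s \<nu> by (intro mult_mono) auto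
        then have "2 / (s t x * (\<nu> + s t x)) \<le> 2 / (\<nu> / 2 * \<nu>)" using s \<nu> by (intro divide_left_mono) auto
        then show "2 / (s t x * (\<nu> + s t x)) \<le> 4 / \<nu>\<^sup>2" by (simp add: power2_eq_square)
      qed (use Epb[OF tx] in auto)
      have b0: "0 \<le> 2 / (s t x * (\<nu> + s t x)) * Ep t x" using s Epb[OF tx] by simp
      have "t powr \<alpha>1 * \<bar>dkern (\<nu> * r t x powr (2 * \<sigma>)) (r t x) t\<bar> = \<bar>t powr \<alpha>1 * dkern (\<nu> * r t x powr (2 * \<sigma>)) (r t x) t\<bar>"
        by (simp add: abs_mult)
      also have "\<dots> = x powr (2 - 4 * \<sigma>) * \<bar>(s t x + \<nu>) / (2 * s t x) * (Em t x / q t x) - 2 / (s t x * (\<nu> + s t x)) * Ep t x\<bar>"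
        unfolding D1[OF tx] abs_mult[of "x powr _"] by simp
      also have "\<dots> \<le> x powr (2 - 4 * \<sigma>) * (2 * (4 / \<nu> * x powr (- p) * E x) + 4 / \<nu>\<^sup>2 * E x)"
        using a a0 b b0 by (intro mult_left_mono) auto
      also have "\<dots> = 8 / \<nu> * (x powr (- (2 * \<sigma>)) * E x) + 4 / \<nu>\<^sup>2 * (x powr (2 - 4 * \<sigma>) * E x)"
      proof -
        \<comment> \<open>The division by \<open>q\<close> costs x^(-p), which leads exactly to the
          lowest power -2\<sigma> that the envelope admits.\<close>
        have "x powr (2 - 4 * \<sigma>) * x powr (- p) = x powr (- (2 * \<sigma>))" unfolding powr_add[symmetric] by (simp add: p_def)
        then show ?thesis by (simp add: distrib_left mult.assoc[symmetric]) (simp add: mult_ac)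
      qed
      also have "\<dots> \<le> 8 / \<nu> * ?env x + 4 / \<nu>\<^sup>2 * ?env x"
        using \<sigma> \<nu> by (intro add_mono mult_left_mono env x) auto
      also have "\<dots> = (4 / \<nu>\<^sup>2 + 8 / \<nu>) * ?env x" by (simp add: algebra_simps)
      also have "\<dots> \<le> A * ?env x" using Ab by (intro mult_right_mono envelope_nonneg)
      finally show "t powr \<alpha>1 * \<bar>dkern (\<nu> * r t x powr (2 * \<sigma>)) (r t x) t\<bar> \<le> A * ?env x" .
    }
    have "t powr \<alpha>1 * \<bar>- (1 / \<nu>) * r t x powr p * (exp (- (1 / \<nu>) * t * r t x powr p) / (\<nu> * r t x powr (2 * \<sigma>)))\<bar>
      = \<bar>t powr \<alpha>1 * (- (1 / \<nu>) * r t x powr p * (exp (- (1 / \<nu>) * t * r t x powr p) / (\<nu> * r t x powr (2 * \<sigma>))))\<bar>"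
      by (simp only: abs_mult abs_of_nonneg[OF powr_ge_zero])
    also have "\<dots> = 1 / \<nu>\<^sup>2 * (x powr (2 - 4 * \<sigma>) * E x)" unfolding P2[OF t x] using E0[of x] by (simp add: abs_mult)
    also have "\<dots> \<le> A * ?env x" using Ab \<sigma> by (intro AE x) auto
    finally show "t powr \<alpha>1 * \<bar>- (1 / \<nu>) * r t x powr p * (exp (- (1 / \<nu>) * t * r t x powr p) / (\<nu> * r t x powr (2 * \<sigma>)))\<bar> \<le> A * ?env x" .
  next
    fix x :: real assume x: "x > 0"
    have "((\<lambda>t. - (t powr \<alpha>0 * (x powr p * ((Ep t x - Em t x) / s t x)))) \<longlongrightarrow> - (0 * (x powr p * ((E x - 0) / \<nu>)))) at_top"
      using \<nu> by (intro tendsto_intros Eplim Emlim slim tl x) auto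
    then have l: "((\<lambda>t. - (t powr \<alpha>0 * (x powr p * ((Ep t x - Em t x) / s t x)))) \<longlongrightarrow> 0) at_top" by simp
    show "((\<lambda>t. t powr \<alpha>1 * - ((r t x)\<^sup>2 * kern (\<nu> * r t x powr (2 * \<sigma>)) (r t x) t)) \<longlongrightarrow> 0) at_top"
      by (rule Lim_transform_eventually[OF l]) (use evr[OF x] in \<open>eventually_elim, simp only: X2 x\<close>)
    have "((\<lambda>t. x powr (2 - 4 * \<sigma>) * ((s t x + \<nu>) / (2 * s t x) * (Em t x / q t x) - 2 / (s t x * (\<nu> + s t x)) * Ep t x) - - (1 / \<nu>\<^sup>2 * (x powr (2 - 4 * \<sigma>) * E x)))
      \<longlongrightarrow> x powr (2 - 4 * \<sigma>) * ((\<nu> + \<nu>) / (2 * \<nu>) * 0 - 2 / (\<nu> * (\<nu> + \<nu>)) * E x) - - (1 / \<nu>\<^sup>2 * (x powr (2 - 4 * \<sigma>) * E x))) at_top"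
      using \<nu> by (intro tendsto_intros Eplim Emqlim slim x) auto
    then have l: "((\<lambda>t. x powr (2 - 4 * \<sigma>) * ((s t x + \<nu>) / (2 * s t x) * (Em t x / q t x) - 2 / (s t x * (\<nu> + s t x)) * Ep t x) - - (1 / \<nu>\<^sup>2 * (x powr (2 - 4 * \<sigma>) * E x)))
      \<longlongrightarrow> 0) at_top" using \<nu> by (simp add: power2_eq_square)
    show "((\<lambda>t. t powr \<alpha>1 * (dkern (\<nu> * r t x powr (2 * \<sigma>)) (r t x) t - - (1 / \<nu>) * r t x powr p * (exp (- (1 / \<nu>) * t * r t x powr p) / (\<nu> * r t x powr (2 * \<sigma>))))) \<longlongrightarrow> 0) at_top"
      by (rule Lim_transform_eventually[OF l]) (use evr[OF x] in \<open>eventually_elim, simp only: right_diff_distrib[of "_ powr \<alpha>1"] D1 P2 x\<close>)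
  qed (use Ab \<nu> \<rho> in auto)
qed

section \<open>Norms of the profiles\<close>

definition profile_dominated :: "real \<Rightarrow> real \<Rightarrow> real \<Rightarrow> (real \<Rightarrow> real \<Rightarrow> real) \<Rightarrow> bool" where
  "profile_dominated p \<alpha> e P \<longleftrightarrow> (\<exists>A c. A \<ge> 0 \<and> c > 0 \<and>
    (\<forall>t\<ge>1. \<forall>x>0. t powr \<alpha> * \<bar>P t (t powr (-1/p) * x)\<bar> \<le> A * envelope e c p x))"

lemma low_freq_profile_dominated: "low_freq p \<alpha> e X0 X1 P \<Longrightarrow> profile_dominated p \<alpha> e P"
  unfolding low_freq_def profile_dominated_def by blast

text \<open>Scaled frequencies are positive, so identities for r > 0 suffice. This connects the
  kernel at \<sigma> = 1/2 with the closed form of its profile.\<close>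

lemma low_freq_cong:
  assumes "low_freq p \<alpha> e X0 X1 P"
    and eq: "\<And>t r. r > 0 \<Longrightarrow> X0 t r = X0' t r" "\<And>t r. r > 0 \<Longrightarrow> X1 t r = X1' t r"
      "\<And>t r. r > 0 \<Longrightarrow> P t r = P' t r"
  shows "low_freq p \<alpha> e X0' X1' P'"
proof -
  have pos: "t powr (-1/p) * x > 0" if "t \<ge> 1" "x > 0" for t x :: real using that by simp
  obtain A c \<rho> where A: "A \<ge> 0" "c > 0" "\<rho> > 0"
    and dom': "\<forall>t\<ge>1. \<forall>x>0. t powr (-1/p) * x \<le> \<rho> \<longrightarrow>
      t powr \<alpha> * \<bar>X0 t (t powr (-1/p) * x)\<bar> \<le> A * envelope e c p x \<and>
      t powr \<alpha> * \<bar>X1 t (t powr (-1/p) * x)\<bar> \<le> A * envelope e c p x"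
    and domP': "\<forall>t\<ge>1. \<forall>x>0. t powr \<alpha> * \<bar>P t (t powr (-1/p) * x)\<bar> \<le> A * envelope e c p x"
    and lim': "\<forall>x>0. ((\<lambda>t. t powr \<alpha> * X0 t (t powr (-1/p) * x)) \<longlongrightarrow> 0) at_top"
      "\<forall>x>0. ((\<lambda>t. t powr \<alpha> * (X1 t (t powr (-1/p) * x) - P t (t powr (-1/p) * x))) \<longlongrightarrow> 0) at_top"
    using assms(1) unfolding low_freq_def by (elim exE conjE) (rule that)
  note dom = dom'[rule_format] and domP = domP'[rule_format] and lim = lim'[rule_format]
  show ?thesis unfolding low_freq_def
  proof (rule exI[of _ A], rule exI[of _ c], rule exI[of _ \<rho>], intro conjI allI impI)
    fix t x :: real assume tx: "t \<ge> 1" "x > 0"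
    show "t powr \<alpha> * \<bar>P' t (t powr (-1/p) * x)\<bar> \<le> A * envelope e c p x"
      using domP[OF tx] unfolding eq[OF pos[OF tx]] .
    assume "t powr (-1/p) * x \<le> \<rho>"
    from dom[OF tx this] show "t powr \<alpha> * \<bar>X0' t (t powr (-1/p) * x)\<bar> \<le> A * envelope e c p x"
      "t powr \<alpha> * \<bar>X1' t (t powr (-1/p) * x)\<bar> \<le> A * envelope e c p x"
      unfolding eq[OF pos[OF tx]] by auto
  next
    fix x :: real assume x: "x > 0"
    show "((\<lambda>t. t powr \<alpha> * X0' t (t powr (-1/p) * x)) \<longlongrightarrow> 0) at_top"
      by (rule Lim_transform_eventually[OF lim(1)[OF x]])
        (use eventually_ge_at_top[of 1] in \<open>eventually_elim, simp only: eq[OF pos[OF _ x]]\<close>)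
    show "((\<lambda>t. t powr \<alpha> * (X1' t (t powr (-1/p) * x) - P' t (t powr (-1/p) * x))) \<longlongrightarrow> 0) at_top"
      by (rule Lim_transform_eventually[OF lim(2)[OF x]])
        (use eventually_ge_at_top[of 1] in \<open>eventually_elim, simp only: eq[OF pos[OF _ x]]\<close>)
  qed (use A in auto)
qed

lemma profile_L2:
  fixes k :: real
  assumes P: "profile_dominated p \<alpha> e P" and p: "p > 0" and e: "e > - real CARD('n) / 2" "e \<le> 2" and k: "k \<ge> 0"
    and m: "\<And>t. (\<lambda>\<xi>::real^'n. P t (norm \<xi>)) \<in> borel_measurable lborel"
  shows "\<And>t. t \<ge> 1 \<Longrightarrow> L2 (\<lambda>\<xi>::real^'n. complex_of_real (norm \<xi> powr k) * of_real (P t (norm \<xi>)))"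
    and "\<exists>C. \<forall>t\<ge>1. l2norm (\<lambda>\<xi>::real^'n. complex_of_real (norm \<xi> powr k) * of_real (P t (norm \<xi>)))
      \<le> C * t powr (- ((real CARD('n) / 2 + k) / p + \<alpha>))"
proof -
  obtain A c where A: "A \<ge> 0" "c > 0"
    and dom: "\<And>t x. t \<ge> 1 \<Longrightarrow> x > 0 \<Longrightarrow> t powr \<alpha> * \<bar>P t (t powr (-1/p) * x)\<bar> \<le> A * envelope e c p x"
    using P unfolding profile_dominated_def by blast
  note [measurable] = m
  define H where "H \<eta> = norm \<eta> powr k * (A * envelope e c p (norm \<eta>))" for \<eta> :: "real^'n"
  have LH: "L2 H" unfolding H_def by (rule L2_envelope[OF e p A(2) k])
  have *: "L2 (\<lambda>\<xi>::real^'n. complex_of_real (norm \<xi> powr k) * of_real (P t (norm \<xi>))) \<and>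
    l2norm (\<lambda>\<xi>::real^'n. complex_of_real (norm \<xi> powr k) * of_real (P t (norm \<xi>))) \<le> l2norm H * t powr (- ((real CARD('n) / 2 + k) / p + \<alpha>))"
    if t: "t \<ge> 1" for t
  proof -
    define g where "g \<xi> = complex_of_real (P t (norm \<xi>))" for \<xi> :: "real^'n"
    have gm [measurable]: "g \<in> borel_measurable lborel" unfolding g_def by measurable
    let ?F = "\<lambda>\<eta>. of_real (norm \<eta> powr k) * g ((t powr (-1/p)) *\<^sub>R \<eta>)"
    have Fm: "?F \<in> borel_measurable lborel" by measurable
    have FH: "norm (?F \<eta>) \<le> t powr (- \<alpha>) * norm (H \<eta>)" if \<eta>: "\<eta> \<noteq> 0" for \<eta>
    proof -
      have "t powr \<alpha> * \<bar>P t (t powr (-1/p) * norm \<eta>)\<bar> \<le> A * envelope e c p (norm \<eta>)"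
        using \<eta> by (intro dom t) simp
      then have "t powr (- \<alpha>) * (t powr \<alpha> * \<bar>P t (t powr (-1/p) * norm \<eta>)\<bar>) \<le> t powr (- \<alpha>) * (A * envelope e c p (norm \<eta>))"
        by (rule mult_left_mono) simp
      moreover have "t powr (- \<alpha>) * (t powr \<alpha> * z) = z" for z using t by (simp add: powr_minus)
      ultimately have "\<bar>P t (t powr (-1/p) * norm \<eta>)\<bar> \<le> t powr (- \<alpha>) * (A * envelope e c p (norm \<eta>))" by simp
      then have "norm \<eta> powr k * \<bar>P t (t powr (-1/p) * norm \<eta>)\<bar> \<le> norm \<eta> powr k * (t powr (- \<alpha>) * (A * envelope e c p (norm \<eta>)))"
        by (rule mult_left_mono) simp
      moreover have "norm (?F \<eta>) = norm \<eta> powr k * \<bar>P t (t powr (-1/p) * norm \<eta>)\<bar>"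
        using t by (simp add: g_def norm_mult)
      moreover have "norm (H \<eta>) = norm \<eta> powr k * (A * envelope e c p (norm \<eta>))"
        using A by (simp add: H_def abs_mult envelope_nonneg)
      ultimately show ?thesis by (simp add: mult.left_commute)
    qed
    have ae: "AE \<eta> in lborel. norm (?F \<eta>) \<le> t powr (- \<alpha>) * norm (H \<eta>)"
      using AE_nonzero by (rule eventually_mono) (rule FH)
    have t0: "t > 0" "p \<noteq> 0" using t p by auto
    have L: "L2 ?F" by (rule L2_scaled(1)[OF LH Fm ae])
    have N: "l2norm ?F \<le> t powr (- \<alpha>) * l2norm H" by (rule L2_scaled(2)[OF LH Fm ae]) simp
    have "l2norm (\<lambda>\<xi>. of_real (norm \<xi> powr k) * g \<xi>) = t powr (- ((real CARD('n) / 2 + k) / p)) * l2norm ?F"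
      by (rule l2norm_scale(2)[OF gm t0])
    also have "\<dots> \<le> t powr (- ((real CARD('n) / 2 + k) / p)) * (t powr (- \<alpha>) * l2norm H)"
      using N by (rule mult_left_mono) simp
    also have "\<dots> = l2norm H * t powr (- ((real CARD('n) / 2 + k) / p + \<alpha>))"
    proof -
      have "t powr (- (a + \<alpha>)) = t powr (- a) * t powr (- \<alpha>)" for a by (simp flip: powr_add)
      then show ?thesis by (simp only: mult_ac)
    qed
    finally show ?thesis using L l2norm_scale(1)[OF gm t0, of k] by (simp add: g_def)
  qed
  then show "\<And>t. t \<ge> 1 \<Longrightarrow> L2 (\<lambda>\<xi>::real^'n. complex_of_real (norm \<xi> powr k) * of_real (P t (norm \<xi>)))"
    "\<exists>C. \<forall>t\<ge>1. l2norm (\<lambda>\<xi>::real^'n. complex_of_real (norm \<xi> powr k) * of_real (P t (norm \<xi>)))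
      \<le> C * t powr (- ((real CARD('n) / 2 + k) / p + \<alpha>))" by blast+
qed

section \<open>Lower bounds for the profiles\<close>

lemma l2norm_pos:
  fixes g :: "real^'n \<Rightarrow> 'b::{banach,second_countable_topology}"
  assumes "L2 g" "open S" "S \<noteq> {}" "\<And>\<eta>. \<eta> \<in> S \<Longrightarrow> g \<eta> \<noteq> 0"
  shows "l2norm g > 0"
proof (rule ccontr)
  assume "\<not> l2norm g > 0"
  then have "l2norm g = 0" using l2norm_nonneg[of g] by linarith
  from l2norm_eq_0_AE[OF assms(1) this] have "AE \<eta> in lebesgue. g \<eta> = 0" by (rule AE_completion)
  then have "AE \<eta> in lebesgue. \<eta> \<notin> S" by (rule eventually_mono) (use assms(4) in auto)
  then have "negligible S"
    using assms(2) by (simp add: negligible_iff_null_sets AE_iff_null_sets)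
  then show False using open_not_negligible[OF assms(2,3)] by blast
qed

text \<open>Comparing the integral with its image under the dilation by \<open>1 + 1/\<tau>\<close> shifts the phase
  by \<open>norm \<eta>\<close>, so the squares at the two phases cannot both be small.\<close>

lemma oscillation_lower_bound:
  fixes \<phi> :: "real \<Rightarrow> real"
  assumes cont: "continuous_on UNIV \<phi>" and le1: "\<And>y. \<bar>\<phi> y\<bar> \<le> 1"
    and shift: "\<And>a b. (sin (a - b))\<^sup>2 \<le> 2 * ((\<phi> a)\<^sup>2 + (\<phi> b)\<^sup>2)"
  shows "\<exists>c>0. \<forall>\<tau>\<ge>2. c \<le> l2norm (\<lambda>\<eta>::real^'n. if 1 \<le> norm \<eta> \<and> norm \<eta> \<le> 3 then \<phi> (\<tau> * norm \<eta>) else 0)"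
proof -
  \<comment> \<open>The outer radius is a parameter: phases are compared on the annulus up to 2, and
    the dilated annulus fits into radius 3.\<close>
  define f where "f \<tau> r \<eta> = (if 1 \<le> norm \<eta> \<and> norm \<eta> \<le> r then (\<phi> (\<tau> * norm \<eta>))\<^sup>2 else 0)" for \<tau> r and \<eta> :: "real^'n"
  \<comment> \<open>Since 2 < pi the sine is positive on the open annulus, so the integral of
    \<open>g\<close> is a positive constant independent of the frequency.\<close>
  define g where "g \<eta> = (if 1 \<le> norm \<eta> \<and> norm \<eta> \<le> 2 then (sin (norm \<eta>))\<^sup>2 else 0)" for \<eta> :: "real^'n"
  have [measurable]: "\<phi> \<in> borel_measurable borel" by (rule borel_measurable_continuous_onI[OF cont])
  have \<phi>1: "(\<phi> y)\<^sup>2 \<le> 1" for y using le1[of y] by (simp add: abs_square_le_1)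
  have fi: "integrable lborel (f \<tau> r)" for \<tau> r
    by (rule L2_bounded_support(2)[of _ 1 r], unfold f_def, measurable) (use \<phi>1 in auto)
  have gL: "L2 (\<lambda>\<eta>::real^'n. if 1 \<le> norm \<eta> \<and> norm \<eta> \<le> 2 then sin (norm \<eta>) else 0)"
  proof (rule L2_bounded_support(1))
    show "norm (if 1 \<le> norm \<eta> \<and> norm \<eta> \<le> 2 then sin (norm \<eta>) else 0) \<le> 1" for \<eta> :: "real^'n" by simp
    show "(if 1 \<le> norm \<eta> \<and> norm \<eta> \<le> 2 then sin (norm \<eta>) else 0) = 0" if "norm \<eta> > 2" for \<eta> :: "real^'n"
      using that by simp
  qed measurable
  have gi: "integrable lborel g"
    by (rule L2_bounded_support(2)[of _ 1 2], unfold g_def, measurable) (auto simp: abs_square_le_1)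
  have gpos: "0 < (LINT \<eta>|lborel. g \<eta>)"
  proof -
    have "0 < l2norm (\<lambda>\<eta>::real^'n. if 1 \<le> norm \<eta> \<and> norm \<eta> \<le> 2 then sin (norm \<eta>) else 0)"
    proof (rule l2norm_pos[OF gL])
      have "open ((\<lambda>\<eta>::real^'n. norm \<eta>) -` {1<..<2})" by (rule open_vimage) (auto intro: continuous_intros)
      then show "open {\<eta>::real^'n. 1 < norm \<eta> \<and> norm \<eta> < 2}" by (simp add: vimage_def)
      have "(3/2) *\<^sub>R axis undefined 1 \<in> {\<eta>::real^'n. 1 < norm \<eta> \<and> norm \<eta> < 2}" by simp
      then show "{\<eta>::real^'n. 1 < norm \<eta> \<and> norm \<eta> < 2} \<noteq> {}" by blast
      fix \<eta> :: "real^'n" assume "\<eta> \<in> {\<eta>. 1 < norm \<eta> \<and> norm \<eta> < 2}"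
      then have "sin (norm \<eta>) > 0" using pi_gt3 by (intro sin_gt_zero) auto
      then show "(if 1 \<le> norm \<eta> \<and> norm \<eta> \<le> 2 then sin (norm \<eta>) else 0) \<noteq> 0"
        using \<open>\<eta> \<in> _\<close> by simp
    qed
    then have "0 < (l2norm (\<lambda>\<eta>::real^'n. if 1 \<le> norm \<eta> \<and> norm \<eta> \<le> 2 then sin (norm \<eta>) else 0))\<^sup>2" by simp
    also have "\<dots> = (LINT \<eta>|lborel. g \<eta>)"
      unfolding l2norm_squared g_def by (intro Bochner_Integration.integral_cong) auto
    finally show ?thesis .
  qed
  have J: "(LINT \<eta>|lborel. g \<eta>) / 4 \<le> (LINT \<eta>|lborel. f \<tau> 3 \<eta>)" if \<tau>: "\<tau> \<ge> 2" for \<tau>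
  proof -
    \<comment> \<open>For \<tau> \<ge> 2 this factor is at most 3/2 and maps the annulus from 1 to 2
      into the one from 1 to 3.\<close>
    define \<mu> where "\<mu> = 1 + 1 / \<tau>"
    have \<mu>: "1 \<le> \<mu>" "\<mu> \<le> 3/2" "\<tau> * \<mu> = \<tau> + 1" using \<tau> by (auto simp: \<mu>_def field_simps)
    have \<mu>0: "\<mu> > 0" using \<mu> by simp
    have m3: "f \<tau> 3 \<in> borel_measurable lborel" using fi by (rule borel_measurable_integrable)
    have i3: "integrable lborel (\<lambda>\<eta>. f \<tau> 3 (\<mu> *\<^sub>R \<eta>))" using lborel_scale(1)[OF \<mu>0 m3] fi by simp
    have "(LINT \<eta>|lborel. f (\<tau> + 1) 2 \<eta>) \<le> (LINT \<eta>|lborel. f \<tau> 3 (\<mu> *\<^sub>R \<eta>))"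
    proof (rule integral_mono[OF fi i3])
      fix \<eta> :: "real^'n"
      show "f (\<tau> + 1) 2 \<eta> \<le> f \<tau> 3 (\<mu> *\<^sub>R \<eta>)"
      proof (cases "1 \<le> norm \<eta> \<and> norm \<eta> \<le> 2")
        case True
        have n: "norm (\<mu> *\<^sub>R \<eta>) = \<mu> * norm \<eta>" using \<mu>0 by simp
        have "1 * 1 \<le> \<mu> * norm \<eta>" "\<mu> * norm \<eta> \<le> 3/2 * 2" by (rule mult_mono; use True \<mu> in linarith)+
        moreover have e: "(\<tau> + 1) * norm \<eta> = \<tau> * (\<mu> * norm \<eta>)" unfolding \<mu>(3)[symmetric] by simp
        ultimately show ?thesis using True unfolding f_def n e by simp
      qed (auto simp: f_def)
    qed
    \<comment> \<open>The Jacobian of the dilation is at least 1 and can be inserted for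
      free.\<close>
    also have "\<dots> \<le> \<mu> ^ CARD('n) * (LINT \<eta>|lborel. f \<tau> 3 (\<mu> *\<^sub>R \<eta>))"
    proof -
      have "0 \<le> (LINT \<eta>|lborel. f \<tau> 3 (\<mu> *\<^sub>R \<eta>))" by (simp add: f_def)
      then show ?thesis using mult_right_mono[OF one_le_power[OF \<mu>(1), of "CARD('n)"]] by fastforce
    qed
    also have "\<dots> = (LINT \<eta>|lborel. f \<tau> 3 \<eta>)" using lborel_scale(2)[OF \<mu>0 m3] by simp
    finally have 1: "(LINT \<eta>|lborel. f (\<tau> + 1) 2 \<eta>) \<le> (LINT \<eta>|lborel. f \<tau> 3 \<eta>)" .
    have 2: "(LINT \<eta>|lborel. f \<tau> 2 \<eta>) \<le> (LINT \<eta>|lborel. f \<tau> 3 \<eta>)"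
      by (rule integral_mono[OF fi fi]) (auto simp: f_def)
    have "(LINT \<eta>|lborel. g \<eta>) \<le> (LINT \<eta>|lborel. 2 * (f (\<tau> + 1) 2 \<eta> + f \<tau> 2 \<eta>))"
    proof (rule integral_mono[OF gi])
      show "integrable lborel (\<lambda>\<eta>. 2 * (f (\<tau> + 1) 2 \<eta> + f \<tau> 2 \<eta>))" using fi by auto
      fix \<eta> :: "real^'n"
      show "g \<eta> \<le> 2 * (f (\<tau> + 1) 2 \<eta> + f \<tau> 2 \<eta>)"
        using shift[of "(\<tau> + 1) * norm \<eta>" "\<tau> * norm \<eta>"] by (simp add: g_def f_def algebra_simps)
    qed
    also have "\<dots> = 2 * ((LINT \<eta>|lborel. f (\<tau> + 1) 2 \<eta>) + (LINT \<eta>|lborel. f \<tau> 2 \<eta>))" using fi by simp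
    finally have 3: "(LINT \<eta>|lborel. g \<eta>) \<le> 2 * ((LINT \<eta>|lborel. f (\<tau> + 1) 2 \<eta>) + (LINT \<eta>|lborel. f \<tau> 2 \<eta>))" .
    have key: "a \<le> 2 * (b + c) \<Longrightarrow> b \<le> d \<Longrightarrow> c \<le> d \<Longrightarrow> a / 4 \<le> d" for a b c d :: real by simp
    show ?thesis by (rule key[OF 3 1 2])
  qed
  show ?thesis
  proof (intro exI[of _ "sqrt ((LINT \<eta>|lborel. g \<eta>) / 4)"] conjI allI impI)
    show "sqrt ((LINT \<eta>|lborel. g \<eta>) / 4) > 0" using gpos by simp
    fix \<tau> :: real assume "\<tau> \<ge> 2"
    have "l2norm (\<lambda>\<eta>::real^'n. if 1 \<le> norm \<eta> \<and> norm \<eta> \<le> 3 then \<phi> (\<tau> * norm \<eta>) else 0) = sqrt (LINT \<eta>|lborel. f \<tau> 3 \<eta>)"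
      unfolding l2norm_def f_def by (intro arg_cong[where f=sqrt] Bochner_Integration.integral_cong) auto
    then show "sqrt ((LINT \<eta>|lborel. g \<eta>) / 4) \<le> l2norm (\<lambda>\<eta>::real^'n. if 1 \<le> norm \<eta> \<and> norm \<eta> \<le> 3 then \<phi> (\<tau> * norm \<eta>) else 0)"
      using J[OF \<open>\<tau> \<ge> 2\<close>] by simp
  qed
qed

text \<open>Exact self-similarity makes the norm at time t equal to the norm at time 1 times a power
  of t; it remains that the latter norm is positive, for which nonvanishing near 0 is
  enough.\<close>

lemma profile_lower_self_similar:
  fixes k :: real
  assumes P: "profile_dominated p \<alpha> e P" and p: "p > 0" and e: "e > - real CARD('n) / 2" "e \<le> 2" and k: "k \<ge> 0"
    and m: "\<And>t. (\<lambda>\<xi>::real^'n. P t (norm \<xi>)) \<in> borel_measurable lborel"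
    and sim: "\<And>t x. t \<ge> 1 \<Longrightarrow> x > 0 \<Longrightarrow> t powr \<alpha> * P t (t powr (-1/p) * x) = P 1 x"
    and nz: "\<delta> > 0" "\<And>x. 0 < x \<Longrightarrow> x < \<delta> \<Longrightarrow> P 1 x \<noteq> 0"
  shows "\<exists>c>0. \<forall>t\<ge>1. c * t powr (- ((real CARD('n) / 2 + k) / p + \<alpha>))
    \<le> l2norm (\<lambda>\<xi>::real^'n. complex_of_real (norm \<xi> powr k) * of_real (P t (norm \<xi>)))"
proof -
  note [measurable] = m
  let ?G = "\<lambda>t \<xi>::real^'n. complex_of_real (norm \<xi> powr k) * of_real (P t (norm \<xi>))"
  have pos: "l2norm (?G 1) > 0"
  proof (rule l2norm_pos[OF profile_L2(1)[OF P p e k m order_refl]])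
    show "open (ball (0::real^'n) \<delta> - {0})" by (intro open_Diff) auto
    have "(\<delta> / 2) *\<^sub>R axis undefined 1 \<in> ball (0::real^'n) \<delta> - {0}" using nz(1) by (simp add: axis_eq_0_iff)
    then show "ball (0::real^'n) \<delta> - {0} \<noteq> {}" by blast
    fix \<eta> :: "real^'n" assume "\<eta> \<in> ball 0 \<delta> - {0}"
    then show "?G 1 \<eta> \<noteq> 0" using nz(2)[of "norm \<eta>"] by simp
  qed
  have eqn: "l2norm (?G t) = l2norm (?G 1) * t powr (- ((real CARD('n) / 2 + k) / p + \<alpha>))" if t: "t \<ge> 1" for t
  proof -
    define g where "g \<xi> = complex_of_real (P t (norm \<xi>))" for \<xi> :: "real^'n"
    have gm [measurable]: "g \<in> borel_measurable lborel" unfolding g_def by measurable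
    have t0: "t > 0" "p \<noteq> 0" using t p by auto
    let ?F = "\<lambda>\<eta>. of_real (norm \<eta> powr k) * g ((t powr (-1/p)) *\<^sub>R \<eta>)"
    have "l2norm ?F = l2norm (\<lambda>\<eta>. of_real (t powr (- \<alpha>)) * ?G 1 \<eta>)"
    proof (rule l2norm_cong_AE)
      show "AE \<eta> in lborel. norm (?F \<eta>) = norm (of_real (t powr (- \<alpha>)) * ?G 1 \<eta>)"
        using AE_nonzero
      proof eventually_elim
        case (elim \<eta>)
        then have "P 1 (norm \<eta>) = t powr \<alpha> * P t (t powr (-1/p) * norm \<eta>)" using sim[OF t, of "norm \<eta>"] by simp
        then have eqP: "t powr (- \<alpha>) * P 1 (norm \<eta>) = P t (t powr (-1/p) * norm \<eta>)" using t by (simp add: powr_minus)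
        have "norm (?F \<eta>) = norm \<eta> powr k * \<bar>P t (t powr (-1/p) * norm \<eta>)\<bar>" using t by (simp add: g_def norm_mult)
        also have "\<dots> = norm \<eta> powr k * (t powr (- \<alpha>) * \<bar>P 1 (norm \<eta>)\<bar>)" unfolding eqP[symmetric] abs_mult by simp
        also have "\<dots> = norm (of_real (t powr (- \<alpha>)) * ?G 1 \<eta>)" by (simp add: norm_mult)
        finally show ?case .
      qed
    qed measurable
    also have "\<dots> = t powr (- \<alpha>) * l2norm (?G 1)" unfolding l2norm_cmult by simp
    finally have F: "l2norm ?F = t powr (- \<alpha>) * l2norm (?G 1)" .
    have pa: "t powr (- (a + \<alpha>)) = t powr (- a) * t powr (- \<alpha>)" for a by (simp flip: powr_add)
    have "l2norm (?G t) = l2norm (\<lambda>\<xi>. of_real (norm \<xi> powr k) * g \<xi>)" by (simp only: g_def)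
    also have "\<dots> = t powr (- ((real CARD('n) / 2 + k) / p)) * l2norm ?F" by (rule l2norm_scale(2)[OF gm t0])
    finally show ?thesis unfolding F pa by (simp only: mult_ac)
  qed
  show ?thesis
  proof (rule exI[of _ "l2norm (?G 1)"], intro conjI allI impI)
    fix t :: real assume "t \<ge> 1"
    then show "l2norm (?G 1) * t powr (- ((real CARD('n) / 2 + k) / p + \<alpha>)) \<le> l2norm (?G t)"
      by (rule eq_refl[OF eqn[symmetric]])
  qed (rule pos)
qed

text \<open>On the annulus from 1 to 3 the amplitude is bounded below by \<open>w0\<close> and
  |\<eta>|^k is at least 1, so only the oscillating factor \<open>\<phi>\<close> has to be bounded
  below in norm.\<close>

lemma profile_lower_oscillating:
  fixes k w0 :: real and \<phi> :: "real \<Rightarrow> real"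
  assumes P: "profile_dominated p \<alpha> e P" and p: "p > 1" and e: "e > - real CARD('n) / 2" "e \<le> 2" and k: "k \<ge> 0"
    and m: "\<And>t. (\<lambda>\<xi>::real^'n. P t (norm \<xi>)) \<in> borel_measurable lborel"
    and osc: "continuous_on UNIV \<phi>" "\<And>y. \<bar>\<phi> y\<bar> \<le> 1" "\<And>a b. (sin (a - b))\<^sup>2 \<le> 2 * ((\<phi> a)\<^sup>2 + (\<phi> b)\<^sup>2)"
    and w: "w0 > 0" "\<And>t x. t \<ge> 1 \<Longrightarrow> 1 \<le> x \<Longrightarrow> x \<le> 3 \<Longrightarrow> w0 * \<bar>\<phi> (t powr (1 - 1/p) * x)\<bar> \<le> t powr \<alpha> * \<bar>P t (t powr (-1/p) * x)\<bar>"
  shows "\<exists>c>0. \<forall>\<^sub>F t in at_top. c * t powr (- ((real CARD('n) / 2 + k) / p + \<alpha>))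
    \<le> l2norm (\<lambda>\<xi>::real^'n. complex_of_real (norm \<xi> powr k) * of_real (P t (norm \<xi>)))"
proof -
  note [measurable] = m
  have [measurable]: "\<phi> \<in> borel_measurable borel" by (rule borel_measurable_continuous_onI[OF osc(1)])
  obtain c where c: "c > 0" "\<And>\<tau>. \<tau> \<ge> 2 \<Longrightarrow> c \<le> l2norm (\<lambda>\<eta>::real^'n. if 1 \<le> norm \<eta> \<and> norm \<eta> \<le> 3 then \<phi> (\<tau> * norm \<eta>) else 0)"
    using oscillation_lower_bound[OF osc, where 'n='n] by blast
  \<comment> \<open>Here p > 1 is used: the frequency of oscillation in the scaled variable grows
    without bound.\<close>
  have tau: "\<forall>\<^sub>F t in at_top. (2::real) \<le> t powr (1 - 1/p)"
    using eventually_ge_at_top[of "2 powr (1 / (1 - 1/p))"]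
  proof eventually_elim
    case (elim t)
    have a: "1 - 1/p > 0" using p by simp
    have "(2 powr (1 / (1 - 1/p))) powr (1 - 1/p) \<le> t powr (1 - 1/p)" using elim a by (intro powr_mono2) auto
    moreover have "1 / (1 - 1/p) * (1 - 1/p) = 1" using a p by simp
    ultimately show ?case unfolding powr_powr by simp
  qed
  have lowb: "w0 * c * t powr (- ((real CARD('n) / 2 + k) / p + \<alpha>))
    \<le> l2norm (\<lambda>\<xi>::real^'n. complex_of_real (norm \<xi> powr k) * of_real (P t (norm \<xi>)))"
    if t: "t \<ge> 1" and \<tau>: "2 \<le> t powr (1 - 1/p)" for t
  proof -
    define g where "g \<xi> = complex_of_real (P t (norm \<xi>))" for \<xi> :: "real^'n"
    have gm [measurable]: "g \<in> borel_measurable lborel" unfolding g_def by measurable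
    have t0: "t > 0" "p \<noteq> 0" "p > 0" using t p by auto
    let ?F = "\<lambda>\<eta>. of_real (norm \<eta> powr k) * g ((t powr (-1/p)) *\<^sub>R \<eta>)"
    let ?\<Phi> = "\<lambda>\<eta>::real^'n. if 1 \<le> norm \<eta> \<and> norm \<eta> \<le> 3 then \<phi> (t powr (1 - 1/p) * norm \<eta>) else 0"
    have "L2 (\<lambda>\<xi>. of_real (norm \<xi> powr k) * g \<xi>)" unfolding g_def by (rule profile_L2(1)[OF P t0(3) e k m t])
    then have LF: "L2 ?F" using l2norm_scale(1)[OF gm t0(1,2), of k] by simp
    have "l2norm (\<lambda>\<eta>. (w0 * t powr (- \<alpha>)) *\<^sub>R ?\<Phi> \<eta>) \<le> l2norm ?F"
    proof (rule l2norm_mono[OF LF], intro AE_I2)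
      fix \<eta> :: "real^'n"
      show "norm ((w0 * t powr (- \<alpha>)) *\<^sub>R ?\<Phi> \<eta>) \<le> norm (?F \<eta>)"
      proof (cases "1 \<le> norm \<eta> \<and> norm \<eta> \<le> 3")
        case True
        have "t powr (- \<alpha>) * (w0 * \<bar>\<phi> (t powr (1 - 1/p) * norm \<eta>)\<bar>) \<le> t powr (- \<alpha>) * (t powr \<alpha> * \<bar>P t (t powr (-1/p) * norm \<eta>)\<bar>)"
          using True by (intro mult_left_mono w(2)[OF t]) auto
        also have "\<dots> = 1 * \<bar>P t (t powr (-1/p) * norm \<eta>)\<bar>" using t by (simp add: powr_minus)
        also have "\<dots> \<le> norm \<eta> powr k * \<bar>P t (t powr (-1/p) * norm \<eta>)\<bar>"
          using True k by (intro mult_right_mono ge_one_powr_ge_zero) auto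
        finally show ?thesis using True w(1) t by (simp add: g_def norm_mult abs_mult mult_ac)
      qed auto
    qed
    then have "w0 * t powr (- \<alpha>) * l2norm ?\<Phi> \<le> l2norm ?F" unfolding l2norm_scaleR using w(1) by (simp add: abs_mult)
    moreover have "w0 * t powr (- \<alpha>) * c \<le> w0 * t powr (- \<alpha>) * l2norm ?\<Phi>" using c(2)[OF \<tau>] w(1) by (intro mult_left_mono) auto
    ultimately have "t powr (- ((real CARD('n) / 2 + k) / p)) * (w0 * t powr (- \<alpha>) * c) \<le> t powr (- ((real CARD('n) / 2 + k) / p)) * l2norm ?F"
      by (intro mult_left_mono) auto
    also have "\<dots> = l2norm (\<lambda>\<xi>. of_real (norm \<xi> powr k) * g \<xi>)" by (rule l2norm_scale(2)[OF gm t0(1,2), symmetric])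
    also have "t powr (- ((real CARD('n) / 2 + k) / p)) * (w0 * t powr (- \<alpha>) * c) = w0 * c * t powr (- ((real CARD('n) / 2 + k) / p + \<alpha>))"
    proof -
      have "t powr (- (a + \<alpha>)) = t powr (- a) * t powr (- \<alpha>)" for a by (simp flip: powr_add)
      then show ?thesis by (simp only: mult_ac)
    qed
    finally show ?thesis by (simp add: g_def)
  qed
  have "\<forall>\<^sub>F t in at_top. w0 * c * t powr (- ((real CARD('n) / 2 + k) / p + \<alpha>))
    \<le> l2norm (\<lambda>\<xi>::real^'n. complex_of_real (norm \<xi> powr k) * of_real (P t (norm \<xi>)))"
    using tau eventually_ge_at_top[of 1] by eventually_elim (rule lowb)
  then show ?thesis using c(1) w(1) by (intro exI[of _ "w0 * c"]) simp
qed

text \<open>By the mean value theorem the difference quotients are bounded by \<open>P1\<close> at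
  intermediate times; for times in [1, t + 1] one envelope in the unscaled variable dominates them
  all. The strict bound t > 1 leaves a neighbourhood of t inside that interval.\<close>

lemma profile_has_L2_deriv:
  assumes P: "profile_dominated p \<alpha> e P" and P1: "profile_dominated p \<alpha>1 e P1" and p: "p > 0"
    and e: "e > - real CARD('n) / 2" "e \<le> 2"
    and m: "\<And>t. (\<lambda>\<xi>::real^'n. P t (norm \<xi>)) \<in> borel_measurable lborel" "\<And>t. (\<lambda>\<xi>::real^'n. P1 t (norm \<xi>)) \<in> borel_measurable lborel"
    and d: "\<And>t r. t > 0 \<Longrightarrow> r > 0 \<Longrightarrow> ((\<lambda>t. P t r) has_real_derivative P1 t r) (at t)"
    and t: "t > 1"
  shows "has_L2_deriv (\<lambda>s \<xi>::real^'n. complex_of_real (P s (norm \<xi>))) (\<lambda>\<xi>. complex_of_real (P1 t (norm \<xi>))) t"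
proof -
  note [measurable] = m
  obtain A c where A: "A \<ge> 0" "c > 0"
    and dom: "\<And>t x. t \<ge> 1 \<Longrightarrow> x > 0 \<Longrightarrow> t powr \<alpha>1 * \<bar>P1 t (t powr (-1/p) * x)\<bar> \<le> A * envelope e c p x"
    using P1 unfolding profile_dominated_def by blast
  define T where "T = t + 1"
  \<comment> \<open>Collects the largest powers of \<open>s\<close> over [1, T]: from the
    normalisation, and from rewriting the envelope at x = s^(1/p) r in terms of r.\<close>
  define C where "C = T powr \<bar>\<alpha>1\<bar> * (A * (T powr (\<bar>e\<bar> / p) + T powr (2 / p)))"
  have C0: "C \<ge> 0" using A by (simp add: C_def)
  have bd: "\<bar>P1 s r\<bar> \<le> C * envelope e c p r" if s: "s \<in> {1..T}" and r: "r > 0" for s r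
  proof -
    have le: "s powr a \<le> T powr \<bar>a\<bar>" for a
    proof -
      have "s powr a \<le> s powr \<bar>a\<bar>" using s by (intro powr_mono) auto
      also have "\<dots> \<le> T powr \<bar>a\<bar>" using s by (intro powr_mono2) auto
      finally show ?thesis .
    qed
    define x where "x = s powr (1/p) * r"
    have x: "x > 0" using s r by (simp add: x_def)
    have rx: "s powr (-1/p) * x = r" using s by (simp add: x_def powr_minus)
    have "s powr \<alpha>1 * \<bar>P1 s r\<bar> \<le> A * envelope e c p x" using dom[of s x] s x unfolding rx by simp
    then have "s powr (- \<alpha>1) * (s powr \<alpha>1 * \<bar>P1 s r\<bar>) \<le> s powr (- \<alpha>1) * (A * envelope e c p x)"
      by (rule mult_left_mono) simp
    moreover have "s powr (- \<alpha>1) * (s powr \<alpha>1 * z) = z" for z using s by (simp add: powr_minus)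
    ultimately have "\<bar>P1 s r\<bar> \<le> s powr (- \<alpha>1) * (A * envelope e c p x)" by simp
    also have "\<dots> \<le> T powr \<bar>\<alpha>1\<bar> * (A * envelope e c p x)"
      using le[of "- \<alpha>1"] A by (intro mult_right_mono) (auto simp: envelope_nonneg)
    also have "envelope e c p x \<le> (T powr (\<bar>e\<bar> / p) + T powr (2 / p)) * envelope e c p r"
    proof -
      have xe: "x powr a = s powr (a / p) * r powr a" for a unfolding x_def by (simp add: powr_mult powr_powr)
      have "s powr (e / p) \<le> T powr (\<bar>e\<bar> / p)" using le[of "e / p"] p by (simp add: abs_divide)
      moreover have "s powr (2 / p) \<le> T powr (2 / p)" using le[of "2 / p"] p by simp
      ultimately have "x powr e + x powr 2 \<le> T powr (\<bar>e\<bar> / p) * r powr e + T powr (2 / p) * r powr 2"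
        unfolding xe by (intro add_mono mult_right_mono) auto
      also have "\<dots> \<le> (T powr (\<bar>e\<bar> / p) + T powr (2 / p)) * (r powr e + r powr 2)"
        by (simp add: algebra_simps)
      finally have 1: "x powr e + x powr 2 \<le> (T powr (\<bar>e\<bar> / p) + T powr (2 / p)) * (r powr e + r powr 2)" .
      \<comment> \<open>Since s \<ge> 1, x^p = s r^p is at least r^p, so the exponential at
        \<open>x\<close> lies below the one at \<open>r\<close>.\<close>
      have "1 * r powr p \<le> s powr 1 * r powr p" using s by (intro mult_right_mono) auto
      then have "c * r powr p \<le> c * x powr p" unfolding xe using p A s by simp
      then have 2: "exp (- c * x powr p) \<le> exp (- c * r powr p)" by simp
      show ?thesis unfolding envelope_def mult.assoc[symmetric] using 1 2 by (intro mult_mono) auto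
    qed
    finally show ?thesis using A by (simp add: C_def mult.assoc mult_left_mono)
  qed
  have LH: "L2 (\<lambda>\<xi>::real^'n. norm \<xi> powr 0 * (C * envelope e c p (norm \<xi>)))" by (rule L2_envelope[OF e p A(2)]) simp
  let ?V = "\<lambda>s \<xi>::real^'n. complex_of_real (P s (norm \<xi>))"
  have ev: "\<forall>\<^sub>F s in at t within {0..}. s \<in> {1<..<T}"
  proof -
    have "\<forall>\<^sub>F s in nhds t. s \<in> {1<..<T}" by (rule eventually_nhds_in_open) (use t in \<open>auto simp: T_def\<close>)
    then show ?thesis unfolding eventually_at_filter by eventually_elim simp
  qed
  show ?thesis unfolding has_L2_deriv_def
  proof (rule L2_dominated_convergence_at[OF LH])
    show "\<forall>\<^sub>F s in at t within {0..}. (\<lambda>\<xi>. (?V s \<xi> - ?V t \<xi>) /\<^sub>R (s - t)) \<in> borel_measurable lborel \<and>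
      (AE \<xi> in lborel. norm ((?V s \<xi> - ?V t \<xi>) /\<^sub>R (s - t)) \<le> norm (norm \<xi> powr 0 * (C * envelope e c p (norm \<xi>))))"
      using ev
    proof eventually_elim
      case (elim s)
      have bnd: "norm ((?V s \<xi> - ?V t \<xi>) /\<^sub>R (s - t)) \<le> norm (norm \<xi> powr 0 * (C * envelope e c p (norm \<xi>)))" if \<xi>: "\<xi> \<noteq> 0" for \<xi>
      proof -
        have "\<bar>(P s (norm \<xi>) - P t (norm \<xi>)) / (s - t)\<bar> \<le> C * envelope e c p (norm \<xi>)"
          by (rule real_mvt_quotient_bound[where f="\<lambda>s. P s (norm \<xi>)" and f'="\<lambda>s. P1 s (norm \<xi>)" and a=1 and b=T])
            (use \<xi> d bd elim t C0 in \<open>auto simp: T_def envelope_nonneg\<close>)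
        moreover have "norm ((?V s \<xi> - ?V t \<xi>) /\<^sub>R (s - t)) = \<bar>(P s (norm \<xi>) - P t (norm \<xi>)) / (s - t)\<bar>"
          by (simp add: abs_divide divide_inverse abs_mult mult.commute flip: of_real_diff)
        ultimately show ?thesis using \<xi> C0 by (simp add: envelope_nonneg)
      qed
      show ?case
      proof
        show "(\<lambda>\<xi>. (?V s \<xi> - ?V t \<xi>) /\<^sub>R (s - t)) \<in> borel_measurable lborel" by measurable
        show "AE \<xi> in lborel. norm ((?V s \<xi> - ?V t \<xi>) /\<^sub>R (s - t)) \<le> norm (norm \<xi> powr 0 * (C * envelope e c p (norm \<xi>)))"
          using AE_nonzero by (rule eventually_mono) (rule bnd)
      qed
    qed
    have "((\<lambda>s. (?V s \<xi> - ?V t \<xi>) /\<^sub>R (s - t)) \<longlongrightarrow> of_real (P1 t (norm \<xi>))) (at t within {0..})" if \<xi>: "\<xi> \<noteq> 0" for \<xi>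
    proof -
      have "((\<lambda>s. (P s (norm \<xi>) - P t (norm \<xi>)) / (s - t)) \<longlongrightarrow> P1 t (norm \<xi>)) (at t within {0..})"
        using d[of t "norm \<xi>"] t \<xi> unfolding has_field_derivative_iff by (auto intro: tendsto_within_subset)
      from tendsto_of_real[OF this, where 'a=complex] show ?thesis
        by (simp add: scaleR_conv_of_real divide_inverse mult.commute)
    qed
    then show "AE \<xi> in lborel. ((\<lambda>s. (?V s \<xi> - ?V t \<xi>) /\<^sub>R (s - t)) \<longlongrightarrow> of_real (P1 t (norm \<xi>))) (at t within {0..})"
      using AE_nonzero by (auto elim!: eventually_mono)
    show "at t within {0..} \<noteq> bot" using t by (intro at_within_Ici_nontrivial) simp
  qed measurable
qed

section \<open>Asymptotics of the solution\<close>

lemma nabla_of_fourier: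
  fixes f F :: "real^'n \<Rightarrow> complex"
  assumes f: "L2 f" and F: "L2 (\<lambda>\<xi>. of_real (norm \<xi> powr k) * F \<xi>)" and ae: "AE \<xi> in lborel. fourier f \<xi> = F \<xi>"
  shows "nabla_L2 k f" "nabla_norm k f = l2norm (\<lambda>\<xi>. of_real (norm \<xi> powr k) * F \<xi>)"
proof -
  note [measurable] = fourier_measurable[OF f]
  have m: "nabla_symbol k f \<in> borel_measurable lborel" unfolding nabla_symbol_def[abs_def] by measurable
  have ae': "AE \<xi> in lborel. norm (nabla_symbol k f \<xi>) = norm (of_real (norm \<xi> powr k) * F \<xi>)"
    using ae by eventually_elim (simp add: nabla_symbol_def)
  have ae'': "AE \<xi> in lborel. norm (of_real (norm \<xi> powr k) * F \<xi>) = norm (nabla_symbol k f \<xi>)"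
    using ae' by eventually_elim simp
  show "nabla_L2 k f" unfolding nabla_L2_def using f L2_cong_AE[OF F m ae''] by blast
  show "nabla_norm k f = l2norm (\<lambda>\<xi>. of_real (norm \<xi> powr k) * F \<xi>)"
    unfolding nabla_norm_def by (rule l2norm_cong_AE[OF m L2_measurable[OF F] ae'])
qed

lemma remainder_fourier:
  fixes v G :: "real^'n \<Rightarrow> real"
  assumes v: "L2 v" and G: "L2 (cplx G)"
  shows "L2 (remainder v m G)"
    and "AE \<xi> in lborel. fourier (remainder v m G) \<xi> = fourier (cplx v) \<xi> - of_real m * of_real (G \<xi>)"
proof -
  have vc: "L2 (cplx v)" using v by (simp add: L2_cplx)
  note I = inv_fourier_props[OF G]
  have mI: "L2 (\<lambda>x. of_real m * inv_fourier (cplx G) x)" by (rule L2_cmult[OF I(1)])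
  have r: "remainder v m G = (\<lambda>x. cplx v x - of_real m * inv_fourier (cplx G) x)"
    by (simp add: remainder_def fun_eq_iff)
  show "L2 (remainder v m G)" unfolding r by (rule L2_diff[OF vc mI])
  show "AE \<xi> in lborel. fourier (remainder v m G) \<xi> = fourier (cplx v) \<xi> - of_real m * of_real (G \<xi>)"
    unfolding r using fourier_diff[OF vc mI] fourier_cmult[OF I(1), of "of_real m"] I(2)
    by eventually_elim simp
qed

lemma has_L2_deriv_linear:
  fixes v w :: "real \<Rightarrow> real^'n \<Rightarrow> complex"
  assumes "has_L2_deriv v v' t" "has_L2_deriv w w' t"
  shows "has_L2_deriv (\<lambda>s \<xi>. v s \<xi> - a * w s \<xi>) (\<lambda>\<xi>. v' \<xi> - a * w' \<xi>) t"
proof -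
  have "(\<lambda>s \<xi>. (v s \<xi> - a * w s \<xi> - (v t \<xi> - a * w t \<xi>)) /\<^sub>R (s - t))
    = (\<lambda>s \<xi>. (v s \<xi> - v t \<xi>) /\<^sub>R (s - t) - a * ((w s \<xi> - w t \<xi>) /\<^sub>R (s - t)))"
    by (simp add: fun_eq_iff scaleR_conv_of_real algebra_simps)
  then show ?thesis using L2_tendsto_diff[OF assms(1)[unfolded has_L2_deriv_def] L2_tendsto_cmult[OF assms(2)[unfolded has_L2_deriv_def], of a]]
    unfolding has_L2_deriv_def by simp
qed

lemma two_sided_of_smallo:
  fixes f g h :: "real \<Rightarrow> real"
  assumes fg: "\<forall>\<^sub>F t in at_top. \<bar>f t - \<mu> * g t\<bar> \<le> h t" and h: "h \<in> o(\<lambda>t. t powr \<gamma>)" and \<mu>: "\<mu> \<ge> 0"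
    and up: "\<forall>\<^sub>F t in at_top. g t \<le> C * t powr \<gamma>"
    and low: "c > 0" "\<forall>\<^sub>F t in at_top. c * t powr \<gamma> \<le> g t"
  shows "\<exists>K>0. \<forall>\<^sub>F t in at_top. (\<mu> > 0 \<longrightarrow> inverse K * t powr \<gamma> \<le> f t) \<and> f t \<le> K * t powr \<gamma>"
proof -
  \<comment> \<open>Half of the main term, so that the error can be absorbed. For \<mu> = 0 only the
    upper bound is claimed and any positive number will do.\<close>
  define \<epsilon> where "\<epsilon> = (if \<mu> > 0 then \<mu> * c / 2 else 1)"
  have \<epsilon>: "\<epsilon> > 0" using low(1) by (simp add: \<epsilon>_def)
  define K where "K = max (\<mu> * C + \<epsilon>) (inverse \<epsilon>)"
  have K: "K > 0" "\<mu> * C + \<epsilon> \<le> K" "inverse K \<le> \<epsilon>"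
  proof -
    have i: "inverse \<epsilon> \<le> K" by (simp add: K_def)
    then show "K > 0" using \<epsilon> by (meson inverse_positive_iff_positive less_le_trans)
    show "\<mu> * C + \<epsilon> \<le> K" by (simp add: K_def)
    show "inverse K \<le> \<epsilon>" using le_imp_inverse_le[OF i] \<epsilon> by simp
  qed
  have "\<forall>\<^sub>F t in at_top. norm (h t) \<le> \<epsilon> * norm (t powr \<gamma>)" by (rule landau_o.smallD[OF h \<epsilon>])
  then have "\<forall>\<^sub>F t in at_top. (\<mu> > 0 \<longrightarrow> inverse K * t powr \<gamma> \<le> f t) \<and> f t \<le> K * t powr \<gamma>"
    using fg up low(2)
  proof eventually_elim
    case (elim t)
    have ht: "h t \<le> \<epsilon> * t powr \<gamma>" using elim(1) by simp
    have "\<mu> * g t \<le> \<mu> * (C * t powr \<gamma>)" using elim(3) \<mu> by (rule mult_left_mono)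
    then have "f t \<le> (\<mu> * C + \<epsilon>) * t powr \<gamma>" using elim(2) ht by (simp add: algebra_simps)
    also have "\<dots> \<le> K * t powr \<gamma>" using K(2) by (rule mult_right_mono) simp
    finally have u: "f t \<le> K * t powr \<gamma>" .
    have "inverse K * t powr \<gamma> \<le> f t" if "\<mu> > 0"
    proof -
      have "inverse K * t powr \<gamma> \<le> \<epsilon> * t powr \<gamma>" using K(3) by (rule mult_right_mono) simp
      moreover have "\<mu> * (c * t powr \<gamma>) \<le> \<mu> * g t" using elim(4) \<mu> by (rule mult_left_mono)
      moreover have "\<mu> * (c * t powr \<gamma>) = 2 * (\<epsilon> * t powr \<gamma>)" using that by (simp add: \<epsilon>_def)
      ultimately show ?thesis using elim(2) ht by linarith
    qed
    with u show ?case by blast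
  qed
  with K(1) show ?thesis by blast
qed

context damped_wave
begin

text \<open>Decay is available for kern0, dkern and r kern. The spare power of r in the last one
  lets u1 in H^k0 match u0 in H^(k0+1) for k up to k0 + 1; a time derivative turns kern0 into - r^2
  kern and uses that power up, hence k \<le> k0.\<close>

lemma high_frequency:
  assumes \<rho>: "\<rho> > 0" and k: "0 \<le> k"
  shows "\<exists>B d. B \<ge> 0 \<and> d > 0 \<and> (\<forall>t\<ge>1. \<forall>r>\<rho>.
    (k \<le> k0 + 1 \<longrightarrow> r powr k * \<bar>kern0 (damp r) r t\<bar> \<le> B * exp (- d * t) * r powr (k0 + 1)
       \<and> r powr k * \<bar>kern (damp r) r t\<bar> \<le> B * exp (- d * t) * r powr k0) \<and>
    (k \<le> k0 \<longrightarrow> r powr k * \<bar>- (r\<^sup>2 * kern (damp r) r t)\<bar> \<le> B * exp (- d * t) * r powr (k0 + 1)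
       \<and> r powr k * \<bar>dkern (damp r) r t\<bar> \<le> B * exp (- d * t) * r powr k0))"
proof -
  obtain C d where C: "C > 0" "d > 0" and dec: "\<And>r t. r \<ge> \<rho> \<Longrightarrow> t \<ge> 0 \<Longrightarrow>
     \<bar>kern0 (damp r) r t\<bar> \<le> C * exp (- d * t) \<and> \<bar>dkern (damp r) r t\<bar> \<le> C * exp (- d * t)
   \<and> r * \<bar>kern (damp r) r t\<bar> \<le> C * exp (- d * t)"
    using kern_decay[OF \<nu> \<sigma> \<rho>] unfolding damp_def by blast
  \<comment> \<open>Only the differences k - k0 - 1 and k - k0 occur between the weight that is
    wanted and the weight that is available; being nonpositive where they are used, they give powers
    that are largest at \<open>\<rho>\<close>.\<close>
  define L where "L = \<rho> powr (k - k0 - 1) + \<rho> powr (k - k0)"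
  have L: "L \<ge> 0" by (simp add: L_def)
  have core: "r powr a * z \<le> L * C * exp (- d * t) * r powr b"
    if r: "r > \<rho>" and z: "0 \<le> z" "z \<le> C * exp (- d * t)" and ab: "a \<le> b" "a - b = k - k0 - 1 \<or> a - b = k - k0" for r t z a b
  proof -
    have "r powr (a - b) \<le> \<rho> powr (a - b)" using r \<rho> ab(1) by (intro powr_mono2') auto
    also have "\<dots> \<le> L" using ab(2) by (auto simp: L_def)
    finally have "r powr (a - b) * z \<le> L * (C * exp (- d * t))" using z L by (intro mult_mono) auto
    then have "r powr b * (r powr (a - b) * z) \<le> r powr b * (L * (C * exp (- d * t)))" by (rule mult_left_mono) simp
    moreover have "r powr a = r powr b * r powr (a - b)" using r \<rho> by (simp flip: powr_add)
    ultimately show ?thesis by (simp only: mult_ac)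
  qed
  show ?thesis
  proof (rule exI[of _ "L * C"], rule exI[of _ d], intro conjI allI impI)
    fix t r :: real assume t: "t \<ge> 1" and r: "r > \<rho>"
    have r0: "r > 0" using r \<rho> by simp
    note dec = dec[OF less_imp_le[OF r] order_trans[OF zero_le_one t]]
    have kr: "r powr k * \<bar>kern (damp r) r t\<bar> = r powr (k - 1) * (r * \<bar>kern (damp r) r t\<bar>)"
      using r0 by (simp add: powr_diff)
    { assume "k \<le> k0 + 1"
      then show "r powr k * \<bar>kern0 (damp r) r t\<bar> \<le> L * C * exp (- d * t) * r powr (k0 + 1)"
        "r powr k * \<bar>kern (damp r) r t\<bar> \<le> L * C * exp (- d * t) * r powr k0"
        unfolding kr by (intro core[OF r]; use dec r0 in auto)+ }
    have kr2: "r powr k * \<bar>- (r\<^sup>2 * kern (damp r) r t)\<bar> = r powr (k + 1) * (r * \<bar>kern (damp r) r t\<bar>)"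
      using r0 by (simp add: powr_add abs_mult power2_eq_square)
    { assume "k \<le> k0"
      then show "r powr k * \<bar>- (r\<^sup>2 * kern (damp r) r t)\<bar> \<le> L * C * exp (- d * t) * r powr (k0 + 1)"
        "r powr k * \<bar>dkern (damp r) r t\<bar> \<le> L * C * exp (- d * t) * r powr k0"
        unfolding kr2 by (intro core[OF r]; use dec r0 in auto)+ }
  qed (use C L in auto)
qed

text \<open>\<open>Y\<close> stands for \<open>U\<close> or \<open>V\<close>. The two-sided bound is
  stated as an implication because the lower bound for the profile has a different source in each
  range of \<sigma>; it is transferred by the triangle inequality, the distance to m P being of
  smaller order.\<close>

lemma component_asymptotics:
  fixes k :: real
  assumes low: "low_freq p \<alpha> e X0 X1 P" and p: "p > 0" and e: "e > - real CARD('n) / 2" "e \<le> 2" and k: "k \<ge> 0"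
    and X: "\<And>t. (\<lambda>\<xi>::real^'n. X0 t (norm \<xi>)) \<in> borel_measurable lborel"
      "\<And>t. (\<lambda>\<xi>::real^'n. X1 t (norm \<xi>)) \<in> borel_measurable lborel"
      "\<And>t. (\<lambda>\<xi>::real^'n. P t (norm \<xi>)) \<in> borel_measurable lborel"
    and high: "\<And>\<rho>. \<rho> > 0 \<Longrightarrow> \<exists>B d. B \<ge> 0 \<and> d > 0 \<and> (\<forall>t\<ge>1. \<forall>r>\<rho>.
      r powr k * \<bar>X0 t r\<bar> \<le> B * exp (- d * t) * r powr (k0 + 1) \<and> r powr k * \<bar>X1 t r\<bar> \<le> B * exp (- d * t) * r powr k0)"
    and Y: "\<And>t. t > 0 \<Longrightarrow> L2 (Y t)"
      "\<And>t. t > 0 \<Longrightarrow> AE \<xi> in lborel. Y t \<xi> = of_real (X0 t (norm \<xi>)) * W0 \<xi> + of_real (X1 t (norm \<xi>)) * W1 \<xi>"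
  defines "\<gamma> \<equiv> (real CARD('n) / 2 + k) / p + \<alpha>"
  shows "\<And>t. t \<ge> 1 \<Longrightarrow> L2 (\<lambda>\<xi>. of_real (norm \<xi> powr k) * (Y t \<xi> - of_real m * of_real (P t (norm \<xi>))))"
    and "(\<lambda>t. l2norm (\<lambda>\<xi>. of_real (norm \<xi> powr k) * (Y t \<xi> - of_real m * of_real (P t (norm \<xi>))))) \<in> o(\<lambda>t. t powr (- \<gamma>))"
    and "\<And>t. t \<ge> 1 \<Longrightarrow> L2 (\<lambda>\<xi>. of_real (norm \<xi> powr k) * Y t \<xi>)"
    and "\<exists>c>0. \<forall>\<^sub>F t in at_top. c * t powr (- \<gamma>)
        \<le> l2norm (\<lambda>\<xi>::real^'n. complex_of_real (norm \<xi> powr k) * of_real (P t (norm \<xi>))) \<Longrightarrow>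
      \<exists>C>0. \<forall>\<^sub>F t in at_top. (m1 \<noteq> 0 \<longrightarrow> inverse C * t powr (- \<gamma>) \<le> l2norm (\<lambda>\<xi>. of_real (norm \<xi> powr k) * Y t \<xi>))
        \<and> l2norm (\<lambda>\<xi>. of_real (norm \<xi> powr k) * Y t \<xi>) \<le> C * t powr (- \<gamma>)"
proof -
  note [measurable] = X
  obtain A c \<rho> where A: "A \<ge> 0" "c > 0" "\<rho> > 0"
    and dom': "\<forall>t\<ge>1. \<forall>x>0. t powr (-1/p) * x \<le> \<rho> \<longrightarrow>
      t powr \<alpha> * \<bar>X0 t (t powr (-1/p) * x)\<bar> \<le> A * envelope e c p x \<and>
      t powr \<alpha> * \<bar>X1 t (t powr (-1/p) * x)\<bar> \<le> A * envelope e c p x"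
    and domP': "\<forall>t\<ge>1. \<forall>x>0. t powr \<alpha> * \<bar>P t (t powr (-1/p) * x)\<bar> \<le> A * envelope e c p x"
    and lim': "\<forall>x>0. ((\<lambda>t. t powr \<alpha> * X0 t (t powr (-1/p) * x)) \<longlongrightarrow> 0) at_top"
      "\<forall>x>0. ((\<lambda>t. t powr \<alpha> * (X1 t (t powr (-1/p) * x) - P t (t powr (-1/p) * x))) \<longlongrightarrow> 0) at_top"
    using low unfolding low_freq_def by (elim exE conjE) (rule that)
  obtain M where M: "\<And>\<xi>. cmod (W0 \<xi>) \<le> M" "\<And>\<xi>. cmod (W1 \<xi>) \<le> M" using W_bounded by blast
  obtain B d where B: "B \<ge> 0" "d > 0" and hi: "\<forall>t\<ge>1. \<forall>r>\<rho>.
      r powr k * \<bar>X0 t r\<bar> \<le> B * exp (- d * t) * r powr (k0 + 1) \<and> r powr k * \<bar>X1 t r\<bar> \<le> B * exp (- d * t) * r powr k0"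
    using high[OF A(3)] by (elim exE conjE) (rule that)
  let ?D = "\<lambda>t \<xi>. of_real (X0 t (norm \<xi>)) * W0 \<xi> + of_real (X1 t (norm \<xi>)) * W1 \<xi> - of_real (m * P t (norm \<xi>))"
  note as = asymptotic_profile[OF p A(2,3) k e A(1) W_measurable M W1_at_0 X dom'[rule_format] domP'[rule_format]
      lim'(1)[rule_format] lim'(2)[rule_format] hi[rule_format] B(2,1) W_L2]
  let ?E = "\<lambda>t \<xi>. of_real (norm \<xi> powr k) * (Y t \<xi> - of_real m * of_real (P t (norm \<xi>)))"
  have E: "L2 (?E t) \<and> l2norm (?E t) = l2norm (\<lambda>\<xi>. of_real (norm \<xi> powr k) * ?D t \<xi>)" if t: "t \<ge> 1" for t
  proof -
    have t0: "t > 0" using t by simp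
    note [measurable] = L2_measurable[OF Y(1)[OF t0]]
    have m: "?E t \<in> borel_measurable lborel" by measurable
    have ae: "AE \<xi> in lborel. norm (of_real (norm \<xi> powr k) * ?D t \<xi>) = norm (?E t \<xi>)"
      using Y(2)[OF t0] by eventually_elim simp
    have LD: "L2 (\<lambda>\<xi>. of_real (norm \<xi> powr k) * ?D t \<xi>)" by (rule as(1)) (assumption | rule t)+
    show ?thesis using L2_cong_AE[OF LD m ae] l2norm_cong_AE[OF L2_measurable[OF LD] m ae] by simp
  qed
  show c1: "L2 (?E t)" if "t \<ge> 1" for t using E[OF that] by blast
  have "\<forall>\<^sub>F t in at_top. l2norm (?E t) = l2norm (\<lambda>\<xi>. of_real (norm \<xi> powr k) * ?D t \<xi>)"
    using eventually_ge_at_top[of 1] by eventually_elim (simp only: E)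
  from landau_o.small.in_cong[OF this] show c2: "(\<lambda>t. l2norm (?E t)) \<in> o(\<lambda>t. t powr (- \<gamma>))"
    unfolding \<gamma>_def by (rule iffD2) ((rule as(2)); assumption)
  let ?P = "\<lambda>t \<xi>::real^'n. complex_of_real (norm \<xi> powr k) * of_real (P t (norm \<xi>))"
  let ?Y = "\<lambda>t \<xi>. of_real (norm \<xi> powr k) * Y t \<xi>"
  note Pd = low_freq_profile_dominated[OF low]
  note LP = profile_L2(1)[OF Pd p e k X(3)]
  have Yd: "?Y t = (\<lambda>\<xi>. ?E t \<xi> + of_real m * ?P t \<xi>)" for t by (simp add: algebra_simps fun_eq_iff)
  show c3: "L2 (?Y t)" if t: "t \<ge> 1" for t
    unfolding Yd by (rule L2_add[OF c1[OF t] L2_cmult[OF LP[OF t]]])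
  assume "\<exists>c>0. \<forall>\<^sub>F t in at_top. c * t powr (- \<gamma>) \<le> l2norm (?P t)"
  then obtain c' where c': "c' > 0" "\<forall>\<^sub>F t in at_top. c' * t powr (- \<gamma>) \<le> l2norm (?P t)" by blast
  obtain C where C: "\<forall>t\<ge>1. l2norm (?P t) \<le> C * t powr (- \<gamma>)"
    using profile_L2(2)[OF Pd p e k X(3)] unfolding \<gamma>_def by blast
  have up: "\<forall>\<^sub>F t in at_top. l2norm (?P t) \<le> C * t powr (- \<gamma>)"
    using eventually_ge_at_top[of 1] by eventually_elim (use C in blast)
  have close: "\<forall>\<^sub>F t in at_top. \<bar>l2norm (?Y t) - \<bar>m\<bar> * l2norm (?P t)\<bar> \<le> l2norm (?E t)"
    using eventually_ge_at_top[of 1]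
  proof eventually_elim
    case (elim t)
    have "\<bar>l2norm (?Y t) - l2norm (\<lambda>\<xi>. of_real m * ?P t \<xi>)\<bar> \<le> l2norm (\<lambda>\<xi>. ?Y t \<xi> - of_real m * ?P t \<xi>)"
      by (rule l2norm_diff_abs[OF c3[OF elim] L2_cmult[OF LP[OF elim]]])
    moreover have "(\<lambda>\<xi>. ?Y t \<xi> - of_real m * ?P t \<xi>) = ?E t" by (simp add: algebra_simps fun_eq_iff)
    ultimately show ?case by (simp add: l2norm_cmult)
  qed
  have m0: "\<bar>m\<bar> > 0 \<longleftrightarrow> m1 \<noteq> 0" by (simp add: m_def fourier_const_def)
  show "\<exists>C>0. \<forall>\<^sub>F t in at_top. (m1 \<noteq> 0 \<longrightarrow> inverse C * t powr (- \<gamma>) \<le> l2norm (?Y t)) \<and> l2norm (?Y t) \<le> C * t powr (- \<gamma>)"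
    using two_sided_of_smallo[OF close c2 abs_ge_zero up c'] unfolding m0 .
qed

text \<open>On the Fourier side the remainder is a difference of two differentiable functions; its
  derivative is brought back by the inverse transform. Since \<open>time_deriv\<close> is a choice,
  it agrees with that preimage only AE, which suffices for its transform.\<close>

lemma remainder_time_deriv:
  fixes G :: "real \<Rightarrow> real^'n \<Rightarrow> real"
  assumes t: "t > 1" and G: "\<And>s. s \<ge> 1 \<Longrightarrow> L2 (cplx (G s))" and G': "L2 (cplx G')"
    and d: "has_L2_deriv (\<lambda>s. cplx (G s)) (cplx G') t"
  shows "\<exists>w. has_L2_deriv (\<lambda>s. remainder (u s) m (G s)) w t"
    and "L2 (time_deriv (\<lambda>s. remainder (u s) m (G s)) t)"
    and "AE \<xi> in lborel. fourier (time_deriv (\<lambda>s. remainder (u s) m (G s)) t) \<xi> = V t \<xi> - of_real m * of_real (G' \<xi>)"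
proof -
  let ?R = "\<lambda>s. remainder (u s) m (G s)" and ?F = "\<lambda>s \<xi>. U s \<xi> - of_real m * of_real (G s \<xi>)"
  let ?F' = "\<lambda>\<xi>. V t \<xi> - of_real m * of_real (G' \<xi>)"
  have t0: "t \<ge> 0" "t \<ge> 1" using t by auto
  have dF: "has_L2_deriv ?F ?F' t" by (rule has_L2_deriv_linear[OF U_has_L2_deriv[OF t0(1)] d])
  have R: "L2 (?R s) \<and> L2 (?F s) \<and> (AE \<xi> in lborel. fourier (?R s) \<xi> = ?F s \<xi>)" if s: "s \<ge> 1" for s
  proof -
    have s0: "s \<ge> 0" using s by simp
    show ?thesis using remainder_fourier[OF u_L2(1)[OF s0] G[OF s], of m] L2_diff[OF UV_L2(1)[OF s0] L2_cmult[OF G[OF s], of "of_real m"]]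
      unfolding U_def by blast
  qed
  have ev: "\<forall>\<^sub>F s in at t within {0..}. L2 (?R s) \<and> L2 (?F s) \<and> (AE \<xi> in lborel. fourier (?R s) \<xi> = ?F s \<xi>)"
  proof -
    have "\<forall>\<^sub>F s in nhds t. s \<in> {1<..}" by (rule eventually_nhds_in_open) (use t in auto)
    then have "\<forall>\<^sub>F s in at t within {0..}. s \<in> {1<..}" unfolding eventually_at_filter by eventually_elim simp
    then show ?thesis by eventually_elim (rule R, simp)
  qed
  have LF': "L2 ?F'" by (rule L2_diff[OF UV_L2(2)[OF t0(1)] L2_cmult[OF G']])
  note w = inv_fourier_props[OF LF']
  have "has_L2_deriv ?R (inv_fourier ?F') t"
    using has_L2_deriv_fourier_iff[OF ev _ _ _ w(1) LF' w(2)] R[OF t0(2)] dF by blast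
  then have dR: "has_L2_deriv ?R (inv_fourier ?F') t" .
  then show "\<exists>w. has_L2_deriv ?R w t" by blast
  note dT = has_L2_deriv_time_deriv[OF dR]
  show LT: "L2 (time_deriv ?R t)" using dT unfolding has_L2_deriv_def by (rule L2_tendstoD(1))
  have "fourier (time_deriv ?R t) = fourier (inv_fourier ?F')"
    by (rule fourier_cong_AE[OF L2_measurable[OF LT] L2_measurable[OF w(1)] has_L2_deriv_unique[OF dT dR t0(1)]])
  with w(2) show "AE \<xi> in lborel. fourier (time_deriv ?R t) \<xi> = ?F' \<xi>" by simp
qed

end

section \<open>Closed forms and nonvanishing of the profiles\<close>

lemma half_profile_eq:
  fixes r t \<nu> :: real
  assumes "r > 0" "\<nu> > 0"
  shows "kern (\<nu> * r) r t = (if \<nu> < 2 then 2 * exp (- (\<nu> / 2) * t * r) * sin (t * r * sqrt (4 - \<nu>\<^sup>2) / 2) / (r * sqrt (4 - \<nu>\<^sup>2))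
      else if \<nu> = 2 then t * exp (- t * r)
      else 2 * exp (- (\<nu> / 2) * t * r) * sinh (t * r * sqrt (\<nu>\<^sup>2 - 4) / 2) / (r * sqrt (\<nu>\<^sup>2 - 4)))"
proof -
  consider "\<nu> < 2" | "\<nu> = 2" | "\<nu> > 2" by linarith
  then show ?thesis
  proof cases
    case 1
    define q where "q = r * sqrt (4 - \<nu>\<^sup>2) / 2"
    have "0 < (2 - \<nu>) * (2 + \<nu>)" using 1 assms by (intro mult_pos_pos) auto
    then have s: "4 - \<nu>\<^sup>2 > 0" by (simp add: algebra_simps power2_eq_square)
    have q: "q > 0" using s assms by (simp add: q_def)
    have "(\<nu> * r)\<^sup>2 / 4 - r\<^sup>2 = - q\<^sup>2" using s by (simp add: q_def power_mult_distrib power_divide field_simps)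
    then have "kern (\<nu> * r) r t = exp (- (\<nu> * r / 2) * t) * (sin (q * t) / q)"
      unfolding kern_def using gsin_gcos_pos(3)[OF q] by simp
    also have "\<dots> = 2 * exp (- (\<nu> / 2) * t * r) * sin (t * r * sqrt (4 - \<nu>\<^sup>2) / 2) / (r * sqrt (4 - \<nu>\<^sup>2))"
      by (simp add: q_def mult_ac)
    finally show ?thesis using 1 by simp
  next
    case 3
    define q where "q = r * sqrt (\<nu>\<^sup>2 - 4) / 2"
    have "0 < (\<nu> - 2) * (2 + \<nu>)" using 3 by (intro mult_pos_pos) auto
    then have s: "\<nu>\<^sup>2 - 4 > 0" by (simp add: algebra_simps power2_eq_square)
    have q: "q > 0" using s assms by (simp add: q_def)
    have "(\<nu> * r)\<^sup>2 / 4 - r\<^sup>2 = q\<^sup>2" using s by (simp add: q_def power_mult_distrib power_divide field_simps)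
    then have "kern (\<nu> * r) r t = exp (- (\<nu> * r / 2) * t) * (sinh (q * t) / q)"
      unfolding kern_def using gsin_gcos_pos(1)[OF q] by simp
    also have "\<dots> = 2 * exp (- (\<nu> / 2) * t * r) * sinh (t * r * sqrt (\<nu>\<^sup>2 - 4) / 2) / (r * sqrt (\<nu>\<^sup>2 - 4))"
      by (simp add: q_def mult_ac)
    finally show ?thesis using 3 by simp
  qed (auto simp: kern_def gsin_def mult_ac)
qed

text \<open>The initial data decide: \<open>kern\<close> has derivative 1 at 0 and
  \<open>dkern\<close> has value 1 there. Away from 0 zeros can occur when the kernels
  oscillate.\<close>

lemma kern_nonzero_near_0:
  "\<exists>\<delta>>0. \<forall>x. 0 < x \<longrightarrow> x < \<delta> \<longrightarrow> kern \<nu> 1 x \<noteq> 0 \<and> dkern \<nu> 1 x \<noteq> 0"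
proof -
  have "(kern \<nu> 1 has_real_derivative 1) (at 0)" using kern_deriv[of \<nu> 1 0] by simp
  from DERIV_pos_inc_right[OF this] obtain d1 where d1: "d1 > 0" "\<And>h. h > 0 \<Longrightarrow> h < d1 \<Longrightarrow> kern \<nu> 1 h > 0"
    by auto
  have "(dkern \<nu> 1 \<longlongrightarrow> 1) (at 0)" using DERIV_isCont[OF dkern_deriv[of \<nu> 1 0]] by (simp add: isCont_def)
  then have "\<forall>\<^sub>F x in at 0. dkern \<nu> 1 x > 0" by (rule order_tendstoD) simp
  then obtain d2 where d2: "d2 > 0" "\<And>x. x \<noteq> 0 \<Longrightarrow> dist x 0 < d2 \<Longrightarrow> dkern \<nu> 1 x > 0"
    unfolding eventually_at by blast
  show ?thesis
  proof (intro exI[of _ "min d1 d2"] conjI allI impI)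
    fix x :: real assume x: "0 < x" "x < min d1 d2"
    show "kern \<nu> 1 x \<noteq> 0" using d1(2)[of x] x by simp
    show "dkern \<nu> 1 x \<noteq> 0" using d2(2)[of x] x by simp
  qed (use d1 d2 in simp)
qed

lemma square_sum_bound:
  fixes a b c d :: real
  assumes "\<bar>c\<bar> \<le> 1" "\<bar>d\<bar> \<le> 1"
  shows "(a * c - d * b)\<^sup>2 \<le> 2 * (a\<^sup>2 + b\<^sup>2)"
proof -
  have "\<bar>a * c - d * b\<bar> \<le> \<bar>a\<bar> * \<bar>c\<bar> + \<bar>d\<bar> * \<bar>b\<bar>" by (metis abs_mult abs_triangle_ineq4)
  also have "\<dots> \<le> \<bar>a\<bar> * 1 + 1 * \<bar>b\<bar>" using assms by (intro add_mono mult_mono) auto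
  finally have "(a * c - d * b)\<^sup>2 \<le> (\<bar>a\<bar> + \<bar>b\<bar>)\<^sup>2" by (simp add: abs_le_square_iff[symmetric])
  also have "\<dots> \<le> 2 * (a\<^sup>2 + b\<^sup>2)" using sum_squares_bound[of "\<bar>a\<bar>" "\<bar>b\<bar>"] by (simp add: power2_sum)
  finally show ?thesis .
qed

text \<open>The addition formula writes sin(a - b) as a combination of sin a and sin b, or of cos a
  and cos b, with coefficients of modulus at most 1.\<close>

lemma sin_cos_shift:
  fixes a b :: real
  shows "(sin (a - b))\<^sup>2 \<le> 2 * ((sin a)\<^sup>2 + (sin b)\<^sup>2)" "(sin (a - b))\<^sup>2 \<le> 2 * ((cos a)\<^sup>2 + (cos b)\<^sup>2)"
  using square_sum_bound[of "cos b" "cos a" "sin a" "sin b"] square_sum_bound[of "sin a" "- sin b" "cos b" "- cos a"]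
  by (auto simp: sin_diff algebra_simps power2_commute)

context damped_wave
begin

text \<open>\<open>P1\<close> plays two roles: it may be the time derivative of \<open>P0\<close>,
  and then the remainder itself can be differentiated; in any case it is the profile of the time
  derivative of the solution. The derivative hypothesis therefore appears only as a premise of the
  second conclusion. \<open>\<beta>\<close> is the decay gained by one time derivative.\<close>

lemma profile_asymptotics:
  fixes P0 P1 :: "real \<Rightarrow> real \<Rightarrow> real"
  assumes low0: "low_freq p \<alpha>0 e (\<lambda>t r. kern0 (damp r) r t) (\<lambda>t r. kern (damp r) r t) P0"
    and low1: "low_freq p \<alpha>1 e (\<lambda>t r. - (r\<^sup>2 * kern (damp r) r t)) (\<lambda>t r. dkern (damp r) r t) P1"
    and p: "p > 0" and e: "e > - real CARD('n) / 2" "e \<le> 2"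
    and mP: "\<And>t. (\<lambda>\<xi>::real^'n. P0 t (norm \<xi>)) \<in> borel_measurable lborel" "\<And>t. (\<lambda>\<xi>::real^'n. P1 t (norm \<xi>)) \<in> borel_measurable lborel"
    and lb0: "\<And>k. k \<ge> 0 \<Longrightarrow> \<exists>c>0. \<forall>\<^sub>F t in at_top. c * t powr (- ((real CARD('n) / 2 + k) / p + \<alpha>0))
        \<le> l2norm (\<lambda>\<xi>::real^'n. complex_of_real (norm \<xi> powr k) * of_real (P0 t (norm \<xi>)))"
    and lb1: "\<And>k. k \<ge> 0 \<Longrightarrow> \<exists>c>0. \<forall>\<^sub>F t in at_top. c * t powr (- ((real CARD('n) / 2 + k) / p + \<alpha>1))
        \<le> l2norm (\<lambda>\<xi>::real^'n. complex_of_real (norm \<xi> powr k) * of_real (P1 t (norm \<xi>)))"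
    and \<gamma>0: "\<And>k. (real CARD('n) / 2 + k) / p + \<alpha>0 = decay_exponent CARD('n) \<sigma> k"
    and \<gamma>1: "\<And>k. (real CARD('n) / 2 + k) / p + \<alpha>1 = decay_exponent CARD('n) \<sigma> k + \<beta>"
    and k: "k \<ge> 0"
  shows "k \<le> k0 + 1 \<Longrightarrow> (\<forall>\<^sub>F t in at_top. nabla_L2 k (remainder (u t) m (\<lambda>\<xi>. P0 t (norm \<xi>)))) \<and>
      (\<lambda>t. nabla_norm k (remainder (u t) m (\<lambda>\<xi>. P0 t (norm \<xi>)))) \<in> o(\<lambda>t. t powr (- decay_exponent CARD('n) \<sigma> k))"
    and "k \<le> k0 \<Longrightarrow> (\<And>t r. t > 0 \<Longrightarrow> r > 0 \<Longrightarrow> ((\<lambda>t. P0 t r) has_real_derivative P1 t r) (at t)) \<Longrightarrow>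
      (\<forall>\<^sub>F t in at_top. \<exists>w. has_L2_deriv (\<lambda>s. remainder (u s) m (\<lambda>\<xi>. P0 s (norm \<xi>))) w t) \<and>
      (\<forall>\<^sub>F t in at_top. nabla_L2 k (time_deriv (\<lambda>s. remainder (u s) m (\<lambda>\<xi>. P0 s (norm \<xi>))) t)) \<and>
      (\<lambda>t. nabla_norm k (time_deriv (\<lambda>s. remainder (u s) m (\<lambda>\<xi>. P0 s (norm \<xi>))) t)) \<in> o(\<lambda>t. t powr (- decay_exponent CARD('n) \<sigma> k - \<beta>))"
    and "k \<le> k0 \<Longrightarrow> (\<forall>\<^sub>F t in at_top. nabla_L2 k (remainder (time_deriv u t) m (\<lambda>\<xi>. P1 t (norm \<xi>)))) \<and>
      (\<lambda>t. nabla_norm k (remainder (time_deriv u t) m (\<lambda>\<xi>. P1 t (norm \<xi>)))) \<in> o(\<lambda>t. t powr (- decay_exponent CARD('n) \<sigma> k - \<beta>))"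
    and "l \<in> {0, 1::nat} \<Longrightarrow> k + real l \<le> k0 + 1 \<Longrightarrow> \<exists>C>0. \<forall>\<^sub>F t in at_top.
      nabla_L2 k (cplx ((time_deriv ^^ l) u t)) \<and>
      (m1 \<noteq> 0 \<longrightarrow> inverse C * t powr (- decay_exponent CARD('n) \<sigma> k - real l * \<beta>) \<le> nabla_norm k (cplx ((time_deriv ^^ l) u t))) \<and>
      nabla_norm k (cplx ((time_deriv ^^ l) u t)) \<le> C * t powr (- decay_exponent CARD('n) \<sigma> k - real l * \<beta>)"
proof -
  note [measurable] = mP
  have X: "(\<lambda>\<xi>::real^'n. kern0 (damp (norm \<xi>)) (norm \<xi>) t) \<in> borel_measurable lborel"
    "(\<lambda>\<xi>::real^'n. kern (damp (norm \<xi>)) (norm \<xi>) t) \<in> borel_measurable lborel"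
    "(\<lambda>\<xi>::real^'n. - ((norm \<xi>)\<^sup>2 * kern (damp (norm \<xi>)) (norm \<xi>) t)) \<in> borel_measurable lborel"
    "(\<lambda>\<xi>::real^'n. dkern (damp (norm \<xi>)) (norm \<xi>) t) \<in> borel_measurable lborel" for t
    by measurable
  have \<gamma>m: "- (decay_exponent CARD('n) \<sigma> k + \<beta>) = - decay_exponent CARD('n) \<sigma> k - \<beta>" by simp
  have LP: "L2 (\<lambda>\<xi>::real^'n. complex_of_real (P0 t (norm \<xi>)))" "L2 (\<lambda>\<xi>::real^'n. complex_of_real (P1 t (norm \<xi>)))" if t: "t \<ge> 1" for t
  proof -
    have *: "L2 (\<lambda>\<xi>::real^'n. complex_of_real (f (norm \<xi>)))"
      if L: "L2 (\<lambda>\<xi>::real^'n. complex_of_real (norm \<xi> powr 0) * of_real (f (norm \<xi>)))"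
        and [measurable]: "(\<lambda>\<xi>::real^'n. f (norm \<xi>)) \<in> borel_measurable lborel" for f
      by (rule L2_cong_AE[OF L], measurable) (rule eventually_mono[OF AE_nonzero], simp)
    show "L2 (\<lambda>\<xi>::real^'n. complex_of_real (P0 t (norm \<xi>)))"
      by (rule *[OF profile_L2(1)[OF low_freq_profile_dominated[OF low0] p e order_refl mP(1) t] mP(1)])
    show "L2 (\<lambda>\<xi>::real^'n. complex_of_real (P1 t (norm \<xi>)))"
      by (rule *[OF profile_L2(1)[OF low_freq_profile_dominated[OF low1] p e order_refl mP(2) t] mP(2)])
  qed
  have hi0: "\<exists>B d. B \<ge> 0 \<and> d > 0 \<and> (\<forall>t\<ge>1. \<forall>r>\<rho>. r powr k * \<bar>kern0 (damp r) r t\<bar> \<le> B * exp (- d * t) * r powr (k0 + 1)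
      \<and> r powr k * \<bar>kern (damp r) r t\<bar> \<le> B * exp (- d * t) * r powr k0)" if "k \<le> k0 + 1" "\<rho> > 0" for \<rho>
    using high_frequency[OF that(2) k] that(1) by meson
  have hi1: "\<exists>B d. B \<ge> 0 \<and> d > 0 \<and> (\<forall>t\<ge>1. \<forall>r>\<rho>. r powr k * \<bar>- (r\<^sup>2 * kern (damp r) r t)\<bar> \<le> B * exp (- d * t) * r powr (k0 + 1)
      \<and> r powr k * \<bar>dkern (damp r) r t\<bar> \<le> B * exp (- d * t) * r powr k0)" if "k \<le> k0" "\<rho> > 0" for \<rho>
    using high_frequency[OF that(2) k] that(1) by meson
  note as0 = component_asymptotics[OF low0 p e k X(1,2) mP(1) hi0 UV_L2(1)[OF less_imp_le] solution_formula(1), unfolded \<gamma>0]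
  note as1 = component_asymptotics[OF low1 p e k X(3,4) mP(2) hi1 UV_L2(2)[OF less_imp_le] solution_formula(2), unfolded \<gamma>1 \<gamma>m]
  show "(\<forall>\<^sub>F t in at_top. nabla_L2 k (remainder (u t) m (\<lambda>\<xi>. P0 t (norm \<xi>)))) \<and>
      (\<lambda>t. nabla_norm k (remainder (u t) m (\<lambda>\<xi>. P0 t (norm \<xi>)))) \<in> o(\<lambda>t. t powr (- decay_exponent CARD('n) \<sigma> k))"
    if kk: "k \<le> k0 + 1"
  proof -
    let ?F = "\<lambda>t \<xi>. U t \<xi> - of_real m * of_real (P0 t (norm \<xi>))"
    have N: "nabla_L2 k (remainder (u t) m (\<lambda>\<xi>. P0 t (norm \<xi>)))"
      "nabla_norm k (remainder (u t) m (\<lambda>\<xi>. P0 t (norm \<xi>))) = l2norm (\<lambda>\<xi>. of_real (norm \<xi> powr k) * ?F t \<xi>)" if t: "t \<ge> 1" for t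
    proof -
      have t0: "t \<ge> 0" using t by simp
      note r = remainder_fourier[OF u_L2(1)[OF t0] LP(1)[OF t], of m, folded U_def]
      have L: "L2 (\<lambda>\<xi>. of_real (norm \<xi> powr k) * ?F t \<xi>)" by (rule as0(1)) (assumption | rule kk t)+
      show "nabla_L2 k (remainder (u t) m (\<lambda>\<xi>. P0 t (norm \<xi>)))"
        "nabla_norm k (remainder (u t) m (\<lambda>\<xi>. P0 t (norm \<xi>))) = l2norm (\<lambda>\<xi>. of_real (norm \<xi> powr k) * ?F t \<xi>)"
        by (rule nabla_of_fourier[OF r(1) L r(2)])+
    qed
    have s: "(\<lambda>t. l2norm (\<lambda>\<xi>. of_real (norm \<xi> powr k) * ?F t \<xi>)) \<in> o(\<lambda>t. t powr (- decay_exponent CARD('n) \<sigma> k))"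
      by (rule as0(2)) (assumption | rule kk)+
    have ev: "\<forall>\<^sub>F t in at_top. nabla_norm k (remainder (u t) m (\<lambda>\<xi>. P0 t (norm \<xi>))) = l2norm (\<lambda>\<xi>. of_real (norm \<xi> powr k) * ?F t \<xi>)"
      using eventually_ge_at_top[of 1] by eventually_elim (rule N)
    have evN: "\<forall>\<^sub>F t in at_top. nabla_L2 k (remainder (u t) m (\<lambda>\<xi>. P0 t (norm \<xi>)))"
      using eventually_ge_at_top[of 1] by eventually_elim (rule N)
    show ?thesis by (rule conjI[OF evN iffD2[OF landau_o.small.in_cong[OF ev] s]])
  qed
  show "(\<forall>\<^sub>F t in at_top. nabla_L2 k (remainder (time_deriv u t) m (\<lambda>\<xi>. P1 t (norm \<xi>)))) \<and>
      (\<lambda>t. nabla_norm k (remainder (time_deriv u t) m (\<lambda>\<xi>. P1 t (norm \<xi>)))) \<in> o(\<lambda>t. t powr (- decay_exponent CARD('n) \<sigma> k - \<beta>))"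
    if kk: "k \<le> k0"
  proof -
    let ?F = "\<lambda>t \<xi>. V t \<xi> - of_real m * of_real (P1 t (norm \<xi>))"
    have N: "nabla_L2 k (remainder (time_deriv u t) m (\<lambda>\<xi>. P1 t (norm \<xi>)))"
      "nabla_norm k (remainder (time_deriv u t) m (\<lambda>\<xi>. P1 t (norm \<xi>))) = l2norm (\<lambda>\<xi>. of_real (norm \<xi> powr k) * ?F t \<xi>)" if t: "t \<ge> 1" for t
    proof -
      have t0: "t \<ge> 0" using t by simp
      note r = remainder_fourier[OF u_L2(2)[OF t0] LP(2)[OF t], of m, folded V_def]
      have L: "L2 (\<lambda>\<xi>. of_real (norm \<xi> powr k) * ?F t \<xi>)" by (rule as1(1)) (assumption | rule kk t)+
      show "nabla_L2 k (remainder (time_deriv u t) m (\<lambda>\<xi>. P1 t (norm \<xi>)))"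
        "nabla_norm k (remainder (time_deriv u t) m (\<lambda>\<xi>. P1 t (norm \<xi>))) = l2norm (\<lambda>\<xi>. of_real (norm \<xi> powr k) * ?F t \<xi>)"
        by (rule nabla_of_fourier[OF r(1) L r(2)])+
    qed
    have s: "(\<lambda>t. l2norm (\<lambda>\<xi>. of_real (norm \<xi> powr k) * ?F t \<xi>)) \<in> o(\<lambda>t. t powr (- decay_exponent CARD('n) \<sigma> k - \<beta>))"
      by (rule as1(2)) (assumption | rule kk)+
    have ev: "\<forall>\<^sub>F t in at_top. nabla_norm k (remainder (time_deriv u t) m (\<lambda>\<xi>. P1 t (norm \<xi>))) = l2norm (\<lambda>\<xi>. of_real (norm \<xi> powr k) * ?F t \<xi>)"
      using eventually_ge_at_top[of 1] by eventually_elim (rule N)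
    have evN: "\<forall>\<^sub>F t in at_top. nabla_L2 k (remainder (time_deriv u t) m (\<lambda>\<xi>. P1 t (norm \<xi>)))"
      using eventually_ge_at_top[of 1] by eventually_elim (rule N)
    show ?thesis by (rule conjI[OF evN iffD2[OF landau_o.small.in_cong[OF ev] s]])
  qed
  show "(\<forall>\<^sub>F t in at_top. \<exists>w. has_L2_deriv (\<lambda>s. remainder (u s) m (\<lambda>\<xi>. P0 s (norm \<xi>))) w t) \<and>
      (\<forall>\<^sub>F t in at_top. nabla_L2 k (time_deriv (\<lambda>s. remainder (u s) m (\<lambda>\<xi>. P0 s (norm \<xi>))) t)) \<and>
      (\<lambda>t. nabla_norm k (time_deriv (\<lambda>s. remainder (u s) m (\<lambda>\<xi>. P0 s (norm \<xi>))) t)) \<in> o(\<lambda>t. t powr (- decay_exponent CARD('n) \<sigma> k - \<beta>))"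
    if kk: "k \<le> k0" and der: "\<And>t r. t > 0 \<Longrightarrow> r > 0 \<Longrightarrow> ((\<lambda>t. P0 t r) has_real_derivative P1 t r) (at t)"
  proof -
    let ?F = "\<lambda>t \<xi>. V t \<xi> - of_real m * of_real (P1 t (norm \<xi>))"
    let ?R = "\<lambda>s. remainder (u s) m (\<lambda>\<xi>. P0 s (norm \<xi>))"
    have N: "\<exists>w. has_L2_deriv ?R w t" "nabla_L2 k (time_deriv ?R t)"
      "nabla_norm k (time_deriv ?R t) = l2norm (\<lambda>\<xi>. of_real (norm \<xi> powr k) * ?F t \<xi>)" if t: "t > 1" for t
    proof -
      have t1: "t \<ge> 1" using t by simp
      have d: "has_L2_deriv (\<lambda>s \<xi>::real^'n. complex_of_real (P0 s (norm \<xi>))) (\<lambda>\<xi>. complex_of_real (P1 t (norm \<xi>))) t"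
        by (rule profile_has_L2_deriv[OF low_freq_profile_dominated[OF low0] low_freq_profile_dominated[OF low1] p e mP der t])
      note r = remainder_time_deriv[OF t LP(1) LP(2)[OF t1] d]
      show "\<exists>w. has_L2_deriv ?R w t" by (rule r(1)) assumption
      have r2: "L2 (time_deriv ?R t)" by (rule r(2)) assumption
      have r3: "AE \<xi> in lborel. fourier (time_deriv ?R t) \<xi> = ?F t \<xi>" by (rule r(3)) assumption
      have L: "L2 (\<lambda>\<xi>. of_real (norm \<xi> powr k) * ?F t \<xi>)" by (rule as1(1)) (assumption | rule kk t1)+
      show "nabla_L2 k (time_deriv ?R t)"
        "nabla_norm k (time_deriv ?R t) = l2norm (\<lambda>\<xi>. of_real (norm \<xi> powr k) * ?F t \<xi>)"
        by (rule nabla_of_fourier[OF r2 L r3])+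
    qed
    have s: "(\<lambda>t. l2norm (\<lambda>\<xi>. of_real (norm \<xi> powr k) * ?F t \<xi>)) \<in> o(\<lambda>t. t powr (- decay_exponent CARD('n) \<sigma> k - \<beta>))"
      by (rule as1(2)) (assumption | rule kk)+
    have ev: "\<forall>\<^sub>F t in at_top. nabla_norm k (time_deriv ?R t) = l2norm (\<lambda>\<xi>. of_real (norm \<xi> powr k) * ?F t \<xi>)"
      using eventually_gt_at_top[of 1] by eventually_elim (rule N)
    have evD: "\<forall>\<^sub>F t in at_top. \<exists>w. has_L2_deriv ?R w t"
      using eventually_gt_at_top[of 1] by eventually_elim (rule N)
    have evN: "\<forall>\<^sub>F t in at_top. nabla_L2 k (time_deriv ?R t)"
      using eventually_gt_at_top[of 1] by eventually_elim (rule N)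
    show ?thesis by (rule conjI[OF evD conjI[OF evN iffD2[OF landau_o.small.in_cong[OF ev] s]]])
  qed
  have bounds: "\<exists>C>0. \<forall>\<^sub>F t in at_top. nabla_L2 k (cplx (v t)) \<and>
      (m1 \<noteq> 0 \<longrightarrow> inverse C * t powr \<gamma> \<le> nabla_norm k (cplx (v t))) \<and> nabla_norm k (cplx (v t)) \<le> C * t powr \<gamma>"
    if v: "\<And>t. t \<ge> 1 \<Longrightarrow> L2 (cplx (v t))" and L: "\<And>t. t \<ge> 1 \<Longrightarrow> L2 (\<lambda>\<xi>. of_real (norm \<xi> powr k) * fourier (cplx (v t)) \<xi>)"
      and b: "\<exists>C>0. \<forall>\<^sub>F t in at_top. (m1 \<noteq> 0 \<longrightarrow> inverse C * t powr \<gamma> \<le> l2norm (\<lambda>\<xi>. of_real (norm \<xi> powr k) * fourier (cplx (v t)) \<xi>))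
        \<and> l2norm (\<lambda>\<xi>. of_real (norm \<xi> powr k) * fourier (cplx (v t)) \<xi>) \<le> C * t powr \<gamma>"
    for v :: "real \<Rightarrow> real^'n \<Rightarrow> real" and \<gamma>
  proof -
    obtain C where C: "C > 0" "\<forall>\<^sub>F t in at_top. (m1 \<noteq> 0 \<longrightarrow> inverse C * t powr \<gamma> \<le> l2norm (\<lambda>\<xi>. of_real (norm \<xi> powr k) * fourier (cplx (v t)) \<xi>))
        \<and> l2norm (\<lambda>\<xi>. of_real (norm \<xi> powr k) * fourier (cplx (v t)) \<xi>) \<le> C * t powr \<gamma>" using b by blast
    have "\<forall>\<^sub>F t in at_top. nabla_L2 k (cplx (v t)) \<and>
      (m1 \<noteq> 0 \<longrightarrow> inverse C * t powr \<gamma> \<le> nabla_norm k (cplx (v t))) \<and> nabla_norm k (cplx (v t)) \<le> C * t powr \<gamma>"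
      using C(2) eventually_ge_at_top[of 1]
    proof eventually_elim
      case (elim t)
      then show ?case using nabla_of_fourier[OF v L, of t t] by simp
    qed
    with C(1) show ?thesis by blast
  qed
  show "\<exists>C>0. \<forall>\<^sub>F t in at_top. nabla_L2 k (cplx ((time_deriv ^^ l) u t)) \<and>
      (m1 \<noteq> 0 \<longrightarrow> inverse C * t powr (- decay_exponent CARD('n) \<sigma> k - real l * \<beta>) \<le> nabla_norm k (cplx ((time_deriv ^^ l) u t))) \<and>
      nabla_norm k (cplx ((time_deriv ^^ l) u t)) \<le> C * t powr (- decay_exponent CARD('n) \<sigma> k - real l * \<beta>)"
    if l: "l \<in> {0, 1::nat}" and kl: "k + real l \<le> k0 + 1"
  proof (cases "l = 0")
    case True
    have kk: "k \<le> k0 + 1" using kl True by simp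
    have "\<exists>C>0. \<forall>\<^sub>F t in at_top. nabla_L2 k (cplx (u t)) \<and>
      (m1 \<noteq> 0 \<longrightarrow> inverse C * t powr (- decay_exponent CARD('n) \<sigma> k) \<le> nabla_norm k (cplx (u t))) \<and>
      nabla_norm k (cplx (u t)) \<le> C * t powr (- decay_exponent CARD('n) \<sigma> k)"
    proof (rule bounds)
      show "L2 (cplx (u t))" if "t \<ge> 1" for t using that by (intro u_cL2) simp
      show "L2 (\<lambda>\<xi>. of_real (norm \<xi> powr k) * fourier (cplx (u t)) \<xi>)" if "t \<ge> 1" for t
        unfolding U_def[symmetric] by (rule as0(3)) (assumption | rule kk that)+
      show "\<exists>C>0. \<forall>\<^sub>F t in at_top. (m1 \<noteq> 0 \<longrightarrow> inverse C * t powr (- decay_exponent CARD('n) \<sigma> k) \<le> l2norm (\<lambda>\<xi>. of_real (norm \<xi> powr k) * fourier (cplx (u t)) \<xi>))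
        \<and> l2norm (\<lambda>\<xi>. of_real (norm \<xi> powr k) * fourier (cplx (u t)) \<xi>) \<le> C * t powr (- decay_exponent CARD('n) \<sigma> k)"
        unfolding U_def[symmetric] by (rule as0(4)) (assumption | rule kk lb0[OF k, unfolded \<gamma>0])+
    qed
    then show ?thesis using True by simp
  next
    case False
    then have l1: "l = 1" using l by simp
    have kk: "k \<le> k0" using kl l1 by simp
    have "\<exists>C>0. \<forall>\<^sub>F t in at_top. nabla_L2 k (cplx (time_deriv u t)) \<and>
      (m1 \<noteq> 0 \<longrightarrow> inverse C * t powr (- decay_exponent CARD('n) \<sigma> k - \<beta>) \<le> nabla_norm k (cplx (time_deriv u t))) \<and>
      nabla_norm k (cplx (time_deriv u t)) \<le> C * t powr (- decay_exponent CARD('n) \<sigma> k - \<beta>)"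
    proof (rule bounds)
      show "L2 (cplx (time_deriv u t))" if "t \<ge> 1" for t using that by (intro u_cL2) simp
      show "L2 (\<lambda>\<xi>. of_real (norm \<xi> powr k) * fourier (cplx (time_deriv u t)) \<xi>)" if "t \<ge> 1" for t
        unfolding V_def[symmetric] by (rule as1(3)) (assumption | rule kk that)+
      show "\<exists>C>0. \<forall>\<^sub>F t in at_top. (m1 \<noteq> 0 \<longrightarrow> inverse C * t powr (- decay_exponent CARD('n) \<sigma> k - \<beta>) \<le> l2norm (\<lambda>\<xi>. of_real (norm \<xi> powr k) * fourier (cplx (time_deriv u t)) \<xi>))
        \<and> l2norm (\<lambda>\<xi>. of_real (norm \<xi> powr k) * fourier (cplx (time_deriv u t)) \<xi>) \<le> C * t powr (- decay_exponent CARD('n) \<sigma> k - \<beta>)"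
        unfolding V_def[symmetric] by (rule as1(4)) (assumption | rule kk lb1[OF k, unfolded \<gamma>1 \<gamma>m])+
    qed
    then show ?thesis using l1 by simp
  qed
qed

end

section \<open>The three ranges of the damping exponent\<close>

context damped_wave
begin

definition decay_estimates :: bool where
  "decay_estimates \<longleftrightarrow>
    (\<forall>k. 0 \<le> k \<and> k \<le> k0 + 1 \<longrightarrow>
        (\<forall>\<^sub>F t in at_top. nabla_L2 k (remainder (u t) m (profile \<sigma> \<nu> t))) \<and>
        (\<lambda>t. nabla_norm k (remainder (u t) m (profile \<sigma> \<nu> t)))
          \<in> o(\<lambda>t. t powr (- decay_exponent CARD('n) \<sigma> k)))
     \<and>
     (\<forall>k. 0 \<le> k \<and> k + 1 \<le> k0 + 1 \<and> \<sigma> \<le> 1/2 \<longrightarrow>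
        (\<forall>\<^sub>F t in at_top. \<exists>w. has_L2_deriv (\<lambda>s. remainder (u s) m (profile \<sigma> \<nu> s)) w t) \<and>
        (\<forall>\<^sub>F t in at_top. nabla_L2 k (time_deriv (\<lambda>s. remainder (u s)
           m (profile \<sigma> \<nu> s)) t)) \<and>
        (\<lambda>t. nabla_norm k (time_deriv (\<lambda>s. remainder (u s)
           m (profile \<sigma> \<nu> s)) t))
          \<in> o(\<lambda>t. t powr (- decay_exponent CARD('n) \<sigma> k - 1)))
     \<and>
     (\<forall>k. 0 \<le> k \<and> k + 1 \<le> k0 + 1 \<and> \<sigma> > 1/2 \<longrightarrow>
        (\<forall>\<^sub>F t in at_top. nabla_L2 k (remainder (time_deriv u t) m (profile_cos \<sigma> \<nu> t))) \<and>
        (\<lambda>t. nabla_norm k (remainder (time_deriv u t) m (profile_cos \<sigma> \<nu> t)))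
          \<in> o(\<lambda>t. t powr (- decay_exponent CARD('n) \<sigma> k - 1 / (2 * \<sigma>))))
     \<and>
     (\<forall>l\<in>{0, 1::nat}. \<forall>k. 0 \<le> k \<and> k + real l \<le> k0 + 1 \<and> \<sigma> \<le> 1/2 \<longrightarrow>
        (\<exists>C>0. \<forall>\<^sub>F t in at_top.
           nabla_L2 k (cplx ((time_deriv ^^ l) u t)) \<and>
           (m1 \<noteq> 0 \<longrightarrow> inverse C * t powr (- decay_exponent CARD('n) \<sigma> k - real l)
                        \<le> nabla_norm k (cplx ((time_deriv ^^ l) u t))) \<and>
           nabla_norm k (cplx ((time_deriv ^^ l) u t))
             \<le> C * t powr (- decay_exponent CARD('n) \<sigma> k - real l)))
     \<and>
     (\<forall>l\<in>{0, 1::nat}. \<forall>k. 0 \<le> k \<and> k + real l \<le> k0 + 1 \<and> \<sigma> > 1/2 \<longrightarrow>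
        (\<exists>C>0. \<forall>\<^sub>F t in at_top.
           nabla_L2 k (cplx ((time_deriv ^^ l) u t)) \<and>
           (m1 \<noteq> 0 \<longrightarrow> inverse C * t powr (- decay_exponent CARD('n) \<sigma> k - real l / (2 * \<sigma>))
                        \<le> nabla_norm k (cplx ((time_deriv ^^ l) u t))) \<and>
           nabla_norm k (cplx ((time_deriv ^^ l) u t))
             \<le> C * t powr (- decay_exponent CARD('n) \<sigma> k - real l / (2 * \<sigma>))))"

lemma decay_estimatesI:
  fixes P0 P1 :: "real \<Rightarrow> real \<Rightarrow> real"
  assumes low0: "low_freq p \<alpha>0 e (\<lambda>t r. kern0 (damp r) r t) (\<lambda>t r. kern (damp r) r t) P0"
    and low1: "low_freq p \<alpha>1 e (\<lambda>t r. - (r\<^sup>2 * kern (damp r) r t)) (\<lambda>t r. dkern (damp r) r t) P1"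
    and p: "p > 0" and e: "e > - real CARD('n) / 2" "e \<le> 2"
    and mP: "\<And>t. (\<lambda>\<xi>::real^'n. P0 t (norm \<xi>)) \<in> borel_measurable lborel" "\<And>t. (\<lambda>\<xi>::real^'n. P1 t (norm \<xi>)) \<in> borel_measurable lborel"
    and lb0: "\<And>k. k \<ge> 0 \<Longrightarrow> \<exists>c>0. \<forall>\<^sub>F t in at_top. c * t powr (- ((real CARD('n) / 2 + k) / p + \<alpha>0))
        \<le> l2norm (\<lambda>\<xi>::real^'n. complex_of_real (norm \<xi> powr k) * of_real (P0 t (norm \<xi>)))"
    and lb1: "\<And>k. k \<ge> 0 \<Longrightarrow> \<exists>c>0. \<forall>\<^sub>F t in at_top. c * t powr (- ((real CARD('n) / 2 + k) / p + \<alpha>1))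
        \<le> l2norm (\<lambda>\<xi>::real^'n. complex_of_real (norm \<xi> powr k) * of_real (P1 t (norm \<xi>)))"
    and \<gamma>0: "\<And>k. (real CARD('n) / 2 + k) / p + \<alpha>0 = decay_exponent CARD('n) \<sigma> k"
    and \<gamma>1: "\<And>k. \<sigma> \<le> 1/2 \<Longrightarrow> (real CARD('n) / 2 + k) / p + \<alpha>1 = decay_exponent CARD('n) \<sigma> k + 1"
      "\<And>k. \<sigma> > 1/2 \<Longrightarrow> (real CARD('n) / 2 + k) / p + \<alpha>1 = decay_exponent CARD('n) \<sigma> k + 1 / (2 * \<sigma>)"
    and prof: "\<And>t. profile \<sigma> \<nu> t = (\<lambda>\<xi>::real^'n. P0 t (norm \<xi>))"
    and der: "\<And>t r. \<sigma> \<le> 1/2 \<Longrightarrow> t > 0 \<Longrightarrow> r > 0 \<Longrightarrow> ((\<lambda>t. P0 t r) has_real_derivative P1 t r) (at t)"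
    and prof_cos: "\<And>t. \<sigma> > 1/2 \<Longrightarrow> profile_cos \<sigma> \<nu> t = (\<lambda>\<xi>::real^'n. P1 t (norm \<xi>))"
  shows decay_estimates
proof -
  \<comment> \<open>The gain is 1 or 1 / (2 \<sigma>) according to the range and does not depend on
    \<open>k\<close>, so both ranges can share the general estimates.\<close>
  have "\<exists>\<beta>. \<forall>k. (real CARD('n) / 2 + k) / p + \<alpha>1 = decay_exponent CARD('n) \<sigma> k + \<beta>"
    using \<gamma>1 by (cases "\<sigma> \<le> 1/2") (auto simp: not_le)
  then obtain \<beta> where \<beta>: "\<And>k. (real CARD('n) / 2 + k) / p + \<alpha>1 = decay_exponent CARD('n) \<sigma> k + \<beta>" by blast
  note as = profile_asymptotics[OF low0 low1 p e mP lb0 lb1 \<gamma>0]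
  show ?thesis unfolding decay_estimates_def
  proof (intro conjI)
    show "\<forall>k. 0 \<le> k \<and> k \<le> k0 + 1 \<longrightarrow>
        (\<forall>\<^sub>F t in at_top. nabla_L2 k (remainder (u t) m (profile \<sigma> \<nu> t))) \<and>
        (\<lambda>t. nabla_norm k (remainder (u t) m (profile \<sigma> \<nu> t)))
          \<in> o(\<lambda>t. t powr (- decay_exponent CARD('n) \<sigma> k))"
      unfolding prof by (intro allI impI, elim conjE, rule as(1)) (assumption | rule \<beta>)+
    show "\<forall>k. 0 \<le> k \<and> k + 1 \<le> k0 + 1 \<and> \<sigma> \<le> 1/2 \<longrightarrow>
        (\<forall>\<^sub>F t in at_top. \<exists>w. has_L2_deriv (\<lambda>s. remainder (u s) m (profile \<sigma> \<nu> s)) w t) \<and>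
        (\<forall>\<^sub>F t in at_top. nabla_L2 k (time_deriv (\<lambda>s. remainder (u s)
           m (profile \<sigma> \<nu> s)) t)) \<and>
        (\<lambda>t. nabla_norm k (time_deriv (\<lambda>s. remainder (u s)
           m (profile \<sigma> \<nu> s)) t))
          \<in> o(\<lambda>t. t powr (- decay_exponent CARD('n) \<sigma> k - 1))"
      unfolding prof by (intro allI impI, elim conjE, rule as(2)) (assumption | rule \<gamma>1 der | simp)+
    show "\<forall>k. 0 \<le> k \<and> k + 1 \<le> k0 + 1 \<and> \<sigma> > 1/2 \<longrightarrow>
        (\<forall>\<^sub>F t in at_top. nabla_L2 k (remainder (time_deriv u t) m (profile_cos \<sigma> \<nu> t))) \<and>
        (\<lambda>t. nabla_norm k (remainder (time_deriv u t) m (profile_cos \<sigma> \<nu> t)))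
          \<in> o(\<lambda>t. t powr (- decay_exponent CARD('n) \<sigma> k - 1 / (2 * \<sigma>)))"
      by (intro allI impI, elim conjE, simp only: prof_cos, rule as(3)) (assumption | rule \<gamma>1 | simp)+
    show "\<forall>l\<in>{0, 1::nat}. \<forall>k. 0 \<le> k \<and> k + real l \<le> k0 + 1 \<and> \<sigma> \<le> 1/2 \<longrightarrow>
        (\<exists>C>0. \<forall>\<^sub>F t in at_top.
           nabla_L2 k (cplx ((time_deriv ^^ l) u t)) \<and>
           (m1 \<noteq> 0 \<longrightarrow> inverse C * t powr (- decay_exponent CARD('n) \<sigma> k - real l)
                        \<le> nabla_norm k (cplx ((time_deriv ^^ l) u t))) \<and>
           nabla_norm k (cplx ((time_deriv ^^ l) u t))
             \<le> C * t powr (- decay_exponent CARD('n) \<sigma> k - real l))"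
      using as(4)[OF _ _ \<gamma>1(1)] by simp
    show "\<forall>l\<in>{0, 1::nat}. \<forall>k. 0 \<le> k \<and> k + real l \<le> k0 + 1 \<and> \<sigma> > 1/2 \<longrightarrow>
        (\<exists>C>0. \<forall>\<^sub>F t in at_top.
           nabla_L2 k (cplx ((time_deriv ^^ l) u t)) \<and>
           (m1 \<noteq> 0 \<longrightarrow> inverse C * t powr (- decay_exponent CARD('n) \<sigma> k - real l / (2 * \<sigma>))
                        \<le> nabla_norm k (cplx ((time_deriv ^^ l) u t))) \<and>
           nabla_norm k (cplx ((time_deriv ^^ l) u t))
             \<le> C * t powr (- decay_exponent CARD('n) \<sigma> k - real l / (2 * \<sigma>)))"
      using as(4)[OF _ _ \<gamma>1(2)] by simp
  qed
qed

end

lemma eventually_lower_bound: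
  "\<exists>c>0. \<forall>t\<ge>1. c * f t \<le> (g t :: real) \<Longrightarrow> \<exists>c>0. \<forall>\<^sub>F t::real in at_top. c * f t \<le> g t"
  by (metis (mono_tags, lifting) eventually_at_top_linorderI)

context damped_wave
begin

lemma decay_estimates_small:
  assumes s: "\<sigma> < 1/2" and n: "CARD('n) \<ge> 2"
  shows decay_estimates
proof -
  define p where "p = 2 * (1 - \<sigma>)"
  define \<alpha> where "\<alpha> = - (2 * \<sigma>) / p"
  have p: "p > 1" using s by (simp add: p_def)
  have p0: "p > 0" using p by simp
  have \<alpha>1: "(2 - 4 * \<sigma>) / p = 1 + \<alpha>" using p by (simp add: \<alpha>_def p_def field_simps)
  let ?P0 = "\<lambda>t r. exp (- (1 / \<nu>) * t * r powr p) / damp r"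
  let ?P1 = "\<lambda>t r. - (1 / \<nu>) * r powr p * (exp (- (1 / \<nu>) * t * r powr p) / damp r)"
  note low = low_freq_small[OF \<nu> \<sigma>(1) s, folded p_def, folded \<alpha>_def, unfolded \<alpha>1, folded damp_def]
  note dom = low[THEN low_freq_profile_dominated]
  \<comment> \<open>The profile is singular of order 2\<sigma> < 1, which is at most n/2 because n
    \<ge> 2.\<close>
  have e: "- (2 * \<sigma>) > - real CARD('n) / 2" "- (2 * \<sigma>) \<le> 2" using s n \<sigma> by auto
  have m: "(\<lambda>\<xi>::real^'n. ?P0 t (norm \<xi>)) \<in> borel_measurable lborel" "(\<lambda>\<xi>::real^'n. ?P1 t (norm \<xi>)) \<in> borel_measurable lborel" for t
    by measurable
  \<comment> \<open>Both ingredients of the profile are exactly homogeneous, so it is self-similar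
    without error.\<close>
  have sp: "(t powr (-1/p) * x) powr p = x powr p / t" "damp (t powr (-1/p) * x) = t powr \<alpha> * damp x"
    if "t \<ge> 1" for t x :: real
    unfolding damp_def scaled_powr \<alpha>_def using that p by (simp_all add: powr_minus divide_inverse)
  have sim: "t powr \<alpha> * ?P0 t (t powr (-1/p) * x) = ?P0 1 x" if "t \<ge> 1" "x > 0" for t x
    unfolding sp[OF that(1)] using that by simp
  have sim1: "t powr (1 + \<alpha>) * ?P1 t (t powr (-1/p) * x) = ?P1 1 x" if "t \<ge> 1" "x > 0" for t x
    unfolding sp[OF that(1)] powr_add using that by simp
  show ?thesis
  proof (rule decay_estimatesI[OF low p0 e m])
    fix k :: real assume k: "k \<ge> 0"
    show "\<exists>c>0. \<forall>\<^sub>F t in at_top. c * t powr (- ((real CARD('n) / 2 + k) / p + \<alpha>))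
        \<le> l2norm (\<lambda>\<xi>::real^'n. complex_of_real (norm \<xi> powr k) * of_real (?P0 t (norm \<xi>)))"
      by (rule eventually_lower_bound, rule profile_lower_self_similar[OF dom(1) p0 e k m(1) sim, where \<delta>=1]) (use \<nu> in \<open>auto simp: damp_def\<close>)
    show "\<exists>c>0. \<forall>\<^sub>F t in at_top. c * t powr (- ((real CARD('n) / 2 + k) / p + (1 + \<alpha>)))
        \<le> l2norm (\<lambda>\<xi>::real^'n. complex_of_real (norm \<xi> powr k) * of_real (?P1 t (norm \<xi>)))"
      by (rule eventually_lower_bound, rule profile_lower_self_similar[OF dom(2) p0 e k m(2) sim1, where \<delta>=1]) (use \<nu> in \<open>auto simp: damp_def\<close>)
  next
    fix k :: real
    have "(real CARD('n) / 2 + k) / (2 * q) + - (2 * \<sigma>) / (2 * q) = real CARD('n) / (4 * q) - \<sigma> / q + k / (2 * q)" for q :: real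
      by (simp add: add_divide_distrib)
    note g = this[of "1 - \<sigma>"]
    show "(real CARD('n) / 2 + k) / p + \<alpha> = decay_exponent CARD('n) \<sigma> k"
      "(real CARD('n) / 2 + k) / p + (1 + \<alpha>) = decay_exponent CARD('n) \<sigma> k + 1"
      using g s by (simp_all add: \<alpha>_def p_def decay_exponent_def)
  next
    show "profile \<sigma> \<nu> t = (\<lambda>\<xi>::real^'n. ?P0 t (norm \<xi>))" for t using s by (simp add: profile_def[abs_def] p_def damp_def)
    show "((\<lambda>t. ?P0 t r) has_real_derivative ?P1 t r) (at t)" if "r > 0" for t r
    proof -
      have "((\<lambda>t. exp (- (1 / \<nu>) * t * r powr p)) has_real_derivative - (1 / \<nu>) * r powr p * exp (- (1 / \<nu>) * t * r powr p)) (at t)"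
        using \<nu> by (auto intro!: derivative_eq_intros)
      from DERIV_cdivide[OF this, of "damp r"] show ?thesis by simp
    qed
  qed (use s in auto)
qed

lemma decay_estimates_half:
  assumes s: "\<sigma> = 1/2"
  shows decay_estimates
proof -
  define P0 where "P0 t r = (if \<nu> < 2 then 2 * exp (- (\<nu> / 2) * t * r) * sin (t * r * sqrt (4 - \<nu>\<^sup>2) / 2) / (r * sqrt (4 - \<nu>\<^sup>2))
      else if \<nu> = 2 then t * exp (- t * r)
      else 2 * exp (- (\<nu> / 2) * t * r) * sinh (t * r * sqrt (\<nu>\<^sup>2 - 4) / 2) / (r * sqrt (\<nu>\<^sup>2 - 4)))" for t r :: real
  let ?P1 = "\<lambda>t r. dkern (\<nu> * r) r t"
  have P0: "kern (\<nu> * r) r t = P0 t r" if "r > 0" for t r unfolding P0_def by (rule half_profile_eq[OF that \<nu>])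
  have d: "\<nu> * r = damp r" if "r > 0" for r unfolding damp_def using that by (simp add: s)
  have low0: "low_freq 1 (-1) 0 (\<lambda>t r. kern0 (damp r) r t) (\<lambda>t r. kern (damp r) r t) P0"
    by (rule low_freq_cong[OF low_freq_half(1)[OF \<nu>]]) (simp_all only: d P0[symmetric])
  have low1: "low_freq 1 0 0 (\<lambda>t r. - (r\<^sup>2 * kern (damp r) r t)) (\<lambda>t r. dkern (damp r) r t) ?P1"
    by (rule low_freq_cong[OF low_freq_half(2)[OF \<nu>]]) (simp_all only: d)
  note dom = low0[THEN low_freq_profile_dominated] low1[THEN low_freq_profile_dominated]
  have e: "(0::real) > - real CARD('n) / 2" "(0::real) \<le> 2" by auto
  have m: "(\<lambda>\<xi>::real^'n. P0 t (norm \<xi>)) \<in> borel_measurable lborel" "(\<lambda>\<xi>::real^'n. ?P1 t (norm \<xi>)) \<in> borel_measurable lborel" for t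
  proof -
    have sh: "(sinh :: real \<Rightarrow> real) \<in> borel_measurable borel" by (intro borel_measurable_continuous_onI continuous_intros)
    note [measurable] = sh
    show "(\<lambda>\<xi>::real^'n. P0 t (norm \<xi>)) \<in> borel_measurable lborel" unfolding P0_def by measurable
  qed measurable
  obtain \<delta> where \<delta>: "\<delta> > 0" "\<And>x. 0 < x \<Longrightarrow> x < \<delta> \<Longrightarrow> kern \<nu> 1 x \<noteq> 0 \<and> dkern \<nu> 1 x \<noteq> 0"
    using kern_nonzero_near_0[of \<nu>] by blast
  have r: "t powr (-1/1) * x = x / t" if "t \<ge> 1" for t x :: real using that by (simp add: powr_minus divide_inverse)
  have sc: "P0 t r = kern \<nu> 1 (r * t) / r" "?P1 t r = dkern \<nu> 1 (r * t)" if "r > 0" for t r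
    unfolding P0[OF that, symmetric] by (rule kern_scale[OF that])+
  have sim: "t powr (-1) * P0 t (t powr (-1/1) * x) = P0 1 x" "t powr 0 * ?P1 t (t powr (-1/1) * x) = ?P1 1 x" if t: "t \<ge> 1" and x: "x > 0" for t x
  proof -
    have "x / t > 0" using t x by simp
    note sc' = sc[OF this] sc[OF x]
    show "t powr (-1) * P0 t (t powr (-1/1) * x) = P0 1 x" "t powr 0 * ?P1 t (t powr (-1/1) * x) = ?P1 1 x"
      unfolding r[OF t] sc' using t x by (simp_all add: powr_minus)
  qed
  show ?thesis
  proof (rule decay_estimatesI[OF low0 low1 zero_less_one e m])
    fix k :: real assume k: "k \<ge> 0"
    show "\<exists>c>0. \<forall>\<^sub>F t in at_top. c * t powr (- ((real CARD('n) / 2 + k) / 1 + -1))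
        \<le> l2norm (\<lambda>\<xi>::real^'n. complex_of_real (norm \<xi> powr k) * of_real (P0 t (norm \<xi>)))"
      by (rule eventually_lower_bound, rule profile_lower_self_similar[OF dom(1) zero_less_one e k m(1) sim(1) \<delta>(1)])
        (use \<delta>(2) in \<open>auto simp: sc\<close>)
    show "\<exists>c>0. \<forall>\<^sub>F t in at_top. c * t powr (- ((real CARD('n) / 2 + k) / 1 + 0))
        \<le> l2norm (\<lambda>\<xi>::real^'n. complex_of_real (norm \<xi> powr k) * of_real (?P1 t (norm \<xi>)))"
      by (rule eventually_lower_bound, rule profile_lower_self_similar[OF dom(2) zero_less_one e k m(2) sim(2) \<delta>(1)])
        (use \<delta>(2) in \<open>auto simp: sc\<close>)
  next
    fix k :: real
    show "(real CARD('n) / 2 + k) / 1 + -1 = decay_exponent CARD('n) \<sigma> k"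
      "(real CARD('n) / 2 + k) / 1 + 0 = decay_exponent CARD('n) \<sigma> k + 1"
      using s by (simp_all add: decay_exponent_def)
  next
    show "profile \<sigma> \<nu> t = (\<lambda>\<xi>::real^'n. P0 t (norm \<xi>))" for t using s by (auto simp: profile_def fun_eq_iff P0_def)
    show "((\<lambda>t. P0 t r) has_real_derivative ?P1 t r) (at t)" if "r > 0" for t r
      using kern_deriv[of "\<nu> * r" r t] unfolding P0[OF that, abs_def] by simp
  qed (use s in auto)
qed

lemma decay_estimates_large:
  assumes s: "\<sigma> > 1/2" and n: "CARD('n) \<ge> 3"
  shows decay_estimates
proof -
  define p where "p = 2 * \<sigma>"
  have p: "p > 1" using s by (simp add: p_def)
  have p0: "p > 0" using p by simp
  let ?P0 = "\<lambda>t r. exp (- (\<nu> / 2) * t * r powr p) * sin (t * r) / r"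
  let ?P1 = "\<lambda>t r. exp (- (\<nu> * t * r powr p / 2)) * cos (t * r)"
  note low = low_freq_large[OF \<nu> s \<sigma>(2), folded damp_def, folded p_def]
  note dom = low[THEN low_freq_profile_dominated]
  \<comment> \<open>The singularity 1/|\<xi>| of the sine profile is bounded by the envelope of
    order -1, square integrable near 0 because n \<ge> 3.\<close>
  have e: "(-1::real) > - real CARD('n) / 2" "(-1::real) \<le> 2" using n by auto
  have m: "(\<lambda>\<xi>::real^'n. ?P0 t (norm \<xi>)) \<in> borel_measurable lborel" "(\<lambda>\<xi>::real^'n. ?P1 t (norm \<xi>)) \<in> borel_measurable lborel" for t
    by measurable
  have sp: "(t powr (-1/p) * x) powr p = x powr p / t" "t * (t powr (-1/p) * x) = t powr (1 - 1/p) * x"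
    if "t \<ge> 1" for t x :: real
    unfolding scaled_powr using that p by (simp_all add: powr_minus divide_inverse powr_diff)
  \<comment> \<open>The smallest value of the damping factor on the annulus from 1 to 3; the factor
    1/x of the sine profile costs another 1/3.\<close>
  define w where "w = exp (- (\<nu> * 3 powr p / 2))"
  have wx: "w \<le> exp (- (\<nu> * x powr p / 2))" if "0 \<le> x" "x \<le> 3" for x
    unfolding w_def using \<nu> p that by (auto intro!: powr_mono2)
  have c0: "w / 3 * \<bar>sin (t powr (1 - 1/p) * x)\<bar> \<le> t powr (-1/p) * \<bar>?P0 t (t powr (-1/p) * x)\<bar>"
    if t: "t \<ge> 1" and x: "1 \<le> x" "x \<le> 3" for t x
  proof -
    have "w / 3 \<le> exp (- (\<nu> * x powr p / 2)) / x" using wx[of x] x by (intro frac_le) auto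
    then have "w / 3 * \<bar>sin (t powr (1 - 1/p) * x)\<bar> \<le> exp (- (\<nu> * x powr p / 2)) / x * \<bar>sin (t powr (1 - 1/p) * x)\<bar>"
      by (rule mult_right_mono) simp
    also have "\<dots> = t powr (-1/p) * \<bar>?P0 t (t powr (-1/p) * x)\<bar>"
      unfolding sp[OF t] using t x by (simp add: abs_mult abs_divide)
    finally show ?thesis .
  qed
  have c1: "w * \<bar>cos (t powr (1 - 1/p) * x)\<bar> \<le> t powr 0 * \<bar>?P1 t (t powr (-1/p) * x)\<bar>"
    if t: "t \<ge> 1" and x: "1 \<le> x" "x \<le> 3" for t x
    unfolding sp[OF t] using t mult_right_mono[OF wx[of x], of "\<bar>cos (t powr (1 - 1/p) * x)\<bar>"] x by (simp add: abs_mult)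
  have w0: "w > 0" "w / 3 > 0" by (auto simp: w_def)
  show ?thesis
  proof (rule decay_estimatesI[OF low p0 e m])
    fix k :: real assume k: "k \<ge> 0"
    show "\<exists>c>0. \<forall>\<^sub>F t in at_top. c * t powr (- ((real CARD('n) / 2 + k) / p + -1/p))
        \<le> l2norm (\<lambda>\<xi>::real^'n. complex_of_real (norm \<xi> powr k) * of_real (?P0 t (norm \<xi>)))"
      by (rule profile_lower_oscillating[OF dom(1) p e k m(1) _ _ sin_cos_shift(1) w0(2) c0]) (auto intro: continuous_intros)
    show "\<exists>c>0. \<forall>\<^sub>F t in at_top. c * t powr (- ((real CARD('n) / 2 + k) / p + 0))
        \<le> l2norm (\<lambda>\<xi>::real^'n. complex_of_real (norm \<xi> powr k) * of_real (?P1 t (norm \<xi>)))"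
      by (rule profile_lower_oscillating[OF dom(2) p e k m(2) _ _ sin_cos_shift(2) w0(1) c1]) (auto intro: continuous_intros)
  next
    fix k :: real
    show "(real CARD('n) / 2 + k) / p + -1/p = decay_exponent CARD('n) \<sigma> k"
      "(real CARD('n) / 2 + k) / p + 0 = decay_exponent CARD('n) \<sigma> k + 1 / (2 * \<sigma>)"
      using s by (simp_all add: p_def decay_exponent_def field_simps)
  next
    show "profile \<sigma> \<nu> t = (\<lambda>\<xi>::real^'n. ?P0 t (norm \<xi>))" for t using s by (simp add: profile_def[abs_def] p_def)
    show "profile_cos \<sigma> \<nu> t = (\<lambda>\<xi>::real^'n. ?P1 t (norm \<xi>))" for t by (simp add: profile_cos_def[abs_def] p_def)
  qed (use s in auto)
qed

end

text \<open>The lower bounds are conditional on m1 \<noteq> 0: if m1 = 0 the leading term vanishes,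
  and the o-estimates then say that the norms of the solution are of smaller order. The conjuncts
  with \<open>nabla_L2\<close> exclude the default value 0 of \<open>l2norm\<close>, and the
  existence of \<open>w\<close> shows that \<open>time_deriv\<close> of the remainder is a genuine
  derivative.\<close>

theorem theorem1p2:
  fixes k0 \<nu> \<sigma> m1 :: real
    and u0 u1 :: "real^'n \<Rightarrow> real"
    and u :: "real \<Rightarrow> real^'n \<Rightarrow> real"
  assumes "k0 \<ge> 0" and "\<nu> > 0"
    and "(0 < \<sigma> \<and> \<sigma> < 1/2 \<and> CARD('n) \<ge> 2) \<or> (\<sigma> = 1/2 \<and> CARD('n) \<ge> 1) \<or>
         (1/2 < \<sigma> \<and> \<sigma> \<le> 1 \<and> CARD('n) \<ge> 3)"
    and "sobolev (k0 + 1) u0" and "integrable lborel u0"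
    and "sobolev k0 u1" and "integrable lborel u1"
    and "C0_sobolev (k0 + 1) u" and "C1_sobolev k0 u"
    and "solves_damped_wave \<sigma> \<nu> u"
    and "AE x in lborel. u 0 x = u0 x"
    and "AE x in lborel. time_deriv u 0 x = u1 x"
    and "m1 = (LINT y|lborel. u1 y)"
  shows
    "(\<forall>k. 0 \<le> k \<and> k \<le> k0 + 1 \<longrightarrow>
        (\<forall>\<^sub>F t in at_top. nabla_L2 k (remainder (u t) (fourier_const CARD('n) * m1) (profile \<sigma> \<nu> t))) \<and>
        (\<lambda>t. nabla_norm k (remainder (u t) (fourier_const CARD('n) * m1) (profile \<sigma> \<nu> t)))
          \<in> o(\<lambda>t. t powr (- decay_exponent CARD('n) \<sigma> k)))
     \<and>
     (\<forall>k. 0 \<le> k \<and> k + 1 \<le> k0 + 1 \<and> \<sigma> \<le> 1/2 \<longrightarrow>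
        (\<forall>\<^sub>F t in at_top. \<exists>w. has_L2_deriv (\<lambda>s. remainder (u s) (fourier_const CARD('n) * m1) (profile \<sigma> \<nu> s)) w t) \<and>
        (\<forall>\<^sub>F t in at_top. nabla_L2 k (time_deriv (\<lambda>s. remainder (u s)
           (fourier_const CARD('n) * m1) (profile \<sigma> \<nu> s)) t)) \<and>
        (\<lambda>t. nabla_norm k (time_deriv (\<lambda>s. remainder (u s)
           (fourier_const CARD('n) * m1) (profile \<sigma> \<nu> s)) t))
          \<in> o(\<lambda>t. t powr (- decay_exponent CARD('n) \<sigma> k - 1)))
     \<and>
     (\<forall>k. 0 \<le> k \<and> k + 1 \<le> k0 + 1 \<and> \<sigma> > 1/2 \<longrightarrow>
        (\<forall>\<^sub>F t in at_top. nabla_L2 k (remainder (time_deriv u t) (fourier_const CARD('n) * m1) (profile_cos \<sigma> \<nu> t))) \<and>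
        (\<lambda>t. nabla_norm k (remainder (time_deriv u t) (fourier_const CARD('n) * m1) (profile_cos \<sigma> \<nu> t)))
          \<in> o(\<lambda>t. t powr (- decay_exponent CARD('n) \<sigma> k - 1 / (2 * \<sigma>))))
     \<and>
     (\<forall>l\<in>{0, 1::nat}. \<forall>k. 0 \<le> k \<and> k + real l \<le> k0 + 1 \<and> \<sigma> \<le> 1/2 \<longrightarrow>
        (\<exists>C>0. \<forall>\<^sub>F t in at_top.
           nabla_L2 k (cplx ((time_deriv ^^ l) u t)) \<and>
           (m1 \<noteq> 0 \<longrightarrow> inverse C * t powr (- decay_exponent CARD('n) \<sigma> k - real l)
                        \<le> nabla_norm k (cplx ((time_deriv ^^ l) u t))) \<and>
           nabla_norm k (cplx ((time_deriv ^^ l) u t))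
             \<le> C * t powr (- decay_exponent CARD('n) \<sigma> k - real l)))
     \<and>
     (\<forall>l\<in>{0, 1::nat}. \<forall>k. 0 \<le> k \<and> k + real l \<le> k0 + 1 \<and> \<sigma> > 1/2 \<longrightarrow>
        (\<exists>C>0. \<forall>\<^sub>F t in at_top.
           nabla_L2 k (cplx ((time_deriv ^^ l) u t)) \<and>
           (m1 \<noteq> 0 \<longrightarrow> inverse C * t powr (- decay_exponent CARD('n) \<sigma> k - real l / (2 * \<sigma>))
                        \<le> nabla_norm k (cplx ((time_deriv ^^ l) u t))) \<and>
           nabla_norm k (cplx ((time_deriv ^^ l) u t))
             \<le> C * t powr (- decay_exponent CARD('n) \<sigma> k - real l / (2 * \<sigma>))))"
proof -
  interpret damped_wave k0 \<nu> \<sigma> m1 u0 u1 u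
    using assms by unfold_locales auto
  have decay_estimates
    using assms(3) decay_estimates_small decay_estimates_half decay_estimates_large by blast
  then show ?thesis unfolding decay_estimates_def m_def .
qed

end
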